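(* Let $n\ge 3$, $2\le m\le n-1$, $1<p<\infty$, and let $K$ be a cone in $\mathbb{R}^m$. If $p\ge m$ suppose that $K\neq\mathbb{R}^m$, and if $p=m$ suppose in addition that $K\neq\mathbb{R}^m\setminus\{0\}$. Put $\Omega=K\times\mathbb{R}^{n-m}$ and $G=K\cap\mathbb{S}_1^{m-1}$. Then the sharp constant $\mathcal{N}(p,0,\Omega)$ in the inequality $$\big\||y|^{-1}v\big\|_{p,\Omega}\le \mathcal{N}(p,0,\Omega)\,\|\nabla v\|_{p,\Omega},\qquad v\in\dot W^1_p(\Omega),$$ is not attained and equals $(\Lambda^{(p)}(G))^{-1/p}$, where $$\Lambda^{(p)}(G)=\min_{v\in \stackrel{o}{W}{}^1_p(G)\setminus\{0\}}\frac{\displaystyle\int_G\Big(\big(\tfrac{m-p}{p}\big)^2v^2+|\nabla' v|^2\Big)^{p/2}dS}{\displaystyle\int_G|v|^p\,dS}.$$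
   Context: Points of $\mathbb{R}^n=\mathbb{R}^m\times\mathbb{R}^{n-m}$ are written $x=(y;z)$ with $y\in\mathbb{R}^m$, $z\in\mathbb{R}^{n-m}$. A cone in $\mathbb{R}^m$ is a nonempty open connected set invariant under $y\mapsto ty$ for all $t>0$ (the whole space $\mathbb{R}^m$ counts as a cone). For a domain $\Omega\subset\mathbb{R}^n$, $\dot W^1_p(\Omega)$ is the closure of $C_0^\infty(\Omega)$ with respect to the norm $\|\nabla v\|_{p,\Omega}=\|\nabla v\|_{L_p(\Omega)}$. $\mathbb{S}^{m-1}_1$ is the unit sphere in $\mathbb{R}^m$ centered at the origin, $\nabla'$ is the tangential gradient on it, $dS$ its surface measure, and $\stackrel{o}{W}{}^1_p(G)$ is the closure of $C_0^\infty(G)$ in $W^1_p(G)$. The sharp constant is the smallest constant for which the inequality holds for all $v\in\dot W^1_p(\Omega)$; it is attained if there is $v\in\dot W^1_p(\Omega)\setminus\{0\}$ for which the inequality with the sharp constant becomes an equality. *)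

theory Defs
  imports "HOL-Analysis.Analysis"
begin

text \<open>
  The space \<open>\<real>\<^sup>m \<times> \<real>\<^sup>n\<^sup>-\<^sup>m\<close> is a product of two Euclidean spaces, with \<open>y = fst x\<close> and \<open>z = snd x\<close>;
  its product norm is the Euclidean norm. Measures are completed and function spaces consist of
  functions, with zero meaning zero almost everywhere.
\<close>

definition open_cone :: "'a::euclidean_space set \<Rightarrow> bool" where
  "open_cone K \<longleftrightarrow> K \<noteq> {} \<and> open K \<and> connected K \<and> (\<forall>y\<in>K. \<forall>t>0. t *\<^sub>R y \<in> K)"


section \<open>Lebesgue spaces\<close>

definition Lp_member ::
  "real \<Rightarrow> 'a measure \<Rightarrow> ('a \<Rightarrow> 'b::euclidean_space) \<Rightarrow> bool" where
  "Lp_member p M f \<longleftrightarrow>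
     f \<in> borel_measurable M \<and> integrable M (\<lambda>x. norm (f x) powr p)"

text \<open>The Bochner integral of a non-integrable function is \<open>0\<close>, so the next definition is only
  meaningful together with \<open>Lp_member\<close>.\<close>

definition Lp_norm ::
  "real \<Rightarrow> 'a measure \<Rightarrow> ('a \<Rightarrow> 'b::euclidean_space) \<Rightarrow> real" where
  "Lp_norm p M f = (LINT x|M. norm (f x) powr p) powr (1 / p)"

definition locally_integrable ::
  "'a::euclidean_space set \<Rightarrow> ('a \<Rightarrow> 'b::euclidean_space) \<Rightarrow> bool" where
  "locally_integrable \<Omega> f \<longleftrightarrow>
     (\<forall>C. compact C \<and> C \<subseteq> \<Omega> \<longrightarrow> integrable (lebesgue_on C) f)"


section \<open>Test functions and weak gradients on open sets\<close>

text \<open>Meaningful for open \<open>S\<close>: derivatives are two-sided, and being \<open>C\<^sup>k\<^sup>+\<^sup>1\<close> means being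
  differentiable with all first-order partial derivatives \<open>C\<^sup>k\<close>.\<close>

primrec Ck_on :: "nat \<Rightarrow> 'a::euclidean_space set \<Rightarrow> ('a \<Rightarrow> real) \<Rightarrow> bool" where
  "Ck_on 0 S f \<longleftrightarrow> continuous_on S f"
| "Ck_on (Suc k) S f \<longleftrightarrow>
     (\<forall>x\<in>S. f differentiable (at x)) \<and>
     (\<forall>b\<in>Basis. Ck_on k S (\<lambda>x. frechet_derivative f (at x) b))"

definition smooth_on :: "'a::euclidean_space set \<Rightarrow> ('a \<Rightarrow> real) \<Rightarrow> bool" where
  "smooth_on S f \<longleftrightarrow> (\<forall>k. Ck_on k S f)"

definition grad :: "('a::euclidean_space \<Rightarrow> real) \<Rightarrow> 'a \<Rightarrow> 'a" where
  "grad f x = (THE D. GDERIV f x :> D)"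

text \<open>\<open>C\<^sub>0\<^sup>\<infinity>(\<Omega>)\<close>, its elements being extended by zero to the whole space.\<close>

definition test_functions :: "'a::euclidean_space set \<Rightarrow> ('a \<Rightarrow> real) set" where
  "test_functions \<Omega> =
     {\<phi>. smooth_on UNIV \<phi> \<and>
         compact (closure (support_on UNIV \<phi>)) \<and> closure (support_on UNIV \<phi>) \<subseteq> \<Omega>}"

definition has_weak_gradient ::
  "'a::euclidean_space set \<Rightarrow> ('a \<Rightarrow> real) \<Rightarrow> ('a \<Rightarrow> 'a) \<Rightarrow> bool" where
  "has_weak_gradient \<Omega> v g \<longleftrightarrow>
     locally_integrable \<Omega> v \<and> locally_integrable \<Omega> g \<and>
     (\<forall>\<phi>\<in>test_functions \<Omega>.
        (LINT x|lebesgue_on \<Omega>. v x *\<^sub>R grad \<phi> x) = - (LINT x|lebesgue_on \<Omega>. \<phi> x *\<^sub>R g x))"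

text \<open>Weak gradients on an open set are unique up to null sets; any one is picked.\<close>

definition weak_gradient ::
  "'a::euclidean_space set \<Rightarrow> ('a \<Rightarrow> real) \<Rightarrow> 'a \<Rightarrow> 'a" where
  "weak_gradient \<Omega> v = (SOME g. has_weak_gradient \<Omega> v g)"

definition gradient_norm ::
  "real \<Rightarrow> 'a::euclidean_space set \<Rightarrow> ('a \<Rightarrow> real) \<Rightarrow> real" where
  "gradient_norm p \<Omega> v = Lp_norm p (lebesgue_on \<Omega>) (weak_gradient \<Omega> v)"

text \<open>
  The closure of \<open>C\<^sub>0\<^sup>\<infinity>(\<Omega>)\<close> in the gradient norm. On all functions with gradient in \<open>L\<^sub>p\<close> this is
  only a seminorm (it vanishes on constants), so a naive closure there would contain the
  constants. What is meant is the completion of \<open>C\<^sub>0\<^sup>\<infinity>(\<Omega>)\<close>, realised as a space of functions: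
  the approximating test functions must also converge to \<open>v\<close> in \<open>L\<^sub>1\<^sub>,\<^sub>l\<^sub>o\<^sub>c(\<Omega>)\<close>. Whenever Hardy's
  inequality holds with some constant, gradient-Cauchy sequences of test functions converge in
  \<open>L\<^sub>1\<^sub>,\<^sub>l\<^sub>o\<^sub>c(\<Omega>)\<close>, so that nothing is lost.
\<close>

definition W_dot :: "real \<Rightarrow> 'a::euclidean_space set \<Rightarrow> ('a \<Rightarrow> real) set" where
  "W_dot p \<Omega> =
     {v. (\<exists>g. has_weak_gradient \<Omega> v g \<and> Lp_member p (lebesgue_on \<Omega>) g) \<and>
         (\<exists>\<phi>. (\<forall>j::nat. \<phi> j \<in> test_functions \<Omega>) \<and>
              (\<lambda>j. gradient_norm p \<Omega> (\<lambda>x. \<phi> j x - v x)) \<longlonglongrightarrow> 0 \<and>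
              (\<forall>C. compact C \<and> C \<subseteq> \<Omega> \<longrightarrow>
                 (\<lambda>j. LINT x|lebesgue_on C. \<bar>\<phi> j x - v x\<bar>) \<longlonglongrightarrow> 0))}"


section \<open>Sobolev functions on subsets of the unit sphere\<close>

text \<open>Surface measure on the unit sphere of \<open>\<real>\<^sup>m\<close>: the measure of \<open>A\<close> is \<open>m\<close> times the volume of
  \<open>{x. 0 < norm x < 1 \<and> sgn x \<in> A}\<close> (polar coordinates), where \<open>sgn x = x / norm x\<close>. The
  measure lives on the ambient space and is concentrated on the sphere.\<close>

definition sphere_measure :: "'a::euclidean_space measure" where
  "sphere_measure =
     completion (scale_measure (of_nat DIM('a))
       (distr (restrict_space lborel (ball 0 1)) borel sgn))"

text \<open>A function on the sphere is smooth iff its extension \<open>f \<circ> sgn\<close>, homogeneous of degree \<open>0\<close>,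
  is smooth off the origin, and its tangential gradient is then the gradient of this extension.\<close>

definition sphere_test_functions :: "'a::euclidean_space set \<Rightarrow> ('a \<Rightarrow> real) set" where
  "sphere_test_functions G =
     {f. smooth_on (- {0}) (\<lambda>x. f (sgn x)) \<and>
         compact (closure (support_on (sphere 0 1) f)) \<and>
         closure (support_on (sphere 0 1) f) \<subseteq> G}"

text \<open>Weak form, for relatively open subsets \<open>G\<close> of the sphere: the gradient of a function
  homogeneous of degree \<open>0\<close> is homogeneous of degree \<open>-1\<close>.\<close>

definition has_weak_tangential_gradient ::
  "'a::euclidean_space set \<Rightarrow> ('a \<Rightarrow> real) \<Rightarrow> ('a \<Rightarrow> 'a) \<Rightarrow> bool" where
  "has_weak_tangential_gradient G v g \<longleftrightarrow>
     has_weak_gradient {x. x \<noteq> 0 \<and> sgn x \<in> G} (\<lambda>x. v (sgn x)) (\<lambda>x. g (sgn x) /\<^sub>R norm x)"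

definition weak_tangential_gradient ::
  "'a::euclidean_space set \<Rightarrow> ('a \<Rightarrow> real) \<Rightarrow> 'a \<Rightarrow> 'a" where
  "weak_tangential_gradient G v = (SOME g. has_weak_tangential_gradient G v g)"

abbreviation sphere_measure_on :: "'a::euclidean_space set \<Rightarrow> 'a measure" where
  "sphere_measure_on G \<equiv> restrict_space sphere_measure G"

definition W1_sphere :: "real \<Rightarrow> 'a::euclidean_space set \<Rightarrow> ('a \<Rightarrow> real) set" where
  "W1_sphere p G =
     {v. Lp_member p (sphere_measure_on G) v \<and>
         (\<exists>g. has_weak_tangential_gradient G v g \<and> Lp_member p (sphere_measure_on G) g)}"

definition W1_sphere_norm ::
  "real \<Rightarrow> 'a::euclidean_space set \<Rightarrow> ('a \<Rightarrow> real) \<Rightarrow> real" where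
  "W1_sphere_norm p G v =
     Lp_norm p (sphere_measure_on G) v +
     Lp_norm p (sphere_measure_on G) (weak_tangential_gradient G v)"

definition W1_sphere_0 :: "real \<Rightarrow> 'a::euclidean_space set \<Rightarrow> ('a \<Rightarrow> real) set" where
  "W1_sphere_0 p G =
     {v \<in> W1_sphere p G.
        \<exists>\<phi>. (\<forall>j::nat. \<phi> j \<in> sphere_test_functions G) \<and>
            (\<lambda>j. W1_sphere_norm p G (\<lambda>x. \<phi> j x - v x)) \<longlonglongrightarrow> 0}"

definition sphere_quotient ::
  "real \<Rightarrow> 'a::euclidean_space set \<Rightarrow> ('a \<Rightarrow> real) \<Rightarrow> real" where
  "sphere_quotient p G v =
     (LINT x|sphere_measure_on G.
        (((real DIM('a) - p) / p)\<^sup>2 * (v x)\<^sup>2 +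
         (norm (weak_tangential_gradient G v x))\<^sup>2) powr (p / 2)) /
     (LINT x|sphere_measure_on G. \<bar>v x\<bar> powr p)"

definition sphere_quotients :: "real \<Rightarrow> 'a::euclidean_space set \<Rightarrow> real set" where
  "sphere_quotients p G =
     sphere_quotient p G `
       {v \<in> W1_sphere_0 p G. \<not> (AE x in sphere_measure_on G. v x = 0)}"

definition is_minimum :: "'a::linorder set \<Rightarrow> 'a \<Rightarrow> bool" where
  "is_minimum S l \<longleftrightarrow> l \<in> S \<and> (\<forall>s\<in>S. l \<le> s)"


section \<open>Hardy's inequality\<close>

definition hardy_norm ::
  "real \<Rightarrow> ('a::euclidean_space \<times> 'b::euclidean_space) set \<Rightarrow> ('a \<times> 'b \<Rightarrow> real) \<Rightarrow> real" where
  "hardy_norm p \<Omega> v = Lp_norm p (lebesgue_on \<Omega>) (\<lambda>x. v x / norm (fst x))"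

text \<open>Integrability is part of the inequality: the left-hand side has to be finite.\<close>

definition hardy_inequality ::
  "real \<Rightarrow> ('a::euclidean_space \<times> 'b::euclidean_space) set \<Rightarrow> real \<Rightarrow> bool" where
  "hardy_inequality p \<Omega> C \<longleftrightarrow>
     (\<forall>v\<in>W_dot p \<Omega>.
        Lp_member p (lebesgue_on \<Omega>) (\<lambda>x. v x / norm (fst x)) \<and>
        hardy_norm p \<Omega> v \<le> C * gradient_norm p \<Omega> v)"

definition is_sharp_hardy_constant ::
  "real \<Rightarrow> ('a::euclidean_space \<times> 'b::euclidean_space) set \<Rightarrow> real \<Rightarrow> bool" where
  "is_sharp_hardy_constant p \<Omega> N \<longleftrightarrow> is_minimum {C. hardy_inequality p \<Omega> C} N"

definition hardy_equality_attained ::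
  "real \<Rightarrow> ('a::euclidean_space \<times> 'b::euclidean_space) set \<Rightarrow> real \<Rightarrow> bool" where
  "hardy_equality_attained p \<Omega> N \<longleftrightarrow>
     (\<exists>v\<in>W_dot p \<Omega>. \<not> (AE x in lebesgue_on \<Omega>. v x = 0) \<and>
        hardy_norm p \<Omega> v = N * gradient_norm p \<Omega> v)"

end

theory Submission
 imports Defs "HOL-Complex_Analysis.Great_Picard"
begin

text \<open>Let m be the dimension of y, put c = (m - p)/p, and let \<Lambda> be the infimum of the
  spherical quotient over smooth functions with compact support in G. The integrand of the numerator
  is the p-th power of the norm of the pair (c v, tangential gradient of v), so the quotient
  compares two Lp norms.

  The inequality. For a test function \<phi> on K let U(x) be the p-th root of the integral of
  |\<phi>(s x)|^p s^(m-p-1) over s > 0. U is homogeneous of degree -c, so on the unit sphere its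
  radial derivative is -c U and its full gradient has the norm of the pair formed from c U and its
  tangential gradient. Hoelder's inequality in s bounds the p-th power of the full gradient at w by
  the integral of |grad \<phi>(s w)|^p s^(m-1) over the ray. Hence U is a competitor on the sphere,
  and integration over G in polar coordinates (\<open>nn_integral_polar\<close>) gives \<Lambda>
  times the integral of |\<phi>|^p/|y|^p at most the integral of |grad \<phi>|^p. The locale
  \<open>ray_average\<close> does this with a truncation to a radial interval [a,b] and a
  regularisation by \<delta>, which are removed in \<open>Hardy_annulus\<close> and
  \<open>Hardy_test\<close>. The truncation leaves a boundary term at radius a: it has the right
  sign for p < m, and for p \<ge> m it vanishes, because K \<noteq> R^m keeps the origin outside K.
  Applying this for each fixed z gives \<open>Hardy_test_cylinder\<close>, and Fatou's lemma extends
  it to the energy space in \<open>Hardy_W_dot\<close>. Only the y-part of the gradient appears on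
  the right.

  No extremal. Equality would force the z-part of the gradient to vanish. Then v does not depend on
  z, and v/|y| cannot be in Lp unless v = 0 (\<open>weak_gradient_fst_only\<close>).

  Sharpness. The functions |y|^(-c) u(y/|y|) formally have the Hardy quotient of u on the sphere.
  They are cut off logarithmically in |y| and at a huge scale in z; the error is of order 1/R
  (\<open>trial_inequality\<close>) and disappears as R tends to infinity
  (\<open>sphere_le_cylinder\<close>, \<open>Hardy_constant_ge\<close>).

  The minimum. A minimizing sequence has an Lp-convergent subsequence by Rellich's theorem
  (\<open>sphere_Rellich\<close>); uniform convexity (\<open>uniform_convexity_powr\<close>)
  upgrades this to convergence of the gradients, so the infimum is attained
  (\<open>minimizer\<close>) and bounds all Sobolev quotients
  (\<open>quotient_ge_\<Lambda>\<close>).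

  Positivity. If p \<noteq> m then c \<noteq> 0 and \<Lambda> \<ge> |c|^p. If p = m, a sequence with
  quotient tending to 0 has gradients tending to 0 and vanishes at a unit vector outside G. Since p
  exceeds the dimension of the sphere, a Morrey type estimate (\<open>Morrey_at_zero\<close>) makes
  its Lp mass vanish near that point, and connectedness spreads this over the whole sphere, which
  contradicts the normalization (\<open>\<Lambda>_pos\<close>).\<close>

abbreviation (input) tends :: "(nat \<Rightarrow> 'a::topological_space) \<Rightarrow> 'a \<Rightarrow> bool" ("((_)/ ----> (_))" [60, 60] 60) where
 "X ----> l \<equiv> X \<longlonglongrightarrow> l"

abbreviation "borel_funs \<equiv> borel_measurable borel"

abbreviation "ind \<equiv> indicator"

section \<open>Smooth functions\<close>

lemma Ck_on_cong:
 assumes "open S" "\<And>x. x \<in> S \<Longrightarrow> f x = g x" "Ck_on k S f"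
 shows "Ck_on k S g" using assms(2,3)
proof (induction k arbitrary: f g)
 case 0
 then show ?case by (simp cong: continuous_on_cong)
next
 case (Suc k)
 have der: "(g has_derivative frechet_derivative f (at x)) (at x)" if "x \<in> S" for x
 proof (rule has_derivative_transform_within_open[of f _ x UNIV S])
  show "(f has_derivative frechet_derivative f (at x)) (at x)" using Suc.prems(2) that by (simp add: frechet_derivative_works)
 qed (use Suc.prems(1) that \<open>open S\<close> in auto)
 have "Ck_on k S (\<lambda>x. frechet_derivative g (at x) b)" if "b \<in> Basis" for b
 proof (rule Suc.IH)
  show "frechet_derivative f (at x) b = frechet_derivative g (at x) b" if "x \<in> S" for x
   using frechet_derivative_at[OF der[OF that]] by (rule fun_cong)
  show "Ck_on k S (\<lambda>x. frechet_derivative f (at x) b)" using Suc.prems(2) that by simp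
 qed
 then show ?case using der unfolding Ck_on.simps differentiable_def by blast
qed

text \<open>Lets an explicit derivative replace the one chosen by \<open>frechet_derivative\<close>;
  all later C^k proofs enter through this rule.\<close>

lemma Ck_on_SucI:
 assumes "open S" "\<And>x. x \<in> S \<Longrightarrow> (f has_derivative f' x) (at x)"
  and "\<And>b. b \<in> Basis \<Longrightarrow> Ck_on k S (\<lambda>x. f' x b)"
 shows "Ck_on (Suc k) S f"
proof -
 have "frechet_derivative f (at x) = f' x" if "x \<in> S" for x
  using frechet_derivative_at[OF assms(2)[OF that]] by simp
 then have "Ck_on k S (\<lambda>x. frechet_derivative f (at x) b)" if "b \<in> Basis" for b
  by (intro Ck_on_cong[OF assms(1) _ assms(3)[OF that]]) simp
 then show ?thesis using assms(2) unfolding Ck_on.simps differentiable_def by blast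
qed

lemma Ck_on_SucD:
 assumes "Ck_on (Suc k) S f"
 shows "\<And>x. x \<in> S \<Longrightarrow> (f has_derivative frechet_derivative f (at x)) (at x)"
  and "\<And>b. b \<in> Basis \<Longrightarrow> Ck_on k S (\<lambda>x. frechet_derivative f (at x) b)" using assms by (auto simp: frechet_derivative_works)

lemma Ck_on_Suc_imp: "Ck_on (Suc k) S f \<Longrightarrow> Ck_on k S f"
proof (induction k arbitrary: f)
 case 0
 then show ?case by (auto intro!: continuous_at_imp_continuous_on differentiable_imp_continuous_within)
next
 case (Suc k)
 have "\<forall>b\<in>Basis. Ck_on k S (\<lambda>x. frechet_derivative f (at x) b)" using Suc.prems by (auto simp del: Ck_on.simps intro!: Suc.IH dest: Ck_on_SucD(2))
 with Suc.prems show ?case by simp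
qed

lemma Ck_on_subset: "Ck_on k S f \<Longrightarrow> T \<subseteq> S \<Longrightarrow> Ck_on k T f"
 by (induction k arbitrary: f) (auto intro: continuous_on_subset)

lemma Ck_on_const: "open S \<Longrightarrow> Ck_on k S (\<lambda>x. c)"
proof (induction k arbitrary: c)
 case (Suc k)
 show ?case by (rule Ck_on_SucI[OF Suc.prems, where f'="\<lambda>x h. 0"]) (auto intro: Suc)
qed auto

lemma Ck_on_add: "open S \<Longrightarrow> Ck_on k S f \<Longrightarrow> Ck_on k S g \<Longrightarrow> Ck_on k S (\<lambda>x. f x + g x)"
proof (induction k arbitrary: f g)
 case 0
 then show ?case by (auto intro: continuous_intros)
next
 case (Suc k)
 note D = Ck_on_SucD[OF Suc.prems(2)] Ck_on_SucD[OF Suc.prems(3)]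
 show ?case by (rule Ck_on_SucI[OF Suc.prems(1) has_derivative_add[OF D(1,3)]]) (auto intro: Suc D)
qed

lemma Ck_on_mult: "open S \<Longrightarrow> Ck_on k S f \<Longrightarrow> Ck_on k S g \<Longrightarrow> Ck_on k S (\<lambda>x. f x * g x)"
proof (induction k arbitrary: f g)
 case 0
 then show ?case by (auto intro: continuous_intros)
next
 case (Suc k)
 note D = Ck_on_SucD[OF Suc.prems(2)] Ck_on_SucD[OF Suc.prems(3)]
 show ?case by (rule Ck_on_SucI[OF Suc.prems(1) has_derivative_mult[OF D(1,3)]])
    (auto intro!: Suc.IH Suc.prems(1) D(2,4) Ck_on_add Suc.prems(2,3)[THEN Ck_on_Suc_imp])
qed

lemma Ck_on_sum: "open S \<Longrightarrow> (\<And>i. i \<in> I \<Longrightarrow> Ck_on k S (f i)) \<Longrightarrow> Ck_on k S (\<lambda>x. \<Sum>i\<in>I. f i x)"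
 by (induction I rule: infinite_finite_induct) (auto intro: Ck_on_const Ck_on_add)

lemma Ck_on_prod: "open S \<Longrightarrow> (\<And>i. i \<in> I \<Longrightarrow> Ck_on k S (f i)) \<Longrightarrow> Ck_on k S (\<lambda>x. \<Prod>i\<in>I. f i x)"
 by (induction I rule: infinite_finite_induct) (auto intro: Ck_on_const Ck_on_mult)

lemma Ck_on_bounded_linear:
 assumes "open S" "bounded_linear l"
 shows "Ck_on k S l"
proof (cases k)
 case 0
 then show ?thesis using assms by (auto intro: linear_continuous_on)
next
 case (Suc j)
 show ?thesis unfolding Suc by (rule Ck_on_SucI[OF assms(1), where f'="\<lambda>x. l"]) (auto intro: Ck_on_const assms bounded_linear_imp_has_derivative)
qed

text \<open>By the chain rule each partial derivative of the composite is a finite sum of partial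
  derivatives of h times partial derivatives of g taken at h. The induction hypothesis applies to
  the latter, with h unchanged but regarded as one order less regular.\<close>

lemma Ck_on_compose:
 fixes g :: "'b::euclidean_space \<Rightarrow> real" and h :: "'a::euclidean_space \<Rightarrow> 'b"
 assumes "open S" "open T" "Ck_on k T g" "\<And>b. b \<in> Basis \<Longrightarrow> Ck_on k S (\<lambda>x. h x \<bullet> b)"
  and "h ` S \<subseteq> T"
 shows "Ck_on k S (\<lambda>x. g (h x))" using assms(3-5)
proof (induction k arbitrary: g)
 case 0
 have "continuous_on S h" using 0(2) by (auto intro: continuous_on_componentwise[THEN iffD2])
 then show ?case using 0 by (auto intro: continuous_on_compose2)
next
 case (Suc k)
 note Dg = Ck_on_SucD[OF Suc.prems(1)] and Dh = Ck_on_SucD[OF Suc.prems(2)]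
 define h' where "h' x v = (\<Sum>b\<in>Basis. frechet_derivative (\<lambda>x. h x \<bullet> b) (at x) v *\<^sub>R b)" for x v
 have h': "(h has_derivative h' x) (at x)" if "x \<in> S" for x
  by (subst has_derivative_componentwise_within) (use that Dh(1) in "auto simp: h'_def")
 have g': "(g has_derivative frechet_derivative g (at (h x))) (at (h x))" if "x \<in> S" for x
  using Dg(1) that Suc.prems by auto
 have eq: "frechet_derivative g (at (h x)) (h' x v) = (\<Sum>b\<in>Basis. frechet_derivative (\<lambda>x. h x \<bullet> b) (at x) v * frechet_derivative g (at (h x)) b)"
  if "x \<in> S" for x v
 proof -
  interpret linear "frechet_derivative g (at (h x))" using g'[OF that] has_derivative_linear by blast
  show ?thesis by (simp add: h'_def sum scale)
 qed
 show ?case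
 proof (rule Ck_on_SucI[OF assms(1)])
  show "((\<lambda>x. g (h x)) has_derivative (\<lambda>v. frechet_derivative g (at (h x)) (h' x v))) (at x)"
   if "x \<in> S" for x
   using has_derivative_compose[OF h'[OF that] g'[OF that]] .
  fix v :: 'a assume v: "v \<in> Basis"
  have "Ck_on k S (\<lambda>x. \<Sum>b\<in>Basis. frechet_derivative (\<lambda>x. h x \<bullet> b) (at x) v * frechet_derivative g (at (h x)) b)"
  proof (rule Ck_on_sum[OF assms(1)], rule Ck_on_mult[OF assms(1)])
   fix b :: 'b assume b: "b \<in> Basis"
   show "Ck_on k S (\<lambda>x. frechet_derivative (\<lambda>x. h x \<bullet> b) (at x) v)" by (rule Dh(2)[OF b v])
   show "Ck_on k S (\<lambda>x. frechet_derivative g (at (h x)) b)" by (rule Suc.IH[OF Dg(2)[OF b] Ck_on_Suc_imp[OF Suc.prems(2)] Suc.prems(3)])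
  qed
  then show "Ck_on k S (\<lambda>x. frechet_derivative g (at (h x)) (h' x v))" by (rule Ck_on_cong[OF assms(1), rotated]) (simp add: eq)
 qed
qed

lemma smooth_on_cong: "open S \<Longrightarrow> (\<And>x. x \<in> S \<Longrightarrow> f x = g x) \<Longrightarrow> smooth_on S f \<Longrightarrow> smooth_on S g"
 unfolding smooth_on_def by (blast intro: Ck_on_cong)

lemma smooth_on_subset: "smooth_on S f \<Longrightarrow> T \<subseteq> S \<Longrightarrow> smooth_on T f"
 by (auto simp: smooth_on_def intro: Ck_on_subset)

lemma smooth_on_const: "open S \<Longrightarrow> smooth_on S (\<lambda>x. c)"
 by (simp add: smooth_on_def Ck_on_const)

lemma smooth_on_add: "open S \<Longrightarrow> smooth_on S f \<Longrightarrow> smooth_on S g \<Longrightarrow> smooth_on S (\<lambda>x. f x + g x)"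
 by (simp add: smooth_on_def Ck_on_add)

lemma smooth_on_mult: "open S \<Longrightarrow> smooth_on S f \<Longrightarrow> smooth_on S g \<Longrightarrow> smooth_on S (\<lambda>x. f x * g x)"
 by (simp add: smooth_on_def Ck_on_mult)

lemma smooth_on_diff:
 assumes "open S" "smooth_on S f" "smooth_on S g"
 shows "smooth_on S (\<lambda>x. f x - g x)" using smooth_on_add[OF assms(1,2) smooth_on_mult[OF assms(1) smooth_on_const assms(3), of "-1"]] assms(1) by simp

lemma smooth_on_sum: "open S \<Longrightarrow> (\<And>i. i \<in> I \<Longrightarrow> smooth_on S (f i)) \<Longrightarrow> smooth_on S (\<lambda>x. \<Sum>i\<in>I. f i x)"
 by (simp add: smooth_on_def Ck_on_sum)

lemma smooth_on_prod: "open S \<Longrightarrow> (\<And>i. i \<in> I \<Longrightarrow> smooth_on S (f i)) \<Longrightarrow> smooth_on S (\<lambda>x. \<Prod>i\<in>I. f i x)"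
 by (simp add: smooth_on_def Ck_on_prod)

lemma smooth_on_linear: "open S \<Longrightarrow> bounded_linear l \<Longrightarrow> smooth_on S l"
 by (simp add: smooth_on_def Ck_on_bounded_linear)

lemma smooth_on_compose:
 fixes g :: "'b::euclidean_space \<Rightarrow> real" and h :: "'a::euclidean_space \<Rightarrow> 'b"
 assumes "open S" "open T" "smooth_on T g" "\<And>b. b \<in> Basis \<Longrightarrow> smooth_on S (\<lambda>x. h x \<bullet> b)"
  and "h ` S \<subseteq> T"
 shows "smooth_on S (\<lambda>x. g (h x))" using assms unfolding smooth_on_def by (blast intro: Ck_on_compose)

lemma smooth_on_compose_real:
 fixes g :: "real \<Rightarrow> real" and h :: "'a::euclidean_space \<Rightarrow> real"
 assumes "open S" "open T" "smooth_on T g" "smooth_on S h" "h ` S \<subseteq> T"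
 shows "smooth_on S (\<lambda>x. g (h x))" using assms by (intro smooth_on_compose[of S T g h]) auto

lemma smooth_on_continuous: "smooth_on S f \<Longrightarrow> continuous_on S f"
 unfolding smooth_on_def by (metis Ck_on.simps(1))

section \<open>Smoothness of powers, exponential, logarithm, the flat function and the norm\<close>

lemma Ck_on_real_SucI:
 fixes f :: "real \<Rightarrow> real"
 assumes "open S" "\<And>x. x \<in> S \<Longrightarrow> (f has_real_derivative f' x) (at x)" "Ck_on k S f'"
 shows "Ck_on (Suc k) S f" by (rule Ck_on_SucI[OF assms(1) has_field_derivative_imp_has_derivative[OF assms(2)]]) (use assms(3) in auto)

lemma smooth_on_powr: "smooth_on {0<..} (\<lambda>x::real. x powr a)"
proof -
 have "Ck_on k {0<..} (\<lambda>x::real. c * x powr a)" for k c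
 proof (induction k arbitrary: a c)
  case 0
  then show ?case by (auto intro!: continuous_intros)
 next
  case (Suc k)
  show ?case
  proof (rule Ck_on_real_SucI[where f'="\<lambda>x. (c * a) * x powr (a - 1)"])
   fix x :: real assume "x \<in> {0<..}"
   then have "((\<lambda>x. x powr a) has_real_derivative a * x powr (a - 1)) (at x)" by (intro has_real_derivative_powr) auto
   from DERIV_cmult[OF this, of c]
   show "((\<lambda>x. c * x powr a) has_real_derivative c * a * x powr (a - 1)) (at x)" by (simp add: mult.assoc)
  qed (auto intro!: Suc)
 qed
 from this[of _ 1] show ?thesis by (simp add: smooth_on_def)
qed

lemma smooth_on_exp: "smooth_on UNIV (exp :: real \<Rightarrow> real)"
proof -
 have "Ck_on k UNIV (exp :: real \<Rightarrow> real)" for k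
 proof (induction k)
  case (Suc k)
  show ?case by (rule Ck_on_real_SucI[where f'=exp]) (auto intro!: Suc derivative_eq_intros)
 qed (auto intro!: continuous_intros)
 then show ?thesis by (simp add: smooth_on_def)
qed

lemma smooth_on_ln: "smooth_on {0<..} (ln :: real \<Rightarrow> real)"
 unfolding smooth_on_def
proof
 fix k show "Ck_on k {0<..} (ln :: real \<Rightarrow> real)"
 proof (cases k)
  case 0
  then show ?thesis by (auto intro!: continuous_intros)
 next
  case (Suc j)
  have "Ck_on j {0<..} (\<lambda>x::real. x powr -1)" using smooth_on_powr[of "-1"] by (simp add: smooth_on_def)
  then show ?thesis unfolding Suc by (intro Ck_on_real_SucI[where f'="\<lambda>x. x powr -1"]) (auto intro!: derivative_eq_intros simp: powr_minus field_simps)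
 qed
qed

definition flat :: "real \<Rightarrow> real" where "flat t = (if t \<le> 0 then 0 else exp (- inverse t))"

lemma flat_nonneg: "0 \<le> flat t" and flat_pos_iff: "0 < flat t \<longleftrightarrow> 0 < t" and flat_le_1: "flat t \<le> 1"
 by (auto simp: flat_def)

text \<open>The functions t^(-n) exp(-1/t), extended by 0 to t \<le> 0, form a family that is closed
  under differentiation up to linear combinations; so the induction is over the whole family with a
  free coefficient.\<close>

lemma smooth_on_flat: "smooth_on UNIV flat"
proof -
 define E :: "nat \<Rightarrow> real \<Rightarrow> real" where "E n t = (if t \<le> 0 then 0 else inverse t ^ n * exp (- inverse t))" for n t
 have lim0: "((\<lambda>t. inverse t ^ n * exp (- inverse t)) \<longlongrightarrow> 0) (at_right (0::real))" for n
 proof -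
  have "((\<lambda>t::real. inverse t ^ n / exp (inverse t)) \<longlongrightarrow> 0) (at_right 0)"
   by (rule filterlim_compose[OF tendsto_power_div_exp_0 filterlim_inverse_at_top_right])
  then show ?thesis by (simp add: exp_minus divide_inverse)
 qed
 have E0: "(E n \<longlongrightarrow> 0) (at 0)" for n
  unfolding filterlim_at_split
 proof
  show "(E n \<longlongrightarrow> 0) (at_left 0)" by (rule tendsto_eventually) (auto simp: E_def eventually_at_filter)
  show "(E n \<longlongrightarrow> 0) (at_right 0)" using lim0[of n] by (rule Lim_transform_eventually) (auto simp: E_def eventually_at_filter)
 qed
 have der: "(E n has_real_derivative (E (n + 2) t - n * E (Suc n) t)) (at t)" for n t
 proof (cases "t = 0")
  case True
  \<comment> \<open>The difference quotient of \<open>E n\<close> at 0 is \<open>E (Suc n)\<close>,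
    so flatness of the next member of the family gives the derivative 0.\<close>
  have "((\<lambda>h. (E n (0 + h) - E n 0) / h) \<longlongrightarrow> 0) (at 0)" using E0[of "Suc n"] by (rule Lim_transform_eventually) (auto simp: E_def eventually_at_filter field_simps)
  then show ?thesis using True by (simp add: E_def DERIV_def)
 next
  case False
  show ?thesis
  proof (cases "t < 0")
   case True
   have "((\<lambda>x. 0) has_real_derivative 0) (at t)" by simp
   then have "(E n has_real_derivative 0) (at t)" by (rule has_field_derivative_transform_within_open[where S="{..<0}"]) (use True in "auto simp: E_def")
   then show ?thesis using True by (simp add: E_def)
  next
   case F: False
   with False have "t > 0" by simp
   have inv: "((\<lambda>t. inverse t) has_real_derivative - (inverse t ^ 2)) (at t)"
    using \<open>t > 0\<close> by (auto intro!: derivative_eq_intros simp: power2_eq_square)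
   have D0: "((\<lambda>t. inverse t ^ n * exp (- inverse t)) has_real_derivative (inverse t ^ n * (exp (- inverse t) * inverse t ^ 2)
      + (n * inverse t ^ (n - 1) * - (inverse t ^ 2)) * exp (- inverse t))) (at t)" by (rule derivative_eq_intros inv refl | simp)+
   have "n * inverse t ^ (n - 1) * inverse t ^ 2 = n * inverse t ^ Suc n" by (cases n) (auto simp: power2_eq_square algebra_simps)
   then have e1: "(n * inverse t ^ (n - 1) * - (inverse t ^ 2)) * exp (- inverse t) = - (n * E (Suc n) t)" using \<open>t > 0\<close> by (simp add: E_def)
   have e2: "inverse t ^ n * (exp (- inverse t) * inverse t ^ 2) = E (n + 2) t" using \<open>t > 0\<close> by (simp add: E_def power_add power2_eq_square)
   have "((\<lambda>t. inverse t ^ n * exp (- inverse t)) has_real_derivative (E (n + 2) t - n * E (Suc n) t)) (at t)" using D0 unfolding e1 e2 by simp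
   then show ?thesis by (rule has_field_derivative_transform_within_open[where S="{0<..}"]) (use \<open>t > 0\<close> in "auto simp: E_def")
  qed
 qed
 have "Ck_on k UNIV (\<lambda>t. c * E n t)" for k n c
 proof (induction k arbitrary: n c)
  case 0
  have "continuous_on UNIV (E n)" using der DERIV_isCont by (blast intro: continuous_at_imp_continuous_on)
  then show ?case by (auto intro: continuous_intros)
 next
  case (Suc k)
  have "Ck_on k UNIV (\<lambda>t. c * E (n + 2) t + (- c * n) * E (Suc n) t)" by (intro Ck_on_add Suc.IH) auto
  then show ?case by (intro Ck_on_real_SucI[where f'="\<lambda>t. c * E (n + 2) t + (- c * n) * E (Suc n) t"]) (auto intro!: derivative_eq_intros der simp: algebra_simps)
 qed
 from this[of _ 1 0] have "smooth_on UNIV (E 0)" by (simp add: smooth_on_def)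
 moreover have "E 0 = flat" by (auto simp: E_def flat_def)
 ultimately show ?thesis by simp
qed

lemma smooth_on_norm_powr: "smooth_on (- {0::'a::euclidean_space}) (\<lambda>x. norm x powr a)"
proof -
 have sq: "smooth_on (- {0::'a}) (\<lambda>x. x \<bullet> x)" unfolding euclidean_inner[of x x for x]
  by (intro smooth_on_sum smooth_on_mult smooth_on_linear bounded_linear_inner_left) auto
 have "smooth_on (- {0::'a}) (\<lambda>x. (x \<bullet> x) powr (a/2))" by (rule smooth_on_compose_real[OF _ _ smooth_on_powr sq]) auto
 then show ?thesis by (rule smooth_on_cong[rotated 2]) (auto simp: norm_eq_sqrt_inner powr_half_sqrt[symmetric] powr_powr)
qed

lemma smooth_on_sgn: "smooth_on (- {0::'a::euclidean_space}) (\<lambda>x. sgn x \<bullet> b)"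
proof -
 have "smooth_on (- {0::'a}) (\<lambda>x. norm x powr -1 * (x \<bullet> b))"
  by (intro smooth_on_mult smooth_on_norm_powr smooth_on_linear bounded_linear_inner_left) auto
 then show ?thesis by (rule smooth_on_cong[rotated 2]) (auto simp: sgn_div_norm powr_minus)
qed

lemma smooth_on_ln_norm: "smooth_on (- {0::'a::euclidean_space}) (\<lambda>x. ln (norm x))"
proof -
 have "smooth_on (- {0::'a}) (\<lambda>x. norm x)" using smooth_on_norm_powr[of 1] by (rule smooth_on_cong[rotated 2]) auto
 then show ?thesis by (intro smooth_on_compose_real[OF _ _ smooth_on_ln]) auto
qed

section \<open>Differentiation of integrals with a parameter\<close>

lemma frechet_derivative_param:
 fixes F :: "'a::euclidean_space \<times> real \<Rightarrow> real"
 assumes "F differentiable (at (x, s))"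
 shows "((\<lambda>x. F (x, s)) has_derivative (\<lambda>v. frechet_derivative F (at (x, s)) (v, 0))) (at x)" by (rule has_derivative_compose[where f="\<lambda>x. (x, s)"])
   (use assms in "auto simp: frechet_derivative_works intro!: derivative_eq_intros")

text \<open>A partial derivative of the parameter integral is the parameter integral of the
  derivative of F in the direction (v, 0), which is again of the required class; hence the induction
  on k for all F at once. Used for averages over rays and over segments.\<close>

lemma Ck_on_integral:
 fixes F :: "'a::euclidean_space \<times> real \<Rightarrow> real"
 assumes "open S" "Ck_on k (S \<times> T) F" "open T" "{a..b} \<subseteq> T"
 shows "Ck_on k S (\<lambda>x. integral {a..b} (\<lambda>s. F (x, s)))" using assms(2)
proof (induction k arbitrary: F)
 case 0
 then have "continuous_on (S \<times> {a..b}) F" by (rule continuous_on_subset[OF Ck_on.simps(1)[THEN iffD1]]) (use assms(4) in auto)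
 then show ?case unfolding Ck_on.simps using integral_continuous_on_param[of S a b "\<lambda>x s. F (x, s)"] by (simp add: split_beta' cbox_interval)
next
 case (Suc k)
 note D = Ck_on_SucD[OF Suc.prems]
 have C0: "Ck_on 0 (S \<times> T) f" if "Ck_on k (S \<times> T) f" for f
  using that by (induction k) (auto dest: Ck_on_Suc_imp simp del: Ck_on.simps)
 have F'c: "continuous_on (S \<times> T) (\<lambda>y. frechet_derivative F (at y) (v, 0))" if "v \<in> Basis" for v
  using C0[OF D(2)[of "(v,0)"]] that by (auto simp: Basis_prod_def)
 have Fc: "continuous_on (S \<times> T) F" by (intro continuous_at_imp_continuous_on ballI has_derivative_continuous[OF D(1)])
 define F' where "F' x s v = frechet_derivative F (at (x, s)) (v, 0)" for x s v
 have lin: "bounded_linear (F' x s)" if "x \<in> S" "s \<in> T" for x s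
 proof -
  have "bounded_linear (frechet_derivative F (at (x, s)))" using D(1)[of "(x, s)"] that has_derivative_bounded_linear by blast
  from bounded_linear_compose[OF this bounded_linear_Pair[OF bounded_linear_ident bounded_linear_zero]]
  show ?thesis by (simp add: F'_def[abs_def])
 qed
 have Fsum: "F' x s v = (\<Sum>i\<in>Basis. F' x s i * (v \<bullet> i))" if "x \<in> S" "s \<in> T" for x s v
 proof -
  interpret bounded_linear "F' x s" using lin[OF that] .
  have "F' x s v = F' x s (\<Sum>i\<in>Basis. (v \<bullet> i) *\<^sub>R i)" by (simp only: euclidean_representation)
  also have "\<dots> = (\<Sum>i\<in>Basis. F' x s i * (v \<bullet> i))" by (simp add: sum scale mult.commute)
  finally show ?thesis .
 qed
 have contF': "continuous_on (S \<times> {a..b}) (\<lambda>y. F' (fst y) (snd y) i)" if "i \<in> Basis" for i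
  unfolding F'_def using F'c[OF that] assms(4) by (auto intro: continuous_on_subset)
 have der: "((\<lambda>x. integral {a..b} (\<lambda>s. F (x, s))) has_derivative (\<lambda>v. \<Sum>i\<in>Basis. integral {a..b} (\<lambda>s. F' x s i) * (v \<bullet> i))) (at x)" if "x \<in> S" for x
 proof -
  obtain e where e: "e > 0" "ball x e \<subseteq> S" using \<open>open S\<close> \<open>x \<in> S\<close> open_contains_ball by blast
  \<comment> \<open>The Leibniz rule asks for a derivative valued in bounded linear maps; assembling
    it from partial derivatives makes its continuity immediate.\<close>
  define fx where "fx y s = (\<Sum>i\<in>Basis. F' y s i *\<^sub>R blinfun_inner_left i)" for y s
  have fx_apply: "blinfun_apply (fx y s) v = F' y s v" if "y \<in> S" "s \<in> T" for y s v
   by (subst Fsum[OF that]) (simp add: fx_def blinfun.sum_left blinfun.scaleR_left inner_commute)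
  have "((\<lambda>x. integral (cbox a b) (\<lambda>s. F (x, s))) has_derivative integral (cbox a b) (fx x)) (at x within ball x e)"
  proof (rule leibniz_rule)
   fix y t assume y: "y \<in> ball x e" and t: "t \<in> cbox a b"
   have "(y, t) \<in> S \<times> T" using y t e assms(4) by auto
   then have "((\<lambda>x. F (x, t)) has_derivative F' y t) (at y)" unfolding F'_def[abs_def] by (intro frechet_derivative_param) (use Suc.prems in auto)
   moreover have "F' y t = blinfun_apply (fx y t)" using fx_apply[of y t] \<open>(y, t) \<in> S \<times> T\<close> by auto
   ultimately show "((\<lambda>x. F (x, t)) has_derivative blinfun_apply (fx y t)) (at y within ball x e)" by (auto intro: has_derivative_at_withinI)
  next
   fix y assume "y \<in> ball x e"
   then have "continuous_on {a..b} (\<lambda>s. F (y, s))" using assms(4) e by (intro continuous_on_compose2[OF Fc]) (auto intro!: continuous_intros)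
   then show "(\<lambda>s. F (y, s)) integrable_on cbox a b" by (simp add: integrable_continuous_interval)
  next
   have "continuous_on (ball x e \<times> cbox a b) (\<lambda>z. F' (fst z) (snd z) i)" if "i \<in> Basis" for i
    by (rule continuous_on_subset[OF contF'[OF that]]) (use e in auto)
   then show "continuous_on (ball x e \<times> cbox a b) (\<lambda>(x, t). fx x t)" unfolding fx_def split_beta by (intro continuous_intros) auto
  qed (use e in auto)
  moreover have "blinfun_apply (integral (cbox a b) (fx x)) = (\<lambda>v. \<Sum>i\<in>Basis. integral {a..b} (\<lambda>s. F' x s i) * (v \<bullet> i))"
  proof
   fix v
   have int: "(\<lambda>s. F' x s i) integrable_on {a..b}" if "i \<in> Basis" for i
    by (rule integrable_continuous_interval, rule continuous_on_compose2[OF contF'[OF that], of _ "\<lambda>s. (x, s)", simplified])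
      (use \<open>x \<in> S\<close> in "auto intro!: continuous_intros")
   have "(fx x) integrable_on cbox a b" unfolding fx_def by (intro integrable_sum integrable_on_scaleR_left) (use int in auto)
   then have "blinfun_apply (integral (cbox a b) (fx x)) v = integral (cbox a b) (\<lambda>s. blinfun_apply (fx x s) v)" by (rule blinfun_apply_integral)
   also have "\<dots> = integral {a..b} (\<lambda>s. \<Sum>i\<in>Basis. F' x s i * (v \<bullet> i))"
    by (auto intro!: integral_cong simp: fx_def blinfun.sum_left blinfun.scaleR_left inner_commute)
   also have "\<dots> = (\<Sum>i\<in>Basis. integral {a..b} (\<lambda>s. F' x s i) * (v \<bullet> i))" by (subst integral_sum) (auto intro!: integrable_on_mult_left int)
   finally show "blinfun_apply (integral (cbox a b) (fx x)) v = (\<Sum>i\<in>Basis. integral {a..b} (\<lambda>s. F' x s i) * (v \<bullet> i))" .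
  qed
  moreover have "at x within ball x e = at x" using e by (intro at_within_open) auto
  ultimately show ?thesis by simp
 qed
 show ?case
 proof (rule Ck_on_SucI[OF \<open>open S\<close> der])
  fix v :: 'a assume v: "v \<in> Basis"
  have "Ck_on k S (\<lambda>x. integral {a..b} (\<lambda>s. frechet_derivative F (at (x, s)) (v, 0)))"
   by (rule Suc.IH) (rule D(2), use v in "auto simp: Basis_prod_def")
  then show "Ck_on k S (\<lambda>x. \<Sum>i\<in>Basis. integral {a..b} (\<lambda>s. F' x s i) * (v \<bullet> i))" by (rule Ck_on_cong[OF \<open>open S\<close>, rotated])
     (use v in "simp add: F'_def inner_Basis if_distrib sum.delta cong: if_cong")
 qed
qed

lemma smooth_on_integral:
 fixes F :: "'a::euclidean_space \<times> real \<Rightarrow> real"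
 assumes "open S" "smooth_on (S \<times> T) F" "open T" "{a..b} \<subseteq> T"
 shows "smooth_on S (\<lambda>x. integral {a..b} (\<lambda>s. F (x, s)))" using assms unfolding smooth_on_def by (blast intro: Ck_on_integral)

section \<open>Classical gradients\<close>

lemma gderiv_unique:
 assumes "GDERIV f x :> D" "GDERIV f x :> D'"
 shows "D = D'"
proof -
 have "(\<lambda>h. h \<bullet> D) = (\<lambda>h. h \<bullet> D')" using assms has_derivative_unique unfolding gderiv_def by blast
 then show ?thesis by (metis inner_commute vector_eq_ldot)
qed

lemma grad_eq: "GDERIV f x :> D \<Longrightarrow> grad f x = D"
 unfolding grad_def by (rule the_equality) (auto intro: gderiv_unique)

lemma smooth_on_GDERIV:
 fixes f :: "'a::euclidean_space \<Rightarrow> real"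
 assumes "smooth_on S f" "x \<in> S"
 shows "GDERIV f x :> grad f x"
proof -
 have "Ck_on (Suc 0) S f" using assms(1) by (auto simp: smooth_on_def)
 note D = Ck_on_SucD(1)[OF this assms(2)]
 interpret linear "frechet_derivative f (at x)" using D has_derivative_linear by blast
 have "frechet_derivative f (at x) v = v \<bullet> (\<Sum>b\<in>Basis. frechet_derivative f (at x) b *\<^sub>R b)" for v
 proof -
  have "frechet_derivative f (at x) v = frechet_derivative f (at x) (\<Sum>b\<in>Basis. (v \<bullet> b) *\<^sub>R b)" by (simp only: euclidean_representation)
  also have "\<dots> = v \<bullet> (\<Sum>b\<in>Basis. frechet_derivative f (at x) b *\<^sub>R b)" by (simp add: sum scale inner_sum_right mult.commute)
  finally show ?thesis .
 qed
 then have G: "GDERIV f x :> (\<Sum>b\<in>Basis. frechet_derivative f (at x) b *\<^sub>R b)" unfolding gderiv_def by (intro has_derivative_eq_rhs[OF D] ext)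
 from G grad_eq[OF G] show ?thesis by simp
qed

section \<open>Lebesgue spaces\<close>

lemma Lp_norm_nonneg: "0 \<le> Lp_norm p M f"
 by (simp add: Lp_norm_def)

lemma Lp_norm_powr:
 assumes "0 < p"
 shows "Lp_norm p M f powr p = (LINT x|M. norm (f x) powr p)" using assms by (simp add: Lp_norm_def powr_powr integral_nonneg)

lemma Lp_norm_cong_AE:
 assumes "AE x in M. norm (f x) = norm (g x)" "f \<in> borel_measurable M" "g \<in> borel_measurable M"
 shows "Lp_norm p M f = Lp_norm p M g" unfolding Lp_norm_def by (intro arg_cong2[where f="(powr)"] integral_cong_AE) (use assms in auto)

lemma Lp_member_bound:
 fixes f :: "'a \<Rightarrow> 'b::euclidean_space" and g :: "'a \<Rightarrow> 'c::euclidean_space"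
 assumes "0 < p" "Lp_member p M g" "f \<in> borel_measurable M" "AE x in M. norm (f x) \<le> norm (g x)"
 shows "Lp_member p M f" unfolding Lp_member_def
proof
 have "AE x in M. norm (norm (f x) powr p) \<le> norm (norm (g x) powr p)" using assms(4) by eventually_elim (use assms(1) in "auto intro: powr_mono2")
 with assms(2,3) show "integrable M (\<lambda>x. norm (f x) powr p)" by (auto simp: Lp_member_def intro: Bochner_Integration.integrable_bound)
qed fact

lemma Lp_norm_mono:
 fixes f :: "'a \<Rightarrow> 'b::euclidean_space" and g :: "'a \<Rightarrow> 'c::euclidean_space"
 assumes "0 < p" "Lp_member p M g" "f \<in> borel_measurable M" "AE x in M. norm (f x) \<le> norm (g x)"
 shows "Lp_norm p M f \<le> Lp_norm p M g"
proof -
 have "Lp_member p M f" using assms by (rule Lp_member_bound)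
 moreover have "AE x in M. norm (f x) powr p \<le> norm (g x) powr p" using assms(4) by eventually_elim (use assms(1) in "auto intro: powr_mono2")
 ultimately show ?thesis using assms unfolding Lp_norm_def Lp_member_def by (intro powr_mono2 integral_mono_AE) (auto intro: integral_nonneg)
qed

lemma Lp_norm_eq_0_iff:
 assumes "0 < p" "Lp_member p M f"
 shows "Lp_norm p M f = 0 \<longleftrightarrow> (AE x in M. f x = 0)" using assms unfolding Lp_norm_def Lp_member_def by (simp add: integral_nonneg_eq_0_iff_AE)

section \<open>Convexity of powers; the inequalities of Minkowski, Hoelder and Jensen\<close>

lemma powr_convex_nonneg:
 assumes "1 \<le> p"
 shows "convex_on {0..} (\<lambda>x::real. x powr p)"
proof (rule convex_on_linorderI)
 fix t x y :: real
 assume t: "0 < t" "t < 1" and xy: "x \<in> {0..}" "y \<in> {0..}" "x < y"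
 have "t powr p \<le> t powr 1" using t assms by (intro powr_mono') auto
 then have "t powr p * y powr p \<le> t * y powr p" using t by (intro mult_right_mono) auto
 then show "((1 - t) *\<^sub>R x + t *\<^sub>R y) powr p \<le> (1 - t) * x powr p + t * y powr p" using convex_onD[OF powr_convex[OF assms], of t x y] t xy
  by (cases "x = 0") (auto simp: powr_mult)
qed auto

text \<open>Convexity applied to a/(1-t) and b/t with weights 1-t and t. Keeping t free is what
  yields Minkowski's inequality with constant 1.\<close>

lemma norm_add_powr_le:
 fixes a b :: "'a::real_normed_vector"
 assumes "1 \<le> p" "0 < t" "t < 1"
 shows "norm (a + b) powr p \<le> (1 - t) powr (1 - p) * norm a powr p + t powr (1 - p) * norm b powr p"
proof -
 have *: "s * (x / s) powr p = s powr (1 - p) * x powr p" if "0 < s" "0 \<le> x" for s x :: real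
  using that by (simp add: powr_divide powr_diff)
 have "norm (a + b) powr p \<le> ((1 - t) *\<^sub>R (norm a / (1 - t)) + t *\<^sub>R (norm b / t)) powr p"
  using assms by (intro powr_mono2) (auto intro: norm_triangle_ineq)
 also have "\<dots> \<le> (1 - t) * (norm a / (1 - t)) powr p + t * (norm b / t) powr p" using assms by (intro convex_onD[OF powr_convex_nonneg]) auto
 finally show ?thesis using assms by (simp add: *)
qed

lemma Minkowski:
 fixes f g :: "'a \<Rightarrow> 'b::euclidean_space"
 assumes p: "1 < p" and f: "Lp_member p M f" and g: "Lp_member p M g"
 shows Lp_member_add: "Lp_member p M (\<lambda>x. f x + g x)"
  and Lp_norm_triangle: "Lp_norm p M (\<lambda>x. f x + g x) \<le> Lp_norm p M f + Lp_norm p M g"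
proof -
 have [measurable]: "f \<in> borel_measurable M" "g \<in> borel_measurable M" using f g by (auto simp: Lp_member_def)
 have If: "integrable M (\<lambda>x. norm (f x) powr p)" and Ig: "integrable M (\<lambda>x. norm (g x) powr p)" using f g by (auto simp: Lp_member_def)
 have int: "integrable M (\<lambda>x. (1 - t) powr (1 - p) * norm (f x) powr p + t powr (1 - p) * norm (g x) powr p)" for t
  by (intro Bochner_Integration.integrable_add integrable_mult_right If Ig)
 have pw: "norm (f x + g x) powr p \<le> (1 - t) powr (1 - p) * norm (f x) powr p + t powr (1 - p) * norm (g x) powr p"
  if "0 < t" "t < 1" for t x
  using norm_add_powr_le[of p t] p that by simp
 have Is: "integrable M (\<lambda>x. norm (f x + g x) powr p)" by (rule Bochner_Integration.integrable_bound[OF int[of "1/2"]])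
    (use pw[of "1/2"] in "auto intro!: AE_I2 order_trans[OF _ abs_ge_self]")
 then show "Lp_member p M (\<lambda>x. f x + g x)" by (simp add: Lp_member_def)
 define A B where "A = Lp_norm p M f" and "B = Lp_norm p M g"
 have A: "A powr p = (LINT x|M. norm (f x) powr p)" and B: "B powr p = (LINT x|M. norm (g x) powr p)"
  using p by (auto simp: A_def B_def Lp_norm_powr)
 show "Lp_norm p M (\<lambda>x. f x + g x) \<le> Lp_norm p M f + Lp_norm p M g"
 proof (cases "A = 0 \<or> B = 0")
  case True
  then consider "AE x in M. f x = 0" "A = 0" | "AE x in M. g x = 0" "B = 0" using Lp_norm_eq_0_iff[of p M] f g p by (auto simp: A_def B_def)
  then show ?thesis
  proof cases
   case 1
   have "Lp_norm p M (\<lambda>x. f x + g x) = Lp_norm p M g" by (rule Lp_norm_cong_AE) (use 1 in auto)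
   with 1 show ?thesis by (simp add: A_def)
  next
   case 2
   have "Lp_norm p M (\<lambda>x. f x + g x) = Lp_norm p M f" by (rule Lp_norm_cong_AE) (use 2 in auto)
   with 2 show ?thesis by (simp add: B_def)
  qed
 next
  case False
  then have pos: "A > 0" "B > 0" using Lp_norm_nonneg[of p M] by (auto simp: A_def B_def less_le)
  \<comment> \<open>The minimizing weight: with it the two terms of the convexity bound add up to
    exactly (A + B)^p.\<close>
  define t where "t = B / (A + B)"
  have t: "0 < t" "t < 1" "1 - t = A / (A + B)" using pos by (auto simp: t_def field_simps)
  have *: "(x / (A + B)) powr (1 - p) * x powr p = (A + B) powr (p - 1) * x" if "x > 0" for x
  proof -
   have "(x / (A + B)) powr (1 - p) * x powr p = x powr (1 - p) * x powr p / (A + B) powr (1 - p)" using that pos by (simp add: powr_divide)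
   also have "x powr (1 - p) * x powr p = x" using that by (simp add: powr_add[symmetric])
   finally show ?thesis using that pos by (simp add: powr_diff powr_minus divide_simps)
  qed
  have "(LINT x|M. norm (f x + g x) powr p) \<le> (LINT x|M. (1 - t) powr (1 - p) * norm (f x) powr p + t powr (1 - p) * norm (g x) powr p)"
   by (intro integral_mono Is int pw t)
  also have "\<dots> = (1 - t) powr (1 - p) * A powr p + t powr (1 - p) * B powr p"
   unfolding A B by (subst Bochner_Integration.integral_add) (auto intro: If Ig)
  also have "\<dots> = (A + B) powr (p - 1) * A + (A + B) powr (p - 1) * B" unfolding t(3) by (simp add: * pos t_def)
  also have "\<dots> = (A + B) powr (p - 1) * (A + B) powr 1" using pos by (simp add: distrib_left)
  also have "\<dots> = (A + B) powr p" unfolding powr_add[symmetric] by simp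
  finally have "Lp_norm p M (\<lambda>x. f x + g x) \<le> ((A + B) powr p) powr (1 / p)"
   unfolding Lp_norm_def using p by (intro powr_mono2) (auto intro: integral_nonneg)
  with pos p show ?thesis by (simp add: powr_powr A_def B_def)
 qed
qed

lemma Lp_member_uminus: "Lp_member p M f \<Longrightarrow> Lp_member p M (\<lambda>x. - f x)"
 and Lp_norm_uminus: "Lp_norm p M (\<lambda>x. - f x) = Lp_norm p M f" by (auto simp: Lp_member_def Lp_norm_def)

lemma Lp_member_diff:
 assumes "1 < p" "Lp_member p M f" "Lp_member p M g"
 shows "Lp_member p M (\<lambda>x. f x - g x)" using Lp_member_add[OF assms(1,2) Lp_member_uminus[OF assms(3)]] by simp

lemma Lp_norm_minus_commute: "Lp_norm p M (\<lambda>x. f x - g x) = Lp_norm p M (\<lambda>x. g x - f x)"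
 by (simp add: Lp_norm_def norm_minus_commute)

lemma Lp_norm_triangle_diff:
 assumes "1 < p" "Lp_member p M f" "Lp_member p M g"
 shows "\<bar>Lp_norm p M f - Lp_norm p M g\<bar> \<le> Lp_norm p M (\<lambda>x. f x - g x)"
proof -
 have "Lp_norm p M f \<le> Lp_norm p M g + Lp_norm p M (\<lambda>x. f x - g x)" using Lp_norm_triangle[OF assms(1,3) Lp_member_diff[OF assms]] by simp
 moreover have "Lp_norm p M g \<le> Lp_norm p M f + Lp_norm p M (\<lambda>x. g x - f x)"
  using Lp_norm_triangle[OF assms(1,2) Lp_member_diff[OF assms(1,3,2)]] by simp
 ultimately show ?thesis by (simp add: Lp_norm_minus_commute[of p M g f])
qed

lemma Lp_norm_scaleR: "0 < p \<Longrightarrow> Lp_norm p M (\<lambda>x. c *\<^sub>R f x) = \<bar>c\<bar> * Lp_norm p M f"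
 by (simp add: Lp_norm_def powr_mult powr_powr integral_nonneg)

lemma Lp_member_scaleR: "Lp_member p M f \<Longrightarrow> Lp_member p M (\<lambda>x. c *\<^sub>R f x)"
 by (auto simp: Lp_member_def powr_mult)

lemma Lp_norm_tendsto:
 assumes "1 < p" "\<And>n. Lp_member p M (f n)" "Lp_member p M g" "(\<lambda>n. Lp_norm p M (\<lambda>x. f n x - g x)) ----> 0"
 shows "(\<lambda>n. Lp_norm p M (f n)) ----> Lp_norm p M g"
proof -
 have "(\<lambda>n. Lp_norm p M (f n) - Lp_norm p M g) ----> 0" by (rule Lim_null_comparison[OF _ assms(4)]) (use Lp_norm_triangle_diff[OF assms(1,2,3)] in auto)
 then show ?thesis by (simp add: LIM_zero_iff)
qed

text \<open>Young's inequality pointwise after dividing f and g by their norms, the case of a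
  vanishing norm being separate.\<close>

lemma Hoelder:
 fixes f g :: "'a \<Rightarrow> real"
 assumes pq: "1 < p" "1 < q" "1 / p + 1 / q = 1"
  and f: "Lp_member p M f" and g: "Lp_member q M g"
 shows integrable_Hoelder: "integrable M (\<lambda>x. f x * g x)"
  and integral_Hoelder: "(LINT x|M. \<bar>f x * g x\<bar>) \<le> Lp_norm p M f * Lp_norm q M g"
proof -
 have [measurable]: "f \<in> borel_measurable M" "g \<in> borel_measurable M" using f g by (auto simp: Lp_member_def)
 have If: "integrable M (\<lambda>x. \<bar>f x\<bar> powr p)" and Ig: "integrable M (\<lambda>x. \<bar>g x\<bar> powr q)" using f g by (auto simp: Lp_member_def)
 have Y: "\<bar>f x * g x\<bar> \<le> \<bar>f x\<bar> powr p / p + \<bar>g x\<bar> powr q / q" for x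
  using Youngs_inequality[OF pq, of "\<bar>f x\<bar>" "\<bar>g x\<bar>"] by (simp add: abs_mult)
 have "integrable M (\<lambda>x. \<bar>f x\<bar> powr p / p + \<bar>g x\<bar> powr q / q)" by (intro Bochner_Integration.integrable_add integrable_divide If Ig)
 then show I: "integrable M (\<lambda>x. f x * g x)" by (rule Bochner_Integration.integrable_bound) (use Y in "auto intro!: AE_I2 order_trans[OF _ abs_ge_self]")
 define A B where "A = Lp_norm p M f" and "B = Lp_norm q M g"
 have A: "A powr p = (LINT x|M. \<bar>f x\<bar> powr p)" and B: "B powr q = (LINT x|M. \<bar>g x\<bar> powr q)" using pq by (auto simp: A_def B_def Lp_norm_powr)
 show "(LINT x|M. \<bar>f x * g x\<bar>) \<le> Lp_norm p M f * Lp_norm q M g"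
 proof (cases "A = 0 \<or> B = 0")
  case True
  then have "AE x in M. f x * g x = 0" using Lp_norm_eq_0_iff[of p M f] Lp_norm_eq_0_iff[of q M g] f g pq by (auto simp: A_def B_def)
  then have "(LINT x|M. \<bar>f x * g x\<bar>) = 0" by (subst integral_cong_AE[where g="\<lambda>x. 0"]) auto
  then show ?thesis by (simp add: Lp_norm_nonneg)
 next
  case False
  then have pos: "A > 0" "B > 0" using Lp_norm_nonneg[of p M f] Lp_norm_nonneg[of q M g] by (auto simp: A_def B_def less_le)
  have Y': "\<bar>f x * g x\<bar> / (A * B) \<le> \<bar>f x\<bar> powr p / A powr p / p + \<bar>g x\<bar> powr q / B powr q / q" for x
   using Youngs_inequality[OF pq, of "\<bar>f x\<bar> / A" "\<bar>g x\<bar> / B"] pos by (simp add: abs_mult powr_divide)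
  have "(LINT x|M. \<bar>f x * g x\<bar>) / (A * B) = (LINT x|M. \<bar>f x * g x\<bar> / (A * B))" by simp
  also have "\<dots> \<le> (LINT x|M. \<bar>f x\<bar> powr p / A powr p / p + \<bar>g x\<bar> powr q / B powr q / q)"
   by (intro integral_mono Y' Bochner_Integration.integrable_add integrable_divide If Ig integrable_abs I)
  also have "\<dots> = 1 / p + 1 / q"
   using pos by (subst Bochner_Integration.integral_add) (auto intro!: integrable_divide If Ig simp: A[symmetric] B[symmetric])
  finally show ?thesis using pos pq by (simp add: A_def B_def field_simps)
 qed
qed

text \<open>Hoelder's inequality against the constant function 1, which is in every Lq on a finite
  measure space.\<close>

lemma powr_Jensen:
 fixes f :: "'a \<Rightarrow> real"
 assumes p: "1 < p" and "finite_measure M" and f: "Lp_member p M f"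
 shows "integrable M f"
  and "(LINT x|M. \<bar>f x\<bar>) powr p \<le> measure M (space M) powr (p - 1) * (LINT x|M. \<bar>f x\<bar> powr p)"
proof -
 interpret finite_measure M by fact
 define q where "q = p / (p - 1)"
 have pq: "1 < p" "1 < q" "1 / p + 1 / q = 1" using p by (auto simp: q_def field_simps)
 have one: "Lp_member q M (\<lambda>x. 1::real)" by (simp add: Lp_member_def)
 show "integrable M f" using integrable_Hoelder[OF pq f one] by simp
 have "(LINT x|M. \<bar>f x\<bar>) \<le> Lp_norm p M f * Lp_norm q M (\<lambda>x. 1::real)" using integral_Hoelder[OF pq f one] by simp
 then have "(LINT x|M. \<bar>f x\<bar>) powr p \<le> (Lp_norm p M f * Lp_norm q M (\<lambda>x. 1::real)) powr p"
  using p by (intro powr_mono2) (auto intro: integral_nonneg)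
 also have "\<dots> = (LINT x|M. \<bar>f x\<bar> powr p) * measure M (space M) powr (p - 1)" using p Lp_norm_powr[of p M f]
  by (simp add: powr_mult Lp_norm_nonneg) (simp add: Lp_norm_def powr_powr q_def)
 finally show "(LINT x|M. \<bar>f x\<bar>) powr p \<le> measure M (space M) powr (p - 1) * (LINT x|M. \<bar>f x\<bar> powr p)" by (simp add: mult.commute)
qed

section \<open>Strict and uniform convexity of the p-th power of the norm\<close>

text \<open>The mean value theorem on both halves of [x,y], combined with the strict monotonicity of
  the derivative. The argument also covers x = 0, where only continuity is available.\<close>

lemma strict_midpoint_powr:
 fixes x y :: real
 assumes p: "1 < p" and xy: "0 \<le> x" "x < y"
 shows "((x + y) / 2) powr p < (x powr p + y powr p) / 2"
proof -
 define m where "m = (x + y) / 2"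
 have m: "x < m" "m < y" "m - x = y - m" using xy by (auto simp: m_def field_simps)
 have cont: "continuous_on {a..b} (\<lambda>x. x powr p)" if "0 \<le> a" for a b :: real
  using p that by (intro continuous_on_powr') auto
 have der: "((\<lambda>x. x powr p) has_real_derivative p * z powr (p - 1)) (at z)" if "0 < z" for z :: real
  using that by (intro has_real_derivative_powr) auto
 have diff: "(\<lambda>x. x powr p) differentiable (at z)" if "0 < z" for z :: real
  using der[OF that] real_differentiable_def by blast
 obtain l z where lz: "x < z" "z < m" "DERIV (\<lambda>x. x powr p) z :> l" "m powr p - x powr p = (m - x) * l"
  using MVT[OF m(1) cont[OF xy(1)]] diff xy(1) by (metis order_le_less_trans)
 obtain l' z' where lz': "m < z'" "z' < y" "DERIV (\<lambda>x. x powr p) z' :> l'" "y powr p - m powr p = (y - m) * l'"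
  using MVT[OF m(2) cont] diff xy(1) m by (smt (verit))
 have "l = p * z powr (p - 1)" "l' = p * z' powr (p - 1)" using DERIV_unique[OF lz(3) der] DERIV_unique[OF lz'(3) der] lz lz' xy m by auto
 moreover have "z powr (p - 1) < z' powr (p - 1)" using lz lz' xy p by (intro powr_less_mono2) auto
 ultimately have "l < l'" using p by simp
 then have "m powr p - x powr p < y powr p - m powr p" unfolding lz(4) lz'(4) m(3) using m by simp
 then show ?thesis by (simp add: m_def)
qed

text \<open>Strict convexity forces equal norms. Then the midpoint has that same norm, and the
  parallelogram identity leaves no room for a - b.\<close>

lemma midpoint_powr_eq_imp_eq:
 fixes a b :: "'a::real_inner"
 assumes p: "1 < p" and eq: "(norm a powr p + norm b powr p) / 2 \<le> norm ((1/2) *\<^sub>R (a + b)) powr p"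
 shows "a = b"
proof -
 have tri: "norm ((1/2) *\<^sub>R (a + b)) \<le> (norm a + norm b) / 2" using norm_triangle_ineq[of a b] by simp
 then have le: "norm ((1/2) *\<^sub>R (a + b)) powr p \<le> ((norm a + norm b) / 2) powr p" using p by (intro powr_mono2) auto
 have n: "norm a = norm b"
 proof (rule ccontr)
  assume "norm a \<noteq> norm b"
  then have "((norm a + norm b) / 2) powr p < (norm a powr p + norm b powr p) / 2"
   using strict_midpoint_powr[OF p, of "norm a" "norm b"] strict_midpoint_powr[OF p, of "norm b" "norm a"]
   by (cases "norm a < norm b") (auto simp: add.commute)
  with le eq show False by simp
 qed
 have "norm a \<le> norm ((1/2) *\<^sub>R (a + b))"
 proof (rule ccontr)
  assume "\<not> ?thesis"
  then have "norm ((1/2) *\<^sub>R (a + b)) powr p < norm a powr p" using p by (intro powr_less_mono2) auto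
  with eq n show False by simp
 qed
 then have "(2 * norm a)\<^sup>2 \<le> (norm (a + b))\<^sup>2" by (intro power_mono) auto
 moreover have "(norm (a + b))\<^sup>2 + (norm (a - b))\<^sup>2 = 2 * (norm a)\<^sup>2 + 2 * (norm b)\<^sup>2"
  by (simp add: power2_norm_eq_inner inner_add inner_diff inner_commute)
 ultimately have "(norm (a - b))\<^sup>2 \<le> 0" using n by (simp add: power2_eq_square)
 then show ?thesis by simp
qed

text \<open>Compactness and homogeneity. Among pairs normalized by |a|^p + |b|^p = 1, those with |a
  - b|^p at least \<epsilon> form a compact set on which the midpoint deficit is positive, hence
  bounded below; all quantities are homogeneous of degree p. It turns almost minimal midpoints into
  a Cauchy estimate, uniformly in 1 < p.\<close>

lemma uniform_convexity_powr:
 fixes p \<epsilon> :: real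
 assumes p: "1 < p" and \<epsilon>: "0 < \<epsilon>"
 obtains C where "0 \<le> C" "\<And>a b :: 'a::euclidean_space. norm (a - b) powr p \<le> \<epsilon> * (norm a powr p + norm b powr p) +
   C * ((norm a powr p + norm b powr p) / 2 - norm ((1/2) *\<^sub>R (a + b)) powr p)"
proof -
 define s where "s z = norm (fst z) powr p + norm (snd z) powr p" for z :: "'a \<times> 'a"
 define D where "D z = s z / 2 - norm ((1/2) *\<^sub>R (fst z + snd z)) powr p" for z :: "'a \<times> 'a"
 define S where "S = {z :: 'a \<times> 'a. s z = 1 \<and> \<epsilon> \<le> norm (fst z - snd z) powr p}"
 have contn: "continuous_on UNIV (\<lambda>z. norm (f z) powr p)" if "continuous_on UNIV f" for f :: "'a \<times> 'a \<Rightarrow> 'a"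
  using p that by (intro continuous_on_powr' continuous_intros) auto
 have cs: "continuous_on UNIV s" unfolding s_def by (intro continuous_intros contn)
 have cD: "continuous_on UNIV D" unfolding D_def using cs by (intro continuous_on_diff continuous_on_divide contn continuous_intros) auto
 have n1: "norm x \<le> 1" if "norm x powr p \<le> 1" for x :: 'a
 proof (rule ccontr)
  assume "\<not> norm x \<le> 1"
  then have "1 powr p < norm x powr p" using p by (intro powr_less_mono2) auto
  with that show False by simp
 qed
 have bnd: "norm (fst z) \<le> 1 \<and> norm (snd z) \<le> 1" if "s z = 1" for z
 proof -
  have "norm (fst z) powr p \<le> 1" "norm (snd z) powr p \<le> 1"
   using that powr_ge_zero[of "norm (fst z)" p] powr_ge_zero[of "norm (snd z)" p] unfolding s_def by linarith+
  then show ?thesis using n1 by blast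
 qed
 have D0: "0 \<le> D z" for z
 proof -
  have "norm ((1/2) *\<^sub>R (fst z + snd z)) powr p \<le> ((1 - 1/2) *\<^sub>R norm (fst z) + (1/2) *\<^sub>R norm (snd z)) powr p"
   using p norm_triangle_ineq[of "fst z" "snd z"] by (intro powr_mono2) auto
  also have "\<dots> \<le> (1 - 1/2) * norm (fst z) powr p + (1/2) * norm (snd z) powr p" using p by (intro convex_onD[OF powr_convex_nonneg]) auto
  finally show ?thesis by (simp add: D_def s_def)
 qed
 have Dpos: "0 < D z" if "z \<in> S" for z
 proof (rule ccontr)
  assume "\<not> 0 < D z"
  then have "fst z = snd z" by (intro midpoint_powr_eq_imp_eq[OF p]) (simp add: D_def s_def)
  with that \<epsilon> show False by (simp add: S_def)
 qed
 have "S \<subseteq> cball 0 1 \<times> cball 0 1"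
 proof
  fix z assume "z \<in> S"
  then show "z \<in> cball 0 1 \<times> cball 0 1" using bnd[of z] by (cases z) (auto simp: S_def)
 qed
 then have "bounded S" by (rule bounded_subset[rotated]) (intro bounded_Times bounded_cball)
 moreover have "closed S" unfolding S_def by (intro closed_Collect_conj closed_Collect_eq closed_Collect_le contn cs continuous_intros)
 ultimately have "compact S" by (simp add: compact_eq_bounded_closed)
 have "\<exists>\<delta>>0. \<forall>z\<in>S. \<delta> \<le> D z"
 proof (cases "S = {}")
  case False
  obtain z where "z \<in> S" "\<forall>y\<in>S. D z \<le> D y" using continuous_attains_inf[OF \<open>compact S\<close> False continuous_on_subset[OF cD]] by auto
  then show ?thesis using Dpos by blast
 qed (auto intro: exI[of _ 1])
 \<comment> \<open>On the compact set |a - b|^p is at most 2^p, hence at most 2^p/\<delta> times the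
   deficit; off it the \<epsilon> term alone suffices. This explains the constant.\<close>
 then obtain \<delta> where \<delta>: "\<delta> > 0" "\<And>z. z \<in> S \<Longrightarrow> \<delta> \<le> D z" by blast
 have unit: "norm (fst z - snd z) powr p \<le> \<epsilon> * s z + 2 powr p / \<delta> * D z" if z: "s z = 1" for z
 proof (cases "z \<in> S")
  case True
  have "norm (fst z - snd z) powr p \<le> 2 powr p" using p bnd[OF z] norm_triangle_ineq4[of "fst z" "snd z"] by (intro powr_mono2) auto
  also have "\<dots> \<le> 2 powr p / \<delta> * D z" using \<delta>(1) \<delta>(2)[OF True] by (simp add: field_simps)
  finally show ?thesis using z \<epsilon> by simp
 next
  case False
  then show ?thesis using z D0[of z] \<delta>(1) by (auto simp: S_def intro: add_increasing2)
 qed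
 have scale: "s (c *\<^sub>R z) = c powr p * s z" "D (c *\<^sub>R z) = c powr p * D z"
   "norm (fst (c *\<^sub>R z) - snd (c *\<^sub>R z)) powr p = c powr p * norm (fst z - snd z) powr p" if "c > 0" for c z
 proof -
  have n: "norm (c *\<^sub>R x) powr p = c powr p * norm x powr p" for x :: 'a
   using that by (simp add: powr_mult)
  show s: "s (c *\<^sub>R z) = c powr p * s z" by (simp add: s_def n distrib_left del: norm_scaleR)
  have "norm ((1/2) *\<^sub>R (fst (c *\<^sub>R z) + snd (c *\<^sub>R z))) powr p = norm (c *\<^sub>R (1/2) *\<^sub>R (fst z + snd z)) powr p"
   by (simp add: scaleR_add_right[symmetric] mult.commute del: norm_scaleR)
  then show "D (c *\<^sub>R z) = c powr p * D z" unfolding D_def s n by (simp only: n right_diff_distrib times_divide_eq_right)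
  show "norm (fst (c *\<^sub>R z) - snd (c *\<^sub>R z)) powr p = c powr p * norm (fst z - snd z) powr p"
   by (simp add: scaleR_diff_right[symmetric] n del: norm_scaleR)
 qed
 have main: "norm (fst z - snd z) powr p \<le> \<epsilon> * s z + 2 powr p / \<delta> * D z" for z
 proof (cases "s z = 0")
  case True
  then have "norm (fst z) powr p = 0" "norm (snd z) powr p = 0"
   using powr_ge_zero[of "norm (fst z)" p] powr_ge_zero[of "norm (snd z)" p] unfolding s_def by linarith+
  then show ?thesis using True D0[of z] \<delta>(1) by (simp add: s_def)
 next
  case False
  then have sp: "s z > 0" by (simp add: s_def less_le)
  define c where "c = s z powr (- 1 / p)"
  have "c powr p = s z powr (- 1 / p * p)" unfolding c_def powr_powr ..
  also have "- 1 / p * p = - 1" using p by simp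
  finally have c: "c > 0" "c powr p * s z = 1" using sp by (auto simp: c_def powr_minus)
  have "c powr p * norm (fst z - snd z) powr p \<le> c powr p * (\<epsilon> * s z + 2 powr p / \<delta> * D z)"
   using unit[of "c *\<^sub>R z"] c by (simp only: scale[OF c(1)]) (simp add: algebra_simps)
  then show ?thesis using c(1) by simp
 qed
 show ?thesis
 proof (rule that[of "2 powr p / \<delta>"])
  show "0 \<le> 2 powr p / \<delta>" using \<delta> by simp
  show "norm (a - b) powr p \<le> \<epsilon> * (norm a powr p + norm b powr p) +
   2 powr p / \<delta> * ((norm a powr p + norm b powr p) / 2 - norm ((1/2) *\<^sub>R (a + b)) powr p)" for a b :: 'a using main[of "(a, b)"] by (simp add: s_def D_def) qed
qed

section \<open>Completeness of Lp over a finite measure\<close>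

lemma Lp_norm_less_iff:
 assumes "0 < p" "0 < e"
 shows "Lp_norm p M f < e \<longleftrightarrow> (LINT x|M. norm (f x) powr p) < e powr p"
proof -
 have "Lp_norm p M f < e \<longleftrightarrow> Lp_norm p M f powr p < e powr p" using assms by (meson Lp_norm_nonneg less_imp_le not_less powr_less_mono2 powr_mono2)
 then show ?thesis using assms by (simp add: Lp_norm_powr)
qed

text \<open>On a finite measure space an Lp-Cauchy sequence is L1-Cauchy, so some subsequence
  converges almost everywhere; Fatou's lemma along this subsequence shows that its limit is also the
  Lp limit.\<close>

lemma Lp_complete:
 fixes f :: "nat \<Rightarrow> 'a \<Rightarrow> 'b::euclidean_space"
 assumes p: "1 < p" and "finite_measure M" and f: "\<And>n. Lp_member p M (f n)"
  and cau: "\<And>e. e > 0 \<Longrightarrow> \<exists>N. \<forall>i\<ge>N. \<forall>j\<ge>N. Lp_norm p M (\<lambda>x. f i x - f j x) < e"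
 obtains g where "Lp_member p M g" "(\<lambda>n. Lp_norm p M (\<lambda>x. f n x - g x)) ----> 0"
proof -
 interpret finite_measure M by fact
 have fm[measurable]: "f n \<in> borel_measurable M" for n using f by (simp add: Lp_member_def)
 have nm: "Lp_member p M (\<lambda>x. norm (h x))" if "Lp_member p M h" for h :: "'a \<Rightarrow> 'b"
  using that by (auto simp: Lp_member_def)
 have fi: "integrable M (f n)" for n
  using powr_Jensen(1)[OF p \<open>finite_measure M\<close> nm[OF f[of n]]] by (rule Bochner_Integration.integrable_bound) auto
 \<comment> \<open>The summand 1 keeps the constant positive even when the whole measure is
   zero.\<close>
 define \<mu> where "\<mu> = measure M (space M) powr ((p - 1) / p) + 1"
 have \<mu>: "\<mu> > 0" unfolding \<mu>_def by (simp add: add_nonneg_pos)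
 have L1: "(LINT x|M. norm (h x)) \<le> \<mu> * Lp_norm p M h" if h: "Lp_member p M h" for h :: "'a \<Rightarrow> 'b"
 proof -
  have "(LINT x|M. norm (h x)) = ((LINT x|M. norm (h x)) powr p) powr (1/p)" using p by (simp add: powr_powr integral_nonneg)
  also have "\<dots> \<le> (measure M (space M) powr (p - 1) * (LINT x|M. norm (h x) powr p)) powr (1/p)"
   using p powr_Jensen(2)[OF p \<open>finite_measure M\<close> nm[OF h]] by (intro powr_mono2) auto
  also have "\<dots> = measure M (space M) powr ((p - 1) / p) * Lp_norm p M h" by (simp add: powr_mult powr_powr Lp_norm_def integral_nonneg)
  also have "\<dots> \<le> \<mu> * Lp_norm p M h" by (intro mult_right_mono Lp_norm_nonneg) (simp add: \<mu>_def)
  finally show ?thesis .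
 qed
 obtain r where r: "strict_mono r" "AE x in M. Cauchy (\<lambda>i. f (r i) x)"
 proof (rule cauchy_L1_AE_cauchy_subseq[of M f])
  fix e :: real assume "e > 0"
  then obtain N where N: "\<forall>i\<ge>N. \<forall>j\<ge>N. Lp_norm p M (\<lambda>x. f i x - f j x) < e / \<mu>" using cau[of "e / \<mu>"] \<mu> by auto
  have "(LINT x|M. norm (f i x - f j x)) < e" if "i \<ge> N" "j \<ge> N" for i j
  proof -
   have "(LINT x|M. norm (f i x - f j x)) \<le> \<mu> * Lp_norm p M (\<lambda>x. f i x - f j x)" by (intro L1 Lp_member_diff p f)
   also have "\<dots> < \<mu> * (e / \<mu>)" using N that \<mu> by (intro mult_strict_left_mono) auto
   finally show ?thesis using \<mu> by simp
  qed
  then show "\<exists>N. \<forall>i\<ge>N. \<forall>j\<ge>N. LINT x|M. norm (f i x - f j x) < e" by blast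
 qed (use fi in auto)
 define g where "g x = lim (\<lambda>i. f (r i) x)" for x
 have gm[measurable]: "g \<in> borel_measurable M" unfolding g_def by measurable
 have lim: "AE x in M. (\<lambda>i. f (r i) x) ----> g x" using r(2) by eventually_elim (auto simp: g_def Cauchy_convergent_iff convergent_LIMSEQ_iff)
 have bound: "(\<integral>\<^sup>+x. norm (f n x - g x) powr p \<partial>M) \<le> e powr p"
  if e: "e > 0" and N: "\<forall>i\<ge>N. \<forall>j\<ge>N. Lp_norm p M (\<lambda>x. f i x - f j x) < e" and n: "n \<ge> N" for n N e
 proof -
  have "(\<integral>\<^sup>+x. norm (f n x - g x) powr p \<partial>M) = (\<integral>\<^sup>+x. liminf (\<lambda>i. ennreal (norm (f n x - f (r i) x) powr p)) \<partial>M)"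
  proof (rule nn_integral_cong_AE, use lim in eventually_elim)
   fix x assume "(\<lambda>i. f (r i) x) ----> g x"
   then have "(\<lambda>i. ennreal (norm (f n x - f (r i) x) powr p)) ----> ennreal (norm (f n x - g x) powr p)"
    using p by (intro tendsto_ennrealI tendsto_powr' tendsto_norm tendsto_diff tendsto_const) auto
   then show "ennreal (norm (f n x - g x) powr p) = liminf (\<lambda>i. ennreal (norm (f n x - f (r i) x) powr p))"
    using lim_imp_Liminf trivial_limit_sequentially by metis
  qed
  also have "\<dots> \<le> liminf (\<lambda>i. \<integral>\<^sup>+x. norm (f n x - f (r i) x) powr p \<partial>M)" by (intro nn_integral_liminf) auto
  also have "\<dots> \<le> e powr p"
  proof (rule Liminf_le)
   have "\<forall>\<^sub>F i in sequentially. r i \<ge> N" using eventually_ge_at_top[of N] by eventually_elim (use seq_suble[OF r(1)] order_trans in blast)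
   then show "\<forall>\<^sub>F i in sequentially. (\<integral>\<^sup>+x. norm (f n x - f (r i) x) powr p \<partial>M) \<le> e powr p"
   proof eventually_elim
    fix i assume "N \<le> r i"
    then have "Lp_norm p M (\<lambda>x. f n x - f (r i) x) < e" using N n by blast
    then have "(LINT x|M. norm (f n x - f (r i) x) powr p) \<le> e powr p" using p e by (subst (asm) Lp_norm_less_iff) auto
    moreover have "integrable M (\<lambda>x. norm (f n x - f (r i) x) powr p)" using Lp_member_diff[OF p f[of n] f[of "r i"]] by (simp add: Lp_member_def)
    ultimately show "(\<integral>\<^sup>+x. norm (f n x - f (r i) x) powr p \<partial>M) \<le> e powr p" by (subst nn_integral_eq_integral) (auto intro: ennreal_leI)
   qed
  qed simp
  finally show ?thesis .
 qed
 have diff: "Lp_member p M (\<lambda>x. f n x - g x) \<and> Lp_norm p M (\<lambda>x. f n x - g x) \<le> e"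
  if e: "e > 0" and N: "\<forall>i\<ge>N. \<forall>j\<ge>N. Lp_norm p M (\<lambda>x. f i x - f j x) < e" and n: "n \<ge> N" for n N e
 proof -
  have b: "(\<integral>\<^sup>+x. norm (f n x - g x) powr p \<partial>M) \<le> e powr p" using bound[OF e N n] .
  have i: "integrable M (\<lambda>x. norm (f n x - g x) powr p)" by (intro integrableI_nonneg) (use b in "auto intro: le_less_trans")
  have "(LINT x|M. norm (f n x - g x) powr p) \<le> e powr p" using b i e by (subst (asm) nn_integral_eq_integral) auto
  then have "Lp_norm p M (\<lambda>x. f n x - g x) \<le> (e powr p) powr (1/p)"
   unfolding Lp_norm_def using p by (intro powr_mono2) (auto intro: integral_nonneg)
  with i e p show ?thesis by (simp add: Lp_member_def powr_powr)
 qed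
 obtain N where N: "\<forall>i\<ge>N. \<forall>j\<ge>N. Lp_norm p M (\<lambda>x. f i x - f j x) < 1" using cau[of 1] by auto
 have "Lp_member p M (\<lambda>x. f N x - (f N x - g x))" by (rule Lp_member_diff[OF p f]) (use diff[OF _ N, of N] in auto)
 moreover have "(\<lambda>x. f N x - (f N x - g x)) = g" by auto
 ultimately have "Lp_member p M g" by simp
 moreover have "(\<lambda>n. Lp_norm p M (\<lambda>x. f n x - g x)) ----> 0"
 proof (rule LIMSEQ_I)
  fix e :: real assume "e > 0"
  then obtain N where N: "\<forall>i\<ge>N. \<forall>j\<ge>N. Lp_norm p M (\<lambda>x. f i x - f j x) < e / 2" using cau[of "e/2"] by auto
  have "norm (Lp_norm p M (\<lambda>x. f n x - g x) - 0) < e" if "n \<ge> N" for n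
   using diff[OF _ N that] \<open>e > 0\<close> Lp_norm_nonneg[of p M "\<lambda>x. f n x - g x"] by auto
  then show "\<exists>no. \<forall>n\<ge>no. norm (Lp_norm p M (\<lambda>x. f n x - g x) - 0) < e" by blast
 qed
 ultimately show ?thesis by (rule that)
qed

section \<open>Weak gradients\<close>

abbreviation "supp f \<equiv> closure (support_on UNIV f)"

section \<open>Test functions and their supports\<close>

lemma Ck_on_Un:
 assumes "open S" "open T" "Ck_on k S f" "Ck_on k T f"
 shows "Ck_on k (S \<union> T) f" using assms(3,4) by (induction k arbitrary: f) (auto intro: continuous_on_open_Un assms(1,2))

lemma smooth_on_Un: "open S \<Longrightarrow> open T \<Longrightarrow> smooth_on S f \<Longrightarrow> smooth_on T f \<Longrightarrow> smooth_on (S \<union> T) f"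
 by (simp add: smooth_on_def Ck_on_Un)

lemma GDERIV_zero: "open S \<Longrightarrow> x \<in> S \<Longrightarrow> (\<And>y. y \<in> S \<Longrightarrow> f y = 0) \<Longrightarrow> GDERIV f x :> 0"
 unfolding gderiv_def by (rule has_derivative_transform_within_open[of "\<lambda>x. 0" _ x UNIV S]) auto

lemma continuous_on_grad:
 assumes "smooth_on S f"
 shows "continuous_on S (grad f)"
proof -
 have C: "Ck_on (Suc 0) S f" using assms by (simp add: smooth_on_def)
 have "continuous_on S (\<lambda>x. grad f x \<bullet> b)" if "b \<in> Basis" for b
 proof -
  have "frechet_derivative f (at x) b = grad f x \<bullet> b" if "x \<in> S" for x
   using frechet_derivative_at[OF smooth_on_GDERIV[OF assms that, unfolded gderiv_def]] by (metis inner_commute)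
  then show ?thesis using Ck_on_SucD(2)[OF C that] by (simp cong: continuous_on_cong)
 qed
 then show ?thesis by (rule continuous_on_componentwise[THEN iffD2, rule_format])
qed

lemma test_functionsD:
 assumes "\<phi> \<in> test_functions \<Omega>"
 shows "smooth_on UNIV \<phi>" "compact (supp \<phi>)" "supp \<phi> \<subseteq> \<Omega>" "\<And>x. x \<notin> supp \<phi> \<Longrightarrow> \<phi> x = 0" "\<And>x. GDERIV \<phi> x :> grad \<phi> x" "\<And>x. x \<notin> supp \<phi> \<Longrightarrow> grad \<phi> x = 0"
  "continuous_on UNIV \<phi>" "continuous_on UNIV (grad \<phi>)"
proof -
 show *: "smooth_on UNIV \<phi>" "compact (supp \<phi>)" "supp \<phi> \<subseteq> \<Omega>" using assms by (auto simp: test_functions_def)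
 show z: "\<phi> x = 0" if "x \<notin> supp \<phi>" for x
  using that closure_subset[of "support_on UNIV \<phi>"] by (auto simp: support_on_def)
 show "GDERIV \<phi> x :> grad \<phi> x" for x using smooth_on_GDERIV[OF *(1)] by simp
 show "grad \<phi> x = 0" if "x \<notin> supp \<phi>" for x
  by (rule grad_eq, rule GDERIV_zero[of "- supp \<phi>"]) (use z that in auto)
 show "continuous_on UNIV \<phi>" "continuous_on UNIV (grad \<phi>)" using smooth_on_continuous continuous_on_grad *(1) by auto
qed

lemma test_functionsI:
 assumes "smooth_on UNIV \<phi>" "compact C" "C \<subseteq> \<Omega>" "\<And>x. x \<notin> C \<Longrightarrow> \<phi> x = 0"
 shows "\<phi> \<in> test_functions \<Omega>"
proof -
 have "support_on UNIV \<phi> \<subseteq> C" using assms(4) by (auto simp: support_on_def)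
 then have "supp \<phi> \<subseteq> C" using assms(2) by (simp add: closure_minimal compact_imp_closed)
 then show ?thesis using assms compact_Int_closed[OF assms(2) closed_closure, of "support_on UNIV \<phi>"] by (auto simp: test_functions_def Int_absorb1)
qed

lemma test_functions_mono: "\<Omega> \<subseteq> \<Omega>' \<Longrightarrow> \<phi> \<in> test_functions \<Omega> \<Longrightarrow> \<phi> \<in> test_functions \<Omega>'"
 by (auto simp: test_functions_def)

text \<open>The product is smooth on \<Omega> and zero off the support of \<phi>; these two open
  sets cover the space. No regularity of u outside \<Omega> enters.\<close>

lemma test_functions_mult:
 assumes "open \<Omega>" "\<phi> \<in> test_functions \<Omega>" "smooth_on \<Omega> u"
 shows "(\<lambda>x. \<phi> x * u x) \<in> test_functions \<Omega>"
proof (rule test_functionsI)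
 note T = test_functionsD[OF assms(2)]
 let ?C = "supp \<phi>"
 have "smooth_on \<Omega> (\<lambda>x. \<phi> x * u x)" using assms T(1) by (intro smooth_on_mult) (auto intro: smooth_on_subset)
 moreover have "smooth_on (- ?C) (\<lambda>x. \<phi> x * u x)" by (rule smooth_on_cong[OF _ _ smooth_on_const[of _ 0]]) (use T(4) in auto)
 ultimately have "smooth_on (\<Omega> \<union> - ?C) (\<lambda>x. \<phi> x * u x)" using assms(1) by (intro smooth_on_Un) auto
 moreover have "\<Omega> \<union> - ?C = UNIV" using T(3) by auto
 ultimately show "smooth_on UNIV (\<lambda>x. \<phi> x * u x)" by simp
 show "compact ?C" "?C \<subseteq> \<Omega>" by fact+
 show "\<phi> x * u x = 0" if "x \<notin> ?C" for x using T(4) that by simp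
qed

lemma integrable_compact_support:
 fixes f :: "'a::euclidean_space \<Rightarrow> 'b::euclidean_space"
 assumes "continuous_on UNIV f" "compact C" "\<And>x. x \<notin> C \<Longrightarrow> f x = 0"
 shows "integrable lborel f"
proof -
 have "integrable lborel (\<lambda>x. ind C x *\<^sub>R f x)" using assms by (intro borel_integrable_compact) (auto intro: continuous_on_subset)
 moreover have "(\<lambda>x. ind C x *\<^sub>R f x) = f" using assms(3) by (auto simp: indicator_def fun_eq_iff)
 ultimately show ?thesis by simp
qed

lemma bounded_compact_support:
 fixes f :: "'a::euclidean_space \<Rightarrow> 'b::euclidean_space"
 assumes "continuous_on UNIV f" "compact C" "\<And>x. x \<notin> C \<Longrightarrow> f x = 0"
 obtains B where "0 < B" "\<And>x. norm (f x) \<le> B"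
proof -
 have "compact (f ` C)" using assms by (intro compact_continuous_image) (auto intro: continuous_on_subset)
 then obtain B where B: "B > 0" "\<forall>y\<in>f ` C. norm y \<le> B" using bounded_pos compact_imp_bounded by metis
 have "norm (f x) \<le> B" for x using B assms(3)[of x] by (cases "x \<in> C") auto
 with B(1) show ?thesis by (rule that)
qed

section \<open>Integration by parts\<close>

lemma lborel_integral_translate:
 fixes f :: "'a::euclidean_space \<Rightarrow> 'b::{banach,second_countable_topology}"
 assumes "f \<in> borel_funs"
 shows "(LINT x|lborel. f (c + x)) = (LINT x|lborel. f x)"
proof -
 have "(LINT x|lborel. f x) = (LINT x|distr lborel borel ((+) c). f x)" by (simp add: lborel_distr_plus)
 also have "\<dots> = (LINT x|lborel. f (c + x))" by (rule integral_distr) (use assms in auto)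
 finally show ?thesis by simp
qed

lemma grad_bound:
 fixes f :: "'a::euclidean_space \<Rightarrow> real"
 assumes "\<And>x. GDERIV f x :> grad f x" "\<And>x. norm (grad f x) \<le> B"
 shows "\<bar>f y - f x\<bar> \<le> B * norm (y - x)"
proof -
 have "norm (f y - f x) \<le> B * norm (y - x)"
 proof (rule differentiable_bound[of UNIV f "\<lambda>x h. h \<bullet> grad f x"])
  show "(f has_derivative (\<lambda>h. h \<bullet> grad f x)) (at x within UNIV)" for x
   using assms(1)[of x] by (simp add: gderiv_def)
  show "onorm (\<lambda>h. h \<bullet> grad f x) \<le> B" for x
  proof (rule onorm_le)
   show "norm (h \<bullet> grad f x) \<le> B * norm h" for h
    using Cauchy_Schwarz_ineq2[of h "grad f x"] mult_right_mono[OF assms(2)[of x] norm_ge_zero[of h]] by (simp add: mult.commute)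
  qed
 qed auto
 then show ?thesis by simp
qed

lemma GDERIV_direction:
 fixes f :: "'a::euclidean_space \<Rightarrow> real"
 assumes "GDERIV f (x + t *\<^sub>R e) :> D"
 shows "((\<lambda>t. f (x + t *\<^sub>R e)) has_real_derivative (e \<bullet> D)) (at t)"
proof (rule has_derivative_imp_has_field_derivative)
 have "((\<lambda>t. x + t *\<^sub>R e) has_derivative (\<lambda>s. s *\<^sub>R e)) (at t)" by (auto intro!: derivative_eq_intros)
 then show "((\<lambda>t. f (x + t *\<^sub>R e)) has_derivative (\<lambda>s. (s *\<^sub>R e) \<bullet> D)) (at t)" by (rule has_derivative_compose) (use assms in "simp add: gderiv_def")
qed simp

text \<open>Difference quotients have integral zero by translation invariance, and they converge
  dominatedly to the partial derivative.\<close>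

lemma integral_grad_zero:
 fixes \<phi> :: "'a::euclidean_space \<Rightarrow> real"
 assumes "\<phi> \<in> test_functions UNIV"
 shows "(LINT x|lborel. grad \<phi> x) = 0"
proof -
 note T = test_functionsD[OF assms]
 let ?C = "supp \<phi>"
 have "integrable lborel (grad \<phi>)" by (rule integrable_compact_support[OF T(8) T(2) T(6)])
 have I: "integrable lborel \<phi>" by (rule integrable_compact_support[OF T(7) T(2) T(4)])
 have [measurable]: "\<phi> \<in> borel_funs" "grad \<phi> \<in> borel_funs" using T by (auto intro: borel_measurable_continuous_onI)
 obtain B where B: "0 < B" "\<And>x. norm (grad \<phi> x) \<le> B" using bounded_compact_support[OF T(8) T(2) T(6)] by blast
 \<comment> \<open>A unit neighbourhood of the support; it contains the supports of all difference
   quotients, whose steps are at most 1.\<close>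
 define C' where "C' = {x + y | x y. x \<in> ?C \<and> y \<in> cball (0::'a) 1}"
 have C': "compact C'" unfolding C'_def by (intro compact_sums T compact_cball)
 have "(LINT x|lborel. grad \<phi> x) \<bullet> b = 0" if b: "b \<in> Basis" for b
 proof -
  define s where "s n x = (\<phi> (x + inverse (Suc n) *\<^sub>R b) - \<phi> x) / inverse (Suc n)" for n :: nat and x
  have "(\<lambda>n. LINT x|lborel. s n x) ----> (LINT x|lborel. b \<bullet> grad \<phi> x)"
  proof (rule integral_dominated_convergence[where w="\<lambda>x. ind C' x *\<^sub>R B"])
   show "integrable lborel (\<lambda>x. ind C' x *\<^sub>R B)" by (rule borel_integrable_compact[OF C']) auto
   show "s n \<in> borel_measurable lborel" for n unfolding s_def by measurable
   show "AE x in lborel. (\<lambda>n. s n x) ----> b \<bullet> grad \<phi> x"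
   proof (rule AE_I2)
    fix x :: 'a
    have "((\<lambda>t. \<phi> (x + t *\<^sub>R b)) has_real_derivative (b \<bullet> grad \<phi> x)) (at 0)" using GDERIV_direction[of \<phi> x 0 b] T(5)[of x] by simp
    then have "((\<lambda>h. (\<phi> (x + h *\<^sub>R b) - \<phi> x) / h) \<longlongrightarrow> b \<bullet> grad \<phi> x) (at 0)" by (simp add: DERIV_def)
    moreover have "filterlim (\<lambda>n. inverse (real (Suc n))) (at 0) sequentially" using LIMSEQ_inverse_real_of_nat by (auto simp: filterlim_at)
    ultimately show "(\<lambda>n. s n x) ----> b \<bullet> grad \<phi> x" unfolding s_def by (rule filterlim_compose)
   qed
   show "AE x in lborel. norm (s n x) \<le> ind C' x *\<^sub>R B" for n
   proof (rule AE_I2)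
    fix x :: 'a
    let ?t = "inverse (Suc n) *\<^sub>R b"
    have nt: "norm ?t = inverse (Suc n)" "norm ?t \<le> 1" using b by (auto simp: divide_simps)
    show "norm (s n x) \<le> ind C' x *\<^sub>R B"
    proof (cases "x \<in> C'")
     case True
     have "\<bar>\<phi> (x + ?t) - \<phi> x\<bar> \<le> B * inverse (Suc n)" using grad_bound[OF T(5) B(2), of "x + ?t" x] nt by simp
     then have "\<bar>\<phi> (x + ?t) - \<phi> x\<bar> / inverse (Suc n) \<le> B" by (subst pos_divide_le_eq) auto
     then show ?thesis using True by (simp add: s_def abs_divide del: inverse_Suc divide_inverse)
    next
     case False
     have "x \<notin> ?C" using False by (force simp: C'_def intro: exI[of _ x] exI[of _ 0])
     moreover have "x + ?t \<notin> ?C"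
     proof
      assume "x + ?t \<in> ?C"
      then have "x \<in> C'" unfolding C'_def using nt by (intro CollectI exI[of _ "x + ?t"] exI[of _ "- ?t"]) auto
      with False show False ..
     qed
     ultimately show ?thesis using T(4) False by (simp add: s_def)
    qed
   qed
  qed auto
  moreover have "(LINT x|lborel. s n x) = 0" for n
  proof -
   have it: "(LINT x|lborel. \<phi> (c + x)) = (LINT x|lborel. \<phi> x)" for c
    by (rule lborel_integral_translate) auto
   have "integrable (distr lborel borel ((+) c)) \<phi>" for c using I by (simp add: lborel_distr_plus)
   then have "integrable lborel (\<lambda>x. \<phi> (c + x))" for c
    by (subst (asm) integrable_distr_eq) auto
   then have "(LINT x|lborel. \<phi> (inverse (Suc n) *\<^sub>R b + x) - \<phi> x) = 0" using I it by (subst Bochner_Integration.integral_diff) auto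
   then show ?thesis unfolding s_def by (subst integral_divide_zero) (simp add: add.commute)
  qed
  ultimately have "(LINT x|lborel. b \<bullet> grad \<phi> x) = 0" using LIMSEQ_unique[of "\<lambda>n. 0::real" 0] by simp
  then show ?thesis using \<open>integrable lborel (grad \<phi>)\<close> by (simp add: inner_commute)
 qed
 note * = this
 show ?thesis
 proof (rule euclidean_eqI)
  fix b :: 'a assume "b \<in> Basis"
  from *[OF this] show "(LINT x|lborel. grad \<phi> x) \<bullet> b = 0 \<bullet> b" unfolding inner_zero_left .
 qed
qed

lemma integral_lebesgue_on_eq:
 fixes f :: "'a::euclidean_space \<Rightarrow> 'b::euclidean_space"
 assumes "\<Omega> \<in> sets lebesgue" "\<And>x. x \<notin> \<Omega> \<Longrightarrow> f x = 0"
 shows "(LINT x|lebesgue_on \<Omega>. f x) = (LINT x|lebesgue. f x)" "integrable (lebesgue_on \<Omega>) f \<longleftrightarrow> integrable lebesgue f"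
proof -
 have "(\<lambda>x. ind \<Omega> x *\<^sub>R f x) = f" using assms(2) by (auto simp: indicator_def)
 then show "(LINT x|lebesgue_on \<Omega>. f x) = (LINT x|lebesgue. f x)" "integrable (lebesgue_on \<Omega>) f \<longleftrightarrow> integrable lebesgue f"
  using assms(1) by (simp_all add: integral_restrict_space integrable_restrict_space)
qed

lemma locally_integrable_continuous:
 assumes "continuous_on \<Omega> f"
 shows "locally_integrable \<Omega> f" unfolding locally_integrable_def
proof safe
 fix C assume C: "compact C" "C \<subseteq> \<Omega>"
 have b: "C \<in> sets borel" using C by (simp add: compact_imp_closed borel_closed)
 have "integrable lborel (\<lambda>x. ind C x *\<^sub>R f x)" using C assms by (intro borel_integrable_compact) (auto intro: continuous_on_subset)
 then show "integrable (lebesgue_on C) f" using b by (subst integrable_restrict_space) (auto simp: integrable_completion)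
qed

lemma integrable_lebesgue_mult_bounded:
 fixes f :: "'a::euclidean_space \<Rightarrow> 'b::euclidean_space" and \<phi> :: "'a \<Rightarrow> real"
 assumes "locally_integrable \<Omega> f" "compact C" "C \<subseteq> \<Omega>" "\<And>x. x \<notin> C \<Longrightarrow> \<phi> x = 0" "\<And>x. \<bar>\<phi> x\<bar> \<le> B" "\<phi> \<in> borel_funs"
 shows "integrable lebesgue (\<lambda>x. \<phi> x *\<^sub>R f x)"
proof -
 have [measurable]: "C \<in> sets borel" using assms by (simp add: compact_imp_closed borel_closed)
 have [measurable]: "\<phi> \<in> borel_measurable lebesgue" using assms(6) by (intro measurable_completion) auto 
 have "integrable (lebesgue_on C) f" using assms by (auto simp: locally_integrable_def)
 then have i: "integrable lebesgue (\<lambda>x. ind C x *\<^sub>R f x)" by (subst (asm) integrable_restrict_space) auto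
 have eq: "(\<lambda>x. \<phi> x *\<^sub>R f x) = (\<lambda>x. \<phi> x *\<^sub>R (ind C x *\<^sub>R f x))" using assms(4) by (auto simp: indicator_def fun_eq_iff)
 have [measurable]: "(\<lambda>x. ind C x *\<^sub>R f x) \<in> borel_measurable lebesgue" using i by auto
 show ?thesis unfolding eq
 proof (rule Bochner_Integration.integrable_bound[OF integrable_scaleR_right[OF i, of B]])
  show "AE x in lebesgue. norm (\<phi> x *\<^sub>R ind C x *\<^sub>R f x) \<le> norm (B *\<^sub>R ind C x *\<^sub>R f x)"
   by (intro AE_I2) (auto simp: indicator_def intro!: mult_right_mono order_trans[OF assms(5) abs_ge_self])
 qed measurable
qed

text \<open>The product of the test function with u is itself a test function, so its gradient
  integrates to zero; the product rule splits it into the two sides of the definition.\<close>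

lemma smooth_has_weak_gradient:
 fixes u :: "'a::euclidean_space \<Rightarrow> real"
 assumes "open \<Omega>" "smooth_on \<Omega> u"
 shows "has_weak_gradient \<Omega> u (grad u)" unfolding has_weak_gradient_def
proof (intro conjI ballI)
 show "locally_integrable \<Omega> u" "locally_integrable \<Omega> (grad u)"
  using assms(2) by (intro locally_integrable_continuous smooth_on_continuous continuous_on_grad; simp)+
 fix \<phi> assume \<phi>: "\<phi> \<in> test_functions \<Omega>"
 note T = test_functionsD[OF \<phi>]
 let ?C = "supp \<phi>"
 have bm: "\<phi> \<in> borel_funs" "grad \<phi> \<in> borel_funs" using T by (auto intro: borel_measurable_continuous_onI)
 have w: "(\<lambda>x. \<phi> x * u x) \<in> test_functions UNIV" using test_functions_mult[OF assms(1) \<phi> assms(2)] test_functions_mono by blast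
 have g: "grad (\<lambda>x. \<phi> x * u x) x = \<phi> x *\<^sub>R grad u x + u x *\<^sub>R grad \<phi> x" for x
 proof (cases "x \<in> \<Omega>")
  case True
  have "GDERIV u x :> grad u x" using smooth_on_GDERIV assms(2) True by blast
  from GDERIV_mult[OF T(5) this] show ?thesis by (rule grad_eq)
 next
  case False
  then have "x \<notin> ?C" using T(3) by auto
  then show ?thesis using T by (auto intro!: grad_eq GDERIV_zero[of "- ?C"])
 qed
 have s: "\<Omega> \<in> sets lebesgue" using assms(1) by simp
 obtain B1 where B1: "\<And>x. norm (\<phi> x) \<le> B1" using bounded_compact_support[OF T(7,2,4)] by blast
 have i1: "integrable lebesgue (\<lambda>x. \<phi> x *\<^sub>R grad u x)" by (rule integrable_lebesgue_mult_bounded[OF \<open>locally_integrable \<Omega> (grad u)\<close> T(2,3,4)]) (use B1 bm in auto)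
 have "continuous_on UNIV (grad (\<lambda>x. \<phi> x * u x))" using test_functionsD(8)[OF w] .
 have i0: "integrable lborel (grad (\<lambda>x. \<phi> x * u x))" by (rule integrable_compact_support[OF test_functionsD(8,2,6)[OF w]])
 then have i0': "integrable lebesgue (grad (\<lambda>x. \<phi> x * u x))" by (subst integrable_completion) auto
 have "integrable lebesgue (\<lambda>x. grad (\<lambda>x. \<phi> x * u x) x - \<phi> x *\<^sub>R grad u x)" using i0' i1 by (rule Bochner_Integration.integrable_diff)
 then have i2: "integrable lebesgue (\<lambda>x. u x *\<^sub>R grad \<phi> x)" by (simp add: g)
 have "0 = (LINT x|lebesgue. grad (\<lambda>x. \<phi> x * u x) x)" using integral_grad_zero[OF w] i0 by (subst integral_completion) auto
 also have "\<dots> = (LINT x|lebesgue. \<phi> x *\<^sub>R grad u x) + (LINT x|lebesgue. u x *\<^sub>R grad \<phi> x)"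
  unfolding g using i1 i2 by (rule Bochner_Integration.integral_add)
 finally have "(LINT x|lebesgue. u x *\<^sub>R grad \<phi> x) = - (LINT x|lebesgue. \<phi> x *\<^sub>R grad u x)" by (simp add: eq_neg_iff_add_eq_0 add.commute)
 then show "(LINT x|lebesgue_on \<Omega>. u x *\<^sub>R grad \<phi> x) = - (LINT x|lebesgue_on \<Omega>. \<phi> x *\<^sub>R grad u x)"
  using T by (subst (1 2) integral_lebesgue_on_eq(1)[OF s]) (auto simp: subset_eq)
qed

section \<open>The fundamental lemma of the calculus of variations\<close>

text \<open>The positive and the negative part of f define finite measures that agree on boxes, an
  intersection-stable generator; hence they agree, and so do their densities.\<close>

lemma box_integrals_zero_imp_AE_zero:
 fixes f :: "'a::euclidean_space \<Rightarrow> real"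
 assumes f: "integrable lebesgue f"
  and z: "\<And>a b. (LINT x|lebesgue. ind (box a b) x * f x) = 0"
 shows "AE x in lebesgue. f x = 0"
proof -
 obtain f' where f'm[measurable]: "f' \<in> borel_measurable lborel" and ff': "AE x in lborel. f x = f' x"
  using completion_ex_borel_measurable_real[of f lborel] f by auto
 have ffc: "AE x in lebesgue. f x = f' x" using ff' by (rule AE_completion)
 have "integrable lebesgue f'" by (rule integrable_cong_AE_imp[OF f _ ffc]) (rule measurable_completion, measurable)
 then have f': "integrable lborel f'" by (subst (asm) integrable_completion) auto
 have z': "(LINT x|lborel. ind (box a b) x * f' x) = 0" for a b
 proof -
  have "(LINT x|lborel. ind (box a b) x * f' x) = (LINT x|lebesgue. ind (box a b) x * f' x)" by (subst integral_completion) auto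
  also have "\<dots> = (LINT x|lebesgue. ind (box a b) x * f x)" using ffc f by (intro integral_cong_AE borel_measurable_times)
    (auto intro: measurable_completion borel_measurable_indicator)
  finally show ?thesis using z by simp
 qed
 \<comment> \<open>Since \<open>ennreal\<close> sends negative numbers to 0, these two densities are
   the positive and the negative part.\<close>
 let ?P = "density lborel (\<lambda>x. ennreal (f' x))" and ?N = "density lborel (\<lambda>x. ennreal (- f' x))"
 have em: "emeasure (density lborel (\<lambda>x. ennreal (h x))) A = ennreal (LINT x|lborel. ind A x * max 0 (h x))"
  if "integrable lborel h" and [measurable]: "A \<in> sets borel" for h :: "'a \<Rightarrow> real" and A
 proof -
  have [measurable]: "h \<in> borel_funs" using that by auto
  have "emeasure (density lborel (\<lambda>x. ennreal (h x))) A = (\<integral>\<^sup>+x. ennreal (ind A x * max 0 (h x)) \<partial>lborel)"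
   by (subst emeasure_density) (auto intro!: nn_integral_cong simp: indicator_def max_def ennreal_neg)
  also have "\<dots> = ennreal (LINT x|lborel. ind A x * max 0 (h x))"
  proof (rule nn_integral_eq_integral)
   show "integrable lborel (\<lambda>x. ind A x * max 0 (h x))" by (rule Bochner_Integration.integrable_bound[OF that(1)]) (auto simp: indicator_def)
  qed (auto simp: indicator_def)
  finally show ?thesis .
 qed
 have "?P = ?N"
 proof (rule measure_eqI_generator_eq[where E="range (\<lambda>(a, b). box a b)" and \<Omega>=UNIV
    and A="\<lambda>n::nat. box (- real n *\<^sub>R One) (real n *\<^sub>R One)"])
  show "Int_stable (range (\<lambda>(a, b). box a b :: 'a set))" unfolding Int_stable_def by (auto simp: box_Int_box)
  show "emeasure ?P X = emeasure ?N X" if X: "X \<in> range (\<lambda>(a, b). box a b)" for X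
  proof -
   obtain a b where X: "X = box a b" using X by auto
   have i: "integrable lborel (\<lambda>x. ind (box a b) x * max 0 (h x))" if "integrable lborel h" for h :: "'a \<Rightarrow> real"
    by (rule Bochner_Integration.integrable_bound[OF that]) (use that in "auto simp: indicator_def")
   have "0 = (LINT x|lborel. ind (box a b) x * f' x)" by (simp only: z')
   also have "\<dots> = (LINT x|lborel. ind (box a b) x * max 0 (f' x) - ind (box a b) x * max 0 (- f' x))"
    by (intro Bochner_Integration.integral_cong) (auto simp: indicator_def)
   also have "\<dots> = (LINT x|lborel. ind (box a b) x * max 0 (f' x)) - (LINT x|lborel. ind (box a b) x * max 0 (- f' x))"
    using f' by (intro Bochner_Integration.integral_diff i) auto
   finally show ?thesis unfolding X using f' by (subst (1 2) em) auto
  qed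
  show "sets ?P = sigma_sets UNIV (range (\<lambda>(a, b). box a b))" "sets ?N = sigma_sets UNIV (range (\<lambda>(a, b). box a b))" by (simp_all add: borel_eq_box)
  show "range (\<lambda>n::nat. box (- real n *\<^sub>R One) (real n *\<^sub>R One)) \<subseteq> range (\<lambda>(a, b). box a b :: 'a set)" by auto
  show "(\<Union>n::nat. box (- real n *\<^sub>R One) (real n *\<^sub>R One :: 'a)) = UNIV" using UN_box_eq_UNIV by simp
  show "emeasure ?P (box (- real n *\<^sub>R One) (real n *\<^sub>R One)) \<noteq> \<infinity>" for n
   using f' by (subst em) auto
 qed auto
 then have "AE x in lborel. ennreal (f' x) = ennreal (- f' x)" by (intro sigma_finite_measure.density_unique[OF sigma_finite_lborel]) auto
 then have "AE x in lborel. f' x = 0"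
 proof eventually_elim
  fix x assume "ennreal (f' x) = ennreal (- f' x)"
  then show "f' x = 0" by (cases "f' x \<le> 0"; cases "f' x \<ge> 0") (auto simp: ennreal_neg)
 qed
 then have "AE x in lborel. f x = 0" using ff' by eventually_elim auto
 then show ?thesis by (rule AE_completion)
qed

definition box_bump :: "'a::euclidean_space \<Rightarrow> 'a \<Rightarrow> 'a \<Rightarrow> real" where "box_bump a b x = (\<Prod>i\<in>Basis. flat ((x - a) \<bullet> i) * flat ((b - x) \<bullet> i))"

lemma smooth_box_bump: "smooth_on UNIV (box_bump a b)"
proof -
 have "smooth_on UNIV (\<lambda>x. x \<bullet> i - c)" "smooth_on UNIV (\<lambda>x. c - x \<bullet> i)" for i :: 'a and c
  by (intro smooth_on_diff smooth_on_linear smooth_on_const bounded_linear_inner_left; simp)+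
 then have "smooth_on UNIV (\<lambda>x. flat (x \<bullet> i - c))" "smooth_on UNIV (\<lambda>x. flat (c - x \<bullet> i))" for i :: 'a and c
  by (auto intro!: smooth_on_compose_real[OF _ _ smooth_on_flat])
 then show ?thesis unfolding box_bump_def[abs_def] inner_diff_left by (intro smooth_on_prod smooth_on_mult) auto
qed

lemma box_bump_pos_iff: "0 < box_bump a b x \<longleftrightarrow> x \<in> box a b"
 and box_bump_nonneg: "0 \<le> box_bump a b x"
proof -
 show nn: "0 \<le> box_bump a b x" unfolding box_bump_def by (intro prod_nonneg mult_nonneg_nonneg ballI flat_nonneg)
 show "0 < box_bump a b x \<longleftrightarrow> x \<in> box a b"
 proof
  assume "x \<in> box a b"
  then show "0 < box_bump a b x" unfolding box_bump_def by (intro prod_pos ballI mult_pos_pos) (auto simp: flat_pos_iff mem_box inner_diff_left)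
 next
  assume pos: "0 < box_bump a b x"
  have "flat ((x - a) \<bullet> i) * flat ((b - x) \<bullet> i) \<noteq> 0" if "i \<in> Basis" for i
   using pos that unfolding box_bump_def by (metis finite_Basis less_irrefl prod_zero_iff)
  then have "0 < flat ((x - a) \<bullet> i) \<and> 0 < flat ((b - x) \<bullet> i)" if "i \<in> Basis" for i
   using that flat_nonneg[of "(x - a) \<bullet> i"] flat_nonneg[of "(b - x) \<bullet> i"] by fastforce
  then show "x \<in> box a b" by (auto simp: flat_pos_iff mem_box inner_diff_left)
 qed
qed

lemma box_bump_zero: "x \<notin> box a b \<Longrightarrow> box_bump a b x = 0"
 using box_bump_pos_iff[of a b x] box_bump_nonneg[of a b x] by auto

text \<open>The indicator of the open box is the bounded pointwise limit of the test functions 1 -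
  exp(-n b), where b is a bump that is positive exactly on the box.\<close>

lemma fundamental_lemma_box:
 fixes f :: "'a::euclidean_space \<Rightarrow> real"
 assumes "locally_integrable \<Omega> f" "cbox a b \<subseteq> \<Omega>"
  and z: "\<And>\<phi>. \<phi> \<in> test_functions \<Omega> \<Longrightarrow> (LINT x|lebesgue. \<phi> x * f x) = 0"
 shows "(LINT x|lebesgue. ind (box a b) x * f x) = 0"
proof -
 have "integrable (lebesgue_on (cbox a b)) f" using assms by (auto simp: locally_integrable_def)
 then have i: "integrable lebesgue (\<lambda>x. ind (cbox a b) x * f x)" by (subst (asm) integrable_restrict_space) auto
 define s where "s n x = (1 - exp (- (real n * box_bump a b x)))" for n x
 have sm: "smooth_on UNIV (s n)" for n
 proof -
  have 1: "smooth_on UNIV (\<lambda>x. - real n * box_bump a b x)" by (intro smooth_on_mult smooth_on_const smooth_box_bump) auto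
  have "smooth_on UNIV (\<lambda>x. exp (- real n * box_bump a b x))" by (rule smooth_on_compose_real[OF _ _ smooth_on_exp 1]) auto
  then show ?thesis unfolding s_def[abs_def] by (intro smooth_on_diff smooth_on_const) auto
 qed
 have s0: "s n x = 0" if "x \<notin> box a b" for n x using box_bump_zero[OF that] by (simp add: s_def)
 have s1: "0 \<le> s n x" "s n x \<le> 1" for n x using box_bump_nonneg[of a b x] by (auto simp: s_def)
 have t: "s n \<in> test_functions \<Omega>" for n
  by (rule test_functionsI[OF sm compact_cbox assms(2)]) (use s0 box_subset_cbox in blast)
 have slim: "(\<lambda>n. s n x) ----> ind (box a b) x" for x
 proof (cases "x \<in> box a b")
  case True
  then have "0 < box_bump a b x" by (simp add: box_bump_pos_iff)
  then have "filterlim (\<lambda>n. real n * box_bump a b x) at_top sequentially"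
   by (intro filterlim_at_top_mult_tendsto_pos[OF tendsto_const _ filterlim_real_sequentially, THEN filterlim_cong[OF refl refl, THEN iffD1, rotated]]) (auto simp: mult.commute)
  then have "(\<lambda>n. exp (- (real n * box_bump a b x))) ----> 0" by (intro filterlim_compose[OF exp_at_bot]) (auto simp: filterlim_uminus_at_bot)
  then have "(\<lambda>n. 1 - exp (- (real n * box_bump a b x))) ----> 1 - 0" by (intro tendsto_intros)
  then show ?thesis using True by (simp add: s_def)
 qed (simp add: s0)
 have [measurable]: "s n \<in> borel_measurable lebesgue" for n
  using smooth_on_continuous[OF sm[of n]] by (intro measurable_completion) (auto intro: borel_measurable_continuous_onI)
 have im: "(\<lambda>x. ind (cbox a b) x * f x) \<in> borel_measurable lebesgue" using i by auto
 have "(\<lambda>n. LINT x|lebesgue. s n x * (ind (cbox a b) x * f x)) ----> (LINT x|lebesgue. ind (box a b) x * (ind (cbox a b) x * f x))"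
 proof (rule integral_dominated_convergence[where w="\<lambda>x. norm (ind (cbox a b) x * f x)"])
  show "AE x in lebesgue. (\<lambda>n. s n x * (ind (cbox a b) x * f x)) ----> ind (box a b) x * (ind (cbox a b) x * f x)"
   by (intro AE_I2 tendsto_mult slim tendsto_const)
  show "AE x in lebesgue. norm (s n x * (ind (cbox a b) x * f x)) \<le> norm (ind (cbox a b) x * f x)" for n
   using s1 by (auto simp: abs_mult intro!: mult_left_le_one_le)
  show "(\<lambda>x. s n x * (ind (cbox a b) x * f x)) \<in> borel_measurable lebesgue" for n
   by (rule borel_measurable_times[OF _ im]) fact
  show "(\<lambda>x. ind (box a b) x * (ind (cbox a b) x * f x)) \<in> borel_measurable lebesgue"
   by (rule borel_measurable_times[OF borel_measurable_indicator im]) simp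
 qed (use i in auto)
 moreover have "s n x * (ind (cbox a b) x * f x) = s n x * f x" for n x
  using s0[of x n] box_subset_cbox[of a b] by (auto simp: indicator_def)
 moreover have "ind (box a b) x * (ind (cbox a b) x * f x) = ind (box a b) x * f x" for x
  using box_subset_cbox[of a b] by (auto simp: indicator_def)
 ultimately show ?thesis using z[OF t] LIMSEQ_unique[of "\<lambda>n. 0::real" 0] by simp
qed

text \<open>The open set is a countable union of closed boxes. Inside each of them the integrals
  over all smaller boxes vanish, and the boundary of a box is a null set.\<close>

lemma fundamental_lemma:
 fixes f :: "'a::euclidean_space \<Rightarrow> real"
 assumes \<Omega>: "open \<Omega>" and f: "locally_integrable \<Omega> f"
  and z: "\<And>\<phi>. \<phi> \<in> test_functions \<Omega> \<Longrightarrow> (LINT x|lebesgue. \<phi> x * f x) = 0"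
 shows "AE x in lebesgue. x \<in> \<Omega> \<longrightarrow> f x = 0"
proof -
 obtain \<D> where D: "countable \<D>" "\<D> \<subseteq> Pow \<Omega>" "\<And>X. X \<in> \<D> \<Longrightarrow> \<exists>a b. X = cbox a b" "\<Union>\<D> = \<Omega>" using open_countable_Union_open_cbox[OF \<Omega>] by metis
 have cb: "AE x in lebesgue. x \<in> X \<longrightarrow> f x = 0" if X: "X \<in> \<D>" for X
 proof -
  obtain a b where X: "X = cbox a b" "cbox a b \<subseteq> \<Omega>" using D X by blast
  have "integrable (lebesgue_on (cbox a b)) f" using f X by (auto simp: locally_integrable_def)
  then have i: "integrable lebesgue (\<lambda>x. ind (cbox a b) x * f x)" by (subst (asm) integrable_restrict_space) auto
  have i': "integrable lebesgue (\<lambda>x. ind (box a b) x * f x)"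
  proof (rule Bochner_Integration.integrable_bound[OF i])
   have "(\<lambda>x. ind (box a b) x * f x) = (\<lambda>x. ind (box a b) x * (ind (cbox a b) x * f x))"
    using box_subset_cbox[of a b] by (auto simp: indicator_def fun_eq_iff)
   then show "(\<lambda>x. ind (box a b) x * f x) \<in> borel_measurable lebesgue"
    by (simp only:) (intro borel_measurable_times borel_measurable_indicator borel_measurable_integrable[OF i], simp)
  qed (use box_subset_cbox[of a b] in "auto simp: indicator_def")
  have "AE x in lebesgue. ind (box a b) x * f x = 0"
  proof (rule box_integrals_zero_imp_AE_zero[OF i'])
   fix c d
   obtain c' d' where cd: "box c d \<inter> box a b = box c' d'" by (auto simp: box_Int_box)
   have "(LINT x|lebesgue. ind (box c' d') x * f x) = 0"
   proof (cases "box c' d' = {}")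
    case False
    \<comment> \<open>For a nonempty open box the closure is the closed box, which therefore stays
      inside the given closed box and so inside \<Omega>.\<close>
    then have "cbox c' d' = closure (box c' d')" by (simp add: closure_box)
    also have "\<dots> \<subseteq> cbox a b" using cd box_subset_cbox by (intro closure_minimal) auto
    finally show ?thesis using X f z by (intro fundamental_lemma_box[OF f]) auto
   qed simp
   then show "(LINT x|lebesgue. ind (box c d) x * (ind (box a b) x * f x)) = 0"
    unfolding cd[symmetric] by (simp add: indicator_inter_arith mult.assoc)
  qed
  moreover have "AE x in lebesgue. x \<notin> cbox a b - box a b"
   by (rule AE_not_in) (use negligible_frontier_interval[of a b] in "simp add: negligible_iff_null_sets")
  ultimately show ?thesis by eventually_elim (auto simp: X indicator_def split: if_splits)
 qed
 have "AE x in lebesgue. \<forall>X\<in>\<D>. x \<in> X \<longrightarrow> f x = 0" by (subst AE_ball_countable[OF D(1)]) (use cb in blast)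
 then show ?thesis by eventually_elim (use D(4) in blast)
qed

section \<open>Weak gradients: componentwise form, uniqueness, differences\<close>

lemma locally_integrable_diff: "locally_integrable \<Omega> f \<Longrightarrow> locally_integrable \<Omega> g \<Longrightarrow> locally_integrable \<Omega> (\<lambda>x. f x - g x)"
 unfolding locally_integrable_def by blast

lemma weak_gradient_integrable:
 assumes "\<phi> \<in> test_functions \<Omega>" "locally_integrable \<Omega> (f :: 'a::euclidean_space \<Rightarrow> 'b::euclidean_space)"
 shows "integrable lebesgue (\<lambda>x. \<phi> x *\<^sub>R f x)" "integrable lebesgue (\<lambda>x. (grad \<phi> x \<bullet> b) *\<^sub>R f x)"
proof -
 note T = test_functionsD[OF assms(1)]
 obtain B1 where B1: "\<And>x. norm (\<phi> x) \<le> B1" using bounded_compact_support[OF T(7,2,4)] by blast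
 obtain B2 where B2: "\<And>x. norm (grad \<phi> x) \<le> B2" using bounded_compact_support[OF T(8,2,6)] by blast
 show "integrable lebesgue (\<lambda>x. \<phi> x *\<^sub>R f x)" by (rule integrable_lebesgue_mult_bounded[OF assms(2) T(2,3,4)])
    (use B1 T in "auto intro: borel_measurable_continuous_onI")
 have "\<bar>grad \<phi> x \<bullet> b\<bar> \<le> B2 * norm b" for x
  using Cauchy_Schwarz_ineq2[of "grad \<phi> x" b] mult_right_mono[OF B2[of x] norm_ge_zero[of b]] by linarith
 then show "integrable lebesgue (\<lambda>x. (grad \<phi> x \<bullet> b) *\<^sub>R f x)" by (intro integrable_lebesgue_mult_bounded[OF assms(2) T(2,3)])
    (use T in "auto intro!: borel_measurable_continuous_onI continuous_intros")
qed

text \<open>Reduces the vector identity over a restricted measure to scalar identities over the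
  whole space. Test functions vanish off \<Omega>, so the restriction is harmless.\<close>

lemma has_weak_gradient_iff:
 fixes v :: "'a::euclidean_space \<Rightarrow> real"
 assumes "open \<Omega>"
 shows "has_weak_gradient \<Omega> v g \<longleftrightarrow> locally_integrable \<Omega> v \<and> locally_integrable \<Omega> g \<and> (\<forall>\<phi>\<in>test_functions \<Omega>. \<forall>b\<in>Basis.
    (LINT x|lebesgue. (grad \<phi> x \<bullet> b) * v x) = - (LINT x|lebesgue. \<phi> x * (g x \<bullet> b)))"
proof -
 have "((LINT x|lebesgue_on \<Omega>. v x *\<^sub>R grad \<phi> x) = - (LINT x|lebesgue_on \<Omega>. \<phi> x *\<^sub>R g x)) \<longleftrightarrow>
   (\<forall>b\<in>Basis. (LINT x|lebesgue. (grad \<phi> x \<bullet> b) * v x) = - (LINT x|lebesgue. \<phi> x * (g x \<bullet> b)))"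
  if v: "locally_integrable \<Omega> v" and g: "locally_integrable \<Omega> g" and \<phi>: "\<phi> \<in> test_functions \<Omega>" for \<phi>
 proof -
  note T = test_functionsD[OF \<phi>]
  have s: "\<Omega> \<in> sets lebesgue" using assms by simp
  have i1: "integrable lebesgue (\<lambda>x. v x *\<^sub>R grad \<phi> x)"
  proof -
   have "integrable lebesgue (\<lambda>x. \<Sum>b\<in>Basis. ((grad \<phi> x \<bullet> b) * v x) *\<^sub>R b)" using weak_gradient_integrable(2)[OF \<phi> v]
    by (intro Bochner_Integration.integrable_sum integrable_scaleR_left) auto
   moreover have "(\<lambda>x. \<Sum>b\<in>Basis. ((grad \<phi> x \<bullet> b) * v x) *\<^sub>R b) = (\<lambda>x. v x *\<^sub>R grad \<phi> x)"
    by (rule ext, subst (2) euclidean_representation[symmetric]) (simp add: scaleR_sum_right mult.commute)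
   ultimately show ?thesis by simp
  qed
  have i2: "integrable lebesgue (\<lambda>x. \<phi> x *\<^sub>R g x)" using weak_gradient_integrable(1)[OF \<phi> g] .
  have "(LINT x|lebesgue_on \<Omega>. v x *\<^sub>R grad \<phi> x) \<bullet> b = (LINT x|lebesgue. (grad \<phi> x \<bullet> b) * v x)" for b
   using T i1 by (subst integral_lebesgue_on_eq(1)[OF s]) (auto simp: subset_eq mult.commute integral_inner_left[symmetric] simp del: integral_inner_left)
  moreover have "(LINT x|lebesgue_on \<Omega>. \<phi> x *\<^sub>R g x) \<bullet> b = (LINT x|lebesgue. \<phi> x * (g x \<bullet> b))" for b
   using T i2 by (subst integral_lebesgue_on_eq(1)[OF s]) (auto simp: subset_eq integral_inner_left[symmetric] simp del: integral_inner_left)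
  ultimately show ?thesis by (subst euclidean_eq_iff) simp
 qed
 then show ?thesis unfolding has_weak_gradient_def by blast
qed

lemma has_weak_gradient_unique:
 fixes v :: "'a::euclidean_space \<Rightarrow> real"
 assumes \<Omega>: "open \<Omega>" and g: "has_weak_gradient \<Omega> v g" and h: "has_weak_gradient \<Omega> v h"
 shows "AE x in lebesgue_on \<Omega>. g x = h x"
proof -
 have lg: "locally_integrable \<Omega> g" "locally_integrable \<Omega> h" using g h by (auto simp: has_weak_gradient_def)
 have "AE x in lebesgue. x \<in> \<Omega> \<longrightarrow> (g x - h x) \<bullet> b = 0" if b: "b \<in> Basis" for b
 proof (rule fundamental_lemma[OF \<Omega>])
  show "locally_integrable \<Omega> (\<lambda>x. (g x - h x) \<bullet> b)" using locally_integrable_diff[OF lg] unfolding locally_integrable_def by auto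
  fix \<phi> assume \<phi>: "\<phi> \<in> test_functions \<Omega>"
  have "integrable lebesgue (\<lambda>x. \<phi> x * (g x \<bullet> b))" "integrable lebesgue (\<lambda>x. \<phi> x * (h x \<bullet> b))"
   using integrable_inner_left[OF weak_gradient_integrable(1)[OF \<phi> lg(1)], of b] integrable_inner_left[OF weak_gradient_integrable(1)[OF \<phi> lg(2)], of b] by auto
  then have "(LINT x|lebesgue. \<phi> x * ((g x - h x) \<bullet> b)) = (LINT x|lebesgue. \<phi> x * (g x \<bullet> b)) - (LINT x|lebesgue. \<phi> x * (h x \<bullet> b))"
   by (subst Bochner_Integration.integral_diff[symmetric]) (auto simp: inner_diff_left right_diff_distrib)
  also have "(LINT x|lebesgue. \<phi> x * (g x \<bullet> b)) = - (LINT x|lebesgue. (grad \<phi> x \<bullet> b) * v x)"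
   using g \<phi> b unfolding has_weak_gradient_iff[OF \<Omega>] by simp
  also have "(LINT x|lebesgue. \<phi> x * (h x \<bullet> b)) = - (LINT x|lebesgue. (grad \<phi> x \<bullet> b) * v x)"
   using h \<phi> b unfolding has_weak_gradient_iff[OF \<Omega>] by simp
  finally show "(LINT x|lebesgue. \<phi> x * ((g x - h x) \<bullet> b)) = 0" by simp
 qed
 then have "AE x in lebesgue. \<forall>b\<in>Basis. x \<in> \<Omega> \<longrightarrow> (g x - h x) \<bullet> b = 0" by (intro AE_finite_allI) auto
 then have "AE x in lebesgue. x \<in> \<Omega> \<longrightarrow> g x = h x" by eventually_elim (auto simp: inner_diff_left intro: euclidean_eqI)
 then show ?thesis using \<Omega> by (subst AE_restrict_space_iff) auto
qed

lemma has_weak_gradient_diff: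
 fixes u v :: "'a::euclidean_space \<Rightarrow> real"
 assumes \<Omega>: "open \<Omega>" and u: "has_weak_gradient \<Omega> u g" and v: "has_weak_gradient \<Omega> v h"
 shows "has_weak_gradient \<Omega> (\<lambda>x. u x - v x) (\<lambda>x. g x - h x)" unfolding has_weak_gradient_iff[OF \<Omega>]
proof (intro conjI ballI)
 have l: "locally_integrable \<Omega> u" "locally_integrable \<Omega> g" "locally_integrable \<Omega> v" "locally_integrable \<Omega> h"
  using u v by (auto simp: has_weak_gradient_def)
 then show "locally_integrable \<Omega> (\<lambda>x. u x - v x)" "locally_integrable \<Omega> (\<lambda>x. g x - h x)" by (auto intro: locally_integrable_diff)
 fix \<phi> and b :: 'a assume \<phi>: "\<phi> \<in> test_functions \<Omega>" and b: "b \<in> Basis"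
 have i: "integrable lebesgue (\<lambda>x. (grad \<phi> x \<bullet> b) * u x)" "integrable lebesgue (\<lambda>x. (grad \<phi> x \<bullet> b) * v x)"
  using weak_gradient_integrable(2)[OF \<phi> l(1)] weak_gradient_integrable(2)[OF \<phi> l(3)] by auto
 have j: "integrable lebesgue (\<lambda>x. \<phi> x * (g x \<bullet> b))" "integrable lebesgue (\<lambda>x. \<phi> x * (h x \<bullet> b))"
  using integrable_inner_left[OF weak_gradient_integrable(1)[OF \<phi> l(2)], of b] integrable_inner_left[OF weak_gradient_integrable(1)[OF \<phi> l(4)], of b] by auto
 show "(LINT x|lebesgue. (grad \<phi> x \<bullet> b) * (u x - v x)) = - (LINT x|lebesgue. \<phi> x * ((g x - h x) \<bullet> b))"
  using u v \<phi> b i j unfolding has_weak_gradient_iff[OF \<Omega>] by (simp add: inner_diff_left right_diff_distrib)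
qed

lemma weak_gradient_AE:
 fixes v :: "'a::euclidean_space \<Rightarrow> real"
 assumes "open \<Omega>" "has_weak_gradient \<Omega> v g"
 shows "has_weak_gradient \<Omega> v (weak_gradient \<Omega> v)" "AE x in lebesgue_on \<Omega>. weak_gradient \<Omega> v x = g x"
proof -
 show *: "has_weak_gradient \<Omega> v (weak_gradient \<Omega> v)" unfolding weak_gradient_def using someI[of "\<lambda>g. has_weak_gradient \<Omega> v g" g] assms(2) by blast
 show "AE x in lebesgue_on \<Omega>. weak_gradient \<Omega> v x = g x" by (rule has_weak_gradient_unique[OF assms(1) * assms(2)])
qed

text \<open>Weak gradients are picked by \<open>SOME\<close> and known only up to null sets;
  completeness of the measure gives their measurability back.\<close>

lemma (in complete_measure) measurable_AE_eq:
 assumes g: "g \<in> measurable M N" and eq: "AE x in M. f x = g x" and sp: "\<And>x. f x \<in> space N"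
 shows "f \<in> measurable M N"
proof (rule measurableI)
 fix A assume A: "A \<in> sets N"
 show "f -` A \<inter> space M \<in> sets M"
 proof (rule in_sets_AE)
  show "AE x in M. (x \<in> g -` A \<inter> space M) = (x \<in> f -` A \<inter> space M)" using eq by eventually_elim auto
  show "g -` A \<inter> space M \<in> sets M" using g A by (rule measurable_sets)
 qed auto
qed (rule sp)

section \<open>Polar coordinates\<close>

lemma nn_integral_scale_measure':
 assumes f: "f \<in> borel_measurable M"
 shows "(\<integral>\<^sup>+x. f x \<partial>scale_measure r M) = r * (\<integral>\<^sup>+x. f x \<partial>M)"
proof -
 have "scale_measure r M = density M (\<lambda>_. r)" by (rule measure_eqI) (auto simp: emeasure_density nn_integral_cmult_indicator)
 then show ?thesis using f by (simp add: nn_integral_density nn_integral_cmult)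
qed

lemma nn_integral_lborel_scale:
 fixes h :: "'a::euclidean_space \<Rightarrow> ennreal"
 assumes [measurable]: "h \<in> borel_funs" and c: "0 < c"
 shows "(\<integral>\<^sup>+x. h x \<partial>lborel) = ennreal (c ^ DIM('a)) * (\<integral>\<^sup>+x. h (c *\<^sub>R x) \<partial>lborel)"
 by (subst lborel_affine[of c 0]) (use c in "auto simp: nn_integral_density nn_integral_distr nn_integral_cmult")

text \<open>The surface measure before completion: its Borel sigma-algebra suits Fubini's theorem
  and composition of measurable maps.\<close>

definition sphere_borel :: "'a::euclidean_space measure" where "sphere_borel = scale_measure (of_nat DIM('a)) (distr (restrict_space lborel (ball 0 1)) borel sgn)"

lemma sphere_measure_eq: "sphere_measure = completion sphere_borel"
 by (simp add: sphere_measure_def sphere_borel_def)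

lemma sets_sphere_borel [simp, measurable_cong]: "sets sphere_borel = sets borel"
 and space_sphere_borel [simp]: "space sphere_borel = UNIV" by (auto simp: sphere_borel_def space_scale_measure)

lemma space_sphere_measure [simp]: "space sphere_measure = UNIV"
 by (simp add: sphere_measure_eq)

lemma borel_in_sphere_measure [simp]: "A \<in> sets borel \<Longrightarrow> A \<in> sets sphere_measure"
 by (simp add: sphere_measure_eq sets_completionI_sets)

lemma sgn_restrict_measurable: "sgn \<in> restrict_space lborel (ball 0 1) \<rightarrow>\<^sub>M (borel :: 'a::euclidean_space measure)"
 by (rule measurable_restrict_space1) simp

lemma nn_integral_sphere_borel:
 fixes f :: "'a::euclidean_space \<Rightarrow> ennreal"
 assumes [measurable]: "f \<in> borel_funs"
 shows "(\<integral>\<^sup>+x. f x \<partial>sphere_borel) = of_nat DIM('a) * (\<integral>\<^sup>+x\<in>ball 0 1. f (sgn x) \<partial>lborel)" unfolding sphere_borel_def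
 by (subst nn_integral_scale_measure', simp, subst nn_integral_distr[OF sgn_restrict_measurable], simp, subst nn_integral_restrict_space) auto

lemma finite_sphere_borel: "finite_measure (sphere_borel :: 'a::euclidean_space measure)"
proof
 have "emeasure (sphere_borel :: 'a measure) UNIV = (\<integral>\<^sup>+x. 1 \<partial>(sphere_borel :: 'a measure))" by simp
 also have "\<dots> = of_nat DIM('a) * emeasure lborel (ball (0::'a) 1)" by (subst nn_integral_sphere_borel) auto
 also have "\<dots> < \<infinity>" using emeasure_bounded_finite[of "ball (0::'a) 1"] by (auto simp: ennreal_mult_less_top of_nat_less_top)
 finally show "emeasure (sphere_borel :: 'a measure) (space sphere_borel) \<noteq> \<infinity>" by simp
qed

lemma finite_sphere_measure: "finite_measure (sphere_measure :: 'a::euclidean_space measure)"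
 unfolding sphere_measure_eq
 by (rule finite_measureI) (use finite_measure.emeasure_finite[OF finite_sphere_borel] in "simp add: emeasure_completion")

text \<open>This weight in s appears after the change of variables in
  \<open>nn_integral_polar\<close>; its integral 1/m cancels the factor m of the surface
  measure.\<close>

lemma nn_integral_power_tail:
 fixes r :: real
 assumes r: "0 < r" and m: "0 < (m::nat)"
 shows "(\<integral>\<^sup>+s\<in>{r<..}. ennreal (r ^ m / s ^ Suc m) \<partial>lborel) = ennreal (1 / m)"
proof -
 have "(\<integral>\<^sup>+s\<in>{r<..}. ennreal (r ^ m / s ^ Suc m) \<partial>lborel) = (\<integral>\<^sup>+s\<in>{r..}. ennreal (r ^ m / s ^ Suc m) \<partial>lborel)"
 proof (rule nn_integral_cong_AE)
  have "AE s in lborel. s \<noteq> r" using AE_lborel_singleton[of r] by simp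
  then show "AE s in lborel. ennreal (r ^ m / s ^ Suc m) * ind {r<..} s = ennreal (r ^ m / s ^ Suc m) * ind {r..} s"
   by eventually_elim (auto simp: indicator_def)
 qed
 also have "\<dots> = 0 - (- (r ^ m / (m * r ^ m)))"
 proof (rule nn_integral_FTC_atLeast[where F="\<lambda>s::real. - (r ^ m / (m * s ^ m))"])
  fix s :: real assume s: "r \<le> s"
  then have "s > 0" using r by simp
  obtain k where k: "m = Suc k" using m by (cases m) auto
  have inv: "((\<lambda>s. inverse s ^ m) has_real_derivative m * inverse s ^ k * (- (inverse s ^ 2))) (at s)"
  proof -
   have "((\<lambda>s. inverse s) has_real_derivative - (inverse s ^ 2)) (at s)"
    using \<open>s > 0\<close> by (auto intro!: derivative_eq_intros simp: power2_eq_square)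
   from DERIV_power[OF this, of m] show ?thesis by (simp add: k ac_simps)
  qed
  have "((\<lambda>s. - (r ^ m / m) * inverse s ^ m) has_real_derivative - (r ^ m / m) * (m * inverse s ^ k * (- (inverse s ^ 2)))) (at s)"
   by (rule DERIV_cmult[OF inv])
  moreover have "- (r ^ m / m) * (m * inverse s ^ k * (- (inverse s ^ 2))) = r ^ m / s ^ Suc m"
  proof -
   have "- (r ^ m / m) * (m * inverse s ^ k * (- (inverse s ^ 2))) = r ^ m * (inverse s ^ k * inverse s ^ 2)" using m by simp
   also have "inverse s ^ k * inverse s ^ 2 = inverse s ^ Suc m" by (simp add: k power2_eq_square)
   finally show ?thesis by (simp add: divide_inverse power_inverse)
  qed
  moreover have "(\<lambda>s::real. - (r ^ m / m) * inverse s ^ m) = (\<lambda>s::real. - (r ^ m / (m * s ^ m)))" by (auto simp: field_simps)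
  ultimately show "((\<lambda>s::real. - (r ^ m / (m * s ^ m))) has_real_derivative r ^ m / s ^ Suc m) (at s)" by simp
  show "0 \<le> r ^ m / s ^ Suc m" using \<open>s > 0\<close> r by simp
 next
  have "((\<lambda>s::real. inverse s ^ m) \<longlongrightarrow> 0 ^ m) at_top" by (intro tendsto_power tendsto_inverse_0_at_top filterlim_ident)
  then have "((\<lambda>s::real. - (r ^ m / m) * inverse s ^ m) \<longlongrightarrow> - (r ^ m / m) * 0 ^ m) at_top" by (rule tendsto_mult[OF tendsto_const])
  moreover have "(\<lambda>s::real. - (r ^ m / m) * inverse s ^ m) = (\<lambda>s::real. - (r ^ m / (m * s ^ m)))" by (auto simp: field_simps)
  ultimately show "((\<lambda>s::real. - (r ^ m / (m * s ^ m))) \<longlongrightarrow> 0) at_top" using m by (simp add: zero_power)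
 qed measurable
 also have "0 - (- (r ^ m / (m * r ^ m))) = 1 / m" using r by simp
 finally show ?thesis .
qed

text \<open>The right side is by definition m times an integral over the unit ball of the radial
  integral J at sgn x. By homogeneity of J, Fubini's theorem and the substitution y = s x, it
  becomes the integral of F(y) against the weight |y|^m/s^(m+1) over s > |y|. That weight integrates
  to 1/m.\<close>

theorem nn_integral_polar:
 fixes F :: "'a::euclidean_space \<Rightarrow> ennreal"
 assumes [measurable]: "F \<in> borel_funs"
 shows "(\<integral>\<^sup>+x. F x \<partial>lborel) = (\<integral>\<^sup>+w. (\<integral>\<^sup>+s\<in>{0<..}. F (s *\<^sub>R w) * ennreal (s ^ (DIM('a) - 1)) \<partial>lborel) \<partial>sphere_borel)"
proof -
 define m where "m = DIM('a)"
 have m: "0 < m" "m = Suc (m - 1)" by (auto simp: m_def)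
 have [measurable]: "(\<lambda>z. ind (ball 0 1) (snd z) :: ennreal) \<in> borel_measurable (borel \<Otimes>\<^sub>M (borel :: 'a measure))"
  by (rule measurable_compose[OF measurable_snd borel_measurable_indicator]) simp
 have [measurable]: "(\<lambda>z. ind {norm (snd z)<..} (fst z) :: ennreal) \<in> borel_measurable (borel \<Otimes>\<^sub>M (borel :: 'a measure))"
 proof -
  have "(\<lambda>z. ind {norm (snd z)<..} (fst z) :: ennreal) = ind {z \<in> space (borel \<Otimes>\<^sub>M (borel :: 'a measure)). norm (snd z) < fst z}"
   by (auto simp: indicator_def fun_eq_iff space_pair_measure)
  then show ?thesis by simp
 qed
 have [measurable]: "(\<lambda>z. ind {norm (fst z)<..} (snd z) :: ennreal) \<in> borel_measurable ((borel :: 'a measure) \<Otimes>\<^sub>M borel)"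
 proof -
  have "(\<lambda>z. ind {norm (fst z)<..} (snd z) :: ennreal) = ind {z \<in> space ((borel :: 'a measure) \<Otimes>\<^sub>M borel). norm (fst z) < snd z}"
   by (auto simp: indicator_def fun_eq_iff space_pair_measure)
  then show ?thesis by simp
 qed
 define J where "J w = (\<integral>\<^sup>+s\<in>{0<..}. F (s *\<^sub>R w) * ennreal (s ^ (m - 1)) \<partial>lborel)" for w
 have [measurable]: "J \<in> borel_funs" unfolding J_def by measurable
 \<comment> \<open>J is homogeneous of degree -m, by the substitution of |x| s for s in the radial
   integral.\<close>
 have J: "J (sgn x) = ennreal (norm x ^ m) * J x" if "x \<noteq> 0" for x
 proof -
  have "J (sgn x) = ennreal (norm x) * (\<integral>\<^sup>+s. F ((0 + norm x * s) *\<^sub>R sgn x) * ennreal ((0 + norm x * s) ^ (m - 1)) * ind {0<..} (0 + norm x * s) \<partial>lborel)"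
   unfolding J_def using that by (subst nn_integral_real_affine[of _ "norm x" 0]) auto
  also have "(\<integral>\<^sup>+s. F ((0 + norm x * s) *\<^sub>R sgn x) * ennreal ((0 + norm x * s) ^ (m - 1)) * ind {0<..} (0 + norm x * s) \<partial>lborel) =
    (\<integral>\<^sup>+s. ennreal (norm x ^ (m - 1)) * (F (s *\<^sub>R x) * ennreal (s ^ (m - 1)) * ind {0<..} s) \<partial>lborel)" using that by (intro nn_integral_cong)
     (auto simp: indicator_def sgn_div_norm zero_less_mult_iff power_mult_distrib ennreal_mult ac_simps)
  also have "\<dots> = ennreal (norm x ^ (m - 1)) * J x" unfolding J_def by (rule nn_integral_cmult) measurable
  also have "ennreal (norm x) * (ennreal (norm x ^ (m - 1)) * J x) = ennreal (norm x ^ m) * J x"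
   by (subst (2) m(2)) (simp add: ennreal_mult mult.assoc)
  finally show ?thesis .
 qed
 have "(\<integral>\<^sup>+w. J w \<partial>sphere_borel) = of_nat m * (\<integral>\<^sup>+x\<in>ball 0 1. J (sgn x) \<partial>lborel)"
  unfolding m_def by (rule nn_integral_sphere_borel) measurable
 also have "(\<integral>\<^sup>+x\<in>ball 0 1. J (sgn x) \<partial>lborel) = (\<integral>\<^sup>+x. (\<integral>\<^sup>+s. ind (ball 0 1) x * ennreal (norm x ^ m) *
    (F (s *\<^sub>R x) * ennreal (s ^ (m - 1)) * ind {0<..} s) \<partial>lborel) \<partial>lborel)" proof (rule nn_integral_cong_AE)
  have "AE x in lborel. x \<noteq> (0::'a)" using AE_lborel_singleton[of 0] by simp
  then show "AE x in lborel. J (sgn x) * ind (ball 0 1) x = (\<integral>\<^sup>+s. ind (ball 0 1) x * ennreal (norm x ^ m) *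
    (F (s *\<^sub>R x) * ennreal (s ^ (m - 1)) * ind {0<..} s) \<partial>lborel)" by eventually_elim (simp add: J, subst nn_integral_cmult, auto simp: J_def ac_simps) qed
 also have "\<dots> = (\<integral>\<^sup>+s. (\<integral>\<^sup>+x. ind (ball 0 1) x * ennreal (norm x ^ m) * (F (s *\<^sub>R x) * ennreal (s ^ (m - 1)) * ind {0<..} s) \<partial>lborel) \<partial>lborel)"
  by (rule lborel_pair.Fubini') (subst measurable_cong_sets[OF sets_pair_measure_cong[OF sets_lborel sets_lborel] refl], unfold split_beta', measurable)
 also have "\<dots> = (\<integral>\<^sup>+s. (\<integral>\<^sup>+y. F y * (ennreal (norm y ^ m / s ^ Suc m) * ind {norm y<..} s) \<partial>lborel) \<partial>lborel)"
 proof (rule nn_integral_cong)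
  fix s :: real
  show "(\<integral>\<^sup>+x. ind (ball 0 1) x * ennreal (norm x ^ m) * (F (s *\<^sub>R x) * ennreal (s ^ (m - 1)) * ind {0<..} s) \<partial>lborel) =
    (\<integral>\<^sup>+y. F y * (ennreal (norm y ^ m / s ^ Suc m) * ind {norm y<..} s) \<partial>lborel)" proof (cases "s > 0") case True
   have "(\<integral>\<^sup>+y. F y * (ennreal (norm y ^ m / s ^ Suc m) * ind {norm y<..} s) \<partial>lborel) =
     ennreal (s ^ m) * (\<integral>\<^sup>+x. F (s *\<^sub>R x) * (ennreal (norm (s *\<^sub>R x) ^ m / s ^ Suc m) * ind {norm (s *\<^sub>R x)<..} s) \<partial>lborel)"
    unfolding m_def by (rule nn_integral_lborel_scale[OF _ True]) (simp add: indicator_def)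
   also have "\<dots> = (\<integral>\<^sup>+x. ennreal (s ^ m) * (F (s *\<^sub>R x) * (ennreal (norm (s *\<^sub>R x) ^ m / s ^ Suc m) * ind {norm (s *\<^sub>R x)<..} s)) \<partial>lborel)"
    by (rule nn_integral_cmult[symmetric]) (simp add: indicator_def)
   also have "\<dots> = (\<integral>\<^sup>+x. ind (ball 0 1) x * ennreal (norm x ^ m) * (F (s *\<^sub>R x) * ennreal (s ^ (m - 1)) * ind {0<..} s) \<partial>lborel)"
   proof (rule nn_integral_cong)
    fix x :: 'a
    have "s ^ m * (norm (s *\<^sub>R x) ^ m / s ^ Suc m) = norm x ^ m * s ^ (m - 1)"
    proof -
     have "s ^ m = s * s ^ (m - 1)" using m(2) by (metis power_Suc)
     moreover have "norm (s *\<^sub>R x) ^ m = s ^ m * norm x ^ m" using True by (simp add: power_mult_distrib)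
     ultimately show ?thesis using True by simp
    qed
    then have e: "ennreal (s ^ m) * ennreal (norm (s *\<^sub>R x) ^ m / s ^ Suc m) = ennreal (norm x ^ m) * ennreal (s ^ (m - 1))"
     using True by (simp add: ennreal_mult[symmetric] del: norm_scaleR)
    have i: "ind {norm (s *\<^sub>R x)<..} s = (ind (ball 0 1) x :: ennreal)" "ind {0<..} s = (1::ennreal)"
     using True by (auto simp: indicator_def)
    show "ennreal (s ^ m) * (F (s *\<^sub>R x) * (ennreal (norm (s *\<^sub>R x) ^ m / s ^ Suc m) * ind {norm (s *\<^sub>R x)<..} s)) =
      ind (ball 0 1) x * ennreal (norm x ^ m) * (F (s *\<^sub>R x) * ennreal (s ^ (m - 1)) * ind {0<..} s)" proof -
     let ?a = "ennreal (s ^ m)" and ?b = "ennreal (norm (s *\<^sub>R x) ^ m / s ^ Suc m)"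
      and ?I = "ind (ball 0 1) x :: ennreal"
     have "?a * (F (s *\<^sub>R x) * (?b * ?I)) = (?a * ?b) * (F (s *\<^sub>R x) * ?I)" by (simp only: ac_simps)
     then show ?thesis unfolding i e by (simp only: ac_simps mult_1_left)
    qed
   qed
   finally show ?thesis ..
  next
   case False
   then have "ind {0<..} s = (0::ennreal)" "ind {norm y<..} s = (0::ennreal)" for y :: 'a
    using norm_ge_zero[of y] by (auto simp: indicator_def simp del: norm_ge_zero)
   then show ?thesis by simp
  qed
 qed
 also have "\<dots> = (\<integral>\<^sup>+y. (\<integral>\<^sup>+s. F y * (ennreal (norm y ^ m / s ^ Suc m) * ind {norm y<..} s) \<partial>lborel) \<partial>lborel)" by (rule lborel_pair.Fubini')
    (subst measurable_cong_sets[OF sets_pair_measure_cong[OF sets_lborel sets_lborel] refl], unfold split_beta', measurable)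
 also have "\<dots> = (\<integral>\<^sup>+y. F y * ennreal (1 / m) \<partial>lborel)"
 proof (rule nn_integral_cong_AE)
  have "AE x in lborel. x \<noteq> (0::'a)" using AE_lborel_singleton[of 0] by simp
  then show "AE y in lborel. (\<integral>\<^sup>+s. F y * (ennreal (norm y ^ m / s ^ Suc m) * ind {norm y<..} s) \<partial>lborel) = F y * ennreal (1 / m)"
  proof eventually_elim
   fix y :: 'a assume "y \<noteq> 0"
   have "(\<integral>\<^sup>+s. F y * (ennreal (norm y ^ m / s ^ Suc m) * ind {norm y<..} s) \<partial>lborel) =
     F y * (\<integral>\<^sup>+s\<in>{norm y<..}. ennreal (norm y ^ m / s ^ Suc m) \<partial>lborel)" by (rule nn_integral_cmult) measurable
   also have "\<dots> = F y * ennreal (1 / m)" using nn_integral_power_tail[of "norm y" m] \<open>y \<noteq> 0\<close> m(1) by simp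
   finally show "(\<integral>\<^sup>+s. F y * (ennreal (norm y ^ m / s ^ Suc m) * ind {norm y<..} s) \<partial>lborel) = F y * ennreal (1 / m)" .
  qed
 qed
 also have "\<dots> = (\<integral>\<^sup>+y. F y \<partial>lborel) * ennreal (1 / m)" by (rule nn_integral_multc) measurable
 finally have "(\<integral>\<^sup>+w. J w \<partial>sphere_borel) = of_nat m * ((\<integral>\<^sup>+y. F y \<partial>lborel) * ennreal (1 / m))" .
 also have "\<dots> = (of_nat m * ennreal (1 / m)) * (\<integral>\<^sup>+y. F y \<partial>lborel)" by (simp add: ac_simps)
 also have "of_nat m * ennreal (1 / m) = 1" using m(1) by (simp add: ennreal_of_nat_eq_real_of_nat ennreal_mult[symmetric])
 finally show ?thesis by (simp add: J_def m_def)
qed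

lemma AE_sphere_borel_norm: "AE w in sphere_borel. norm w = 1"
proof -
 have *: "(\<integral>\<^sup>+w. ind {w::'a. norm w \<noteq> 1} w \<partial>sphere_borel) = 0"
 proof -
  have "AE x in lborel. x \<noteq> (0::'a)" using AE_lborel_singleton[of 0] by simp
  then have "AE x in lborel. ind {w::'a. norm w \<noteq> 1} (sgn x) * ind (ball 0 1) x = (0::ennreal)" by eventually_elim (auto simp: norm_sgn)
  then have "(\<integral>\<^sup>+x\<in>ball 0 1. ind {w::'a. norm w \<noteq> 1} (sgn x) \<partial>lborel) = (\<integral>\<^sup>+(x::'a). 0 \<partial>lborel)" by (rule nn_integral_cong_AE)
  then show ?thesis by (subst nn_integral_sphere_borel) auto
 qed
 show ?thesis by (rule AE_I[of _ _ "{w. norm w \<noteq> 1}"]) (use * in auto)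
qed

lemma nn_integral_polar_product:
 fixes h :: "'a::euclidean_space \<Rightarrow> ennreal" and g :: "real \<Rightarrow> ennreal"
 assumes [measurable]: "h \<in> borel_funs" "g \<in> borel_funs"
 shows "(\<integral>\<^sup>+x. h (sgn x) * g (norm x) \<partial>lborel) = (\<integral>\<^sup>+w. h w \<partial>sphere_borel) * (\<integral>\<^sup>+s\<in>{0<..}. g s * ennreal (s ^ (DIM('a) - 1)) \<partial>lborel)"
proof -
 have "(\<integral>\<^sup>+x. h (sgn x) * g (norm x) \<partial>lborel) =
  (\<integral>\<^sup>+w. (\<integral>\<^sup>+s\<in>{0<..}. h (sgn (s *\<^sub>R w)) * g (norm (s *\<^sub>R w)) * ennreal (s ^ (DIM('a) - 1)) \<partial>lborel) \<partial>sphere_borel)"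
  by (rule nn_integral_polar) measurable
 also have "\<dots> = (\<integral>\<^sup>+w. h w * (\<integral>\<^sup>+s\<in>{0<..}. g s * ennreal (s ^ (DIM('a) - 1)) \<partial>lborel) \<partial>sphere_borel)"
 proof (rule nn_integral_cong_AE)
  show "AE w in sphere_borel. (\<integral>\<^sup>+s\<in>{0<..}. h (sgn (s *\<^sub>R w)) * g (norm (s *\<^sub>R w)) * ennreal (s ^ (DIM('a) - 1)) \<partial>lborel) =
    h w * (\<integral>\<^sup>+s\<in>{0<..}. g s * ennreal (s ^ (DIM('a) - 1)) \<partial>lborel)" using AE_sphere_borel_norm proof eventually_elim
   fix w :: 'a assume w: "norm w = 1"
   have "(\<integral>\<^sup>+s\<in>{0<..}. h (sgn (s *\<^sub>R w)) * g (norm (s *\<^sub>R w)) * ennreal (s ^ (DIM('a) - 1)) \<partial>lborel) =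
     (\<integral>\<^sup>+s. h w * (g s * ennreal (s ^ (DIM('a) - 1)) * ind {0<..} s) \<partial>lborel)"
    using w by (intro nn_integral_cong) (auto simp: indicator_def sgn_scaleR sgn_div_norm ac_simps)
   also have "\<dots> = h w * (\<integral>\<^sup>+s\<in>{0<..}. g s * ennreal (s ^ (DIM('a) - 1)) \<partial>lborel)" by (rule nn_integral_cmult) measurable
   finally show "(\<integral>\<^sup>+s\<in>{0<..}. h (sgn (s *\<^sub>R w)) * g (norm (s *\<^sub>R w)) * ennreal (s ^ (DIM('a) - 1)) \<partial>lborel) =
    h w * (\<integral>\<^sup>+s\<in>{0<..}. g s * ennreal (s ^ (DIM('a) - 1)) \<partial>lborel)" . qed qed
 also have "\<dots> = (\<integral>\<^sup>+w. h w \<partial>sphere_borel) * (\<integral>\<^sup>+s\<in>{0<..}. g s * ennreal (s ^ (DIM('a) - 1)) \<partial>lborel)"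
  by (rule nn_integral_multc) measurable
 finally show ?thesis .
qed

section \<open>Null sets and measurability under the radial projection\<close>

text \<open>Polar coordinates identify null sets of the sphere with null cones. For the converse
  direction, an exceptional unit vector makes its entire open ray exceptional, and a ray has
  positive length; so almost every unit vector is good.\<close>

lemma AE_sgn_iff:
 fixes P :: "'a::euclidean_space \<Rightarrow> bool"
 shows "(AE x in lebesgue. P (sgn x)) \<longleftrightarrow> (AE w in sphere_measure. P w)" unfolding AE_completion_iff sphere_measure_eq
proof
 assume "AE w in sphere_borel. P w"
 then obtain N where N: "{w \<in> space sphere_borel. \<not> P w} \<subseteq> N" "emeasure sphere_borel N = 0" "N \<in> sets sphere_borel" by (rule AE_E)
 have [measurable]: "N \<in> sets borel" using N by simp
 have "(\<integral>\<^sup>+x. ind N (sgn x) * 1 \<partial>lborel) = 0" using nn_integral_polar_product[of "ind N" "\<lambda>_. 1"] N by simp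
 then have "AE x in lborel. ind N (sgn x) * 1 = (0::ennreal)" by (subst (asm) nn_integral_0_iff_AE) auto
 then show "AE x in lborel. P (sgn x)" by eventually_elim (use N in "auto simp: indicator_def split: if_splits")
next
 assume "AE x in lborel. P (sgn x)"
 then obtain N where N: "{x \<in> space lborel. \<not> P (sgn x)} \<subseteq> N" "emeasure lborel N = 0" "N \<in> sets lborel" by (rule AE_E)
 have [measurable]: "N \<in> sets borel" using N by simp
 let ?J = "\<lambda>w. \<integral>\<^sup>+s. ind N (s *\<^sub>R w) * ennreal (s ^ (DIM('a) - 1)) * ind {0<..} s \<partial>lborel"
 have "(\<integral>\<^sup>+w. ?J w \<partial>sphere_borel) = (\<integral>\<^sup>+x. ind N x \<partial>lborel)" by (rule nn_integral_polar[symmetric]) measurable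
 also have "\<dots> = 0" using N by simp
 finally have "AE w in sphere_borel. ?J w = 0" by (subst (asm) nn_integral_0_iff_AE) measurable
 then show "AE w in sphere_borel. P w" using AE_sphere_borel_norm
 proof eventually_elim
  fix w :: 'a assume J: "?J w = 0" and w: "norm w = 1"
  have "AE s in lborel. ind N (s *\<^sub>R w) * ennreal (s ^ (DIM('a) - 1)) * ind {0<..} s = 0"
   using J by (subst (asm) nn_integral_0_iff_AE) measurable
  then have ae: "AE s in lborel. s \<in> {0<..} \<longrightarrow> s *\<^sub>R w \<notin> N" by eventually_elim (auto simp: indicator_def split: if_splits)
  show "P w"
  proof (rule ccontr)
   assume "\<not> P w"
   then have "s *\<^sub>R w \<in> N" if "s > 0" for s
    using N that w by (auto simp: sgn_scaleR sgn_div_norm)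
   note * = this
   have "AE s in lborel. s \<notin> {0<..<1::real}" using ae by eventually_elim (use * in auto)
   then have "emeasure lborel {0<..<1::real} = 0" by (rule AE_iff_measurable[THEN iffD1, rotated 2]) auto
   then show False by simp
  qed
 qed
qed

lemma nn_integral_sphere_polar:
 fixes h :: "'a::euclidean_space \<Rightarrow> ennreal" and g :: "real \<Rightarrow> ennreal"
 assumes h: "h \<in> borel_measurable sphere_measure" and [measurable]: "g \<in> borel_funs"
 shows "(\<integral>\<^sup>+x. h (sgn x) * g (norm x) \<partial>lebesgue) = (\<integral>\<^sup>+w. h w \<partial>sphere_measure) * (\<integral>\<^sup>+s\<in>{0<..}. g s * ennreal (s ^ (DIM('a) - 1)) \<partial>lborel)"
proof -
 obtain h' where h'[measurable]: "h' \<in> borel_measurable sphere_borel" and ae: "AE w in sphere_borel. h w = h' w"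
  using completion_ex_borel_measurable[of h sphere_borel] h by (auto simp: sphere_measure_eq)
 have ae': "AE w in sphere_measure. h w = h' w" using ae unfolding sphere_measure_eq AE_completion_iff .
 have "AE x in lebesgue. h (sgn x) = h' (sgn x)" using ae' by (rule AE_sgn_iff[of "\<lambda>w. h w = h' w", THEN iffD2])
 then have "(\<integral>\<^sup>+x. h (sgn x) * g (norm x) \<partial>lebesgue) = (\<integral>\<^sup>+x. h' (sgn x) * g (norm x) \<partial>lebesgue)"
  by (intro nn_integral_cong_AE) (elim eventually_mono, simp)
 also have "\<dots> = (\<integral>\<^sup>+x. h' (sgn x) * g (norm x) \<partial>lborel)" by (rule nn_integral_completion)
 also have "\<dots> = (\<integral>\<^sup>+w. h' w \<partial>sphere_borel) * (\<integral>\<^sup>+s\<in>{0<..}. g s * ennreal (s ^ (DIM('a) - 1)) \<partial>lborel)"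
  by (rule nn_integral_polar_product) (use h' in auto)
 also have "(\<integral>\<^sup>+w. h' w \<partial>sphere_borel) = (\<integral>\<^sup>+w. h w \<partial>sphere_borel)" using ae by (intro nn_integral_cong_AE) (elim eventually_mono, simp)
 finally show ?thesis by (simp add: sphere_measure_eq nn_integral_completion)
qed

text \<open>A function measurable for the completed surface measure equals a Borel function off a
  null set, and preimages of null sets under \<open>sgn\<close> are null.\<close>

lemma measurable_comp_sgn:
 fixes h :: "'a::euclidean_space \<Rightarrow> 'b::euclidean_space"
 assumes "h \<in> borel_measurable sphere_measure"
 shows "(\<lambda>x. h (sgn x)) \<in> borel_measurable lebesgue"
proof -
 have "(\<lambda>x. h (sgn x) \<bullet> b) \<in> borel_measurable lebesgue" if "b \<in> Basis" for b
 proof -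
  have "(\<lambda>x. h x \<bullet> b) \<in> borel_measurable (completion sphere_borel)" using assms unfolding sphere_measure_eq by simp
  then obtain h' where h'[measurable]: "h' \<in> borel_measurable sphere_borel" and ae: "AE w in sphere_borel. h w \<bullet> b = h' w"
   using completion_ex_borel_measurable_real by blast
  have "AE x in lebesgue. h (sgn x) \<bullet> b = h' (sgn x)" by (rule AE_sgn_iff[of "\<lambda>w. h w \<bullet> b = h' w", THEN iffD2])
     (use ae in "unfold sphere_measure_eq AE_completion_iff")
  then show ?thesis by (rule completion.measurable_AE_eq[rotated]) (use h' in "auto intro: measurable_completion")
 qed
 then show ?thesis by (subst borel_measurable_euclidean_space) blast
qed

section \<open>Functions on the sphere\<close>

lemma borel_measurable_off_zero:
 fixes f :: "'a::euclidean_space \<Rightarrow> 'b::euclidean_space"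
 assumes "continuous_on (- {0}) f"
 shows "f \<in> borel_funs" by (rule borel_measurable_continuous_countable_exceptions[where X="{0}"]) (use assms in auto)

text \<open>Classical counterpart of the weak tangential gradient. Only its values at unit vectors
  are meant; elsewhere the homogeneity of degree -1 of the gradient adds a factor 1/|w|.\<close>

definition tgrad :: "('a::euclidean_space \<Rightarrow> real) \<Rightarrow> 'a \<Rightarrow> 'a" where "tgrad \<phi> w = grad (\<lambda>x. \<phi> (sgn x)) w"

locale smooth_sphere_function =
 fixes \<phi> :: "'a::euclidean_space \<Rightarrow> real"
 assumes smooth: "smooth_on (- {0}) (\<lambda>x. \<phi> (sgn x))"
begin

lemma GDERIV_sgn: "x \<noteq> 0 \<Longrightarrow> GDERIV (\<lambda>x. \<phi> (sgn x)) x :> grad (\<lambda>x. \<phi> (sgn x)) x"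
 using smooth_on_GDERIV[OF smooth] by auto

lemma grad_scale:
 assumes x: "x \<noteq> 0" and c: "c > 0"
 shows "grad (\<lambda>x. \<phi> (sgn x)) (c *\<^sub>R x) = grad (\<lambda>x. \<phi> (sgn x)) x /\<^sub>R c"
proof -
 let ?f = "\<lambda>x. \<phi> (sgn x)"
 have "((\<lambda>y. inverse c *\<^sub>R y) has_derivative (\<lambda>h. inverse c *\<^sub>R h)) (at (c *\<^sub>R x))" by (auto intro!: derivative_eq_intros)
 from has_derivative_compose[OF this, of ?f "\<lambda>h. h \<bullet> grad ?f x"]
 have "((\<lambda>y. ?f (inverse c *\<^sub>R y)) has_derivative (\<lambda>h. (inverse c *\<^sub>R h) \<bullet> grad ?f x)) (at (c *\<^sub>R x))"
  using GDERIV_sgn[OF x] c by (simp add: gderiv_def)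
 moreover have "(\<lambda>y. ?f (inverse c *\<^sub>R y)) = ?f" using c by (auto simp: sgn_scaleR)
 ultimately have "GDERIV ?f (c *\<^sub>R x) :> grad ?f x /\<^sub>R c" by (simp add: gderiv_def)
 then show ?thesis by (rule grad_eq)
qed

lemma grad_eq_tgrad:
 assumes "x \<noteq> 0"
 shows "grad (\<lambda>x. \<phi> (sgn x)) x = tgrad \<phi> (sgn x) /\<^sub>R norm x"
proof -
 have "norm x *\<^sub>R sgn x = x" using assms by (simp add: sgn_div_norm)
 then show ?thesis using grad_scale[of "sgn x" "norm x"] assms by (simp add: tgrad_def sgn_zero_iff)
qed

text \<open>The extension is constant along rays. This orthogonality later makes the square of a
  full gradient the sum of a radial and a tangential square.\<close>

lemma tgrad_radial:
 assumes "x \<noteq> 0"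
 shows "x \<bullet> tgrad \<phi> x = 0"
proof -
 let ?f = "\<lambda>x. \<phi> (sgn x)"
 have "((\<lambda>t. ?f (x + t *\<^sub>R x)) has_real_derivative (x \<bullet> tgrad \<phi> x)) (at 0)"
  using GDERIV_direction[of ?f x 0 x "tgrad \<phi> x"] GDERIV_sgn[OF assms] by (simp add: tgrad_def)
 moreover have "((\<lambda>t. ?f (x + t *\<^sub>R x)) has_real_derivative 0) (at 0)"
 proof (rule has_field_derivative_transform_within_open[of "\<lambda>t. ?f x" _ _ "{-1<..}"])
  fix t :: real assume "t \<in> {-1<..}"
  moreover have "x + t *\<^sub>R x = (1 + t) *\<^sub>R x" by (simp add: algebra_simps)
  ultimately show "?f x = ?f (x + t *\<^sub>R x)" by (simp add: sgn_scaleR)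
 qed auto
 ultimately show ?thesis by (rule DERIV_unique)
qed

lemma continuous_sgn: "continuous_on (- {0}) (\<lambda>x. \<phi> (sgn x))"
 by (rule smooth_on_continuous[OF smooth])

lemma continuous_tgrad: "continuous_on (- {0}) (tgrad \<phi>)"
 unfolding tgrad_def[abs_def] by (rule continuous_on_grad[OF smooth])

lemma sphere_bounds:
 obtains B where "0 < B" "\<And>x. x \<noteq> 0 \<Longrightarrow> \<bar>\<phi> (sgn x)\<bar> \<le> B" "\<And>w. norm w = 1 \<Longrightarrow> \<bar>\<phi> w\<bar> \<le> B" "\<And>w. norm w = 1 \<Longrightarrow> norm (tgrad \<phi> w) \<le> B"
proof -
 have "compact ((\<lambda>x. \<phi> (sgn x)) ` sphere 0 1)" "compact (tgrad \<phi> ` sphere 0 1)"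
  by (intro compact_continuous_image compact_sphere continuous_on_subset[OF continuous_sgn] continuous_on_subset[OF continuous_tgrad]; auto)+
 then obtain B1 B2 where B: "B1 > 0" "\<forall>y\<in>(\<lambda>x. \<phi> (sgn x)) ` sphere 0 1. norm y \<le> B1" "\<forall>y\<in>tgrad \<phi> ` sphere 0 1. norm y \<le> B2"
  using bounded_pos compact_imp_bounded by metis
 have s: "sgn w = w" if "norm w = 1" for w :: 'a using that by (simp add: sgn_div_norm)
 have 1: "\<bar>\<phi> w\<bar> \<le> B1" if "norm w = 1" for w
  using B(2) s[OF that] that by force
 show ?thesis
 proof (rule that[of "max B1 B2"])
  show "\<bar>\<phi> w\<bar> \<le> max B1 B2" if "norm w = 1" for w using 1[OF that] by simp
  show "\<bar>\<phi> (sgn x)\<bar> \<le> max B1 B2" if "x \<noteq> 0" for x using 1[of "sgn x"] that by (simp add: norm_sgn)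
  show "norm (tgrad \<phi> w) \<le> max B1 B2" if "norm w = 1" for w using B(3) that by force
 qed (use B in auto)
qed

end

lemma sphere_test_functionsD:
 fixes \<phi> :: "'a::euclidean_space \<Rightarrow> real"
 assumes "\<phi> \<in> sphere_test_functions G"
 shows "smooth_sphere_function \<phi>"
  and "\<And>w. norm w = 1 \<Longrightarrow> w \<notin> G \<Longrightarrow> \<phi> w = 0"
  and "\<And>w. norm w = 1 \<Longrightarrow> w \<notin> G \<Longrightarrow> tgrad \<phi> w = 0"
proof -
 show "smooth_sphere_function \<phi>" using assms by unfold_locales (simp add: sphere_test_functions_def)
 let ?C = "closure (support_on (sphere 0 1) \<phi>)"
 have C: "?C \<subseteq> G" using assms by (simp add: sphere_test_functions_def)
 have z: "\<phi> w = 0" if "norm w = 1" "w \<notin> ?C" for w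
  using that closure_subset[of "support_on (sphere 0 1) \<phi>"] by (auto simp: support_on_def)
 show "\<phi> w = 0" if "norm w = 1" "w \<notin> G" for w using z[OF that(1)] that(2) C by auto
 have "continuous_on (- {0}) (sgn :: 'a \<Rightarrow> 'a)" by (auto intro!: continuous_intros)
 then have o: "open (sgn -` (- ?C) \<inter> (- {0}))" by (intro continuous_on_open_vimage[THEN iffD1, rule_format]) auto
 show "tgrad \<phi> w = 0" if w: "norm w = 1" "w \<notin> G" for w
  unfolding tgrad_def
 proof (rule grad_eq, rule GDERIV_zero[OF o])
  show "w \<in> sgn -` (- ?C) \<inter> - {0}" using w C by (auto simp: sgn_div_norm)
  show "\<phi> (sgn y) = 0" if "y \<in> sgn -` (- ?C) \<inter> - {0}" for y
   using that by (intro z) (auto simp: norm_sgn)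
 qed
qed

lemma sphere_test_functionsI:
 assumes "smooth_on (- {0}) (\<lambda>x. \<phi> (sgn x))" "compact C" "C \<subseteq> G" "\<And>w. norm w = 1 \<Longrightarrow> w \<notin> C \<Longrightarrow> \<phi> w = 0"
 shows "\<phi> \<in> sphere_test_functions G"
proof -
 have "support_on (sphere 0 1) \<phi> \<subseteq> C" using assms(4) by (auto simp: support_on_def)
 then have "closure (support_on (sphere 0 1) \<phi>) \<subseteq> C" using assms(2) by (simp add: closure_minimal compact_imp_closed)
 then show ?thesis using assms compact_Int_closed[OF assms(2) closed_closure, of "support_on (sphere 0 1) \<phi>"]
  by (auto simp: sphere_test_functions_def Int_absorb1)
qed

lemma sphere_test_functions_lincomb:
 assumes "\<phi> \<in> sphere_test_functions G" "\<psi> \<in> sphere_test_functions G"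
 shows "(\<lambda>x. a * \<phi> x + b * \<psi> x) \<in> sphere_test_functions G"
proof (rule sphere_test_functionsI)
 let ?C = "closure (support_on (sphere 0 1) \<phi>)" and ?D = "closure (support_on (sphere 0 1) \<psi>)"
 show "compact (?C \<union> ?D)" "?C \<union> ?D \<subseteq> G" using assms by (auto simp: sphere_test_functions_def)
 show "smooth_on (- {0}) (\<lambda>x. a * \<phi> (sgn x) + b * \<psi> (sgn x))"
  using assms by (intro smooth_on_add smooth_on_mult smooth_on_const) (auto simp: sphere_test_functions_def)
 show "a * \<phi> w + b * \<psi> w = 0" if "norm w = 1" "w \<notin> ?C \<union> ?D" for w
 proof -
  have "w \<notin> support_on (sphere 0 1) \<phi>" "w \<notin> support_on (sphere 0 1) \<psi>" using that(2) closure_subset by blast+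
  then show ?thesis using that(1) by (simp add: support_on_def)
 qed
qed

lemma tgrad_lincomb:
 assumes "smooth_sphere_function \<phi>" "smooth_sphere_function \<psi>" "norm w = 1"
 shows "tgrad (\<lambda>x. a * \<phi> x + b * \<psi> x) w = a *\<^sub>R tgrad \<phi> w + b *\<^sub>R tgrad \<psi> w"
proof -
 have w: "w \<noteq> 0" using assms(3) by auto
 have D: "GDERIV (\<lambda>x. \<phi> (sgn x)) w :> tgrad \<phi> w" "GDERIV (\<lambda>x. \<psi> (sgn x)) w :> tgrad \<psi> w"
  unfolding tgrad_def using w assms(1,2) by (auto intro: smooth_sphere_function.GDERIV_sgn)
 show ?thesis unfolding tgrad_def[of "\<lambda>x. a * \<phi> x + b * \<psi> x"]
 proof (rule grad_eq)
  show "GDERIV (\<lambda>x. a * \<phi> (sgn x) + b * \<psi> (sgn x)) w :> a *\<^sub>R tgrad \<phi> w + b *\<^sub>R tgrad \<psi> w"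
   using D unfolding gderiv_def by (auto intro!: derivative_eq_intros simp: inner_add_right)
 qed
qed

lemma has_weak_gradient_cong:
 assumes "\<And>x. x \<in> \<Omega> \<Longrightarrow> u x = v x" "\<And>x. x \<in> \<Omega> \<Longrightarrow> g x = h x" "has_weak_gradient \<Omega> u g" "\<Omega> \<in> sets lebesgue"
 shows "has_weak_gradient \<Omega> v h"
proof -
 have "locally_integrable \<Omega> f' \<longleftrightarrow> locally_integrable \<Omega> f" if "\<And>x. x \<in> \<Omega> \<Longrightarrow> f x = f' x" for f f' :: "'a \<Rightarrow> 'b::euclidean_space"
 proof -
  have "integrable (lebesgue_on C) f' \<longleftrightarrow> integrable (lebesgue_on C) f" if "C \<subseteq> \<Omega>" for C
   by (rule Bochner_Integration.integrable_cong[OF refl]) (use that \<open>\<And>x. x \<in> \<Omega> \<Longrightarrow> f x = f' x\<close> in "auto simp: space_restrict_space")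
  then show ?thesis unfolding locally_integrable_def by blast
 qed
 moreover have "(LINT x|lebesgue_on \<Omega>. v x *\<^sub>R grad \<phi> x) = (LINT x|lebesgue_on \<Omega>. u x *\<^sub>R grad \<phi> x)"
  "(LINT x|lebesgue_on \<Omega>. \<phi> x *\<^sub>R h x) = (LINT x|lebesgue_on \<Omega>. \<phi> x *\<^sub>R g x)" for \<phi>
  using assms(1,2) by (auto intro!: Bochner_Integration.integral_cong simp: space_restrict_space)
 ultimately show ?thesis using assms(3) unfolding has_weak_gradient_def by (metis assms(1,2))
qed

section \<open>The cone over G and the Sobolev space on G\<close>

locale hardy_cone =
 fixes K :: "'a::euclidean_space set" and p :: real
 assumes p: "1 < p" and K: "open_cone K"
begin

abbreviation "G \<equiv> K \<inter> sphere 0 1"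
abbreviation "tests \<equiv> sphere_test_functions G"
abbreviation "M \<equiv> sphere_measure_on G"

definition c :: real where "c = (real DIM('a) - p) / p"

text \<open>The open set on which weak tangential gradients are formulated. It is K without the
  origin, a null set.\<close>

definition K0 :: "'a set" where "K0 = {x. x \<noteq> 0 \<and> sgn x \<in> G}"

lemma open_K: "open K" using K by (simp add: open_cone_def)

lemma cone_scale: "y \<in> K \<Longrightarrow> 0 < t \<Longrightarrow> t *\<^sub>R y \<in> K" using K by (auto simp: open_cone_def)

lemma cone_scale_iff: "0 < t \<Longrightarrow> t *\<^sub>R y \<in> K \<longleftrightarrow> y \<in> K"
 using cone_scale[of y t] cone_scale[of "t *\<^sub>R y" "inverse t"] by auto

lemma K0_eq: "K0 = K - {0}"
proof -
 have "sgn x \<in> G \<longleftrightarrow> x \<in> K" if "x \<noteq> 0" for x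
  using cone_scale_iff[of "inverse (norm x)" x] that by (simp add: sgn_div_norm)
 then show ?thesis by (auto simp: K0_def)
qed

lemma open_K0: "open K0"
 unfolding K0_eq using open_K by (auto intro: open_Diff)

lemma sgn_in_G: "x \<in> K \<Longrightarrow> x \<noteq> 0 \<Longrightarrow> sgn x \<in> G"
 using K0_eq by (auto simp: K0_def)

lemma G_borel [measurable, simp]: "G \<in> sets borel"
 using open_K by auto

lemma G_sets [simp]: "G \<in> sets sphere_measure" by simp

lemma G_norm: "w \<in> G \<Longrightarrow> norm w = 1" by simp

lemma space_M [simp]: "space M = G" by (simp add: space_restrict_space)

lemma finite_M: "finite_measure M"
 using finite_sphere_measure by (intro finite_measure_restrict_space) auto

lemma AE_M_iff: "(AE w in M. P w) \<longleftrightarrow> (AE w in sphere_measure. w \<in> G \<longrightarrow> P w)"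
 by (rule AE_restrict_space_iff) simp

lemma AE_K0_iff: "(AE x in lebesgue_on K0. P (sgn x)) \<longleftrightarrow> (AE w in M. P w)"
proof -
 have "(AE x in lebesgue_on K0. P (sgn x)) \<longleftrightarrow> (AE x in lebesgue. x \<in> K0 \<longrightarrow> P (sgn x))" using open_K0 by (intro AE_restrict_space_iff) auto
 also have "\<dots> \<longleftrightarrow> (AE x in lebesgue. sgn x \<in> G \<longrightarrow> P (sgn x))"
 proof -
  have "AE x in lebesgue. x \<noteq> (0::'a)" unfolding AE_completion_iff using AE_lborel_singleton[of 0] by simp
  then have ae: "AE x in lebesgue. x \<in> K0 \<longleftrightarrow> sgn x \<in> G" by eventually_elim (simp add: K0_def)
  show ?thesis
  proof
   assume "AE x in lebesgue. x \<in> K0 \<longrightarrow> P (sgn x)" with ae show "AE x in lebesgue. sgn x \<in> G \<longrightarrow> P (sgn x)" by eventually_elim blast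
  next
   assume "AE x in lebesgue. sgn x \<in> G \<longrightarrow> P (sgn x)" with ae show "AE x in lebesgue. x \<in> K0 \<longrightarrow> P (sgn x)" by eventually_elim blast
  qed
 qed
 also have "\<dots> \<longleftrightarrow> (AE w in sphere_measure. w \<in> G \<longrightarrow> P w)" by (rule AE_sgn_iff)
 finally show ?thesis by (simp only: AE_M_iff)
qed

lemma measurable_M_iff:
 fixes f :: "'a \<Rightarrow> 'b::euclidean_space"
 shows "f \<in> borel_measurable M \<longleftrightarrow> (\<lambda>w. ind G w *\<^sub>R f w) \<in> borel_measurable sphere_measure" by (rule borel_measurable_restrict_space_iff) simp

lemma measurable_M_borel:
 fixes f :: "'a \<Rightarrow> 'b::euclidean_space"
 assumes "f' \<in> borel_funs" "\<And>w. w \<in> G \<Longrightarrow> f w = f' w"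
 shows "f \<in> borel_measurable M"
proof -
 have "f' \<in> borel_measurable sphere_measure"
  unfolding sphere_measure_eq using assms(1) by (intro measurable_completion) (simp cong: measurable_cong_sets)
 then have "f' \<in> borel_measurable M" by (rule measurable_restrict_space1)
 then show ?thesis by (rule measurable_cong[THEN iffD1, rotated]) (use assms(2) in auto)
qed

lemma measurable_M_AE:
 fixes f f' :: "'a \<Rightarrow> 'b::euclidean_space"
 assumes "f' \<in> borel_measurable M" "AE w in M. f w = f' w"
 shows "f \<in> borel_measurable M"
proof -
 have "AE w in sphere_measure. ind G w *\<^sub>R f w = ind G w *\<^sub>R f' w"
  using assms(2) unfolding AE_M_iff by eventually_elim (auto simp: indicator_def)
 with assms(1)[unfolded measurable_M_iff] show ?thesis unfolding measurable_M_iff unfolding sphere_measure_eq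
  by (rule completion.measurable_AE_eq) auto
qed

lemma bounded_Lp_member:
 fixes f :: "'a \<Rightarrow> 'b::euclidean_space"
 assumes "f \<in> borel_measurable M" "\<And>w. w \<in> G \<Longrightarrow> norm (f w) \<le> B"
 shows "Lp_member p M f"
proof -
 interpret finite_measure M by (rule finite_M)
 have "integrable M (\<lambda>w. norm (f w) powr p)" using p assms by (intro integrable_const_bound[of _ "B powr p"] AE_I2) (auto intro!: powr_mono2)
 with assms show ?thesis by (simp add: Lp_member_def)
qed

lemma test_Lp:
 assumes "\<phi> \<in> tests"
 shows "Lp_member p M \<phi>" "Lp_member p M (tgrad \<phi>)" "\<phi> \<in> borel_measurable M" "tgrad \<phi> \<in> borel_measurable M"
proof -
 interpret smooth_sphere_function \<phi> using assms by (rule sphere_test_functionsD)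
 obtain B where B: "\<And>w. norm w = 1 \<Longrightarrow> \<bar>\<phi> w\<bar> \<le> B" "\<And>w. norm w = 1 \<Longrightarrow> norm (tgrad \<phi> w) \<le> B" using sphere_bounds by metis
 show m: "\<phi> \<in> borel_measurable M" "tgrad \<phi> \<in> borel_measurable M" using continuous_sgn continuous_tgrad
  by (auto intro!: measurable_M_borel borel_measurable_off_zero simp: sgn_div_norm)
 show "Lp_member p M \<phi>" "Lp_member p M (tgrad \<phi>)" using bounded_Lp_member[OF m(1)] bounded_Lp_member[OF m(2)] B by auto
qed

lemma test_weak_tgrad:
 assumes "\<phi> \<in> tests"
 shows "has_weak_tangential_gradient G \<phi> (tgrad \<phi>)"
proof -
 interpret smooth_sphere_function \<phi> using assms by (rule sphere_test_functionsD)
 have "has_weak_gradient K0 (\<lambda>x. \<phi> (sgn x)) (grad (\<lambda>x. \<phi> (sgn x)))"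
  using open_K0 by (rule smooth_has_weak_gradient) (rule smooth_on_subset[OF smooth], auto simp: K0_def)
 then have "has_weak_gradient K0 (\<lambda>x. \<phi> (sgn x)) (\<lambda>x. tgrad \<phi> (sgn x) /\<^sub>R norm x)"
  by (rule has_weak_gradient_cong[rotated 2]) (use open_K0 grad_eq_tgrad in "auto simp: K0_def")
 then show ?thesis by (simp add: has_weak_tangential_gradient_def K0_def)
qed

lemma weak_tgrad_unique:
 assumes "has_weak_tangential_gradient G v g" "has_weak_tangential_gradient G v h"
 shows "AE w in M. g w = h w"
proof -
 have "AE x in lebesgue_on K0. g (sgn x) /\<^sub>R norm x = h (sgn x) /\<^sub>R norm x" using assms has_weak_gradient_unique[OF open_K0]
  unfolding has_weak_tangential_gradient_def K0_def by blast
 moreover have "AE x in lebesgue_on K0. x \<in> K0" using AE_space[of "lebesgue_on K0"] by simp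
 ultimately have "AE x in lebesgue_on K0. g (sgn x) = h (sgn x)" by eventually_elim (auto simp: K0_def)
 then show ?thesis by (rule AE_K0_iff[of "\<lambda>w. g w = h w", THEN iffD1])
qed

lemma weak_tgrad_AE:
 assumes "has_weak_tangential_gradient G v g"
 shows "AE w in M. weak_tangential_gradient G v w = g w"
proof (rule weak_tgrad_unique[OF _ assms])
 show "has_weak_tangential_gradient G v (weak_tangential_gradient G v)" unfolding weak_tangential_gradient_def
  using someI[of "\<lambda>g. has_weak_tangential_gradient G v g" g] assms by blast
qed

lemma weak_tgrad_diff:
 assumes "has_weak_tangential_gradient G u g" "has_weak_tangential_gradient G v h"
 shows "has_weak_tangential_gradient G (\<lambda>x. u x - v x) (\<lambda>x. g x - h x)"
 using assms unfolding has_weak_tangential_gradient_def K0_def[symmetric] scaleR_right_diff_distrib by (rule has_weak_gradient_diff[OF open_K0])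

lemma Lp_norm_weak_tgrad:
 assumes "has_weak_tangential_gradient G v g" "g \<in> borel_measurable M"
 shows "Lp_norm p M (weak_tangential_gradient G v) = Lp_norm p M g" using weak_tgrad_AE[OF assms(1)] assms(2)
 by (intro Lp_norm_cong_AE measurable_M_AE[OF assms(2)]) auto

lemma nn_integral_M:
 fixes h :: "'a \<Rightarrow> ennreal"
 shows "(\<integral>\<^sup>+w. h w \<partial>M) = (\<integral>\<^sup>+w\<in>G. h w \<partial>sphere_measure)" by (rule nn_integral_restrict_space) simp

text \<open>The annulus \<open>r < |x| < R\<close> carries the radial factor \<open>\<integral>s\<^sup>m\<^sup>-\<^sup>1 ds \<le> R\<^sup>m\<close>.\<close>

lemma nn_integral_annulus_le:
 fixes h :: "'a \<Rightarrow> real"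
 assumes h: "h \<in> borel_measurable M" and h0: "\<And>w. 0 \<le> h w" and R: "0 < R"
  and C: "C \<subseteq> K0" "C \<subseteq> cball 0 R"
 shows "(\<integral>\<^sup>+x\<in>C. ennreal (h (sgn x)) \<partial>lebesgue) \<le> ennreal (R ^ DIM('a)) * (\<integral>\<^sup>+w. ennreal (h w) \<partial>M)"
proof -
 let ?h = "\<lambda>w. ennreal (h w) * ind G w"
 have "(\<lambda>w. ennreal (ind G w *\<^sub>R h w)) \<in> borel_measurable sphere_measure" using h unfolding measurable_M_iff by simp
 moreover have "(\<lambda>w. ennreal (ind G w *\<^sub>R h w)) = ?h" by (auto simp: indicator_def)
 ultimately have hm: "?h \<in> borel_measurable sphere_measure" by simp
 have "(\<integral>\<^sup>+x\<in>C. ennreal (h (sgn x)) \<partial>lebesgue) \<le> (\<integral>\<^sup>+x. ?h (sgn x) * ind {..R} (norm x) \<partial>lebesgue)"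
  using C by (intro nn_integral_mono) (auto simp: indicator_def K0_def subset_eq)
 also have "\<dots> = (\<integral>\<^sup>+w. ?h w \<partial>sphere_measure) * (\<integral>\<^sup>+s\<in>{0<..}. ind {..R} s * ennreal (s ^ (DIM('a) - 1)) \<partial>lborel)"
  by (rule nn_integral_sphere_polar[OF hm]) measurable
 also have "\<dots> \<le> (\<integral>\<^sup>+w. ?h w \<partial>sphere_measure) * ennreal (R ^ DIM('a))"
 proof (rule mult_left_mono)
  have "(\<integral>\<^sup>+s\<in>{0<..}. ind {..R} s * ennreal (s ^ (DIM('a) - 1)) \<partial>lborel) \<le> (\<integral>\<^sup>+s\<in>{0..R}. ennreal (R ^ (DIM('a) - 1)) \<partial>lborel)"
   by (intro nn_integral_mono) (auto simp: indicator_def intro!: ennreal_leI power_mono)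
  also have "\<dots> = ennreal (R ^ (DIM('a) - 1) * R)" using R by (subst nn_integral_cmult_indicator) (auto simp: ennreal_mult)
  also have "R ^ (DIM('a) - 1) * R = R ^ DIM('a)" by (metis DIM_positive Suc_pred' power_Suc2)
  finally show "(\<integral>\<^sup>+s\<in>{0<..}. ind {..R} s * ennreal (s ^ (DIM('a) - 1)) \<partial>lborel) \<le> ennreal (R ^ DIM('a))" .
 qed simp
 finally show ?thesis by (simp add: nn_integral_M mult.commute)
qed

lemma M_comp_integrable:
 fixes h :: "'a \<Rightarrow> 'b::euclidean_space"
 assumes h: "integrable M h" and C: "compact C" "C \<subseteq> K0" and R: "0 < R" "C \<subseteq> cball 0 R"
 shows "integrable (lebesgue_on C) (\<lambda>x. h (sgn x))" "(LINT x|lebesgue_on C. norm (h (sgn x))) \<le> R ^ DIM('a) * (LINT w|M. norm (h w))"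
proof -
 have [simp]: "C \<in> sets lebesgue" using C(1) by (simp add: lmeasurable_compact fmeasurableD)
 have hM: "h \<in> borel_measurable M" using h by auto
 have "(\<lambda>x. ind G (sgn x) *\<^sub>R h (sgn x)) \<in> borel_measurable lebesgue" using measurable_comp_sgn hM unfolding measurable_M_iff by blast
 then have "(\<lambda>x. ind G (sgn x) *\<^sub>R h (sgn x)) \<in> borel_measurable (lebesgue_on C)" by (rule measurable_restrict_space1)
 then have m: "(\<lambda>x. h (sgn x)) \<in> borel_measurable (lebesgue_on C)" by (rule measurable_cong[THEN iffD1, rotated]) (use C(2) in "auto simp: K0_def")
 have "(\<integral>\<^sup>+x. ennreal (norm (h (sgn x))) \<partial>lebesgue_on C) = (\<integral>\<^sup>+x\<in>C. ennreal (norm (h (sgn x))) \<partial>lebesgue)"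
  by (rule nn_integral_restrict_space) simp
 also have "\<dots> \<le> ennreal (R ^ DIM('a)) * (\<integral>\<^sup>+w. ennreal (norm (h w)) \<partial>M)" using hM by (intro nn_integral_annulus_le C R) auto
 also have "\<dots> = ennreal (R ^ DIM('a) * (LINT w|M. norm (h w)))" using h R by (subst nn_integral_eq_integral) (auto simp: ennreal_mult)
 finally have b: "(\<integral>\<^sup>+x. ennreal (norm (h (sgn x))) \<partial>lebesgue_on C) \<le> ennreal (R ^ DIM('a) * (LINT w|M. norm (h w)))" .
 show i: "integrable (lebesgue_on C) (\<lambda>x. h (sgn x))" by (rule integrableI_bounded[OF m]) (use b in "auto intro: le_less_trans")
 have "ennreal (LINT x|lebesgue_on C. norm (h (sgn x))) = (\<integral>\<^sup>+x. ennreal (norm (h (sgn x))) \<partial>lebesgue_on C)"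
  using i by (intro nn_integral_eq_integral[symmetric]) auto
 with b have "ennreal (LINT x|lebesgue_on C. norm (h (sgn x))) \<le> ennreal (R ^ DIM('a) * (LINT w|M. norm (h w)))" by simp
 then show "(LINT x|lebesgue_on C. norm (h (sgn x))) \<le> R ^ DIM('a) * (LINT w|M. norm (h w))"
  by (rule ennreal_le_iff[THEN iffD1, rotated]) (use R(1) in "auto intro!: mult_nonneg_nonneg integral_nonneg")
qed

lemma Lp_M_integrable:
 fixes h :: "'a \<Rightarrow> 'b::euclidean_space"
 assumes "Lp_member p M h"
 shows "integrable M h" "(LINT w|M. norm (h w)) powr p \<le> measure M (space M) powr (p - 1) * (LINT w|M. norm (h w) powr p)"
proof -
 have n: "Lp_member p M (\<lambda>x. norm (h x))" using assms by (auto simp: Lp_member_def)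
 show "integrable M h" using powr_Jensen(1)[OF p finite_M n] assms by (auto simp: Lp_member_def intro: Bochner_Integration.integrable_bound)
 show "(LINT w|M. norm (h w)) powr p \<le> measure M (space M) powr (p - 1) * (LINT w|M. norm (h w) powr p)"
  using powr_Jensen(2)[OF p finite_M n] by simp
qed

lemma Lp_M_tendsto_L1:
 fixes h :: "nat \<Rightarrow> 'a \<Rightarrow> 'b::euclidean_space"
 assumes h: "\<And>n. Lp_member p M (h n)" and lim: "(\<lambda>n. Lp_norm p M (h n)) ----> 0"
 shows "(\<lambda>n. LINT w|M. norm (h n w)) ----> 0"
proof (rule tendsto_sandwich[OF _ _ tendsto_const])
 show "\<forall>\<^sub>F n in sequentially. 0 \<le> (LINT w|M. norm (h n w))" by simp
 have "(LINT w|M. norm (h n w)) \<le> (measure M (space M) powr (p - 1)) powr (1/p) * Lp_norm p M (h n)" for n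
 proof -
  have "(LINT w|M. norm (h n w)) = ((LINT w|M. norm (h n w)) powr p) powr (1/p)" using p by (simp add: powr_powr integral_nonneg)
  also have "\<dots> \<le> (measure M (space M) powr (p - 1) * (LINT w|M. norm (h n w) powr p)) powr (1/p)"
   using p Lp_M_integrable(2)[OF h[of n]] by (intro powr_mono2) auto
  finally show ?thesis by (simp add: powr_mult Lp_norm_def integral_nonneg)
 qed
 then show "\<forall>\<^sub>F n in sequentially. (LINT w|M. norm (h n w)) \<le> (measure M (space M) powr (p - 1)) powr (1/p) * Lp_norm p M (h n)" by simp
 show "(\<lambda>n. (measure M (space M) powr (p - 1)) powr (1/p) * Lp_norm p M (h n)) ----> 0" using tendsto_mult_left[OF lim] by simp
qed

text \<open>The weak identity holds for each test function and passes to the limit. On the compact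
  support of \<psi> the norm of x is bounded and bounded away from 0, so Lp convergence on the
  sphere gives L1 convergence of the homogeneous extensions there.\<close>

lemma weak_tgrad_limit:
 assumes \<phi>: "\<And>n. \<phi> n \<in> tests"
  and v: "Lp_member p M v" "(\<lambda>n. Lp_norm p M (\<lambda>w. \<phi> n w - v w)) ----> 0"
  and g: "Lp_member p M g" "(\<lambda>n. Lp_norm p M (\<lambda>w. tgrad (\<phi> n) w - g w)) ----> 0"
 shows "has_weak_tangential_gradient G v g"
proof -
 have R: "\<exists>R>0. C \<subseteq> cball 0 R" if "compact C" for C :: "'a set"
  using bounded_subset_ballD[OF compact_imp_bounded[OF that], of 0] ball_subset_cball by blast
 have dC: "\<exists>\<delta>>0. \<forall>x\<in>C. \<delta> \<le> norm x" if C: "compact C" "C \<subseteq> K0" for C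
 proof (cases "C = {}")
  case False
  obtain x where "x \<in> C" "\<forall>y\<in>C. norm x \<le> norm y" using continuous_attains_inf[OF C(1) False, of norm] by (auto intro: continuous_intros)
  then show ?thesis using C(2) by (intro exI[of _ "norm x"]) (auto simp: K0_def)
 qed (auto intro: exI[of _ 1])
 have Csets [simp]: "C \<in> sets lebesgue" if "compact C" for C :: "'a set"
  using that by (simp add: lmeasurable_compact fmeasurableD)
 have lv: "locally_integrable K0 (\<lambda>x. v (sgn x))" unfolding locally_integrable_def
 proof safe
  fix C assume C: "compact C" "C \<subseteq> K0"
  obtain R' where "R' > 0" "C \<subseteq> cball 0 R'" using R[OF C(1)] by blast
  then show "integrable (lebesgue_on C) (\<lambda>x. v (sgn x))" by (rule M_comp_integrable(1)[OF Lp_M_integrable(1)[OF v(1)] C])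
 qed
 have lg: "locally_integrable K0 (\<lambda>x. g (sgn x) /\<^sub>R norm x)" unfolding locally_integrable_def
 proof safe
  fix C assume C: "compact C" "C \<subseteq> K0"
  obtain \<delta> where \<delta>: "\<delta> > 0" "\<forall>x\<in>C. \<delta> \<le> norm x" using dC[OF C] by blast
  obtain R' where "R' > 0" "C \<subseteq> cball 0 R'" using R[OF C(1)] by blast
  then have i: "integrable (lebesgue_on C) (\<lambda>x. g (sgn x))" by (rule M_comp_integrable(1)[OF Lp_M_integrable(1)[OF g(1)] C])
  show "integrable (lebesgue_on C) (\<lambda>x. g (sgn x) /\<^sub>R norm x)"
  proof (rule Bochner_Integration.integrable_bound[OF integrable_scaleR_right[OF i, of "inverse \<delta>"]])
   have "(\<lambda>x. inverse (norm x)) \<in> borel_measurable (lebesgue_on C)" by (rule measurable_restrict_space1, rule measurable_completion) simp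
   then show "(\<lambda>x. g (sgn x) /\<^sub>R norm x) \<in> borel_measurable (lebesgue_on C)" using i by (intro borel_measurable_scaleR) auto
   show "AE x in lebesgue_on C. norm (g (sgn x) /\<^sub>R norm x) \<le> norm (inverse \<delta> *\<^sub>R g (sgn x))"
    using \<delta> by (intro AE_I2) (auto intro!: mult_right_mono le_imp_inverse_le)
  qed
 qed
 have "(LINT x|lebesgue. (grad \<psi> x \<bullet> b) * v (sgn x)) = - (LINT x|lebesgue. \<psi> x * ((g (sgn x) /\<^sub>R norm x) \<bullet> b))"
  if \<psi>: "\<psi> \<in> test_functions K0" and b: "b \<in> Basis" for \<psi> b
 proof -
  note T = test_functionsD[OF \<psi>]
  let ?C = "supp \<psi>"
  obtain \<delta> where \<delta>: "\<delta> > 0" "\<forall>x\<in>?C. \<delta> \<le> norm x" using dC[OF T(2,3)] by blast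
  obtain R where R: "R > 0" "?C \<subseteq> cball 0 R" using R[OF T(2)] by blast
  obtain B1 where B1: "0 < B1" "\<And>x. norm (\<psi> x) \<le> B1" using bounded_compact_support[OF T(7,2,4)] by blast
  obtain B2 where B2: "0 < B2" "\<And>x. norm (grad \<psi> x) \<le> B2" using bounded_compact_support[OF T(8,2,6)] by blast
  \<comment> \<open>One convergence statement for both sides: the bounded weight \<open>a\<close> is
    a partial derivative of \<psi> on the left and \<psi>/|x| on the right.\<close>
  have lim: "(\<lambda>n. LINT x|lebesgue. a x * (h n (sgn x) \<bullet> e)) ----> (LINT x|lebesgue. a x * (h' (sgn x) \<bullet> e))"
   if h: "\<And>n. Lp_member p M (h n)" "Lp_member p M h'" "(\<lambda>n. Lp_norm p M (\<lambda>w. h n w - h' w)) ----> 0"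
    and a: "a \<in> borel_measurable lebesgue" "\<And>x. x \<notin> ?C \<Longrightarrow> a x = 0" "\<And>x. \<bar>a x\<bar> \<le> B" "0 < B" and e: "norm e = 1"
   for a :: "'a \<Rightarrow> real" and h :: "nat \<Rightarrow> 'a \<Rightarrow> 'c::euclidean_space" and h' e B
  proof -
   have int: "integrable lebesgue (\<lambda>x. a x * (f (sgn x) \<bullet> e))" "\<bar>LINT x|lebesgue. a x * (f (sgn x) \<bullet> e)\<bar> \<le> B * (R ^ DIM('a) * (LINT w|M. norm (f w)))"
    if f: "Lp_member p M f" for f :: "'a \<Rightarrow> 'c"
   proof -
    note mi = M_comp_integrable[OF Lp_M_integrable(1)[OF f] T(2,3) R]
    have ma: "a \<in> borel_measurable (lebesgue_on ?C)" using a(1) by (rule measurable_restrict_space1)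
    have i: "integrable (lebesgue_on ?C) (\<lambda>x. a x * (f (sgn x) \<bullet> e))"
    proof (rule Bochner_Integration.integrable_bound[OF integrable_scaleR_right[OF mi(1), of B]])
     show "AE x in lebesgue_on ?C. norm (a x * (f (sgn x) \<bullet> e)) \<le> norm (B *\<^sub>R f (sgn x))"
     proof (rule AE_I2)
      fix x
      have "\<bar>f (sgn x) \<bullet> e\<bar> \<le> norm (f (sgn x))" using Cauchy_Schwarz_ineq2[of "f (sgn x)" e] e by simp
      then show "norm (a x * (f (sgn x) \<bullet> e)) \<le> norm (B *\<^sub>R f (sgn x))" using a(3)[of x] a(4) by (auto simp: abs_mult intro!: mult_mono)
     qed
    qed (use ma mi(1) in measurable)
    with integral_lebesgue_on_eq[of ?C "\<lambda>x. a x * (f (sgn x) \<bullet> e)"] a(2) T(2)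
    have eq: "(LINT x|lebesgue_on ?C. a x * (f (sgn x) \<bullet> e)) = (LINT x|lebesgue. a x * (f (sgn x) \<bullet> e))"
     and i': "integrable lebesgue (\<lambda>x. a x * (f (sgn x) \<bullet> e))" by auto
    show "integrable lebesgue (\<lambda>x. a x * (f (sgn x) \<bullet> e))" by (rule i')
    have "\<bar>LINT x|lebesgue_on ?C. a x * (f (sgn x) \<bullet> e)\<bar> \<le> (LINT x|lebesgue_on ?C. B * norm (f (sgn x)))"
    proof (rule integral_abs_bound_integral[OF i])
     show "integrable (lebesgue_on ?C) (\<lambda>x. B * norm (f (sgn x)))" using mi(1) by auto
     fix x
     have "\<bar>f (sgn x) \<bullet> e\<bar> \<le> norm (f (sgn x))" using Cauchy_Schwarz_ineq2[of "f (sgn x)" e] e by simp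
     then show "\<bar>a x * (f (sgn x) \<bullet> e)\<bar> \<le> B * norm (f (sgn x))" using a(3)[of x] a(4) by (auto simp: abs_mult intro!: mult_mono)
    qed
    also have "\<dots> \<le> B * (R ^ DIM('a) * (LINT w|M. norm (f w)))" using mi(2) a(4) by simp
    finally show "\<bar>LINT x|lebesgue. a x * (f (sgn x) \<bullet> e)\<bar> \<le> B * (R ^ DIM('a) * (LINT w|M. norm (f w)))" unfolding eq .
   qed
   have d: "Lp_member p M (\<lambda>w. h n w - h' w)" for n by (intro Lp_member_diff p h)
   have "(\<lambda>n. (LINT x|lebesgue. a x * (h n (sgn x) \<bullet> e)) - (LINT x|lebesgue. a x * (h' (sgn x) \<bullet> e))) ----> 0"
   proof (rule Lim_null_comparison)
    show "\<forall>\<^sub>F n in sequentially. norm ((LINT x|lebesgue. a x * (h n (sgn x) \<bullet> e)) - (LINT x|lebesgue. a x * (h' (sgn x) \<bullet> e))) \<le>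
      B * (R ^ DIM('a) * (LINT w|M. norm (h n w - h' w)))" proof (rule always_eventually, rule allI) fix n
     have "(LINT x|lebesgue. a x * (h n (sgn x) \<bullet> e)) - (LINT x|lebesgue. a x * (h' (sgn x) \<bullet> e)) = (LINT x|lebesgue. a x * ((h n (sgn x) - h' (sgn x)) \<bullet> e))"
      using int(1)[OF h(1)[of n]] int(1)[OF h(2)]
      by (subst Bochner_Integration.integral_diff[symmetric]) (auto simp: inner_diff_left right_diff_distrib)
     then show "norm ((LINT x|lebesgue. a x * (h n (sgn x) \<bullet> e)) - (LINT x|lebesgue. a x * (h' (sgn x) \<bullet> e))) \<le>
      B * (R ^ DIM('a) * (LINT w|M. norm (h n w - h' w)))" using int(2)[OF d[of n]] by simp qed
    show "(\<lambda>n. B * (R ^ DIM('a) * (LINT w|M. norm (h n w - h' w)))) ----> 0"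
     using tendsto_mult_left[OF tendsto_mult_left[OF Lp_M_tendsto_L1[OF d h(3)]]] by simp
   qed
   then show ?thesis by (simp add: LIM_zero_iff)
  qed
  have "(\<lambda>n. LINT x|lebesgue. (grad \<psi> x \<bullet> b) * (\<phi> n (sgn x) \<bullet> 1)) ----> (LINT x|lebesgue. (grad \<psi> x \<bullet> b) * (v (sgn x) \<bullet> 1))"
  proof (rule lim[OF test_Lp(1)[OF \<phi>] v])
   show "(\<lambda>x. grad \<psi> x \<bullet> b) \<in> borel_measurable lebesgue"
    using T(8) by (intro measurable_completion) (auto intro!: borel_measurable_continuous_onI continuous_intros)
   show "\<bar>grad \<psi> x \<bullet> b\<bar> \<le> B2" for x
    using Cauchy_Schwarz_ineq2[of "grad \<psi> x" b] B2(2)[of x] b by simp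
  qed (use T B2 in auto)
  then have 1: "(\<lambda>n. LINT x|lebesgue. (grad \<psi> x \<bullet> b) * \<phi> n (sgn x)) ----> (LINT x|lebesgue. (grad \<psi> x \<bullet> b) * v (sgn x))" by simp
  have "(\<lambda>n. LINT x|lebesgue. (\<psi> x / norm x) * (tgrad (\<phi> n) (sgn x) \<bullet> b)) ----> (LINT x|lebesgue. (\<psi> x / norm x) * (g (sgn x) \<bullet> b))"
  proof (rule lim[OF test_Lp(2)[OF \<phi>] g])
   show "(\<lambda>x. \<psi> x / norm x) \<in> borel_measurable lebesgue"
   proof (rule measurable_completion)
    have [measurable]: "\<psi> \<in> borel_funs" using T(7) by (rule borel_measurable_continuous_onI)
    show "(\<lambda>x. \<psi> x / norm x) \<in> borel_measurable lborel" by measurable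
   qed
   show "\<bar>\<psi> x / norm x\<bar> \<le> B1 / \<delta>" for x
   proof (cases "x \<in> ?C")
    case True
    then show ?thesis using \<delta> B1(2)[of x] by (auto simp: abs_divide intro!: frac_le)
   qed (use T B1 \<delta> in auto)
  qed (use T B1 \<delta> b in auto)
  moreover have "(\<psi> x / norm x) * (f (sgn x) \<bullet> b) = \<psi> x * ((f (sgn x) /\<^sub>R norm x) \<bullet> b)" for f x
   by (simp add: divide_inverse)
  ultimately have 2: "(\<lambda>n. LINT x|lebesgue. \<psi> x * ((tgrad (\<phi> n) (sgn x) /\<^sub>R norm x) \<bullet> b)) ----> (LINT x|lebesgue. \<psi> x * ((g (sgn x) /\<^sub>R norm x) \<bullet> b))" by simp
  have "(LINT x|lebesgue. (grad \<psi> x \<bullet> b) * \<phi> n (sgn x)) = - (LINT x|lebesgue. \<psi> x * ((tgrad (\<phi> n) (sgn x) /\<^sub>R norm x) \<bullet> b))" for n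
   using test_weak_tgrad[OF \<phi>[of n]] \<psi> b unfolding has_weak_tangential_gradient_def K0_def[symmetric] has_weak_gradient_iff[OF open_K0] by blast
  with 1 have "(\<lambda>n. - (LINT x|lebesgue. \<psi> x * ((tgrad (\<phi> n) (sgn x) /\<^sub>R norm x) \<bullet> b))) ----> (LINT x|lebesgue. (grad \<psi> x \<bullet> b) * v (sgn x))" by simp
  from LIMSEQ_unique[OF this tendsto_minus[OF 2]] show ?thesis .
 qed
 then show ?thesis unfolding has_weak_tangential_gradient_def K0_def[symmetric] has_weak_gradient_iff[OF open_K0] using lv lg by blast
qed

end

section \<open>Rellich compactness on the sphere\<close>

lemma average_powr_le:
 fixes g :: "'a::euclidean_space \<Rightarrow> real"
 assumes p: "1 < p" and [measurable]: "g \<in> borel_funs" "B \<in> sets borel"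
  and bnd: "\<And>h. h \<in> B \<Longrightarrow> \<bar>g h\<bar> \<le> C" and fin: "emeasure lborel B < \<infinity>"
  and \<beta>: "\<beta> = measure lborel B" "0 < \<beta>"
 shows "ennreal (\<bar>(LINT h|restrict_space lborel B. g h) / \<beta>\<bar> powr p) \<le> ennreal (1 / \<beta>) * (\<integral>\<^sup>+h\<in>B. ennreal (\<bar>g h\<bar> powr p) \<partial>lborel)"
proof -
 let ?N = "restrict_space lborel B"
 have fN: "finite_measure ?N" using fin by (intro finite_measureI) (simp add: emeasure_restrict_space space_restrict_space)
 then interpret finite_measure ?N .
 have gm: "g \<in> borel_measurable ?N" by (rule measurable_restrict_space1) simp
 have gi: "integrable ?N (\<lambda>h. norm (g h) powr p)"
  using p gm bnd by (intro integrable_const_bound[of _ "C powr p"] AE_I2) (auto simp: space_restrict_space intro!: powr_mono2)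
 have L: "Lp_member p ?N g" using gi gm by (simp add: Lp_member_def)
 have mB: "measure ?N (space ?N) = \<beta>" by (simp add: \<beta>(1) space_restrict_space measure_restrict_space)
 have "\<bar>(LINT h|?N. g h) / \<beta>\<bar> = \<bar>LINT h|?N. g h\<bar> / \<beta>" using \<beta>(2) by simp
 then have "\<bar>(LINT h|?N. g h) / \<beta>\<bar> powr p = \<bar>LINT h|?N. g h\<bar> powr p * \<beta> powr (- p)" by (simp only: powr_divide powr_minus) (simp add: divide_inverse)
 also have "\<dots> \<le> (LINT h|?N. \<bar>g h\<bar>) powr p * \<beta> powr (- p)" using p by (intro mult_right_mono powr_mono2) (auto intro: integral_abs_bound)
 also have "\<dots> \<le> (\<beta> powr (p - 1) * (LINT h|?N. \<bar>g h\<bar> powr p)) * \<beta> powr (- p)"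
  using powr_Jensen(2)[OF p fN L, unfolded mB] by (intro mult_right_mono) auto
 also have "\<dots> = (\<beta> powr (p - 1) * \<beta> powr (- p)) * (LINT h|?N. \<bar>g h\<bar> powr p)" by simp
 also have "\<beta> powr (p - 1) * \<beta> powr (- p) = \<beta> powr (- 1)" unfolding powr_add[symmetric] by simp
 also have "\<beta> powr (- 1) = 1 / \<beta>" using \<beta>(2) by (simp add: powr_minus divide_inverse)
 finally have "ennreal (\<bar>(LINT h|?N. g h) / \<beta>\<bar> powr p) \<le> ennreal (1 / \<beta>) * ennreal (LINT h|?N. \<bar>g h\<bar> powr p)"
  using \<beta> by (simp add: ennreal_mult[symmetric] integral_nonneg ennreal_leI)
 also have "ennreal (LINT h|?N. \<bar>g h\<bar> powr p) = (\<integral>\<^sup>+h. ennreal (\<bar>g h\<bar> powr p) \<partial>?N)" using gi by (intro nn_integral_eq_integral[symmetric]) auto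
 also have "\<dots> = (\<integral>\<^sup>+h\<in>B. ennreal (\<bar>g h\<bar> powr p) \<partial>lborel)" by (rule nn_integral_restrict_space) simp
 finally show ?thesis .
qed

lemma nn_integral_lborel_translate:
 fixes f :: "'a::euclidean_space \<Rightarrow> ennreal"
 assumes [measurable]: "f \<in> borel_funs"
 shows "(\<integral>\<^sup>+x. f (c + x) \<partial>lborel) = (\<integral>\<^sup>+x. f x \<partial>lborel)"
proof -
 have "(\<integral>\<^sup>+x. f x \<partial>lborel) = (\<integral>\<^sup>+x. f x \<partial>distr lborel borel ((+) c))" by (simp add: lborel_distr_plus)
 also have "\<dots> = (\<integral>\<^sup>+x. f (c + x) \<partial>lborel)" by (rule nn_integral_distr) auto
 finally show ?thesis by simp
qed

text \<open>The increment is the integral of the directional derivative along the segment from x to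
  x + h; Jensen on [0,1], Fubini and translation invariance finish. The differentiability set S is
  kept explicit because extensions of degree 0 are singular at the origin.\<close>

lemma translation_estimate:
 fixes f :: "'a::euclidean_space \<Rightarrow> real"
 assumes p: "1 < p" and [measurable]: "f \<in> borel_funs" "E \<in> sets borel" "A \<in> sets borel"
  and D: "continuous_on S D" "\<And>x. x \<in> S \<Longrightarrow> GDERIV f x :> D x" and Dm[measurable]: "D \<in> borel_funs"
  and S: "A \<subseteq> S" "open S"
  and E: "\<And>x t. x \<in> E \<Longrightarrow> 0 \<le> t \<Longrightarrow> t \<le> 1 \<Longrightarrow> x + t *\<^sub>R h \<in> A"
 shows "(\<integral>\<^sup>+x\<in>E. ennreal (\<bar>f (x + h) - f x\<bar> powr p) \<partial>lborel) \<le> ennreal (norm h powr p) * (\<integral>\<^sup>+x\<in>A. ennreal (norm (D x) powr p) \<partial>lborel)"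
proof -
 have pt: "ennreal (\<bar>f (x + h) - f x\<bar> powr p) \<le>
   (\<integral>\<^sup>+t\<in>{0..1}. ennreal (norm h powr p) * (ennreal (norm (D (x + t *\<^sub>R h)) powr p) * ind A (x + t *\<^sub>R h)) \<partial>lborel)" if x: "x \<in> E" for x
 proof -
  let ?g = "\<lambda>t. h \<bullet> D (x + t *\<^sub>R h)"
  have cont: "continuous_on {0..1} ?g" using E[OF x] S(1) by (intro continuous_intros continuous_on_compose2[OF D(1)]) auto
  have der: "((\<lambda>t. f (x + t *\<^sub>R h)) has_real_derivative ?g t) (at t)" if "0 \<le> t" "t \<le> 1" for t
   using GDERIV_direction[of f x t h, OF D(2)] E[OF x that] S(1) by auto
  have "isCont ?g t" if "0 \<le> t" "t \<le> 1" for t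
  proof -
   have "isCont D (x + t *\<^sub>R h)" using D(1) S E[OF x that] by (auto simp: continuous_on_eq_continuous_at)
   then show ?thesis by (intro continuous_intros isCont_o2[where f="\<lambda>t. x + t *\<^sub>R h"])
  qed
  then have "(LINT t|lborel. ?g t * ind {0..1} t) = f (x + 1 *\<^sub>R h) - f (x + 0 *\<^sub>R h)" using der by (intro integral_FTC_Icc_real) auto
  then have eq: "f (x + h) - f x = (LINT t|restrict_space lborel {0..1}. ?g t)" by (simp add: integral_restrict_space mult.commute)
  have "compact (?g ` {0..1})" by (intro compact_continuous_image cont) simp
  then obtain C where C: "\<forall>y\<in>?g ` {0..1}. norm y \<le> C" using bounded_iff compact_imp_bounded by metis
  have "ennreal (\<bar>(LINT t|restrict_space lborel {0..1}. ?g t) / 1\<bar> powr p) \<le> ennreal (1 / 1) * (\<integral>\<^sup>+t\<in>{0..1}. ennreal (\<bar>?g t\<bar> powr p) \<partial>lborel)"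
   by (rule average_powr_le[OF p, where C=C]) (use C in auto)
  also have "\<dots> \<le> (\<integral>\<^sup>+t\<in>{0..1}. ennreal (norm h powr p) * (ennreal (norm (D (x + t *\<^sub>R h)) powr p) * ind A (x + t *\<^sub>R h)) \<partial>lborel)"
  proof -
   have "ennreal (\<bar>?g t\<bar> powr p) \<le> ennreal (norm h powr p) * ennreal (norm (D (x + t *\<^sub>R h)) powr p)" for t
    using p Cauchy_Schwarz_ineq2[of h "D (x + t *\<^sub>R h)"]
    by (subst ennreal_mult[symmetric]) (auto simp: powr_mult[symmetric] intro!: ennreal_leI powr_mono2)
   then show ?thesis using E[OF x] by (auto intro!: nn_integral_mono simp: indicator_def)
  qed
  finally show ?thesis by (simp add: eq)
 qed
 have "(\<integral>\<^sup>+x\<in>E. ennreal (\<bar>f (x + h) - f x\<bar> powr p) \<partial>lborel) \<le>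
   (\<integral>\<^sup>+x. (\<integral>\<^sup>+t\<in>{0..1}. ennreal (norm h powr p) * (ennreal (norm (D (x + t *\<^sub>R h)) powr p) * ind A (x + t *\<^sub>R h)) \<partial>lborel) \<partial>lborel)"
  using pt by (intro nn_integral_mono) (auto simp: indicator_def)
 also have "\<dots> = (\<integral>\<^sup>+t. (\<integral>\<^sup>+x. ennreal (norm h powr p) * (ennreal (norm (D (x + t *\<^sub>R h)) powr p) * ind A (x + t *\<^sub>R h)) * ind {0..1} t \<partial>lborel) \<partial>lborel)"
  by (rule lborel_pair.Fubini')  (subst measurable_cong_sets[OF sets_pair_measure_cong[OF sets_lborel sets_lborel] refl], unfold split_beta', measurable)
 also have "\<dots> = (\<integral>\<^sup>+t\<in>{0..1::real}. (ennreal (norm h powr p) * (\<integral>\<^sup>+x\<in>A. ennreal (norm (D x) powr p) \<partial>lborel)) \<partial>lborel)"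
 proof (rule nn_integral_cong)
  fix t :: real
  have "(\<integral>\<^sup>+x. ennreal (norm (D (x + t *\<^sub>R h)) powr p) * ind A (x + t *\<^sub>R h) \<partial>lborel) = (\<integral>\<^sup>+x\<in>A. ennreal (norm (D x) powr p) \<partial>lborel)"
   using nn_integral_lborel_translate[of "\<lambda>x. ennreal (norm (D x) powr p) * ind A x" "t *\<^sub>R h"] by (simp add: add.commute)
  then show "(\<integral>\<^sup>+x. ennreal (norm h powr p) * (ennreal (norm (D (x + t *\<^sub>R h)) powr p) * ind A (x + t *\<^sub>R h)) * ind {0..1} t \<partial>lborel) =
    (ennreal (norm h powr p) * (\<integral>\<^sup>+x\<in>A. ennreal (norm (D x) powr p) \<partial>lborel)) * ind {0..1} t"
   by (simp add: nn_integral_multc nn_integral_cmult)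
 qed
 also have "\<dots> = ennreal (norm h powr p) * (\<integral>\<^sup>+x\<in>A. ennreal (norm (D x) powr p) \<partial>lborel)" by (subst nn_integral_cmult_indicator) auto
 finally show ?thesis .
qed

lemma Lp_norm_le_nn_integral:
 fixes f :: "'a \<Rightarrow> 'b::euclidean_space"
 assumes p: "0 < p" and f: "f \<in> borel_measurable M" and C: "0 \<le> C"
  and le: "(\<integral>\<^sup>+x. ennreal (norm (f x) powr p) \<partial>M) \<le> ennreal C"
 shows "Lp_member p M f" "Lp_norm p M f \<le> C powr (1/p)"
proof -
 have i: "integrable M (\<lambda>x. norm (f x) powr p)" by (rule integrableI_nonneg) (use f le in "auto intro: le_less_trans")
 then show "Lp_member p M f" using f by (simp add: Lp_member_def)
 have "(LINT x|M. norm (f x) powr p) \<le> C" using i le C by (subst (asm) nn_integral_eq_integral) auto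
 then show "Lp_norm p M f \<le> C powr (1/p)" unfolding Lp_norm_def using p by (intro powr_mono2) (auto intro: integral_nonneg)
qed

text \<open>Kolmogorov--Riesz: averages over small balls are equicontinuous and close to the functions.\<close>

lemma Kolmogorov_Riesz:
 fixes f :: "nat \<Rightarrow> 'a::euclidean_space \<Rightarrow> real"
 assumes p: "1 < p" and fm[measurable]: "\<And>j. f j \<in> borel_funs"
  and bnd: "\<And>j. \<exists>B. \<forall>x. \<bar>f j x\<bar> \<le> B"
  and Am[measurable]: "A \<in> sets borel" "A1 \<in> sets borel" and Afin: "emeasure lborel A < \<infinity>"
  and \<eta>: "0 < \<eta>" and AA1: "\<And>x h. x \<in> A \<Longrightarrow> norm h < \<eta> \<Longrightarrow> x + h \<in> A1"
  and C: "0 \<le> C"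
  and trans: "\<And>j h. norm h < \<eta> \<Longrightarrow> (\<integral>\<^sup>+x\<in>A1. ennreal (\<bar>f j (x + h) - f j x\<bar> powr p) \<partial>lborel) \<le> ennreal (C * norm h powr p)"
  and bound: "\<And>j. (\<integral>\<^sup>+x\<in>A1. ennreal (\<bar>f j x\<bar> powr p) \<partial>lborel) \<le> ennreal C"
 obtains r where "strict_mono (r :: nat \<Rightarrow> nat)" "\<And>e. e > 0 \<Longrightarrow> \<exists>N. \<forall>i\<ge>N. \<forall>k\<ge>N. Lp_norm p (restrict_space lborel A) (\<lambda>x. f (r i) x - f (r k) x) < e"
proof -
 let ?MA = "restrict_space lborel A"
 have fin: "finite_measure ?MA" using Afin by (intro finite_measureI) (simp add: emeasure_restrict_space space_restrict_space)
 interpret MA: finite_measure ?MA by (rule fin)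
 \<comment> \<open>The averaging radii tend to 0 and stay strictly below \<eta>, so that averages
   over points of A only see A1.\<close>
 define \<delta> where "\<delta> n = \<eta> / (real n + 2)" for n
 have \<delta>: "0 < \<delta> n" "\<delta> n < \<eta>" for n using \<eta> by (auto simp: \<delta>_def divide_simps)
 define B where "B n = ball (0::'a) (\<delta> n)" for n
 define \<beta> where "\<beta> n = measure lborel (B n)" for n
 have \<beta>: "0 < \<beta> n" for n unfolding \<beta>_def B_def using content_ball_pos[OF \<delta>(1)] by simp
 have Bm[measurable]: "B n \<in> sets borel" for n by (simp add: B_def)
 have Bfin: "emeasure lborel (B n) < \<infinity>" for n unfolding B_def by (rule emeasure_lborel_ball_finite)
 have BN: "finite_measure (restrict_space lborel (B n))" for n
  using Bfin[of n] by (intro finite_measureI) (simp add: emeasure_restrict_space space_restrict_space)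
 define av where "av n j x = (LINT h|restrict_space lborel (B n). f j (x + h)) / \<beta> n" for n j x
 have avm[measurable]: "av n j \<in> borel_funs" for n j
 proof -
  have "av n j = (\<lambda>x. (LINT h|lborel. ind (B n) h *\<^sub>R f j (x + h)) / \<beta> n)" by (auto simp: av_def integral_restrict_space)
  then show ?thesis by simp
 qed
 have bm: "(\<lambda>h. f j (x + h)) \<in> borel_funs" for j x by measurable
 have fint: "integrable (restrict_space lborel (B n)) (\<lambda>h. f j (x + h))" for n j x
 proof -
  obtain b where "\<forall>x. \<bar>f j x\<bar> \<le> b" using bnd by blast
  then show ?thesis by (intro finite_measure.integrable_const_bound[OF BN, of _ b] AE_I2 measurable_restrict_space1) (use bm in auto)
 qed
 have jen: "ennreal (\<bar>(LINT h|restrict_space lborel (B n). g h) / \<beta> n\<bar> powr p) \<le> ennreal (1 / \<beta> n) * (\<integral>\<^sup>+h\<in>B n. ennreal (\<bar>g h\<bar> powr p) \<partial>lborel)"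
  if "g \<in> borel_funs" "\<And>h. \<bar>g h\<bar> \<le> b" for g n b
  using that by (intro average_powr_le[OF p, where C=b] Bm Bfin \<beta>) (auto simp: \<beta>_def)
 have lem: "ennreal (\<bar>av n j x\<bar> powr p) \<le> ennreal (C / \<beta> n)" if x: "x \<in> A" for n j x
 proof -
  obtain b where b: "\<forall>x. \<bar>f j x\<bar> \<le> b" using bnd by blast
  have "ennreal (\<bar>av n j x\<bar> powr p) \<le> ennreal (1 / \<beta> n) * (\<integral>\<^sup>+h\<in>B n. ennreal (\<bar>f j (x + h)\<bar> powr p) \<partial>lborel)"
   unfolding av_def using b by (intro jen[where b=b]) auto
  also have "\<dots> \<le> ennreal (1 / \<beta> n) * (\<integral>\<^sup>+h. ennreal (\<bar>f j (x + h)\<bar> powr p) * ind A1 (x + h) \<partial>lborel)"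
   using AA1[OF x] \<delta>(2)[of n] by (intro mult_left_mono nn_integral_mono) (auto simp: indicator_def B_def)
  also have "(\<integral>\<^sup>+h. ennreal (\<bar>f j (x + h)\<bar> powr p) * ind A1 (x + h) \<partial>lborel) = (\<integral>\<^sup>+h\<in>A1. ennreal (\<bar>f j h\<bar> powr p) \<partial>lborel)"
   by (rule nn_integral_lborel_translate[of "\<lambda>h. ennreal (\<bar>f j h\<bar> powr p) * ind A1 h"]) simp
  also have "ennreal (1 / \<beta> n) * (\<integral>\<^sup>+h\<in>A1. ennreal (\<bar>f j h\<bar> powr p) \<partial>lborel) \<le> ennreal (1 / \<beta> n) * ennreal C"
   by (intro mult_left_mono bound) simp
  also have "\<dots> = ennreal (C / \<beta> n)" using C \<beta>[of n] by (simp add: ennreal_mult[symmetric])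
  finally show ?thesis .
 qed
 have av_bound: "\<bar>av n j x\<bar> \<le> (C / \<beta> n) powr (1/p)" if x: "x \<in> A" for n j x
 proof -
  have "\<bar>av n j x\<bar> powr p \<le> C / \<beta> n" using lem[OF x, of n j] C \<beta>[of n] by simp
  then have "(\<bar>av n j x\<bar> powr p) powr (1/p) \<le> (C / \<beta> n) powr (1/p)" using p by (intro powr_mono2) auto
  then show ?thesis using p by (simp add: powr_powr)
 qed
 \<comment> \<open>For fixed n the averages satisfy a Lipschitz bound on A at distances below \<eta>
   that does not depend on j: the increment of the averages is controlled by the translation
   hypothesis through Jensen's inequality.\<close>
 have av_cont: "\<bar>av n j x - av n j y\<bar> \<le> (C / \<beta> n) powr (1/p) * norm (x - y)"
  if x: "x \<in> A" "y \<in> A" and xy: "norm (x - y) < \<eta>" for n j x y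
 proof -
  obtain b where b: "\<forall>x. \<bar>f j x\<bar> \<le> b" using bnd by blast
  have "av n j x - av n j y = (LINT h|restrict_space lborel (B n). f j (x + h) - f j (y + h)) / \<beta> n"
   unfolding av_def using fint by (simp add: diff_divide_distrib)
  then have "ennreal (\<bar>av n j x - av n j y\<bar> powr p) \<le> ennreal (1 / \<beta> n) * (\<integral>\<^sup>+h\<in>B n. ennreal (\<bar>f j (x + h) - f j (y + h)\<bar> powr p) \<partial>lborel)"
   using jen[of "\<lambda>h. f j (x + h) - f j (y + h)" "2 * b" n] b by (simp add: abs_le_iff) (smt (verit) abs_le_iff)
  also have "\<dots> \<le> ennreal (1 / \<beta> n) * (\<integral>\<^sup>+h. ennreal (\<bar>f j ((y + h) + (x - y)) - f j (y + h)\<bar> powr p) * ind A1 (y + h) \<partial>lborel)"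
   using AA1[OF x(2)] \<delta>(2)[of n] by (intro mult_left_mono nn_integral_mono) (auto simp: indicator_def B_def add.commute)
  also have "(\<integral>\<^sup>+h. ennreal (\<bar>f j ((y + h) + (x - y)) - f j (y + h)\<bar> powr p) * ind A1 (y + h) \<partial>lborel) =
    (\<integral>\<^sup>+h\<in>A1. ennreal (\<bar>f j (h + (x - y)) - f j h\<bar> powr p) \<partial>lborel)"
   by (rule nn_integral_lborel_translate[of "\<lambda>h. ennreal (\<bar>f j (h + (x - y)) - f j h\<bar> powr p) * ind A1 h"]) simp
  also have "ennreal (1 / \<beta> n) * (\<integral>\<^sup>+h\<in>A1. ennreal (\<bar>f j (h + (x - y)) - f j h\<bar> powr p) \<partial>lborel) \<le>
    ennreal (1 / \<beta> n) * ennreal (C * norm (x - y) powr p)" by (intro mult_left_mono trans xy) simp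
  also have "\<dots> = ennreal (C / \<beta> n * norm (x - y) powr p)" using C \<beta>[of n] by (simp add: ennreal_mult[symmetric])
  finally have "\<bar>av n j x - av n j y\<bar> powr p \<le> C / \<beta> n * norm (x - y) powr p" using C \<beta>[of n] by simp
  then have "(\<bar>av n j x - av n j y\<bar> powr p) powr (1/p) \<le> (C / \<beta> n * norm (x - y) powr p) powr (1/p)" using p by (intro powr_mono2) auto
  then show ?thesis unfolding powr_mult powr_powr using p by simp
 qed
 have fL: "Lp_member p ?MA (f j)" for j
 proof -
  obtain b where b: "\<forall>x. \<bar>f j x\<bar> \<le> b" using bnd by blast
  have m: "f j \<in> borel_measurable ?MA" by (rule measurable_restrict_space1) simp
  have "integrable ?MA (\<lambda>x. norm (f j x) powr p)" using m p b by (intro MA.integrable_const_bound[of _ "b powr p"] AE_I2) (auto intro!: powr_mono2)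
  with m show ?thesis by (simp add: Lp_member_def)
 qed
 have avL: "Lp_member p ?MA (av n j)" for n j
 proof -
  have m: "av n j \<in> borel_measurable ?MA" by (rule measurable_restrict_space1) simp
  have "integrable ?MA (\<lambda>x. norm (av n j x) powr p)" using m p av_bound
   by (intro MA.integrable_const_bound[of _ "((C / \<beta> n) powr (1/p)) powr p"] AE_I2) (auto simp: space_restrict_space intro!: powr_mono2)
  with m show ?thesis by (simp add: Lp_member_def)
 qed
 \<comment> \<open>Averaging costs at most a multiple of the radius in Lp norm, uniformly in j,
   again by Jensen, Fubini and the translation hypothesis.\<close>
 have close: "Lp_norm p ?MA (\<lambda>x. f j x - av n j x) \<le> C powr (1/p) * \<delta> n" for n j
 proof -
  obtain b where b: "\<forall>x. \<bar>f j x\<bar> \<le> b" using bnd by blast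
  have b2: "\<bar>f j x - f j y\<bar> \<le> 2 * b" for x y using b[rule_format, of x] b[rule_format, of y] by linarith
  have pt: "ennreal (\<bar>f j x - av n j x\<bar> powr p) \<le> ennreal (1 / \<beta> n) * (\<integral>\<^sup>+h\<in>B n. ennreal (\<bar>f j x - f j (x + h)\<bar> powr p) \<partial>lborel)" for x
  proof -
   have "(LINT h|restrict_space lborel (B n). f j x - f j (x + h)) / \<beta> n = f j x - av n j x" unfolding av_def using fint BN[of n] \<beta>[of n]
    by (subst Bochner_Integration.integral_diff)
      (auto simp: finite_measure.integrable_const diff_divide_distrib space_restrict_space measure_restrict_space \<beta>_def)
   then show ?thesis using jen[of "\<lambda>h. f j x - f j (x + h)" "2 * b" n] b2 by simp
  qed
  have "(\<integral>\<^sup>+x. ennreal (norm (f j x - av n j x) powr p) \<partial>?MA) = (\<integral>\<^sup>+x\<in>A. ennreal (\<bar>f j x - av n j x\<bar> powr p) \<partial>lborel)"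
   by (subst nn_integral_restrict_space) auto
  also have "\<dots> \<le> (\<integral>\<^sup>+x\<in>A1. ennreal (1 / \<beta> n) * (\<integral>\<^sup>+h\<in>B n. ennreal (\<bar>f j x - f j (x + h)\<bar> powr p) \<partial>lborel) \<partial>lborel)"
  proof (intro nn_integral_mono)
   fix x
   show "ennreal (\<bar>f j x - av n j x\<bar> powr p) * ind A x \<le>
    ennreal (1 / \<beta> n) * (\<integral>\<^sup>+h\<in>B n. ennreal (\<bar>f j x - f j (x + h)\<bar> powr p) \<partial>lborel) * ind A1 x"
    using pt[of x] AA1[of x 0] \<eta> by (auto simp: indicator_def)
  qed
  also have "\<dots> = (\<integral>\<^sup>+x. (\<integral>\<^sup>+h. ennreal (1 / \<beta> n) * (ennreal (\<bar>f j x - f j (x + h)\<bar> powr p) * ind (B n) h * ind A1 x) \<partial>lborel) \<partial>lborel)"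
  proof (rule nn_integral_cong)
   fix x
   have "(\<integral>\<^sup>+h. ennreal (1 / \<beta> n) * (ennreal (\<bar>f j x - f j (x + h)\<bar> powr p) * ind (B n) h * ind A1 x) \<partial>lborel) =
     (\<integral>\<^sup>+h. (ennreal (1 / \<beta> n) * ind A1 x) * (ennreal (\<bar>f j x - f j (x + h)\<bar> powr p) * ind (B n) h) \<partial>lborel)"
    by (intro nn_integral_cong) (simp add: ac_simps)
   also have "\<dots> = (ennreal (1 / \<beta> n) * ind A1 x) * (\<integral>\<^sup>+h\<in>B n. ennreal (\<bar>f j x - f j (x + h)\<bar> powr p) \<partial>lborel)"
    by (rule nn_integral_cmult) measurable
   finally show "ennreal (1 / \<beta> n) * (\<integral>\<^sup>+h\<in>B n. ennreal (\<bar>f j x - f j (x + h)\<bar> powr p) \<partial>lborel) * ind A1 x =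
     (\<integral>\<^sup>+h. ennreal (1 / \<beta> n) * (ennreal (\<bar>f j x - f j (x + h)\<bar> powr p) * ind (B n) h * ind A1 x) \<partial>lborel)" by (simp add: ac_simps) qed
  also have "\<dots> = (\<integral>\<^sup>+h. (\<integral>\<^sup>+x. ennreal (1 / \<beta> n) * (ennreal (\<bar>f j x - f j (x + h)\<bar> powr p) * ind (B n) h * ind A1 x) \<partial>lborel) \<partial>lborel)"
   by (rule lborel_pair.Fubini') (subst measurable_cong_sets[OF sets_pair_measure_cong[OF sets_lborel sets_lborel] refl], unfold split_beta', measurable)
  also have "\<dots> \<le> (\<integral>\<^sup>+h\<in>B n. ennreal (C * \<delta> n powr p / \<beta> n) \<partial>lborel)"
  proof (intro nn_integral_mono)
   fix h
   have "(\<integral>\<^sup>+x. ennreal (1 / \<beta> n) * (ennreal (\<bar>f j x - f j (x + h)\<bar> powr p) * ind (B n) h * ind A1 x) \<partial>lborel) =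
     (\<integral>\<^sup>+x. (ennreal (1 / \<beta> n) * ind (B n) h) * (ennreal (\<bar>f j (x + h) - f j x\<bar> powr p) * ind A1 x) \<partial>lborel)"
    by (intro nn_integral_cong) (simp add: ac_simps abs_minus_commute)
   also have "\<dots> = (ennreal (1 / \<beta> n) * ind (B n) h) * (\<integral>\<^sup>+x\<in>A1. ennreal (\<bar>f j (x + h) - f j x\<bar> powr p) \<partial>lborel)"
    by (rule nn_integral_cmult) measurable
   also have "\<dots> \<le> (ennreal (1 / \<beta> n) * ind (B n) h) * ennreal (C * \<delta> n powr p)"
   proof (cases "h \<in> B n")
    case True
    then have "norm h < \<eta>" "norm h \<le> \<delta> n" using \<delta>(2)[of n] by (auto simp: B_def)
    then have "ennreal (C * norm h powr p) \<le> ennreal (C * \<delta> n powr p)" using C p by (intro ennreal_leI mult_left_mono powr_mono2) auto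
    then show ?thesis using trans[OF \<open>norm h < \<eta>\<close>, of j] by (intro mult_left_mono) auto
   qed simp
   also have "\<dots> = ennreal (C * \<delta> n powr p / \<beta> n) * ind (B n) h" using C \<beta>[of n] by (auto simp: indicator_def ennreal_mult[symmetric])
   finally show "(\<integral>\<^sup>+x. ennreal (1 / \<beta> n) * (ennreal (\<bar>f j x - f j (x + h)\<bar> powr p) * ind (B n) h * ind A1 x) \<partial>lborel) \<le> ennreal (C * \<delta> n powr p / \<beta> n) * ind (B n) h" .
  qed
  also have "\<dots> = ennreal (C * \<delta> n powr p / \<beta> n) * ennreal (\<beta> n)"
   using Bfin[of n] by (subst nn_integral_cmult_indicator) (auto simp: \<beta>_def emeasure_eq_ennreal_measure)
  also have "\<dots> = ennreal (C * \<delta> n powr p)" using C \<beta>[of n] by (simp add: ennreal_mult[symmetric])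
  finally have le: "(\<integral>\<^sup>+x. ennreal (norm (f j x - av n j x) powr p) \<partial>?MA) \<le> ennreal (C * \<delta> n powr p)" .
  have m: "(\<lambda>x. f j x - av n j x) \<in> borel_measurable ?MA" using fL[of j] avL[of n j] by (auto simp: Lp_member_def)
  have "Lp_norm p ?MA (\<lambda>x. f j x - av n j x) \<le> (C * \<delta> n powr p) powr (1/p)" using p C m le by (intro Lp_norm_le_nn_integral(2)) auto
  then show ?thesis using p C \<delta>(1)[of n] by (simp add: powr_mult powr_powr)
 qed
 obtain D where D: "countable D" "D \<subseteq> A" "A \<subseteq> closure D" using separable by blast
 \<comment> \<open>Diagonal extraction over all scales n and all points of a countable dense set.
   The factor \<beta>(n)^(1/p) makes the bound independent of n, as the extraction requires.\<close>
 obtain r where r: "strict_mono r" and conv: "\<And>z. z \<in> (UNIV :: nat set) \<times> D \<Longrightarrow> \<exists>l. (\<lambda>j. \<beta> (fst z) powr (1/p) * av (fst z) (r j) (snd z)) ----> l"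
 proof (rule function_convergent_subsequence[of "(UNIV :: nat set) \<times> D" "\<lambda>j z. \<beta> (fst z) powr (1/p) * av (fst z) j (snd z)" "C powr (1/p)"])
  show "countable ((UNIV :: nat set) \<times> D)" using D(1) by auto
  fix j and z :: "nat \<times> 'a" assume "z \<in> UNIV \<times> D"
  then have "\<bar>av (fst z) j (snd z)\<bar> \<le> (C / \<beta> (fst z)) powr (1/p)" using D(2) by (intro av_bound) auto
  then have "\<beta> (fst z) powr (1/p) * \<bar>av (fst z) j (snd z)\<bar> \<le> \<beta> (fst z) powr (1/p) * (C / \<beta> (fst z)) powr (1/p)" by (intro mult_left_mono) auto
  also have "\<dots> = C powr (1/p)" using \<beta>[of "fst z"] C by (simp add: powr_mult[symmetric])
  finally show "norm (\<beta> (fst z) powr (1/p) * av (fst z) j (snd z)) \<le> C powr (1/p)" by (simp add: abs_mult)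
 qed blast
 have cauD: "Cauchy (\<lambda>j. av n (r j) y)" if yD: "y \<in> D" for n y
 proof -
  obtain l where "(\<lambda>j. \<beta> n powr (1/p) * av n (r j) y) ----> l" using conv[of "(n, y)"] yD by auto
  then have "(\<lambda>j. inverse (\<beta> n powr (1/p)) * (\<beta> n powr (1/p) * av n (r j) y)) ----> inverse (\<beta> n powr (1/p)) * l" by (rule tendsto_mult_left)
  moreover have "\<beta> n powr (1/p) \<noteq> 0" using \<beta>[of n] by simp
  ultimately have "(\<lambda>j. av n (r j) y) ----> inverse (\<beta> n powr (1/p)) * l" by (simp add: mult.assoc[symmetric])
  then show ?thesis by (rule LIMSEQ_imp_Cauchy)
 qed
 \<comment> \<open>Equicontinuity carries convergence from the dense set to every point of
   A.\<close>
 have cau: "Cauchy (\<lambda>j. av n (r j) x)" if x: "x \<in> A" for n x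
 proof (rule metric_CauchyI)
  fix e :: real assume e: "e > 0"
  define L where "L = (C / \<beta> n) powr (1/p) + 1"
  have L: "L > 0" by (simp add: L_def add_nonneg_pos)
  obtain y where y: "y \<in> D" "dist y x < min \<eta> (e / (3 * L))"
   using D(3) x closure_approachable[of x D] \<eta> e L by (metis divide_pos_pos min_less_iff_conj mult_pos_pos subsetD zero_less_numeral)
  have yx: "\<bar>av n j x - av n j y\<bar> < e / 3" for j
  proof -
   have "\<bar>av n j x - av n j y\<bar> \<le> (C / \<beta> n) powr (1/p) * norm (x - y)" using y D(2) x by (intro av_cont) (auto simp: dist_norm norm_minus_commute)
   also have "\<dots> \<le> L * norm (x - y)" by (intro mult_right_mono) (auto simp: L_def)
   also have "\<dots> < L * (e / (3 * L))" using y L by (intro mult_strict_left_mono) (auto simp: dist_norm norm_minus_commute)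
   finally show ?thesis using L by simp
  qed
  obtain N where N: "\<And>i k. i \<ge> N \<Longrightarrow> k \<ge> N \<Longrightarrow> dist (av n (r i) y) (av n (r k) y) < e / 3"
   using metric_CauchyD[OF cauD[OF y(1), of n], of "e/3"] e by auto
  have "dist (av n (r i) x) (av n (r k) x) < e" if "i \<ge> N" "k \<ge> N" for i k
   using N[OF that] yx[of "r i"] yx[of "r k"] unfolding dist_real_def by linarith
  then show "\<exists>M. \<forall>m\<ge>M. \<forall>n'\<ge>M. dist (av n (r m) x) (av n (r n') x) < e" by blast
 qed
 show ?thesis
 proof (rule that[OF r])
  fix e :: real assume e: "e > 0"
  have "(\<lambda>n. C powr (1/p) * \<delta> n) ----> C powr (1/p) * 0"
  proof (rule tendsto_mult_left)
   have "(\<lambda>n. \<eta> * inverse (real (Suc (Suc n)))) ----> \<eta> * 0" by (intro tendsto_mult_left LIMSEQ_Suc[OF LIMSEQ_inverse_real_of_nat])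
   then show "\<delta> ----> 0" by (simp add: \<delta>_def[abs_def] divide_inverse add.commute)
  qed
  then have "\<forall>\<^sub>F n in sequentially. C powr (1/p) * \<delta> n < e / 4" using e by (intro order_tendstoD(2)) auto
  \<comment> \<open>A single scale n with small averaging error suffices for the given e; at that
    scale the averages converge boundedly, hence in Lp.\<close>
  then obtain n where n: "C powr (1/p) * \<delta> n < e / 4" by (auto simp: eventually_sequentially)
  define F where "F x = lim (\<lambda>j. av n (r j) x)" for x
  have limF: "(\<lambda>j. av n (r j) x) ----> F x" if "x \<in> A" for x
   using cau[OF that, of n] by (simp add: F_def Cauchy_convergent_iff convergent_LIMSEQ_iff)
  have Fb: "\<bar>F x\<bar> \<le> (C / \<beta> n) powr (1/p)" if "x \<in> A" for x
   using tendsto_rabs[OF limF[OF that]] by (rule LIMSEQ_le_const2) (use av_bound that in auto)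
  have Fm: "F \<in> borel_measurable ?MA" unfolding F_def by (rule borel_measurable_lim_metric) (use avL in "auto simp: Lp_member_def")
  have "integrable ?MA (\<lambda>x. norm (F x) powr p)" using Fm p Fb by (intro MA.integrable_const_bound[of _ "((C / \<beta> n) powr (1/p)) powr p"] AE_I2)
     (auto simp: space_restrict_space intro!: powr_mono2)
  with Fm have FL: "Lp_member p ?MA F" by (simp add: Lp_member_def)
  have "(\<lambda>j. LINT x|?MA. norm (av n (r j) x - F x) powr p) ----> (LINT x|?MA. 0)"
  proof (rule integral_dominated_convergence[where w="\<lambda>x. (2 * (C / \<beta> n) powr (1/p)) powr p"])
   show "AE x in ?MA. (\<lambda>j. norm (av n (r j) x - F x) powr p) ----> 0"
   proof (rule AE_I2)
    fix x assume "x \<in> space ?MA"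
    then have "(\<lambda>j. norm (av n (r j) x - F x)) ----> 0" by (intro tendsto_norm_zero LIM_zero limF) (simp add: space_restrict_space)
    then have "(\<lambda>j. norm (av n (r j) x - F x) powr p) ----> 0 powr p" using p by (intro tendsto_powr') auto
    then show "(\<lambda>j. norm (av n (r j) x - F x) powr p) ----> 0" using p by simp
   qed
   show "AE x in ?MA. norm (norm (av n (r j) x - F x) powr p) \<le> (2 * (C / \<beta> n) powr (1/p)) powr p" for j
   proof (rule AE_I2)
    fix x assume "x \<in> space ?MA"
    then have "\<bar>av n (r j) x - F x\<bar> \<le> 2 * (C / \<beta> n) powr (1/p)" using av_bound[of x n "r j"] Fb[of x] by (auto simp: space_restrict_space)
    then show "norm (norm (av n (r j) x - F x) powr p) \<le> (2 * (C / \<beta> n) powr (1/p)) powr p" using p by (auto intro!: powr_mono2)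
   qed
   show "(\<lambda>x. norm (av n (r j) x - F x) powr p) \<in> borel_measurable ?MA" for j
    using Lp_member_diff[OF p avL FL] by (auto simp: Lp_member_def)
  qed (auto simp: MA.integrable_const)
  then have "\<forall>\<^sub>F j in sequentially. (LINT x|?MA. norm (av n (r j) x - F x) powr p) < (e / 4) powr p" using e by (intro order_tendstoD(2)) auto
  then have "\<forall>\<^sub>F j in sequentially. Lp_norm p ?MA (\<lambda>x. av n (r j) x - F x) < e / 4" by eventually_elim (subst Lp_norm_less_iff, use p e in auto)
  then obtain N where N: "\<And>j. j \<ge> N \<Longrightarrow> Lp_norm p ?MA (\<lambda>x. av n (r j) x - F x) < e / 4" unfolding eventually_sequentially by blast
  have near: "Lp_norm p ?MA (\<lambda>x. f (r j) x - F x) < e / 2" if "j \<ge> N" for j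
  proof -
   have "Lp_norm p ?MA (\<lambda>x. (f (r j) x - av n (r j) x) + (av n (r j) x - F x)) \<le>
     Lp_norm p ?MA (\<lambda>x. f (r j) x - av n (r j) x) + Lp_norm p ?MA (\<lambda>x. av n (r j) x - F x)" by (intro Lp_norm_triangle Lp_member_diff p fL avL FL)
   also have "\<dots> < e / 4 + e / 4" using close[of "r j" n] n N[OF that] by linarith
   finally show ?thesis by simp
  qed
  have "Lp_norm p ?MA (\<lambda>x. f (r i) x - f (r k) x) < e" if "i \<ge> N" "k \<ge> N" for i k
  proof -
   have "Lp_norm p ?MA (\<lambda>x. (f (r i) x - F x) + (F x - f (r k) x)) \<le> Lp_norm p ?MA (\<lambda>x. f (r i) x - F x) + Lp_norm p ?MA (\<lambda>x. F x - f (r k) x)"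
    by (intro Lp_norm_triangle Lp_member_diff p fL FL)
   also have "\<dots> < e / 2 + e / 2" using near[OF that(1)] near[OF that(2)] by (simp add: Lp_norm_minus_commute[of p ?MA F])
   finally show ?thesis by simp
  qed
  then show "\<exists>N. \<forall>i\<ge>N. \<forall>k\<ge>N. Lp_norm p ?MA (\<lambda>x. f (r i) x - f (r k) x) < e" by blast
 qed
qed

section \<open>Transfer between annuli and the sphere\<close>

context hardy_cone
begin

lemma test_off_K0:
 assumes "\<phi> \<in> tests" "x \<noteq> 0" "x \<notin> K0"
 shows "\<phi> (sgn x) = 0" "tgrad \<phi> (sgn x) = 0" using sphere_test_functionsD(2,3)[OF assms(1), of "sgn x"] assms(2,3) by (auto simp: K0_def norm_sgn)

text \<open>The extension has degree 0 and its gradient degree -1, so the latter costs the factor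
  \<rho>^(-p); the radial integral is at most R^m.\<close>

lemma test_annulus_bounds:
 assumes \<phi>: "\<phi> \<in> tests" and \<rho>: "0 < \<rho>" "\<rho> \<le> R" and A: "A = {x. \<rho> \<le> norm x \<and> norm x \<le> R}"
 shows "(\<integral>\<^sup>+x\<in>A. ennreal (\<bar>\<phi> (sgn x)\<bar> powr p) \<partial>lborel) \<le> ennreal (R ^ DIM('a) * (LINT w|M. \<bar>\<phi> w\<bar> powr p))"
  "(\<integral>\<^sup>+x\<in>A. ennreal (norm (grad (\<lambda>x. \<phi> (sgn x)) x) powr p) \<partial>lborel) \<le> ennreal (\<rho> powr (- p) * R ^ DIM('a) * (LINT w|M. norm (tgrad \<phi> w) powr p))"
proof -
 interpret smooth_sphere_function \<phi> using \<phi> by (rule sphere_test_functionsD)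
 note L = test_Lp[OF \<phi>]
 have R: "0 < R" using \<rho> by simp
 have gen: "(\<integral>\<^sup>+x\<in>A. ennreal (F x) \<partial>lborel) \<le> ennreal (R ^ DIM('a) * (LINT w|M. k * h w))"
  if hm: "h \<in> borel_measurable M" "integrable M h" "\<And>w. 0 \<le> h w" "0 \<le> k"
   and F: "\<And>x. x \<in> A \<inter> K0 \<Longrightarrow> F x \<le> k * h (sgn x)" "\<And>x. x \<in> A \<Longrightarrow> x \<notin> K0 \<Longrightarrow> F x = 0"
  for F :: "'a \<Rightarrow> real" and h k
 proof -
  have "(\<integral>\<^sup>+x\<in>A. ennreal (F x) \<partial>lborel) = (\<integral>\<^sup>+x\<in>A. ennreal (F x) \<partial>lebesgue)" by (rule nn_integral_completion[symmetric])
  also have "\<dots> \<le> (\<integral>\<^sup>+x\<in>(A \<inter> K0). ennreal (k * h (sgn x)) \<partial>lebesgue)"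
   using F by (intro nn_integral_mono) (auto simp: indicator_def intro!: ennreal_leI)
  also have "\<dots> \<le> ennreal (R ^ DIM('a)) * (\<integral>\<^sup>+w. ennreal (k * h w) \<partial>M)" by (rule nn_integral_annulus_le) (use hm R A in auto)
  also have "\<dots> = ennreal (R ^ DIM('a) * (LINT w|M. k * h w))"
   using hm R by (subst nn_integral_eq_integral) (auto simp: ennreal_mult integral_nonneg)
  finally show ?thesis .
 qed
 have A0: "x \<noteq> 0" if "x \<in> A" for x using that \<rho> A by auto
 have hi: "integrable M (\<lambda>w. \<bar>\<phi> w\<bar> powr p)" "integrable M (\<lambda>w. norm (tgrad \<phi> w) powr p)" using L by (auto simp: Lp_member_def)
 have "(\<integral>\<^sup>+x\<in>A. ennreal (\<bar>\<phi> (sgn x)\<bar> powr p) \<partial>lborel) \<le> ennreal (R ^ DIM('a) * (LINT w|M. 1 * \<bar>\<phi> w\<bar> powr p))"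
  by (rule gen) (use hi test_off_K0[OF \<phi>] A0 p in auto)
 then show "(\<integral>\<^sup>+x\<in>A. ennreal (\<bar>\<phi> (sgn x)\<bar> powr p) \<partial>lborel) \<le> ennreal (R ^ DIM('a) * (LINT w|M. \<bar>\<phi> w\<bar> powr p))" by simp
 have g: "norm (grad (\<lambda>x. \<phi> (sgn x)) x) powr p = norm x powr (- p) * norm (tgrad \<phi> (sgn x)) powr p" if "x \<in> A" for x
  using A0[OF that] by (simp add: grad_eq_tgrad powr_mult inverse_powr powr_minus)
 have "(\<integral>\<^sup>+x\<in>A. ennreal (norm (grad (\<lambda>x. \<phi> (sgn x)) x) powr p) \<partial>lborel) \<le> ennreal (R ^ DIM('a) * (LINT w|M. \<rho> powr (- p) * norm (tgrad \<phi> w) powr p))"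
 proof (rule gen)
  fix x assume x: "x \<in> A \<inter> K0"
  have "norm x powr (- p) \<le> \<rho> powr (- p)" using x p \<rho> A by (intro powr_mono2') auto
  then show "norm (grad (\<lambda>x. \<phi> (sgn x)) x) powr p \<le> \<rho> powr (- p) * norm (tgrad \<phi> (sgn x)) powr p" using g[of x] x by (auto intro!: mult_right_mono)
 qed (use hi g test_off_K0[OF \<phi>] A0 p in auto)
 then show "(\<integral>\<^sup>+x\<in>A. ennreal (norm (grad (\<lambda>x. \<phi> (sgn x)) x) powr p) \<partial>lborel) \<le>
    ennreal (\<rho> powr (- p) * R ^ DIM('a) * (LINT w|M. norm (tgrad \<phi> w) powr p))" by (simp add: ac_simps)
qed

lemma test_comp_measurable:
 assumes "\<phi> \<in> tests"
 shows "(\<lambda>x. \<phi> (sgn x)) \<in> borel_funs" "grad (\<lambda>x. \<phi> (sgn x)) \<in> borel_funs" "\<exists>B. \<forall>x. \<bar>\<phi> (sgn x)\<bar> \<le> B"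
proof -
 interpret smooth_sphere_function \<phi> using assms by (rule sphere_test_functionsD)
 show "(\<lambda>x. \<phi> (sgn x)) \<in> borel_funs" "grad (\<lambda>x. \<phi> (sgn x)) \<in> borel_funs"
  by (intro borel_measurable_off_zero continuous_sgn continuous_on_grad[OF smooth])+
 obtain B where B: "\<And>x. x \<noteq> 0 \<Longrightarrow> \<bar>\<phi> (sgn x)\<bar> \<le> B" using sphere_bounds by metis
 have "\<bar>\<phi> (sgn x)\<bar> \<le> max B \<bar>\<phi> 0\<bar>" for x
  by (cases "x = 0") (use B[of x] in auto)
 then show "\<exists>B. \<forall>x. \<bar>\<phi> (sgn x)\<bar> \<le> B" by blast
qed

text \<open>The annulus 1/2 \<le> |x| \<le> 1 carries the radial factor of s^(m-1) over [1/2,1],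
  which is at least (1/2)^m.\<close>

lemma sphere_norm_le_annulus:
 assumes \<phi>: "(\<lambda>x. \<phi> (sgn x)) \<in> borel_funs" and A: "A = {x::'a. 1/2 \<le> norm x \<and> norm x \<le> 1}"
 shows "ennreal ((1/2) ^ DIM('a)) * (\<integral>\<^sup>+w. ennreal (\<bar>\<phi> w\<bar> powr p) \<partial>M) \<le> (\<integral>\<^sup>+x. ennreal (\<bar>\<phi> (sgn x)\<bar> powr p) \<partial>restrict_space lborel A)"
proof -
 let ?h = "\<lambda>w. ennreal (\<bar>\<phi> (sgn w)\<bar> powr p) * ind G w"
 have [measurable]: "?h \<in> borel_funs" using \<phi> by measurable
 have hm: "?h \<in> borel_measurable sphere_measure" unfolding sphere_measure_eq by (rule measurable_completion) (simp cong: measurable_cong_sets)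
 let ?k = "\<integral>\<^sup>+s. ind {1/2..1} s * ennreal (s ^ (DIM('a) - 1)) * ind {0<..} s \<partial>lborel"
 have k: "ennreal ((1/2) ^ DIM('a)) \<le> ?k"
 proof -
  have "ennreal ((1/2) ^ DIM('a)) = ennreal ((1/2) ^ (DIM('a) - 1) * (1/2))" by (metis DIM_positive Suc_pred' power_Suc2)
  also have "\<dots> = (\<integral>\<^sup>+s\<in>{1/2..1::real}. ennreal ((1/2) ^ (DIM('a) - 1)) \<partial>lborel)"
  proof -
   have "emeasure lborel {1/2..1::real} = ennreal (1/2)" by simp
   then show ?thesis by (subst nn_integral_cmult_indicator, simp, simp only:, intro ennreal_mult) auto
  qed
  also have "\<dots> \<le> ?k" by (intro nn_integral_mono) (auto simp: indicator_def intro!: ennreal_leI power_mono)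
  finally show ?thesis .
 qed
 have "(\<integral>\<^sup>+w. ennreal (\<bar>\<phi> w\<bar> powr p) \<partial>M) = (\<integral>\<^sup>+w. ?h w \<partial>sphere_measure)"
  unfolding nn_integral_M by (intro nn_integral_cong) (auto simp: indicator_def sgn_div_norm)
 then have "ennreal ((1/2) ^ DIM('a)) * (\<integral>\<^sup>+w. ennreal (\<bar>\<phi> w\<bar> powr p) \<partial>M) \<le> ?k * (\<integral>\<^sup>+w. ?h w \<partial>sphere_measure)" using k by (intro mult_mono) auto
 also have "\<dots> = (\<integral>\<^sup>+w. ?h w \<partial>sphere_measure) * ?k" by (rule mult.commute)
 also have "\<dots> = (\<integral>\<^sup>+x. ?h (sgn x) * ind {1/2..1} (norm x) \<partial>lebesgue)" by (rule nn_integral_sphere_polar[OF hm, symmetric]) simp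
 also have "\<dots> = (\<integral>\<^sup>+x. ?h (sgn x) * ind {1/2..1} (norm x) \<partial>lborel)" by (rule nn_integral_completion)
 also have "\<dots> \<le> (\<integral>\<^sup>+x\<in>A. ennreal (\<bar>\<phi> (sgn x)\<bar> powr p) \<partial>lborel)"
 proof -
  have "sgn (sgn x) = sgn x" for x :: 'a by (cases "x = 0") (simp_all add: sgn_div_norm)
  then show ?thesis using A by (intro nn_integral_mono) (auto simp: indicator_def)
 qed
 also have "\<dots> = (\<integral>\<^sup>+x. ennreal (\<bar>\<phi> (sgn x)\<bar> powr p) \<partial>restrict_space lborel A)"
 proof (rule nn_integral_restrict_space[symmetric])
  have "A = cball 0 1 - ball 0 (1/2)" using A by auto
  then show "A \<inter> space lborel \<in> sets lborel" by simp
 qed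
 finally show ?thesis .
qed

text \<open>Functions on the sphere are extended with degree 0 to an annulus, where the compactness
  criterion applies with the Euclidean translation estimate. Convergence on the annulus then returns
  to the sphere.\<close>

theorem sphere_Rellich:
 assumes \<phi>: "\<And>j::nat. \<phi> j \<in> tests"
  and C: "\<And>j. (LINT w|M. \<bar>\<phi> j w\<bar> powr p) \<le> C" "\<And>j. (LINT w|M. norm (tgrad (\<phi> j) w) powr p) \<le> C"
 obtains r where "strict_mono (r :: nat \<Rightarrow> nat)" "\<And>e. e > 0 \<Longrightarrow> \<exists>N. \<forall>i\<ge>N. \<forall>k\<ge>N. Lp_norm p M (\<lambda>w. \<phi> (r i) w - \<phi> (r k) w) < e"
proof -
 \<comment> \<open>Three nested annuli: translations by less than 1/8 map A into A1 and A1 into A2,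
   and all stay away from the origin.\<close>
 define A where "A = {x::'a. 1/2 \<le> norm x \<and> norm x \<le> 1}"
 define A1 where "A1 = {x::'a. 1/4 \<le> norm x \<and> norm x \<le> 2}"
 define A2 where "A2 = {x::'a. 1/8 \<le> norm x \<and> norm x \<le> 3}"
 have "A = cball 0 1 - ball 0 (1/2)" "A1 = cball 0 2 - ball 0 (1/4)" "A2 = cball 0 3 - ball 0 (1/8)" by (auto simp: A_def A1_def A2_def)
 then have sets [measurable]: "A \<in> sets borel" "A1 \<in> sets borel" "A2 \<in> sets borel" by auto
 have C0: "0 \<le> C" using C(1)[of 0] by (rule order_trans[rotated]) (simp add: integral_nonneg)
 let ?f = "\<lambda>j x. \<phi> j (sgn x)"
 define C' where "C' = max (2 ^ DIM('a) * C) ((1/8) powr (- p) * 3 ^ DIM('a) * C)"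
 have C': "0 \<le> C'" using C0 by (simp add: C'_def le_max_iff_disj)
 obtain r where r: "strict_mono (r :: nat \<Rightarrow> nat)"
  and cau: "\<And>e. e > 0 \<Longrightarrow> \<exists>N. \<forall>i\<ge>N. \<forall>k\<ge>N. Lp_norm p (restrict_space lborel A) (\<lambda>x. ?f (r i) x - ?f (r k) x) < e"
 proof (rule Kolmogorov_Riesz[OF p, of ?f A A1 "1/8" C'])
  show "?f j \<in> borel_funs" for j using test_comp_measurable(1)[OF \<phi>] .
  show "\<exists>B. \<forall>x. \<bar>?f j x\<bar> \<le> B" for j using test_comp_measurable(3)[OF \<phi>] .
  have "emeasure lborel A \<le> emeasure lborel (cball (0::'a) 1)" by (intro emeasure_mono) (auto simp: A_def)
  then show "emeasure lborel A < \<infinity>" using emeasure_bounded_finite[of "cball (0::'a) 1"] by auto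
  show "x + h \<in> A1" if "x \<in> A" "norm h < 1/8" for x h
   using that norm_triangle_ineq[of x h] norm_diff_ineq[of x h] by (auto simp: A_def A1_def)
  show "(\<integral>\<^sup>+x\<in>A1. ennreal (\<bar>?f j x\<bar> powr p) \<partial>lborel) \<le> ennreal C'" for j
  proof -
   have "(\<integral>\<^sup>+x\<in>A1. ennreal (\<bar>?f j x\<bar> powr p) \<partial>lborel) \<le> ennreal (2 ^ DIM('a) * (LINT w|M. \<bar>\<phi> j w\<bar> powr p))"
    by (rule test_annulus_bounds(1)[OF \<phi>, of "1/4"]) (auto simp: A1_def)
   also have "\<dots> \<le> ennreal C'" unfolding C'_def by (intro ennreal_leI max.coboundedI1 mult_left_mono C) auto
   finally show ?thesis .
  qed
  show "(\<integral>\<^sup>+x\<in>A1. ennreal (\<bar>?f j (x + h) - ?f j x\<bar> powr p) \<partial>lborel) \<le> ennreal (C' * norm h powr p)"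
   if h: "norm h < 1/8" for j h
  proof -
   interpret smooth_sphere_function "\<phi> j" using \<phi> by (rule sphere_test_functionsD)
   have "(\<integral>\<^sup>+x\<in>A1. ennreal (\<bar>?f j (x + h) - ?f j x\<bar> powr p) \<partial>lborel) \<le>
     ennreal (norm h powr p) * (\<integral>\<^sup>+x\<in>A2. ennreal (norm (grad (?f j) x) powr p) \<partial>lborel)" proof (rule translation_estimate[OF p, where S="- {0}"])
    fix x :: 'a and t :: real assume xt: "x \<in> A1" "0 \<le> t" "t \<le> 1"
    have "norm (t *\<^sub>R h) \<le> norm h" using xt by (simp add: mult_left_le_one_le)
    then show "x + t *\<^sub>R h \<in> A2" using xt h norm_triangle_ineq[of x "t *\<^sub>R h"] norm_diff_ineq[of x "t *\<^sub>R h"] by (auto simp: A1_def A2_def)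
   qed (use test_comp_measurable[OF \<phi>] GDERIV_sgn continuous_on_grad[OF smooth] in "auto simp: A2_def")
   also have "\<dots> \<le> ennreal (norm h powr p) * ennreal C'"
   proof (rule mult_left_mono)
    have "(\<integral>\<^sup>+x\<in>A2. ennreal (norm (grad (?f j) x) powr p) \<partial>lborel) \<le>
      ennreal ((1/8) powr (- p) * 3 ^ DIM('a) * (LINT w|M. norm (tgrad (\<phi> j) w) powr p))" by (rule test_annulus_bounds(2)[OF \<phi>]) (auto simp: A2_def)
    also have "\<dots> \<le> ennreal C'" unfolding C'_def by (intro ennreal_leI max.coboundedI2 mult_left_mono C) auto
    finally show "(\<integral>\<^sup>+x\<in>A2. ennreal (norm (grad (?f j) x) powr p) \<partial>lborel) \<le> ennreal C'" .
   qed simp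
   also have "\<dots> = ennreal (C' * norm h powr p)" using C' by (simp add: ennreal_mult[symmetric] mult.commute)
   finally show ?thesis .
  qed
 qed (use C' in auto)
 show ?thesis
 proof (rule that[OF r])
  fix e :: real assume e: "e > 0"
  define k where "k = ((1/2) ^ DIM('a)) powr (1/p)"
  have k: "0 < k" by (simp add: k_def)
  obtain N where N: "\<forall>i\<ge>N. \<forall>l\<ge>N. Lp_norm p (restrict_space lborel A) (\<lambda>x. ?f (r i) x - ?f (r l) x) < k * e" using cau[of "k * e"] k e by auto
  have "Lp_norm p M (\<lambda>w. \<phi> (r i) w - \<phi> (r l) w) < e" if il: "i \<ge> N" "l \<ge> N" for i l
  proof -
   define \<psi> where "\<psi> w = \<phi> (r i) w - \<phi> (r l) w" for w
   have \<psi>: "\<psi> \<in> tests" using sphere_test_functions_lincomb[OF \<phi>[of "r i"] \<phi>[of "r l"], of 1 "-1"] by (simp add: \<psi>_def[abs_def])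
   have L: "Lp_member p M \<psi>" by (rule test_Lp[OF \<psi>])
   define J where "J = (LINT x|restrict_space lborel A. norm (\<psi> (sgn x)) powr p)"
   have J: "J < (k * e) powr p" using N il Lp_norm_less_iff[of p "k * e" "restrict_space lborel A" "\<lambda>x. \<psi> (sgn x)"] p k e
    by (auto simp: J_def \<psi>_def)
   obtain B where B: "\<forall>x. \<bar>\<psi> (sgn x)\<bar> \<le> B" using test_comp_measurable(3)[OF \<psi>] by blast
   have "emeasure lborel A \<le> emeasure lborel (cball (0::'a) 1)" by (intro emeasure_mono) (auto simp: A_def)
   also have "\<dots> < \<infinity>" using emeasure_bounded_finite[of "cball (0::'a) 1"] by auto
   finally have fA: "finite_measure (restrict_space lborel A)" by (intro finite_measureI) (simp add: emeasure_restrict_space space_restrict_space)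
   have m: "(\<lambda>x. \<psi> (sgn x)) \<in> borel_measurable (restrict_space lborel A)"
    by (rule measurable_restrict_space1) (use test_comp_measurable(1)[OF \<psi>] in simp)
   have iA: "integrable (restrict_space lborel A) (\<lambda>x. \<bar>\<psi> (sgn x)\<bar> powr p)"
    using p B m by (intro finite_measure.integrable_const_bound[OF fA, of _ "B powr p"] AE_I2) (auto intro!: powr_mono2)
   have "ennreal ((1/2) ^ DIM('a)) * (\<integral>\<^sup>+w. ennreal (\<bar>\<psi> w\<bar> powr p) \<partial>M) \<le> (\<integral>\<^sup>+x. ennreal (\<bar>\<psi> (sgn x)\<bar> powr p) \<partial>restrict_space lborel A)"
    using test_comp_measurable(1)[OF \<psi>] by (rule sphere_norm_le_annulus) (simp add: A_def)
   also have "\<dots> = ennreal J" unfolding J_def using iA by (subst nn_integral_eq_integral) auto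
   also have "(\<integral>\<^sup>+w. ennreal (\<bar>\<psi> w\<bar> powr p) \<partial>M) = ennreal (LINT w|M. \<bar>\<psi> w\<bar> powr p)"
    using L by (intro nn_integral_eq_integral) (auto simp: Lp_member_def)
   finally have "ennreal ((1/2) ^ DIM('a) * (LINT w|M. \<bar>\<psi> w\<bar> powr p)) \<le> ennreal J" by (simp add: ennreal_mult integral_nonneg)
   then have "(1/2) ^ DIM('a) * (LINT w|M. \<bar>\<psi> w\<bar> powr p) \<le> J" by (subst (asm) ennreal_le_iff) (auto simp: J_def integral_nonneg)
   then have "(1/2) ^ DIM('a) * (LINT w|M. \<bar>\<psi> w\<bar> powr p) < (k * e) powr p" using J by simp
   also have "(k * e) powr p = (1/2) ^ DIM('a) * e powr p" using p e by (simp add: k_def powr_mult powr_powr)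
   finally have "(LINT w|M. norm (\<psi> w) powr p) < e powr p" by simp
   then show ?thesis using Lp_norm_less_iff[of p e M \<psi>] p e by (simp add: \<psi>_def[abs_def])
  qed
  then show "\<exists>N. \<forall>i\<ge>N. \<forall>k\<ge>N. Lp_norm p M (\<lambda>w. \<phi> (r i) w - \<phi> (r k) w) < e" by blast
 qed
qed

end

section \<open>The minimizer on the sphere\<close>

text \<open>The numerator of the quotient is thus the p-th power of an Lp norm of a vector-valued
  function; Minkowski's inequality and uniform convexity apply to it in this form.\<close>

lemma norm_pair_powr:
 fixes a :: real and b :: "'a::euclidean_space"
 shows "(k\<^sup>2 * a\<^sup>2 + (norm b)\<^sup>2) powr (q / 2) = norm (k * a, b) powr q"
proof -
 have "norm (k * a, b) powr q = ((k\<^sup>2 * a\<^sup>2 + (norm b)\<^sup>2) powr (1/2)) powr q" by (simp add: norm_Pair powr_half_sqrt power_mult_distrib)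
 then show ?thesis by (simp add: powr_powr)
qed

context hardy_cone
begin

text \<open>Denominator, and next the numerator, of the quotient; on smooth functions the classical
  tangential gradient can be used.\<close>

definition I :: "('a \<Rightarrow> real) \<Rightarrow> real" where "I \<phi> = (LINT w|M. \<bar>\<phi> w\<bar> powr p)"

definition Q :: "('a \<Rightarrow> real) \<Rightarrow> real" where "Q \<phi> = (LINT w|M. norm (c * \<phi> w, tgrad \<phi> w) powr p)"

text \<open>An infimum over normalized smooth functions only. That it is the minimum over the whole
  Sobolev space is shown by \<open>minimizer\<close> and
  \<open>quotient_ge_\<Lambda>\<close>.\<close>

definition \<Lambda> :: real where "\<Lambda> = Inf (Q ` {\<phi> \<in> tests. I \<phi> = 1})"

lemma Lp_member_pair:
 assumes "Lp_member p M v" "Lp_member p M g"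
 shows "Lp_member p M (\<lambda>w. (c * v w, g w :: 'a))"
  and "Lp_norm p M (\<lambda>w. (c * v w, g w)) \<le> \<bar>c\<bar> * Lp_norm p M v + Lp_norm p M g"
proof -
 have m: "v \<in> borel_measurable M" "g \<in> borel_measurable M" using assms by (auto simp: Lp_member_def)
 have 1: "Lp_member p M (\<lambda>w. (c * v w, 0 :: 'a))" "Lp_norm p M (\<lambda>w. (c * v w, 0 :: 'a)) = \<bar>c\<bar> * Lp_norm p M v"
 proof -
  show "Lp_member p M (\<lambda>w. (c * v w, 0 :: 'a))" by (rule Lp_member_bound[of p M "\<lambda>w. c *\<^sub>R v w"])
     (use Lp_member_scaleR[OF assms(1), of c] p m in "auto simp: norm_Pair")
  show "Lp_norm p M (\<lambda>w. (c * v w, 0 :: 'a)) = \<bar>c\<bar> * Lp_norm p M v" using Lp_norm_scaleR[of p M c v] p by (simp add: Lp_norm_def norm_Pair)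
 qed
 have 2: "Lp_member p M (\<lambda>w. (0 :: real, g w))" "Lp_norm p M (\<lambda>w. (0 :: real, g w)) = Lp_norm p M g"
 proof -
  show "Lp_member p M (\<lambda>w. (0 :: real, g w))" by (rule Lp_member_bound[of p M g]) (use assms(2) p m in "auto simp: norm_Pair")
  show "Lp_norm p M (\<lambda>w. (0 :: real, g w)) = Lp_norm p M g" by (simp add: Lp_norm_def norm_Pair)
 qed
 show "Lp_member p M (\<lambda>w. (c * v w, g w))" using Lp_member_add[OF p 1(1) 2(1)] by simp
 show "Lp_norm p M (\<lambda>w. (c * v w, g w)) \<le> \<bar>c\<bar> * Lp_norm p M v + Lp_norm p M g" using Lp_norm_triangle[OF p 1(1) 2(1)] 1(2) 2(2) by simp
qed

lemma I_nonneg: "0 \<le> I \<phi>" and Q_nonneg: "0 \<le> Q \<phi>"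
 by (auto simp: I_def Q_def intro: integral_nonneg)

lemma I_eq: "I \<phi> = Lp_norm p M \<phi> powr p"
 and Q_eq: "Q \<phi> = Lp_norm p M (\<lambda>w. (c * \<phi> w, tgrad \<phi> w)) powr p"
 using p Lp_norm_powr[of p M \<phi>] Lp_norm_powr[of p M "\<lambda>w. (c * \<phi> w, tgrad \<phi> w)"] by (auto simp: I_def Q_def)

lemma tgrad_scale:
 assumes "\<phi> \<in> tests" "norm w = 1"
 shows "tgrad (\<lambda>x. k * \<phi> x) w = k *\<^sub>R tgrad \<phi> w"
 using tgrad_lincomb[OF sphere_test_functionsD(1)[OF assms(1)] sphere_test_functionsD(1)[OF assms(1)] assms(2), of k 0] by simp

lemma scale_test:
 assumes \<phi>: "\<phi> \<in> tests"
 shows "(\<lambda>x. k * \<phi> x) \<in> tests" "I (\<lambda>x. k * \<phi> x) = \<bar>k\<bar> powr p * I \<phi>" "Q (\<lambda>x. k * \<phi> x) = \<bar>k\<bar> powr p * Q \<phi>"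
proof -
 show "(\<lambda>x. k * \<phi> x) \<in> tests" using sphere_test_functions_lincomb[OF \<phi> \<phi>, of k 0] by simp
 show "I (\<lambda>x. k * \<phi> x) = \<bar>k\<bar> powr p * I \<phi>" by (simp add: I_def abs_mult powr_mult)
 have "Q (\<lambda>x. k * \<phi> x) = (LINT w|M. \<bar>k\<bar> powr p * norm (c * \<phi> w, tgrad \<phi> w) powr p)" unfolding Q_def
 proof (rule Bochner_Integration.integral_cong[OF refl])
  fix w assume "w \<in> space M"
  then have "(c * (k * \<phi> w), tgrad (\<lambda>x. k * \<phi> x) w) = k *\<^sub>R (c * \<phi> w, tgrad \<phi> w)" using tgrad_scale[OF \<phi>] by simp
  then show "norm (c * (k * \<phi> w), tgrad (\<lambda>x. k * \<phi> x) w) powr p = \<bar>k\<bar> powr p * norm (c * \<phi> w, tgrad \<phi> w) powr p"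
   by (simp only: norm_scaleR powr_mult)
 qed
 then show "Q (\<lambda>x. k * \<phi> x) = \<bar>k\<bar> powr p * Q \<phi>" by (simp add: Q_def)
qed

lemma normalize_test:
 assumes \<phi>: "\<phi> \<in> tests" and I: "0 < I \<phi>"
 obtains \<psi> where "\<psi> \<in> tests" "I \<psi> = 1" "Q \<psi> = Q \<phi> / I \<phi>"
proof (rule that)
 let ?k = "I \<phi> powr (- (1 / p))"
 have "?k powr p = I \<phi> powr (- (1/p) * p)" unfolding powr_powr ..
 also have "- (1/p) * p = - 1" using p by simp
 finally have k: "\<bar>?k\<bar> powr p = 1 / I \<phi>" using I by (simp add: powr_minus divide_inverse)
 show "(\<lambda>x. ?k * \<phi> x) \<in> tests" by (rule scale_test[OF \<phi>])
 show "I (\<lambda>x. ?k * \<phi> x) = 1" "Q (\<lambda>x. ?k * \<phi> x) = Q \<phi> / I \<phi>" unfolding scale_test(2,3)[OF \<phi>] k using I by auto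
qed

text \<open>Makes the infimum one over a nonempty set. A box bump around a unit vector of K works:
  it is positive on an open cone, which is not a null set.\<close>

lemma ex_test: "\<exists>\<phi>\<in>tests. 0 < I \<phi>"
proof -
 have "K \<noteq> {0}" using not_open_singleton open_K by metis
 then obtain y where y: "y \<in> K" "y \<noteq> 0" using K by (auto simp: open_cone_def)
 have w: "sgn y \<in> K" using sgn_in_G[OF y] by simp
 obtain a b where cb: "cbox a b \<subseteq> K" and ab: "sgn y \<in> box a b" using open_contains_cbox[OF open_K w] by metis
 let ?u = "box_bump a b"
 have t: "?u \<in> tests"
 proof (rule sphere_test_functionsI)
  show "smooth_on (- {0}) (\<lambda>x. ?u (sgn x))" by (rule smooth_on_compose[OF _ open_UNIV smooth_box_bump]) (auto intro: smooth_on_sgn)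
  show "compact (cbox a b \<inter> sphere 0 1)" by (intro compact_Int compact_cbox compact_sphere)
  show "cbox a b \<inter> sphere 0 1 \<subseteq> G" using cb by auto
  show "?u w = 0" if "norm w = 1" "w \<notin> cbox a b \<inter> sphere 0 1" for w
   using that box_subset_cbox by (intro box_bump_zero) auto
 qed
 moreover have "I ?u \<noteq> 0"
 proof
  assume "I ?u = 0"
  then have "AE w in M. \<bar>?u w\<bar> powr p = 0"
   unfolding I_def using test_Lp(1)[OF t] by (subst (asm) integral_nonneg_eq_0_iff_AE) (auto simp: Lp_member_def)
  then have "AE w in M. ?u w = 0" by eventually_elim simp
  then have "AE x in lebesgue_on K0. ?u (sgn x) = 0" by (rule AE_K0_iff[THEN iffD2])
  then have ae: "AE x in lebesgue. x \<in> K0 \<longrightarrow> ?u (sgn x) = 0" using open_K0 by (subst (asm) AE_restrict_space_iff) auto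
  let ?O = "sgn -` box a b \<inter> - {0::'a}"
  have "open ?O" by (intro continuous_on_open_vimage[THEN iffD1, rule_format]) (auto intro!: continuous_intros)
  moreover have "?O \<noteq> {}"
  proof -
   have "sgn (sgn y) = sgn y" using y by (simp add: sgn_div_norm)
   then have "sgn y \<in> ?O" using ab y by (auto simp: sgn_zero_iff)
   then show ?thesis by blast
  qed
  ultimately have nn: "\<not> negligible ?O" by (rule open_not_negligible)
  have "AE x in lebesgue. x \<notin> ?O" using ae
  proof eventually_elim
   fix x assume x: "x \<in> K0 \<longrightarrow> ?u (sgn x) = 0"
   show "x \<notin> ?O"
   proof
    assume "x \<in> ?O"
    then have "x \<noteq> 0" "sgn x \<in> box a b" by auto
    moreover have "sgn x \<in> K" using cb box_subset_cbox calculation by blast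
    ultimately have "x \<in> K0" by (auto simp: K0_def norm_sgn)
    with x \<open>sgn x \<in> box a b\<close> show False using box_bump_pos_iff[of a b "sgn x"] by simp
   qed
  qed
  moreover have "{x \<in> space lebesgue. \<not> x \<notin> ?O} = ?O" by auto
  ultimately have "?O \<in> null_sets lebesgue" unfolding completion.AE_iff_null_sets by (simp only:)
  then show False using nn by (simp add: negligible_iff_null_sets)
 qed
 ultimately show ?thesis using I_nonneg[of ?u] by (auto intro!: bexI[of _ ?u])
qed

lemma bdd_Q: "bdd_below (Q ` X)"
 by (rule bdd_belowI2[where m=0]) (rule Q_nonneg)

lemma normalized_nonempty: "{\<phi> \<in> tests. I \<phi> = 1} \<noteq> {}"
proof -
 obtain \<phi> where \<phi>: "\<phi> \<in> tests" "0 < I \<phi>" using ex_test by blast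
 obtain \<psi> where "\<psi> \<in> tests" "I \<psi> = 1" by (rule normalize_test[OF \<phi>])
 then show ?thesis by blast
qed

lemma \<Lambda>_nonneg: "0 \<le> \<Lambda>"
 unfolding \<Lambda>_def using normalized_nonempty Q_nonneg by (intro cInf_greatest) auto

lemma \<Lambda>_le:
 assumes \<phi>: "\<phi> \<in> tests"
 shows "\<Lambda> * I \<phi> \<le> Q \<phi>"
proof (cases "0 < I \<phi>")
 case True
 obtain \<psi> where \<psi>: "\<psi> \<in> tests" "I \<psi> = 1" "Q \<psi> = Q \<phi> / I \<phi>" by (rule normalize_test[OF \<phi> True])
 then have "Q \<psi> \<in> Q ` {\<phi> \<in> tests. I \<phi> = 1}" by blast
 then have "\<Lambda> \<le> Q \<psi>" unfolding \<Lambda>_def by (intro cInf_lower bdd_Q)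
 then show ?thesis using mult_right_mono[of \<Lambda> "Q \<psi>" "I \<phi>"] \<psi>(3) True by simp
next
 case False
 then have "I \<phi> = 0" using I_nonneg[of \<phi>] by simp
 then show ?thesis using Q_nonneg by simp
qed

lemma \<Lambda>_approx:
 assumes "0 < e"
 obtains \<phi> where "\<phi> \<in> tests" "I \<phi> = 1" "Q \<phi> < \<Lambda> + e"
proof -
 have "\<Lambda> < \<Lambda> + e" using assms by simp
 then obtain x where "x \<in> Q ` {\<phi> \<in> tests. I \<phi> = 1}" "x < \<Lambda> + e"
  unfolding \<Lambda>_def by (rule cInf_lessD[rotated, THEN bexE]) (use normalized_nonempty in auto)
 then show ?thesis using that by auto
qed

section \<open>Existence of the minimizer\<close>

text \<open>Convergence in W1p carries \<open>I\<close> and \<open>Q\<close> over to the limit, and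
  the quotient, stated with a chosen weak gradient, can be computed with any other version
  g.\<close>

lemma W1_limit:
 assumes \<phi>: "\<And>n. \<phi> n \<in> tests" and v: "Lp_member p M v" and g: "Lp_member p M g"
  and wg: "has_weak_tangential_gradient G v g"
  and lim: "(\<lambda>n. Lp_norm p M (\<lambda>w. \<phi> n w - v w)) ----> 0" "(\<lambda>n. Lp_norm p M (\<lambda>w. tgrad (\<phi> n) w - g w)) ----> 0"
 shows "(\<lambda>n. I (\<phi> n)) ----> I v"
  and "(\<lambda>n. Q (\<phi> n)) ----> Lp_norm p M (\<lambda>w. (c * v w, g w)) powr p"
  and "sphere_quotient p G v = Lp_norm p M (\<lambda>w. (c * v w, g w)) powr p / I v"
proof -
 note T = test_Lp[OF \<phi>]
 have pw: "(\<lambda>n. x n powr p) ----> y powr p" if "x ----> y" "\<And>n. 0 \<le> x n" for x :: "nat \<Rightarrow> real" and y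
  using that p by (intro tendsto_powr2) auto
 show "(\<lambda>n. I (\<phi> n)) ----> I v" unfolding I_eq by (rule pw[OF Lp_norm_tendsto[OF p T(1) v lim(1)] Lp_norm_nonneg])
 show "(\<lambda>n. Q (\<phi> n)) ----> Lp_norm p M (\<lambda>w. (c * v w, g w)) powr p" unfolding Q_eq
 proof (rule pw[OF Lp_norm_tendsto[OF p Lp_member_pair(1)[OF T(1,2)] Lp_member_pair(1)[OF v g]] Lp_norm_nonneg])
  have "(\<lambda>n. \<bar>c\<bar> * Lp_norm p M (\<lambda>w. \<phi> n w - v w) + Lp_norm p M (\<lambda>w. tgrad (\<phi> n) w - g w)) ----> \<bar>c\<bar> * 0 + 0"
   by (intro tendsto_add tendsto_mult tendsto_const lim)
  moreover have "Lp_norm p M (\<lambda>w. (c * \<phi> n w, tgrad (\<phi> n) w) - (c * v w, g w)) \<le> \<bar>c\<bar> * Lp_norm p M (\<lambda>w. \<phi> n w - v w) + Lp_norm p M (\<lambda>w. tgrad (\<phi> n) w - g w)" for n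
  proof -
   have "(\<lambda>w. (c * \<phi> n w, tgrad (\<phi> n) w) - (c * v w, g w)) = (\<lambda>w. (c * (\<phi> n w - v w), tgrad (\<phi> n) w - g w))" by (simp add: right_diff_distrib)
   then show ?thesis using Lp_member_pair(2)[OF Lp_member_diff[OF p T(1)[of n] v] Lp_member_diff[OF p T(2)[of n] g]] by (simp only:)
  qed
  ultimately show "(\<lambda>n. Lp_norm p M (\<lambda>w. (c * \<phi> n w, tgrad (\<phi> n) w) - (c * v w, g w))) ----> 0"
   by - (rule Lim_null_comparison[OF always_eventually], simp_all add: Lp_norm_nonneg)
 qed
 have mv: "v \<in> borel_measurable M" and mg: "g \<in> borel_measurable M" using v g by (auto simp: Lp_member_def)
 have mw: "weak_tangential_gradient G v \<in> borel_measurable M" by (rule measurable_M_AE[OF mg weak_tgrad_AE[OF wg]])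
 have "(LINT x|M. ((c\<^sup>2 * (v x)\<^sup>2 + (norm (weak_tangential_gradient G v x))\<^sup>2) powr (p / 2))) = (LINT x|M. norm (c * v x, weak_tangential_gradient G v x) powr p)"
  by (simp only: norm_pair_powr)
 also have "\<dots> = (LINT x|M. norm (c * v x, g x) powr p)"
 proof (rule integral_cong_AE)
  have mp: "(\<lambda>x. norm (c * v x, u x) powr p) \<in> borel_measurable M" if "u \<in> borel_measurable M" for u :: "'a \<Rightarrow> 'a"
  proof -
   have "(\<lambda>x. (c * v x, u x)) \<in> borel_measurable M" using that mv by (intro borel_measurable_Pair borel_measurable_times) auto
   moreover have "(\<lambda>z :: real \<times> 'a. norm z powr p) \<in> borel_funs" by measurable
   ultimately show ?thesis by (rule measurable_compose)
  qed
  show "(\<lambda>x. norm (c * v x, weak_tangential_gradient G v x) powr p) \<in> borel_measurable M" "(\<lambda>x. norm (c * v x, g x) powr p) \<in> borel_measurable M"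
   by (rule mp, fact)+
  show "AE x in M. norm (c * v x, weak_tangential_gradient G v x) powr p = norm (c * v x, g x) powr p"
   using weak_tgrad_AE[OF wg] by eventually_elim simp
 qed
 also have "\<dots> = Lp_norm p M (\<lambda>w. (c * v w, g w)) powr p" using p by (subst Lp_norm_powr) auto
 finally show "sphere_quotient p G v = Lp_norm p M (\<lambda>w. (c * v w, g w)) powr p / I v" by (simp add: sphere_quotient_def I_def c_def)
qed

lemma quotient_ge_\<Lambda>:
 assumes "s \<in> sphere_quotients p G"
 shows "\<Lambda> \<le> s"
proof -
 obtain v where v: "v \<in> W1_sphere_0 p G" "\<not> (AE x in M. v x = 0)" "s = sphere_quotient p G v" using assms by (auto simp: sphere_quotients_def)
 obtain g where g: "has_weak_tangential_gradient G v g" "Lp_member p M g" and vL: "Lp_member p M v"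
  using v(1) by (auto simp: W1_sphere_0_def W1_sphere_def)
 obtain \<phi> where \<phi>: "\<And>j. \<phi> j \<in> tests"
  and lim: "(\<lambda>j. W1_sphere_norm p G (\<lambda>x. \<phi> j x - v x)) ----> 0" using v(1) by (auto simp: W1_sphere_0_def)
 have eq: "W1_sphere_norm p G (\<lambda>x. \<phi> j x - v x) = Lp_norm p M (\<lambda>x. \<phi> j x - v x) + Lp_norm p M (\<lambda>x. tgrad (\<phi> j) x - g x)" for j
  unfolding W1_sphere_norm_def using Lp_norm_weak_tgrad[OF weak_tgrad_diff[OF test_weak_tgrad[OF \<phi>[of j]] g(1)]
    borel_measurable_diff[OF test_Lp(4)[OF \<phi>[of j]]]] g(2) by (simp add: Lp_member_def)
 have l1: "(\<lambda>j. Lp_norm p M (\<lambda>x. \<phi> j x - v x)) ----> 0" by (rule tendsto_sandwich[OF _ _ tendsto_const lim]) (auto simp: eq Lp_norm_nonneg)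
 have l2: "(\<lambda>j. Lp_norm p M (\<lambda>x. tgrad (\<phi> j) x - g x)) ----> 0" by (rule tendsto_sandwich[OF _ _ tendsto_const lim]) (auto simp: eq Lp_norm_nonneg)
 note W = W1_limit[of \<phi>, OF \<phi> vL g(2,1) l1 l2]
 have "\<Lambda> * I v \<le> Lp_norm p M (\<lambda>w. (c * v w, g w)) powr p" by (rule LIMSEQ_le[OF tendsto_mult_left[OF W(1)] W(2)]) (use \<Lambda>_le[OF \<phi>] in auto)
 moreover have "I v > 0"
 proof -
  have "Lp_norm p M v \<noteq> 0" using Lp_norm_eq_0_iff[of p M v] v(2) vL p by auto
  then show ?thesis using p by (simp add: I_eq)
 qed
 ultimately show ?thesis unfolding v(3) W(3) by (simp add: field_simps)
qed

text \<open>Rellich's theorem makes a normalized minimizing sequence Cauchy in Lp. Midpoints of late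
  members are then almost normalized, so their \<open>Q\<close> is almost \<Lambda> or more, and
  uniform convexity forces the pairs (c \<phi>, gradient) to be Cauchy too. Completeness yields the
  minimizer.\<close>

theorem minimizer: "\<Lambda> \<in> sphere_quotients p G"
proof -
 have "\<exists>\<phi>. \<phi> \<in> tests \<and> I \<phi> = 1 \<and> Q \<phi> < \<Lambda> + inverse (real (Suc j))" for j
  using \<Lambda>_approx[of "inverse (real (Suc j))"] by (metis inverse_positive_iff_positive of_nat_0_less_iff zero_less_Suc)
 then obtain \<phi>0 where \<phi>0: "\<And>j. \<phi>0 j \<in> tests" "\<And>j. I (\<phi>0 j) = 1" "\<And>j. Q (\<phi>0 j) < \<Lambda> + inverse (real (Suc j))" by metis
 have tQ: "(LINT w|M. norm (tgrad (\<phi>0 j) w) powr p) \<le> Q (\<phi>0 j)" for j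
 proof -
  note L = test_Lp[OF \<phi>0(1)[of j]]
  show ?thesis unfolding Q_def using L Lp_member_pair(1)[OF L(1,2)] p
   by (intro integral_mono) (auto simp: Lp_member_def intro!: powr_mono2 norm_snd_le)
 qed
 obtain r where r: "strict_mono (r :: nat \<Rightarrow> nat)"
  and cau: "\<And>e. e > 0 \<Longrightarrow> \<exists>N. \<forall>i\<ge>N. \<forall>k\<ge>N. Lp_norm p M (\<lambda>w. \<phi>0 (r i) w - \<phi>0 (r k) w) < e"
 proof (rule sphere_Rellich[of \<phi>0, OF \<phi>0(1)])
  show "(LINT w|M. \<bar>\<phi>0 j w\<bar> powr p) \<le> \<Lambda> + 1" for j
   using \<phi>0(2)[of j] \<Lambda>_nonneg by (simp add: I_def)
  have "inverse (real (Suc j)) \<le> 1" for j by (simp add: inverse_le_1_iff)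
  then show "(LINT w|M. norm (tgrad (\<phi>0 j) w) powr p) \<le> \<Lambda> + 1" for j
   using tQ[of j] \<phi>0(3)[of j] by (meson add_left_mono less_imp_le order_trans)
 qed blast
 define \<phi> where "\<phi> j = \<phi>0 (r j)" for j
 have \<phi>: "\<phi> j \<in> tests" "I (\<phi> j) = 1" for j using \<phi>0 by (auto simp: \<phi>_def)
 have Qlim: "(\<lambda>j. Q (\<phi> j)) ----> \<Lambda>"
 proof (rule tendsto_sandwich[OF _ _ tendsto_const])
  show "\<forall>\<^sub>F j in sequentially. \<Lambda> \<le> Q (\<phi> j)" using \<Lambda>_le[OF \<phi>(1)] \<phi>(2) by simp
  have "(\<lambda>j. \<Lambda> + inverse (real (Suc (r j)))) ----> \<Lambda> + 0"
   using LIMSEQ_subseq_LIMSEQ[OF LIMSEQ_inverse_real_of_nat r] by (intro tendsto_intros) (simp add: o_def)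
  then show "(\<lambda>j. \<Lambda> + inverse (real (Suc (r j)))) ----> \<Lambda>" by simp
  show "\<forall>\<^sub>F j in sequentially. Q (\<phi> j) \<le> \<Lambda> + inverse (real (Suc (r j)))" unfolding \<phi>_def by (intro always_eventually allI less_imp_le \<phi>0(3))
 qed
 note T = test_Lp[OF \<phi>(1)]
 have nI: "Lp_norm p M (\<phi> j) = 1" for j
 proof -
  have "Lp_norm p M (\<phi> j) = (Lp_norm p M (\<phi> j) powr p) powr (1 / p)" using p Lp_norm_nonneg[of p M "\<phi> j"] by (simp add: powr_powr)
  then show ?thesis using \<phi>(2)[of j] by (simp add: I_eq)
 qed
 define V where "V j w = (c * \<phi> j w, tgrad (\<phi> j) w)" for j w
 have VL: "Lp_member p M (V j)" for j unfolding V_def by (intro Lp_member_pair T)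
 have QV: "Q (\<phi> j) = (LINT w|M. norm (V j w) powr p)" for j by (simp add: Q_def V_def)
 have cauV: "\<exists>N. \<forall>i\<ge>N. \<forall>k\<ge>N. Lp_norm p M (\<lambda>w. V i w - V k w) < e" if e: "e > 0" for e
 proof -
  \<comment> \<open>Chosen so that the first term of the convexity inequality contributes at most a
    quarter of e^p, the values of \<open>Q\<close> being below \<Lambda> + 1.\<close>
  define \<epsilon> where "\<epsilon> = e powr p / (8 * (\<Lambda> + 1))"
  have \<epsilon>: "\<epsilon> > 0" using e \<Lambda>_nonneg by (simp add: \<epsilon>_def)
  obtain C where C: "0 \<le> C" "\<And>a b :: real \<times> 'a. norm (a - b) powr p \<le> \<epsilon> * (norm a powr p + norm b powr p) +
    C * ((norm a powr p + norm b powr p) / 2 - norm ((1/2) *\<^sub>R (a + b)) powr p)" by (rule uniform_convexity_powr[OF p \<epsilon>]) blast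
  \<comment> \<open>The expression bounds C times the midpoint deficit once the sequence is within
    \<eta>; it tends to 0 with \<eta>.\<close>
  have "((\<lambda>\<eta>. C * (\<Lambda> + \<eta> - \<Lambda> * (1 - \<eta> / 2) powr p)) \<longlongrightarrow> C * (\<Lambda> + 0 - \<Lambda> * (1 - 0 / 2) powr p)) (at_right 0)" by (intro tendsto_intros) auto
  then have "\<forall>\<^sub>F \<eta> in at_right 0. C * (\<Lambda> + \<eta> - \<Lambda> * (1 - \<eta> / 2) powr p) < e powr p / 4" using e by (intro order_tendstoD(2)) auto
  moreover have "\<forall>\<^sub>F \<eta> in at_right (0::real). \<eta> < 1" "\<forall>\<^sub>F \<eta> in at_right (0::real). 0 < \<eta>"
   using eventually_at_right_real[of 0 "1::real"] by (auto elim: eventually_mono)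
  ultimately have "\<forall>\<^sub>F \<eta> in at_right 0. C * (\<Lambda> + \<eta> - \<Lambda> * (1 - \<eta> / 2) powr p) < e powr p / 4 \<and> \<eta> < 1 \<and> 0 < \<eta>" by eventually_elim simp
  then obtain \<eta> where \<eta>: "C * (\<Lambda> + \<eta> - \<Lambda> * (1 - \<eta> / 2) powr p) < e powr p / 4" "\<eta> < 1" "0 < \<eta>"
   using eventually_happens trivial_limit_at_right_real by blast
  obtain N1 where N1: "\<forall>i\<ge>N1. \<forall>k\<ge>N1. Lp_norm p M (\<lambda>w. \<phi> i w - \<phi> k w) < \<eta>" using cau[OF \<eta>(3)] by (auto simp: \<phi>_def)
  have "\<forall>\<^sub>F j in sequentially. Q (\<phi> j) < \<Lambda> + \<eta>" using Qlim \<eta>(3) by (intro order_tendstoD(2)) auto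
  then obtain N2 where N2: "\<And>j. j \<ge> N2 \<Longrightarrow> Q (\<phi> j) < \<Lambda> + \<eta>" by (auto simp: eventually_sequentially)
  have "Lp_norm p M (\<lambda>w. V i w - V k w) < e" if ik: "i \<ge> max N1 N2" "k \<ge> max N1 N2" for i k
  proof -
   define \<psi> where "\<psi> w = 1/2 * \<phi> i w + 1/2 * \<phi> k w" for w
   have \<psi>: "\<psi> \<in> tests" unfolding \<psi>_def[abs_def] by (intro sphere_test_functions_lincomb \<phi>)
   have \<psi>L: "Lp_member p M \<psi>" by (rule test_Lp[OF \<psi>])
   have V\<psi>: "(1/2) *\<^sub>R (V i w + V k w) = (c * \<psi> w, tgrad \<psi> w)" if "w \<in> G" for w
    using tgrad_lincomb[OF sphere_test_functionsD(1)[OF \<phi>(1)] sphere_test_functionsD(1)[OF \<phi>(1)] G_norm[OF that], of "1/2" i "1/2" k]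
    by (simp add: V_def \<psi>_def[abs_def] scaleR_add_right algebra_simps)
   \<comment> \<open>Closeness in Lp keeps the norm of the midpoint above 1 - \<eta>/2. Only here
     does compactness enter the gradient estimate.\<close>
   have "Lp_norm p M (\<phi> i) - Lp_norm p M \<psi> \<le> Lp_norm p M (\<lambda>w. \<phi> i w - \<psi> w)" using Lp_norm_triangle_diff[OF p T(1)[of i] \<psi>L] by simp
   also have "(\<lambda>w. \<phi> i w - \<psi> w) = (\<lambda>w. (1/2) *\<^sub>R (\<phi> i w - \<phi> k w))" by (auto simp: \<psi>_def field_simps)
   also have "Lp_norm p M \<dots> = 1/2 * Lp_norm p M (\<lambda>w. \<phi> i w - \<phi> k w)" using p by (subst Lp_norm_scaleR) auto
   also have "\<dots> \<le> \<eta> / 2" using N1 ik by (auto intro: less_imp_le)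
   finally have "1 - \<eta> / 2 \<le> Lp_norm p M \<psi>" using nI[of i] by simp
   then have "(1 - \<eta> / 2) powr p \<le> I \<psi>" unfolding I_eq using \<eta> p by (intro powr_mono2) auto
   then have "\<Lambda> * (1 - \<eta> / 2) powr p \<le> Q \<psi>" using \<Lambda>_le[OF \<psi>] \<Lambda>_nonneg by (meson mult_left_mono order_trans)
   moreover have "Q \<psi> = (LINT w|M. norm ((1/2) *\<^sub>R (V i w + V k w)) powr p)"
    unfolding Q_def by (intro Bochner_Integration.integral_cong) (use V\<psi> in auto)
   ultimately have mid: "\<Lambda> * (1 - \<eta> / 2) powr p \<le> (LINT w|M. norm ((1/2) *\<^sub>R (V i w + V k w)) powr p)" by simp
   have ii: "integrable M (\<lambda>w. norm (V i w) powr p)" "integrable M (\<lambda>w. norm (V k w) powr p)"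
    "integrable M (\<lambda>w. norm (V i w - V k w) powr p)" "integrable M (\<lambda>w. norm ((1/2) *\<^sub>R (V i w + V k w)) powr p)"
    using VL[of i] VL[of k] Lp_member_diff[OF p VL[of i] VL[of k]] Lp_member_scaleR[OF Lp_member_add[OF p VL[of i] VL[of k]], of "1/2"]
    unfolding Lp_member_def by blast+
   have "(LINT w|M. norm (V i w - V k w) powr p) \<le> (LINT w|M. \<epsilon> * (norm (V i w) powr p + norm (V k w) powr p) +
     C * ((norm (V i w) powr p + norm (V k w) powr p) / 2 - norm ((1/2) *\<^sub>R (V i w + V k w)) powr p))"
    by (intro integral_mono C(2) Bochner_Integration.integrable_add Bochner_Integration.integrable_diff integrable_mult_right integrable_divide ii)
   also have "\<dots> = \<epsilon> * (Q (\<phi> i) + Q (\<phi> k)) + C * ((Q (\<phi> i) + Q (\<phi> k)) / 2 - (LINT w|M. norm ((1/2) *\<^sub>R (V i w + V k w)) powr p))" unfolding QV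
    using ii by (simp only: Bochner_Integration.integral_add Bochner_Integration.integral_diff
      Bochner_Integration.integrable_add Bochner_Integration.integrable_diff integrable_mult_right
      integrable_divide integral_mult_right_zero integral_divide_zero)
   also have "\<dots> \<le> \<epsilon> * (2 * (\<Lambda> + 1)) + C * (\<Lambda> + \<eta> - \<Lambda> * (1 - \<eta> / 2) powr p)"
   proof (intro add_mono mult_left_mono)
    show "Q (\<phi> i) + Q (\<phi> k) \<le> 2 * (\<Lambda> + 1)" using N2[of i] N2[of k] ik \<eta>(2) by simp
    show "(Q (\<phi> i) + Q (\<phi> k)) / 2 - (LINT w|M. norm ((1/2) *\<^sub>R (V i w + V k w)) powr p) \<le> \<Lambda> + \<eta> - \<Lambda> * (1 - \<eta> / 2) powr p"
     using N2[of i] N2[of k] ik mid by (auto simp: field_simps)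
   qed (use \<epsilon> C in auto)
   also have "\<epsilon> * (2 * (\<Lambda> + 1)) = e powr p / 4" using \<Lambda>_nonneg by (simp add: \<epsilon>_def field_simps)
   also have "e powr p / 4 + C * (\<Lambda> + \<eta> - \<Lambda> * (1 - \<eta> / 2) powr p) < e powr p / 4 + e powr p / 4" using \<eta>(1) by simp
   also have "\<dots> \<le> e powr p" using e by simp
   finally show ?thesis using Lp_norm_less_iff[of p e M "\<lambda>w. V i w - V k w"] p e by simp
  qed
  then show ?thesis by blast
 qed
 obtain v where v: "Lp_member p M v" "(\<lambda>n. Lp_norm p M (\<lambda>x. \<phi> n x - v x)) ----> 0"
  by (rule Lp_complete[OF p finite_M T(1)]) (use cau in "auto simp: \<phi>_def")
 obtain g where g: "Lp_member p M g" "(\<lambda>n. Lp_norm p M (\<lambda>x. tgrad (\<phi> n) x - g x)) ----> 0"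
 proof (rule Lp_complete[OF p finite_M T(2)])
  fix e :: real assume e: "e > 0"
  obtain N where N: "\<forall>i\<ge>N. \<forall>k\<ge>N. Lp_norm p M (\<lambda>w. V i w - V k w) < e" using cauV[OF e] by blast
  have "Lp_norm p M (\<lambda>x. tgrad (\<phi> i) x - tgrad (\<phi> j) x) \<le> Lp_norm p M (\<lambda>w. V i w - V j w)" for i j
   using p T Lp_member_diff[OF p VL VL] by (intro Lp_norm_mono) (auto simp: V_def intro!: borel_measurable_diff norm_snd_le)
  then show "\<exists>N. \<forall>i\<ge>N. \<forall>j\<ge>N. Lp_norm p M (\<lambda>x. tgrad (\<phi> i) x - tgrad (\<phi> j) x) < e" using N by (meson le_less_trans)
 qed blast
 have wg: "has_weak_tangential_gradient G v g" by (rule weak_tgrad_limit[of \<phi>, OF \<phi>(1) v g])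
 note W = W1_limit[of \<phi>, OF \<phi>(1) v(1) g(1) wg v(2) g(2)]
 have Iv: "I v = 1" using LIMSEQ_unique[OF W(1), of 1] \<phi>(2) by simp
 have Qv: "Lp_norm p M (\<lambda>w. (c * v w, g w)) powr p = \<Lambda>" using LIMSEQ_unique[OF W(2) Qlim] .
 have "v \<in> W1_sphere_0 p G"
 proof -
  have "W1_sphere_norm p G (\<lambda>x. \<phi> j x - v x) = Lp_norm p M (\<lambda>x. \<phi> j x - v x) + Lp_norm p M (\<lambda>x. tgrad (\<phi> j) x - g x)" for j
   unfolding W1_sphere_norm_def using Lp_norm_weak_tgrad[OF weak_tgrad_diff[OF test_weak_tgrad[OF \<phi>(1)[of j]] wg] borel_measurable_diff[OF T(4)[of j]]] g(1)
   by (simp add: Lp_member_def)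
  then have "(\<lambda>j. W1_sphere_norm p G (\<lambda>x. \<phi> j x - v x)) ----> 0 + 0" by (simp only:) (intro tendsto_add v(2) g(2))
  then show ?thesis unfolding W1_sphere_0_def W1_sphere_def using v(1) g(1) wg \<phi>(1) by auto
 qed
 moreover have "\<not> (AE x in M. v x = 0)"
 proof
  assume "AE x in M. v x = 0"
  then have "Lp_norm p M v = 0" using Lp_norm_eq_0_iff[of p M v] v(1) p by simp
  then show False using Iv p by (simp add: I_eq)
 qed
 moreover have "sphere_quotient p G v = \<Lambda>" using W(3) Iv Qv by simp
 ultimately show ?thesis unfolding sphere_quotients_def by (intro image_eqI[where x=v]) simp_all
qed

lemma is_minimum_\<Lambda>: "is_minimum (sphere_quotients p G) \<Lambda>"
 unfolding is_minimum_def using minimizer quotient_ge_\<Lambda> by blast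

end

section \<open>Positivity of the minimum\<close>

context hardy_cone
begin

text \<open>For \<open>p = m\<close> the substitution \<open>t = s\<^sup>m\<close> on segments starting at the point where \<open>\<phi>\<close> vanishes exactly compensates the loss from rescaling small balls.\<close>

lemma Morrey_at_zero:
 assumes pm: "p = real DIM('a)" and m2: "2 \<le> DIM('a)" and \<phi>: "\<phi> \<in> tests"
  and w0: "norm w0 = 1" "w0 \<notin> G"
 shows "(\<integral>\<^sup>+h\<in>ball 0 (1/2). ennreal (\<bar>\<phi> (sgn (w0 + h))\<bar> powr p) \<partial>lborel) \<le> ennreal (p powr p * 2 * (LINT w|M. norm (tgrad \<phi> w) powr p))"
proof -
 interpret smooth_sphere_function \<phi> using \<phi> by (rule sphere_test_functionsD)
 define f where "f x = \<phi> (sgn x)" for x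
 define D where "D = grad f"
 define m where "m = DIM('a)"
 define T where "T = (LINT w|M. norm (tgrad \<phi> w) powr p)"
 have T: "0 \<le> T" by (simp add: T_def integral_nonneg)
 have Dm[measurable]: "D \<in> borel_funs" and fm[measurable]: "f \<in> borel_funs"
  using test_comp_measurable[OF \<phi>] by (auto simp: D_def f_def[abs_def])
 have Dx: "D x = tgrad \<phi> (sgn x) /\<^sub>R norm x" if "x \<noteq> 0" for x
  using grad_eq_tgrad[OF that] by (simp add: D_def f_def[abs_def])
 have der: "GDERIV f x :> D x" if "x \<noteq> 0" for x using GDERIV_sgn[OF that] by (simp add: D_def f_def[abs_def])
 have contD: "continuous_on (- {0}) D" using continuous_on_grad[OF smooth] by (simp add: D_def f_def[abs_def])
 \<comment> \<open>A ball of radius r/2 around a unit vector lies in an annulus of thickness r.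
   Since p = m, the radial density is s^(-p) s^(m-1) = 1/s, at most 2 there; hence a bound linear in
   r.\<close>
 have J: "(\<integral>\<^sup>+y\<in>ball 0 (r/2). ennreal (norm (D (w0 + y)) powr p) \<partial>lborel) \<le> ennreal (2 * r * T)"
  if r: "0 < r" "r \<le> 1" for r
 proof -
  define g where "g s = ennreal (s powr (- p)) * ind {1 - r/2 <..< 1 + r/2} s" for s :: real
  have [measurable]: "g \<in> borel_funs" unfolding g_def by measurable
  let ?h = "\<lambda>w. ennreal (norm (tgrad \<phi> w) powr p) * ind G w"
  have hm: "?h \<in> borel_measurable sphere_measure"
  proof -
   have "tgrad \<phi> \<in> borel_funs" by (rule borel_measurable_off_zero[OF continuous_tgrad])
   then show ?thesis unfolding sphere_measure_eq by (intro measurable_completion) (simp cong: measurable_cong_sets)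
  qed
  have "(\<integral>\<^sup>+y\<in>ball 0 (r/2). ennreal (norm (D (w0 + y)) powr p) \<partial>lborel) \<le>
    (\<integral>\<^sup>+y. (\<lambda>x. ennreal (norm (D x) powr p) * ind {1 - r/2 <..< 1 + r/2} (norm x)) (w0 + y) \<partial>lborel)" proof (rule nn_integral_mono) fix y
   show "ennreal (norm (D (w0 + y)) powr p) * ind (ball 0 (r/2)) y \<le> (\<lambda>x. ennreal (norm (D x) powr p) * ind {1 - r/2 <..< 1 + r/2} (norm x)) (w0 + y)"
    using norm_triangle_ineq[of w0 y] norm_diff_ineq[of w0 y] w0 by (auto simp: indicator_def)
  qed
  also have "\<dots> = (\<integral>\<^sup>+x. ennreal (norm (D x) powr p) * ind {1 - r/2 <..< 1 + r/2} (norm x) \<partial>lborel)"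
   by (rule nn_integral_lborel_translate) measurable
  also have "\<dots> \<le> (\<integral>\<^sup>+x. ?h (sgn x) * g (norm x) \<partial>lborel)"
  proof (rule nn_integral_mono)
   fix x
   show "ennreal (norm (D x) powr p) * ind {1 - r/2 <..< 1 + r/2} (norm x) \<le> ?h (sgn x) * g (norm x)"
   proof (cases "norm x \<in> {1 - r/2 <..< 1 + r/2}")
    case True
    then have x: "x \<noteq> 0" using r by auto
    show ?thesis
    proof (cases "sgn x \<in> G")
     case G: True
     have "norm (D x) powr p = norm (tgrad \<phi> (sgn x)) powr p * norm x powr (- p)"
      using x by (simp add: Dx powr_mult inverse_powr powr_minus mult.commute)
     then show ?thesis using True G by (simp add: g_def ennreal_mult[symmetric])
    next
     case False
     then have "tgrad \<phi> (sgn x) = 0" using test_off_K0(2)[OF \<phi> x] by (auto simp: K0_def)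
     then show ?thesis using x p by (simp add: Dx)
    qed
   qed simp
  qed
  also have "\<dots> = (\<integral>\<^sup>+x. ?h (sgn x) * g (norm x) \<partial>lebesgue)" by (rule nn_integral_completion[symmetric])
  also have "\<dots> = (\<integral>\<^sup>+w. ?h w \<partial>sphere_measure) * (\<integral>\<^sup>+s\<in>{0<..}. g s * ennreal (s ^ (DIM('a) - 1)) \<partial>lborel)"
   by (rule nn_integral_sphere_polar[OF hm]) measurable
  also have "\<dots> \<le> (\<integral>\<^sup>+w. ?h w \<partial>sphere_measure) * ennreal (2 * r)"
  proof (rule mult_left_mono)
   have "(\<integral>\<^sup>+s\<in>{0<..}. g s * ennreal (s ^ (DIM('a) - 1)) \<partial>lborel) \<le> (\<integral>\<^sup>+s\<in>{1 - r/2 .. 1 + r/2}. ennreal 2 \<partial>lborel)"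
   proof (rule nn_integral_mono)
    fix s :: real
    show "g s * ennreal (s ^ (DIM('a) - 1)) * ind {0<..} s \<le> ennreal 2 * ind {1 - r/2 .. 1 + r/2} s"
    proof (cases "s \<in> {1 - r/2 <..< 1 + r/2}")
     case True
     then have s: "1/2 \<le> s" using r by auto
     have "s powr (- p) * s ^ (DIM('a) - 1) = s powr (- p) * s powr (real (DIM('a) - 1))" using s by (subst powr_realpow) auto
     also have "\<dots> = s powr (- 1)" using m2 by (simp add: powr_add[symmetric] pm of_nat_diff)
     also have "\<dots> \<le> 2" using s by (simp add: powr_minus divide_simps)
     finally have "ennreal (s powr (- p) * s ^ (DIM('a) - 1)) \<le> ennreal 2" by (rule ennreal_leI)
     then have "ennreal (s powr (- p)) * ennreal (s ^ (DIM('a) - 1)) \<le> ennreal 2" using s by (simp only: ennreal_mult powr_ge_zero zero_le_power)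
     then show ?thesis using True s by (simp add: g_def)
    qed (simp add: g_def)
   qed
   also have "\<dots> = ennreal (2 * r)" using r by (subst nn_integral_cmult_indicator) (auto simp: ennreal_mult)
   finally show "(\<integral>\<^sup>+s\<in>{0<..}. g s * ennreal (s ^ (DIM('a) - 1)) \<partial>lborel) \<le> ennreal (2 * r)" .
  qed simp
  also have "(\<integral>\<^sup>+w. ?h w \<partial>sphere_measure) = ennreal T" unfolding nn_integral_M[symmetric] T_def
   using test_Lp(2)[OF \<phi>] by (intro nn_integral_eq_integral) (auto simp: Lp_member_def)
  finally show ?thesis using T r by (simp add: ennreal_mult[symmetric] mult.commute)
 qed
 have m1: "m = Suc (m - 1)" "1 \<le> m - 1" using m2 by (auto simp: m_def)
 define k where "k s h = ennreal (p powr p * (s ^ (m - 1)) powr p * norm (D (w0 + s ^ m *\<^sub>R h)) powr p) *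
   ind (ball 0 (1/2)) h * ind {0..1} s" for s :: real and h
 have pt: "ennreal (\<bar>f (w0 + h)\<bar> powr p) * ind (ball 0 (1/2)) h \<le> (\<integral>\<^sup>+s. k s h \<partial>lborel)" for h
 proof (cases "h \<in> ball 0 (1/2)")
  case True
  have nz: "w0 + s ^ m *\<^sub>R h \<noteq> 0" if "0 \<le> s" "s \<le> 1" for s
  proof
   assume "w0 + s ^ m *\<^sub>R h = 0"
   then have "norm w0 = norm (s ^ m *\<^sub>R h)" by (metis add_eq_0_iff norm_minus_cancel)
   also have "\<dots> \<le> norm h" using that by (simp add: power_le_one mult_left_le_one_le)
   finally show False using True w0 by simp
  qed
  \<comment> \<open>The derivative of f along the reparametrized segment from w0, where f vanishes,
    to w0 + h.\<close>
  let ?g = "\<lambda>s. (real m * s ^ (m - 1)) * (h \<bullet> D (w0 + s ^ m *\<^sub>R h))"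
  have cont: "continuous_on {0..1} ?g" using nz by (intro continuous_intros continuous_on_compose2[OF contD]) auto
  have d: "((\<lambda>s. f (w0 + s ^ m *\<^sub>R h)) has_real_derivative ?g s) (at s)" if "0 \<le> s" "s \<le> 1" for s
  proof -
   have "((\<lambda>t. f (w0 + t *\<^sub>R h)) has_real_derivative (h \<bullet> D (w0 + s ^ m *\<^sub>R h))) (at (s ^ m))" by (rule GDERIV_direction[OF der[OF nz[OF that]]])
   moreover have "((\<lambda>s. s ^ m) has_real_derivative real m * s ^ (m - 1)) (at s)" using DERIV_pow[of m s] by simp
   ultimately have "((\<lambda>s. f (w0 + s ^ m *\<^sub>R h)) has_real_derivative (h \<bullet> D (w0 + s ^ m *\<^sub>R h)) * (real m * s ^ (m - 1))) (at s)"
    by (rule DERIV_chain2)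
   then show ?thesis by (subst mult.commute)
  qed
  have ic: "isCont ?g s" if "0 \<le> s" "s \<le> 1" for s
  proof -
   have "isCont D (w0 + s ^ m *\<^sub>R h)" using contD nz[OF that] continuous_on_eq_continuous_at[of "- {0}" D] by (auto simp: open_Compl)
   then show ?thesis by (intro continuous_intros isCont_o2[where f="\<lambda>s. w0 + s ^ m *\<^sub>R h"])
  qed
  have "(LINT s|lborel. ?g s * ind {0..1} s) = f (w0 + 1 ^ m *\<^sub>R h) - f (w0 + 0 ^ m *\<^sub>R h)" by (rule integral_FTC_Icc_real) (use d ic in auto)
  moreover have "f w0 = 0" using sphere_test_functionsD(2)[OF \<phi> w0] w0 by (simp add: f_def sgn_div_norm)
  moreover have "0 < m" using m1 by simp
  ultimately have eq: "f (w0 + h) = (LINT s|restrict_space lborel {0..1}. ?g s)" by (simp add: integral_restrict_space mult.commute zero_power)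
  have "compact (?g ` {0..1})" by (intro compact_continuous_image cont) simp
  from compact_imp_bounded[OF this] obtain C where C: "\<forall>y\<in>?g ` {0..1}. norm y \<le> C" unfolding bounded_iff by blast
  have "ennreal (\<bar>(LINT s|restrict_space lborel {0..1}. ?g s) / 1\<bar> powr p) \<le> ennreal (1 / 1) * (\<integral>\<^sup>+s\<in>{0..1}. ennreal (\<bar>?g s\<bar> powr p) \<partial>lborel)"
   by (rule average_powr_le[OF p, where C=C]) (use C in auto)
  also have "\<dots> \<le> (\<integral>\<^sup>+s. k s h \<partial>lborel)"
  proof -
   have "ennreal (\<bar>?g s\<bar> powr p) * ind {0..1} s \<le> k s h" for s
   proof (cases "s \<in> {0..1}")
    case s: True
    have "\<bar>h \<bullet> D (w0 + s ^ m *\<^sub>R h)\<bar> \<le> norm h * norm (D (w0 + s ^ m *\<^sub>R h))" by (rule Cauchy_Schwarz_ineq2)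
    also have "\<dots> \<le> 1 * norm (D (w0 + s ^ m *\<^sub>R h))" using True by (intro mult_right_mono) auto
    finally have "\<bar>?g s\<bar> \<le> p * s ^ (m - 1) * norm (D (w0 + s ^ m *\<^sub>R h))" using s by (simp add: abs_mult pm m_def mult_left_mono)
    then have "\<bar>?g s\<bar> powr p \<le> (p * s ^ (m - 1) * norm (D (w0 + s ^ m *\<^sub>R h))) powr p" using p by (intro powr_mono2) auto
    then show ?thesis using s True by (simp add: k_def powr_mult ennreal_leI)
   qed simp
   then show ?thesis by (simp add: nn_integral_mono)
  qed
  finally show ?thesis using True by (simp add: eq)
 qed simp
 have "(\<integral>\<^sup>+h\<in>ball 0 (1/2). ennreal (\<bar>f (w0 + h)\<bar> powr p) \<partial>lborel) \<le> (\<integral>\<^sup>+h. (\<integral>\<^sup>+s. k s h \<partial>lborel) \<partial>lborel)" by (intro nn_integral_mono pt)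
 also have "\<dots> = (\<integral>\<^sup>+s. (\<integral>\<^sup>+h. k s h \<partial>lborel) \<partial>lborel)"
 proof (rule lborel_pair.Fubini')
  have [measurable]: "(\<lambda>z. ind (ball 0 (1/2)) (snd z) :: ennreal) \<in> borel_measurable ((borel :: real measure) \<Otimes>\<^sub>M (borel :: 'a measure))"
   by (rule measurable_compose[OF measurable_snd borel_measurable_indicator]) simp
  show "(\<lambda>(s, h). k s h) \<in> borel_measurable (lborel \<Otimes>\<^sub>M lborel)" unfolding k_def
   by (subst measurable_cong_sets[OF sets_pair_measure_cong[OF sets_lborel sets_lborel] refl], unfold split_beta', measurable)
 qed
 also have "\<dots> \<le> (\<integral>\<^sup>+s\<in>{0..1::real}. ennreal (p powr p * 2 * T) \<partial>lborel)"
 proof (rule nn_integral_mono)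
  fix s :: real
  show "(\<integral>\<^sup>+h. k s h \<partial>lborel) \<le> ennreal (p powr p * 2 * T) * ind {0..1} s"
  proof (cases "s \<in> {0<..1}")
   case True
   define r where "r = s ^ m"
   have r: "0 < r" "r \<le> 1" using True by (auto simp: r_def power_le_one)
   have [measurable]: "ball (0::'a) (r/2) \<in> sets borel" "ball (0::'a) (1/2) \<in> sets borel" by simp_all
   define L where "L = (\<integral>\<^sup>+h\<in>ball 0 (1/2). ennreal (norm (D (w0 + r *\<^sub>R h)) powr p) \<partial>lborel)"
   have "(\<integral>\<^sup>+y\<in>ball 0 (r/2). ennreal (norm (D (w0 + y)) powr p) \<partial>lborel) =
     ennreal (r ^ m) * (\<integral>\<^sup>+h. ennreal (norm (D (w0 + r *\<^sub>R h)) powr p) * ind (ball 0 (r/2)) (r *\<^sub>R h) \<partial>lborel)"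
    unfolding m_def by (rule nn_integral_lborel_scale[OF _ r(1)]) measurable
   also have "(\<integral>\<^sup>+h. ennreal (norm (D (w0 + r *\<^sub>R h)) powr p) * ind (ball 0 (r/2)) (r *\<^sub>R h) \<partial>lborel) = L"
    unfolding L_def using r by (intro nn_integral_cong) (auto simp: indicator_def)
   finally have L: "ennreal (r ^ m) * L \<le> ennreal (2 * r * T)" using J[OF r] by simp
   \<comment> \<open>The weight from the substitution is r^m/r with r = s^m: the factor r^m undoes
     the rescaling of the ball, and 1/r is absorbed by the linear bound \<open>J\<close>.\<close>
   have sp: "(s ^ (m - 1)) powr p = r ^ m / r"
   proof -
    have 1: "(s ^ (m - 1)) powr p = (s ^ (m - 1)) ^ m" using True by (simp add: pm m_def powr_realpow)
    have "s ^ (m - 1) * s = s ^ m" using m1(1) by (metis power_Suc2)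
    then have "(s ^ (m - 1)) ^ m * r = r ^ m" by (simp add: r_def power_mult_distrib[symmetric])
    with 1 show ?thesis using r by (simp add: field_simps)
   qed
   have "(\<integral>\<^sup>+h. k s h \<partial>lborel) = (\<integral>\<^sup>+h. ennreal (p powr p * (s ^ (m - 1)) powr p) * (ennreal (norm (D (w0 + r *\<^sub>R h)) powr p) * ind (ball 0 (1/2)) h) \<partial>lborel)"
    unfolding k_def r_def using True by (intro nn_integral_cong) (simp add: ennreal_mult mult.assoc)
   also have "\<dots> = ennreal (p powr p * (s ^ (m - 1)) powr p) * L" unfolding L_def by (rule nn_integral_cmult) measurable
   also have "\<dots> = ennreal (p powr p / r) * (ennreal (r ^ m) * L)" unfolding sp using r by (simp add: ennreal_mult[symmetric] mult.assoc[symmetric])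
   also have "\<dots> \<le> ennreal (p powr p / r) * ennreal (2 * r * T)" by (intro mult_left_mono L) simp
   also have "\<dots> = ennreal (p powr p * 2 * T)" using r T by (simp add: ennreal_mult[symmetric])
   finally show ?thesis using True by simp
  next
   case False
   then have "k s h = 0" for h using m1 p by (cases "s = 0") (auto simp: k_def)
   then show ?thesis by simp
  qed
 qed
 also have "\<dots> = ennreal (p powr p * 2 * T)" by (subst nn_integral_cmult_indicator) auto
 finally show ?thesis by (simp add: f_def T_def)
qed

section \<open>Propagation of vanishing Lp mass\<close>

lemma nn_integral_powr_add_le:
 fixes f g :: "'b \<Rightarrow> real"
 assumes [measurable]: "f \<in> borel_measurable N" "g \<in> borel_measurable N" "E \<in> sets N"
 shows "(\<integral>\<^sup>+x\<in>E. ennreal (\<bar>f x + g x\<bar> powr p) \<partial>N) \<le>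
  ennreal ((1/2) powr (1 - p)) * ((\<integral>\<^sup>+x\<in>E. ennreal (\<bar>f x\<bar> powr p) \<partial>N) + (\<integral>\<^sup>+x\<in>E. ennreal (\<bar>g x\<bar> powr p) \<partial>N))"
proof -
 have "(\<integral>\<^sup>+x\<in>E. ennreal (\<bar>f x + g x\<bar> powr p) \<partial>N) \<le>
   (\<integral>\<^sup>+x. ennreal ((1/2) powr (1 - p)) * (ennreal (\<bar>f x\<bar> powr p) * ind E x + ennreal (\<bar>g x\<bar> powr p) * ind E x) \<partial>N)" proof (rule nn_integral_mono)
  fix x
  have "\<bar>f x + g x\<bar> powr p \<le> (1/2) powr (1 - p) * (\<bar>f x\<bar> powr p + \<bar>g x\<bar> powr p)"
   using norm_add_powr_le[of p "1/2" "f x" "g x"] p by (simp add: distrib_left)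
  then have "ennreal (\<bar>f x + g x\<bar> powr p) \<le> ennreal ((1/2) powr (1 - p)) * (ennreal (\<bar>f x\<bar> powr p) + ennreal (\<bar>g x\<bar> powr p))"
   by (simp add: ennreal_mult[symmetric] ennreal_plus[symmetric] ennreal_leI del: ennreal_plus)
  then show "ennreal (\<bar>f x + g x\<bar> powr p) * ind E x \<le>
    ennreal ((1/2) powr (1 - p)) * (ennreal (\<bar>f x\<bar> powr p) * ind E x + ennreal (\<bar>g x\<bar> powr p) * ind E x)" by (auto simp: indicator_def) qed
 also have "\<dots> = ennreal ((1/2) powr (1 - p)) * ((\<integral>\<^sup>+x\<in>E. ennreal (\<bar>f x\<bar> powr p) \<partial>N) + (\<integral>\<^sup>+x\<in>E. ennreal (\<bar>g x\<bar> powr p) \<partial>N))"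
  by (subst nn_integral_cmult) (auto simp: nn_integral_add)
 finally show ?thesis .
qed

lemma tendsto_ennreal_le_0:
 fixes X Y :: "nat \<Rightarrow> ennreal"
 assumes "Y ----> 0" "\<And>i. X i \<le> Y i"
 shows "X ----> 0" by (rule tendsto_sandwich[OF _ _ tendsto_const assms(1)]) (use assms(2) in auto)

text \<open>With gradients tending to 0, the translation estimate shows that functions barely change
  in Lp under a shift by h, as long as the segments avoid a neighbourhood of the origin. Hence mass
  that vanishes in one ball vanishes in the shifted ball.\<close>

lemma vanishing_spreads:
 fixes \<phi> :: "nat \<Rightarrow> 'a \<Rightarrow> real"
 assumes \<phi>: "\<And>i. \<phi> i \<in> tests"
  and T: "(\<lambda>i. LINT w|M. norm (tgrad (\<phi> i) w) powr p) ----> 0"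
  and y: "y \<noteq> 0" and \<epsilon>: "0 < \<epsilon>" "\<epsilon> \<le> norm y / 4"
  and van: "(\<lambda>i. \<integral>\<^sup>+x. ennreal (\<bar>\<phi> i (sgn x)\<bar> powr p) * ind (ball y \<epsilon>) x \<partial>lborel) ----> 0"
  and h: "norm h < norm y / 4"
 shows "(\<lambda>i. \<integral>\<^sup>+x. ennreal (\<bar>\<phi> i (sgn x)\<bar> powr p) * ind (ball (y + h) \<epsilon>) x \<partial>lborel) ----> 0"
proof -
 define \<rho> R where "\<rho> = norm y / 4" and "R = 2 * norm y"
 have \<rho>: "0 < \<rho>" "\<rho> \<le> R" using y by (auto simp: \<rho>_def R_def)
 define A where "A = {x::'a. \<rho> \<le> norm x \<and> norm x \<le> R}"
 have "A = cball 0 R - ball 0 \<rho>" by (auto simp: A_def)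
 then have [measurable]: "A \<in> sets borel" by simp
 define B where "B i = \<rho> powr (- p) * R ^ DIM('a) * (LINT w|M. norm (tgrad (\<phi> i) w) powr p)" for i
 have "B ----> \<rho> powr (- p) * R ^ DIM('a) * 0" unfolding B_def[abs_def] by (intro tendsto_mult_left T)
 then have B: "(\<lambda>i. ennreal (norm h powr p) * ennreal (B i)) ----> ennreal (norm h powr p) * ennreal 0"
  by (intro ennreal_tendsto_cmult tendsto_ennrealI) auto
 have est: "(\<integral>\<^sup>+x\<in>ball (y + h) \<epsilon>. ennreal (\<bar>\<phi> i (sgn x)\<bar> powr p) \<partial>lborel) \<le>
   ennreal ((1/2) powr (1 - p)) * (ennreal (norm h powr p) * ennreal (B i) + (\<integral>\<^sup>+x\<in>ball y \<epsilon>. ennreal (\<bar>\<phi> i (sgn x)\<bar> powr p) \<partial>lborel))" for i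
 proof -
  interpret smooth_sphere_function "\<phi> i" using \<phi> by (rule sphere_test_functionsD)
  let ?f = "\<lambda>x. \<phi> i (sgn x)"
  have [measurable]: "?f \<in> borel_funs" by (rule test_comp_measurable[OF \<phi>])
  have [measurable]: "ball (y + h) \<epsilon> \<in> sets borel" "ball y \<epsilon> \<in> sets borel" by simp_all
  have "(\<integral>\<^sup>+x\<in>ball (y + h) \<epsilon>. ennreal (\<bar>?f x\<bar> powr p) \<partial>lborel) =
    (\<integral>\<^sup>+x. (\<lambda>x. ennreal (\<bar>?f x\<bar> powr p) * ind (ball (y + h) \<epsilon>) x) (h + x) \<partial>lborel)" by (rule nn_integral_lborel_translate[symmetric]) measurable
  also have "\<dots> = (\<integral>\<^sup>+x\<in>ball y \<epsilon>. ennreal (\<bar>(?f (x + h) - ?f x) + ?f x\<bar> powr p) \<partial>lborel)"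
   by (intro nn_integral_cong) (auto simp: indicator_def add.commute dist_norm algebra_simps)
  also have "\<dots> \<le> ennreal ((1/2) powr (1 - p)) * ((\<integral>\<^sup>+x\<in>ball y \<epsilon>. ennreal (\<bar>?f (x + h) - ?f x\<bar> powr p) \<partial>lborel) + (\<integral>\<^sup>+x\<in>ball y \<epsilon>. ennreal (\<bar>?f x\<bar> powr p) \<partial>lborel))"
   by (rule nn_integral_powr_add_le) measurable
  also have "\<dots> \<le> ennreal ((1/2) powr (1 - p)) * (ennreal (norm h powr p) * ennreal (B i) + (\<integral>\<^sup>+x\<in>ball y \<epsilon>. ennreal (\<bar>?f x\<bar> powr p) \<partial>lborel))"
  proof (intro mult_left_mono add_right_mono)
   have "(\<integral>\<^sup>+x\<in>ball y \<epsilon>. ennreal (\<bar>?f (x + h) - ?f x\<bar> powr p) \<partial>lborel) \<le>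
     ennreal (norm h powr p) * (\<integral>\<^sup>+x\<in>A. ennreal (norm (grad ?f x) powr p) \<partial>lborel)" proof (rule translation_estimate[OF p, where S="- {0}"])
    fix x :: 'a and t :: real assume xt: "x \<in> ball y \<epsilon>" "0 \<le> t" "t \<le> 1"
    have "norm (t *\<^sub>R h) \<le> norm h" using xt by (simp add: mult_left_le_one_le)
    moreover have "norm (x - y) < norm y / 4" using xt \<epsilon> by (simp add: dist_norm norm_minus_commute)
    ultimately have "norm ((x - y) + t *\<^sub>R h) < norm y / 2" using h norm_triangle_ineq[of "x - y" "t *\<^sub>R h"] by linarith
    then show "x + t *\<^sub>R h \<in> A" using norm_triangle_ineq[of y "(x - y) + t *\<^sub>R h"] norm_diff_ineq[of y "(x - y) + t *\<^sub>R h"]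
     by (simp add: A_def \<rho>_def R_def)
   qed (use test_comp_measurable[OF \<phi>] GDERIV_sgn continuous_on_grad[OF smooth] \<rho> in "auto simp: A_def")
   also have "\<dots> \<le> ennreal (norm h powr p) * ennreal (B i)"
    unfolding B_def by (intro mult_left_mono test_annulus_bounds(2)[OF \<phi> \<rho>]) (auto simp: A_def)
   finally show "(\<integral>\<^sup>+x\<in>ball y \<epsilon>. ennreal (\<bar>?f (x + h) - ?f x\<bar> powr p) \<partial>lborel) \<le> ennreal (norm h powr p) * ennreal (B i)" .
  qed simp
  finally show ?thesis .
 qed
 have "(\<lambda>i. ennreal ((1/2) powr (1 - p)) * (ennreal (norm h powr p) * ennreal (B i) + (\<integral>\<^sup>+x\<in>ball y \<epsilon>. ennreal (\<bar>\<phi> i (sgn x)\<bar> powr p) \<partial>lborel))) ---->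
   ennreal ((1/2) powr (1 - p)) * (ennreal (norm h powr p) * ennreal 0 + 0)" by (intro ennreal_tendsto_cmult tendsto_add B van) simp
 then have "(\<lambda>i. ennreal ((1/2) powr (1 - p)) * (ennreal (norm h powr p) * ennreal (B i) + (\<integral>\<^sup>+x\<in>ball y \<epsilon>. ennreal (\<bar>\<phi> i (sgn x)\<bar> powr p) \<partial>lborel))) ----> 0"
  by simp
 then show ?thesis by (rule tendsto_ennreal_le_0) (rule est)
qed

text \<open>The points near which the mass vanishes form a subset of the punctured space that is
  open with open relative complement. The punctured space is connected for m at least 2, so all its
  points qualify, and compactness of an annulus gives the statement on the sphere.\<close>

lemma vanishing_everywhere:
 fixes \<phi> :: "nat \<Rightarrow> 'a \<Rightarrow> real"
 assumes m2: "2 \<le> DIM('a)" and \<phi>: "\<And>i. \<phi> i \<in> tests"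
  and T: "(\<lambda>i. LINT w|M. norm (tgrad (\<phi> i) w) powr p) ----> 0"
  and y0: "y0 \<noteq> 0" "0 < \<epsilon>0"
  and van: "(\<lambda>i. \<integral>\<^sup>+x. ennreal (\<bar>\<phi> i (sgn x)\<bar> powr p) * ind (ball y0 \<epsilon>0) x \<partial>lborel) ----> 0"
 shows "(\<lambda>i. I (\<phi> i)) ----> 0"
proof -
 define F where "F i E = (\<integral>\<^sup>+x\<in>E. ennreal (\<bar>\<phi> i (sgn x)\<bar> powr p) \<partial>lborel)" for i and E :: "'a set"
 have Fmono: "F i E \<le> F i E'" if "E \<subseteq> E'" for i E E'
  unfolding F_def using that by (intro nn_integral_mono) (auto simp: indicator_def)
 define Z where "Z = {y. y \<noteq> 0 \<and> (\<exists>\<epsilon>>0. (\<lambda>i. F i (ball y \<epsilon>)) ----> 0)}"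
 have small: "\<exists>\<epsilon>>0. \<epsilon> \<le> \<delta> \<and> (\<lambda>i. F i (ball y \<epsilon>)) ----> 0" if "y \<in> Z" "0 < \<delta>" for y \<delta>
 proof -
  obtain \<epsilon> where \<epsilon>: "\<epsilon> > 0" "(\<lambda>i. F i (ball y \<epsilon>)) ----> 0" using \<open>y \<in> Z\<close> by (auto simp: Z_def)
  have "(\<lambda>i. F i (ball y (min \<epsilon> \<delta>))) ----> 0" by (rule tendsto_ennreal_le_0[OF \<epsilon>(2)]) (intro Fmono subset_ball, simp)
  then show ?thesis using \<epsilon> \<open>0 < \<delta>\<close> by (intro exI[of _ "min \<epsilon> \<delta>"]) auto
 qed
 have step: "y + h \<in> Z" if y: "y \<in> Z" and h: "norm h < norm y / 4" for y h
 proof -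
  have "y \<noteq> 0" using y by (simp add: Z_def)
  then obtain \<epsilon> where \<epsilon>: "0 < \<epsilon>" "\<epsilon> \<le> norm y / 4" "(\<lambda>i. F i (ball y \<epsilon>)) ----> 0" using small[OF y, of "norm y / 4"] by auto
  have "(\<lambda>i. F i (ball (y + h) \<epsilon>)) ----> 0" using vanishing_spreads[OF \<phi> T \<open>y \<noteq> 0\<close> \<epsilon>(1,2) _ h] \<epsilon>(3) by (simp add: F_def)
  moreover have "y + h \<noteq> 0"
  proof
   assume "y + h = 0"
   then have "norm y = norm h" by (metis add_eq_0_iff norm_minus_cancel)
   with h \<open>y \<noteq> 0\<close> show False by simp
  qed
  ultimately show ?thesis using \<epsilon> by (auto simp: Z_def)
 qed
 have oZ: "open Z" unfolding open_contains_ball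
 proof
  fix y assume y: "y \<in> Z"
  have "ball y (norm y / 4) \<subseteq> Z"
  proof
   fix x assume "x \<in> ball y (norm y / 4)"
   then have "y + (x - y) \<in> Z" by (intro step y) (simp add: dist_norm norm_minus_commute)
   then show "x \<in> Z" by simp
  qed
  then show "\<exists>e>0. ball y e \<subseteq> Z" using y by (intro exI[of _ "norm y / 4"]) (auto simp: Z_def)
 qed
 have oC: "open (- {0} - Z)" unfolding open_contains_ball
 proof
  fix y assume y: "y \<in> - {0} - Z"
  have "ball y (norm y / 8) \<subseteq> - {0} - Z"
  proof
   \<comment> \<open>A shift smaller than |y|/8 from x to y is smaller than |x|/4, so a point x of Z
     this close would put y into Z.\<close>
   fix x assume x: "x \<in> ball y (norm y / 8)"
   then have d: "norm (y - x) < norm y / 8" by (simp add: dist_norm)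
   have n: "norm y \<le> norm x + norm (y - x)" by (metis add.commute diff_add_cancel norm_triangle_ineq)
   have "x \<noteq> 0" using n d y by auto
   moreover have "x \<notin> Z"
   proof
    assume "x \<in> Z"
    then have "x + (y - x) \<in> Z" by (rule step) (use n d norm_ge_zero[of "y - x"] in linarith)
    with y show False by simp
   qed
   ultimately show "x \<in> - {0} - Z" by simp
  qed
  then show "\<exists>e>0. ball y e \<subseteq> - {0} - Z" using y by (intro exI[of _ "norm y / 8"]) auto
 qed
 have "y0 \<in> Z" using y0 van by (auto simp: Z_def F_def)
 have Zall: "x \<in> Z" if "x \<noteq> 0" for x
 proof (rule ccontr)
  assume "x \<notin> Z"
  have "connected (- {0::'a})" using m2 by (rule connected_punctured_universe)
  then show False using connectedD[of "- {0::'a}" Z "- {0} - Z"] oZ oC \<open>y0 \<in> Z\<close> y0(1) \<open>x \<notin> Z\<close> that by blast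
 qed
 define A where "A = {x::'a. 1/2 \<le> norm x \<and> norm x \<le> 1}"
 have Aeq: "A = cball 0 1 - ball 0 (1/2)" by (auto simp: A_def)
 have "compact A" unfolding Aeq by (intro compact_diff compact_cball open_ball)
 have "\<forall>x\<in>A. \<exists>\<epsilon>>0. (\<lambda>i. F i (ball x \<epsilon>)) ----> 0"
 proof
  fix x assume "x \<in> A"
  then have "x \<noteq> 0" by (auto simp: A_def)
  then have "x \<in> Z" by (rule Zall)
  then show "\<exists>\<epsilon>>0. (\<lambda>i. F i (ball x \<epsilon>)) ----> 0" by (simp add: Z_def)
 qed
 then obtain \<epsilon> where \<epsilon>: "\<And>x. x \<in> A \<Longrightarrow> 0 < \<epsilon> x" "\<And>x. x \<in> A \<Longrightarrow> (\<lambda>i. F i (ball x (\<epsilon> x))) ----> 0" by metis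
 obtain S where S: "S \<subseteq> A" "finite S" "A \<subseteq> (\<Union>x\<in>S. ball x (\<epsilon> x))"
 proof (rule compactE_image[OF \<open>compact A\<close>, of A "\<lambda>x. ball x (\<epsilon> x)"])
  show "A \<subseteq> (\<Union>x\<in>A. ball x (\<epsilon> x))" using \<epsilon>(1) by force
 qed auto
 have FA: "(\<lambda>i. F i A) ----> 0"
 proof (rule tendsto_ennreal_le_0)
  have "(\<lambda>i. \<Sum>x\<in>S. F i (ball x (\<epsilon> x))) ----> (\<Sum>x\<in>S. 0)" by (intro tendsto_sum \<epsilon>) (use S in auto)
  then show "(\<lambda>i. \<Sum>x\<in>S. F i (ball x (\<epsilon> x))) ----> 0" by simp
  show "F i A \<le> (\<Sum>x\<in>S. F i (ball x (\<epsilon> x)))" for i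
  proof -
   have [measurable]: "(\<lambda>x. \<phi> i (sgn x)) \<in> borel_funs" by (rule test_comp_measurable[OF \<phi>])
   have [measurable]: "ball z (\<epsilon> z) \<in> sets borel" for z by simp
   have "F i A \<le> (\<integral>\<^sup>+x. (\<Sum>z\<in>S. ennreal (\<bar>\<phi> i (sgn x)\<bar> powr p) * ind (ball z (\<epsilon> z)) x) \<partial>lborel)" unfolding F_def
   proof (rule nn_integral_mono)
    fix x
    show "ennreal (\<bar>\<phi> i (sgn x)\<bar> powr p) * ind A x \<le> (\<Sum>z\<in>S. ennreal (\<bar>\<phi> i (sgn x)\<bar> powr p) * ind (ball z (\<epsilon> z)) x)"
    proof (cases "x \<in> A")
     case True
     then obtain z where z: "z \<in> S" "x \<in> ball z (\<epsilon> z)" using S by blast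
     have "ennreal (\<bar>\<phi> i (sgn x)\<bar> powr p) * ind A x = ennreal (\<bar>\<phi> i (sgn x)\<bar> powr p) * ind (ball z (\<epsilon> z)) x" using True z by simp
     also have "\<dots> \<le> (\<Sum>z\<in>S. ennreal (\<bar>\<phi> i (sgn x)\<bar> powr p) * ind (ball z (\<epsilon> z)) x)" by (rule member_le_sum) (use z S in auto)
     finally show ?thesis .
    qed simp
   qed
   also have "\<dots> = (\<Sum>x\<in>S. F i (ball x (\<epsilon> x)))" unfolding F_def by (rule nn_integral_sum) measurable
   finally show ?thesis .
  qed
 qed
 have le: "ennreal ((1/2) ^ DIM('a)) * ennreal (I (\<phi> i)) \<le> F i A" for i
 proof -
  have "ennreal ((1/2) ^ DIM('a)) * (\<integral>\<^sup>+w. ennreal (\<bar>\<phi> i w\<bar> powr p) \<partial>M) \<le> (\<integral>\<^sup>+x. ennreal (\<bar>\<phi> i (sgn x)\<bar> powr p) \<partial>restrict_space lborel A)"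
   using test_comp_measurable(1)[OF \<phi>] by (rule sphere_norm_le_annulus) (simp add: A_def)
  also have "\<dots> = F i A" unfolding F_def by (rule nn_integral_restrict_space) (simp add: Aeq)
  also have "(\<integral>\<^sup>+w. ennreal (\<bar>\<phi> i w\<bar> powr p) \<partial>M) = ennreal (I (\<phi> i))"
   unfolding I_def using test_Lp(1)[OF \<phi>] by (intro nn_integral_eq_integral) (auto simp: Lp_member_def)
  finally show ?thesis .
 qed
 have "(\<lambda>i. ennreal ((1/2) ^ DIM('a) * I (\<phi> i))) ----> ennreal 0" using tendsto_ennreal_le_0[OF FA le] by (simp add: ennreal_mult I_nonneg)
 then have "(\<lambda>i. (1/2) ^ DIM('a) * I (\<phi> i)) ----> 0" by (subst (asm) tendsto_ennreal_iff) (auto simp: I_nonneg)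
 then have "(\<lambda>i. 2 ^ DIM('a) * ((1/2) ^ DIM('a) * I (\<phi> i))) ----> 2 ^ DIM('a) * 0" by (rule tendsto_mult_left)
 then show ?thesis by (simp add: power_one_over)
qed

text \<open>For p \<noteq> m the zeroth-order term alone gives the bound |c|^p. For p = m it is
  absent, and the assumption on K supplies a direction outside G where every test function vanishes;
  the Morrey estimate and propagation then rule out \<Lambda> = 0.\<close>

theorem \<Lambda>_pos:
 assumes m2: "2 \<le> DIM('a)" and K: "p = real DIM('a) \<Longrightarrow> K \<noteq> UNIV \<and> K \<noteq> UNIV - {0}"
 shows "0 < \<Lambda>"
proof (cases "p = real DIM('a)")
 case False
 then have c: "c \<noteq> 0" using p by (auto simp: c_def)
 have "\<bar>c\<bar> powr p \<le> Q \<phi>" if \<phi>: "\<phi> \<in> tests" "I \<phi> = 1" for \<phi>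
 proof -
  note L = test_Lp[OF \<phi>(1)]
  have "\<bar>c\<bar> powr p * I \<phi> = (LINT w|M. \<bar>c\<bar> powr p * \<bar>\<phi> w\<bar> powr p)" by (simp add: I_def)
  also have "\<dots> \<le> Q \<phi>" unfolding Q_def
  proof (rule integral_mono)
   show "integrable M (\<lambda>w. \<bar>c\<bar> powr p * \<bar>\<phi> w\<bar> powr p)" using L(1) by (auto simp: Lp_member_def)
   show "integrable M (\<lambda>w. norm (c * \<phi> w, tgrad \<phi> w) powr p)" using Lp_member_pair(1)[OF L(1,2)] by (simp add: Lp_member_def)
   show "\<bar>c\<bar> powr p * \<bar>\<phi> w\<bar> powr p \<le> norm (c * \<phi> w, tgrad \<phi> w) powr p" for w
    using norm_fst_le[of "c * \<phi> w" "tgrad \<phi> w"] p by (simp add: powr_mult[symmetric] abs_mult[symmetric] powr_mono2)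
  qed
  finally show ?thesis using \<phi> by simp
 qed
 then have "\<bar>c\<bar> powr p \<le> \<Lambda>" unfolding \<Lambda>_def using normalized_nonempty by (intro cInf_greatest) auto
 moreover have "0 < \<bar>c\<bar> powr p" using c by simp
 ultimately show ?thesis by linarith
next
 case True
 have c0: "c = 0" unfolding c_def using True by simp
 \<comment> \<open>The two cones excluded for p = m are exactly those containing every nonzero
   vector.\<close>
 have "\<not> UNIV - {0} \<subseteq> K"
 proof
  assume "UNIV - {0} \<subseteq> K"
  then have "K = UNIV \<or> K = UNIV - {0}" by (cases "0 \<in> K") auto
  then show False using K[OF True] by blast
 qed
 then obtain y where y: "y \<noteq> 0" "y \<notin> K" by blast
 define w0 where "w0 = sgn y"
 have w0: "norm w0 = 1" "w0 \<notin> G"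
 proof -
  show "norm w0 = 1" using y(1) by (simp add: w0_def norm_sgn)
  show "w0 \<notin> G"
  proof
   assume "w0 \<in> G"
   then have "y \<in> K0" using y(1) by (simp add: K0_def w0_def)
   then show False using y(2) unfolding K0_eq by simp
  qed
 qed
 show ?thesis
 proof (rule ccontr)
  assume "\<not> 0 < \<Lambda>"
  then have \<Lambda>0: "\<Lambda> = 0" using \<Lambda>_nonneg by simp
  have "\<exists>\<phi>. \<phi> \<in> tests \<and> I \<phi> = 1 \<and> Q \<phi> < inverse (real (Suc j))" for j
   using \<Lambda>_approx[of "inverse (real (Suc j))"] \<Lambda>0 by (metis add_0 inverse_positive_iff_positive of_nat_0_less_iff zero_less_Suc)
  then obtain \<phi> where \<phi>: "\<And>j. \<phi> j \<in> tests" "\<And>j. I (\<phi> j) = 1" "\<And>j. Q (\<phi> j) < inverse (real (Suc j))" by metis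
  have T: "(\<lambda>i. LINT w|M. norm (tgrad (\<phi> i) w) powr p) ----> 0"
  proof (rule tendsto_sandwich[OF _ _ tendsto_const LIMSEQ_inverse_real_of_nat])
   show "\<forall>\<^sub>F i in sequentially. 0 \<le> (LINT w|M. norm (tgrad (\<phi> i) w) powr p)" by (intro always_eventually allI integral_nonneg) simp
   have "Q (\<phi> i) = (LINT w|M. norm (tgrad (\<phi> i) w) powr p)" for i by (simp add: Q_def c0 norm_Pair)
   then show "\<forall>\<^sub>F i in sequentially. (LINT w|M. norm (tgrad (\<phi> i) w) powr p) \<le> inverse (real (Suc i))"
    using \<phi>(3) by (intro always_eventually allI less_imp_le) metis
  qed
  have w00: "w0 \<noteq> 0" using w0 by auto
  have "(\<lambda>i. \<integral>\<^sup>+x. ennreal (\<bar>\<phi> i (sgn x)\<bar> powr p) * ind (ball w0 (1/2)) x \<partial>lborel) ----> 0"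
  proof (rule tendsto_ennreal_le_0)
   have "(\<lambda>i. p powr p * 2 * (LINT w|M. norm (tgrad (\<phi> i) w) powr p)) ----> p powr p * 2 * 0" by (intro tendsto_mult_left T)
   then show "(\<lambda>i. ennreal (p powr p * 2 * (LINT w|M. norm (tgrad (\<phi> i) w) powr p))) ----> 0" by (intro tendsto_ennrealI[of _ 0, simplified]) simp
   fix i
   have [measurable]: "(\<lambda>x. \<phi> i (sgn x)) \<in> borel_funs" by (rule test_comp_measurable[OF \<phi>(1)])
   have [measurable]: "ball w0 (1/2) \<in> sets borel" by simp
   have "(\<integral>\<^sup>+x\<in>ball w0 (1/2). ennreal (\<bar>\<phi> i (sgn x)\<bar> powr p) \<partial>lborel) =
     (\<integral>\<^sup>+h. (\<lambda>x. ennreal (\<bar>\<phi> i (sgn x)\<bar> powr p) * ind (ball w0 (1/2)) x) (w0 + h) \<partial>lborel)" by (rule nn_integral_lborel_translate[symmetric]) measurable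
   also have "\<dots> = (\<integral>\<^sup>+h\<in>ball 0 (1/2). ennreal (\<bar>\<phi> i (sgn (w0 + h))\<bar> powr p) \<partial>lborel)"
    by (intro nn_integral_cong) (auto simp: indicator_def dist_norm)
   also have "\<dots> \<le> ennreal (p powr p * 2 * (LINT w|M. norm (tgrad (\<phi> i) w) powr p))" by (rule Morrey_at_zero[OF True m2 \<phi>(1) w0])
   finally show "(\<integral>\<^sup>+x\<in>ball w0 (1/2). ennreal (\<bar>\<phi> i (sgn x)\<bar> powr p) \<partial>lborel) \<le>
     ennreal (p powr p * 2 * (LINT w|M. norm (tgrad (\<phi> i) w) powr p))" . qed then have "(\<lambda>i. I (\<phi> i)) ----> 0"
   by (intro vanishing_everywhere[OF m2 \<phi>(1) T w00, of "1/2"]) auto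
  then show False using \<phi>(2) LIMSEQ_unique[of "\<lambda>i. 1::real" 1 0] by simp
 qed
qed

end

section \<open>Hardy's inequality for test functions\<close>

lemma continuous_integral_interval:
 fixes f :: "real \<Rightarrow> real"
 assumes "continuous_on {a..b} f"
 shows "integrable (restrict_space lborel {a..b}) f" "integral {a..b} f = (LINT s|restrict_space lborel {a..b}. f s)"
proof -
 have i: "integrable lborel (\<lambda>x. ind {a..b} x *\<^sub>R f x)" by (rule borel_integrable_compact) (use assms in auto)
 then show "integrable (restrict_space lborel {a..b}) f" by (subst integrable_restrict_space) auto
 have "(LINT s|restrict_space lborel {a..b}. f s) = (LINT x:{a..b}|lborel. f x)" by (simp add: integral_restrict_space set_lebesgue_integral_def)
 also have "\<dots> = integral {a..b} f" by (rule set_borel_integral_eq_integral) (use i in "simp add: set_integrable_def")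
 finally show "integral {a..b} f = (LINT s|restrict_space lborel {a..b}. f s)" by simp
qed

lemma square_powr_half:
 fixes x :: real
 assumes "0 \<le> x"
 shows "(x\<^sup>2) powr (q / 2) = x powr q"
proof (cases "x = 0")
 case False
 then have "x\<^sup>2 = x powr 2" using assms by simp
 then show ?thesis by (simp only: powr_powr) simp
qed simp

text \<open>The derivative of \<open>sgn\<close> at a unit vector is the orthogonal projection onto
  the tangent space; the second claim is Pythagoras' theorem.\<close>

lemma norm_tgrad_sgn:
 fixes h :: "'a::euclidean_space \<Rightarrow> real"
 assumes h: "GDERIV h w :> D" and w: "norm w = 1"
 shows "tgrad h w = D - (w \<bullet> D) *\<^sub>R w" "(norm (tgrad h w))\<^sup>2 + (w \<bullet> D)\<^sup>2 = (norm D)\<^sup>2"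
proof -
 have w0: "w \<noteq> 0" and sw: "sgn w = w" using w by (auto simp: sgn_div_norm)
 have "((\<lambda>x. inverse (norm x)) has_derivative (\<lambda>v. - (inverse (norm w) * (v \<bullet> sgn w) * inverse (norm w)))) (at w)"
  by (rule Deriv.has_derivative_inverse[OF _ has_derivative_norm]) (use w0 in auto)
 from has_derivative_scaleR[OF this has_derivative_ident]
 have "((\<lambda>x. x /\<^sub>R norm x) has_derivative (\<lambda>v. v - (v \<bullet> w) *\<^sub>R w)) (at w)" using w sw by simp
 then have sg: "(sgn has_derivative (\<lambda>v. v - (v \<bullet> w) *\<^sub>R w)) (at w)" by (simp add: sgn_div_norm[abs_def])
 have "((\<lambda>x. h (sgn x)) has_derivative (\<lambda>v. (v - (v \<bullet> w) *\<^sub>R w) \<bullet> D)) (at w)"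
  by (rule has_derivative_compose[OF sg]) (use h sw in "simp add: gderiv_def")
 moreover have "(\<lambda>v. (v - (v \<bullet> w) *\<^sub>R w) \<bullet> D) = (\<lambda>v. v \<bullet> (D - (w \<bullet> D) *\<^sub>R w))" by (auto simp: inner_diff_left inner_diff_right)
 ultimately have "GDERIV (\<lambda>x. h (sgn x)) w :> D - (w \<bullet> D) *\<^sub>R w" by (simp add: gderiv_def)
 then show t: "tgrad h w = D - (w \<bullet> D) *\<^sub>R w" unfolding tgrad_def by (rule grad_eq)
 have "w \<bullet> w = 1" using w by (simp add: norm_eq_1)
 then show "(norm (tgrad h w))\<^sup>2 + (w \<bullet> D)\<^sup>2 = (norm D)\<^sup>2" unfolding t power2_norm_eq_inner
  by (simp add: inner_diff_left inner_diff_right inner_commute power2_eq_square algebra_simps)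
qed

text \<open>Averaging over rays turns a test function on the cone into a competitor on the sphere.
 The shift by \<open>\<delta>\<close> inside the average makes the competitor smooth.\<close>

locale ray_average = hardy_cone K p for K :: "'a::euclidean_space set" and p +
 fixes \<phi> :: "'a \<Rightarrow> real" and a b \<delta> :: real
 assumes \<phi>: "\<phi> \<in> test_functions K" and ab: "0 < a" "a < b" and \<delta>: "0 < \<delta>"
  and b: "\<And>x. b \<le> norm x \<Longrightarrow> \<phi> x = 0"
  and a: "0 < c \<or> (\<forall>x. norm x = a \<longrightarrow> \<phi> x = 0)"
begin

text \<open>A smooth, strictly positive substitute for |\<phi>(s x)|^p, equal to \<delta>^p where
  \<phi> vanishes. Without it neither the power p nor the p-th root taken later need be
  differentiable.\<close>

definition \<Theta> :: "'a \<Rightarrow> real \<Rightarrow> real" where "\<Theta> x s = ((\<phi> (s *\<^sub>R x))\<^sup>2 + \<delta>\<^sup>2) powr (p / 2)"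

text \<open>Equal to p c. The weight s^(e-1) used below is the polar density s^(m-1) divided by the
  Hardy weight s^p.\<close>

definition e :: real where "e = real DIM('a) - p"

definition P :: "'a \<Rightarrow> real" where "P x = integral {a..b} (\<lambda>s. \<Theta> x s * s powr (e - 1))"

text \<open>The value of \<open>P\<close> on rays that miss the support of \<phi>.\<close>

definition P0 :: real where "P0 = integral {a..b} (\<lambda>s. \<delta> powr p * s powr (e - 1))"

text \<open>The regularised p-mean along the ray. Subtracting the constant makes it vanish on rays
  that miss the support, hence compactly supported in G.\<close>

definition u :: "'a \<Rightarrow> real" where "u x = P x powr (1 / p) - P0 powr (1 / p)"

definition E :: "'a \<Rightarrow> real" where "E x = integral {a..b} (\<lambda>s. norm (grad \<phi> (s *\<^sub>R x)) powr p * s powr real (DIM('a) - 1))"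

text \<open>Up to the factor p, what multiplies the directional derivative of \<phi> when the
  integrand of \<open>P\<close> is differentiated; the inner derivative raises s^(e-1) to
  s^e.\<close>

definition A :: "'a \<Rightarrow> real \<Rightarrow> real" where "A x s = ((\<phi> (s *\<^sub>R x))\<^sup>2 + \<delta>\<^sup>2) powr (p / 2 - 1) * \<phi> (s *\<^sub>R x) * s powr e"

lemma c_eq: "c = e / p" by (simp add: c_def e_def)

lemma sq_pos: "0 < (\<phi> x)\<^sup>2 + \<delta>\<^sup>2" using \<delta> by (simp add: add_nonneg_pos)

lemmas T = test_functionsD[OF \<phi>]

lemma cont_comp:
 assumes "continuous_on S f" "continuous_on S g"
 shows "continuous_on S (\<lambda>z. \<phi> (f z *\<^sub>R g z))" "continuous_on S (\<lambda>z. grad \<phi> (f z *\<^sub>R g z))"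
 by (intro continuous_on_compose2[OF T(7)] continuous_on_compose2[OF T(8)] continuous_intros assms subset_UNIV)+

lemma \<Theta>_ge: "\<delta> powr p \<le> \<Theta> x s"
proof -
 have "\<delta> powr p = (\<delta>\<^sup>2) powr (p / 2)" using \<delta> by (subst square_powr_half) auto
 also have "\<dots> \<le> \<Theta> x s" unfolding \<Theta>_def using p by (intro powr_mono2) auto
 finally show ?thesis .
qed

lemma \<Theta>_zero: "\<phi> (s *\<^sub>R x) = 0 \<Longrightarrow> \<Theta> x s = \<delta> powr p"
 using \<delta> square_powr_half[of \<delta> p] by (simp add: \<Theta>_def)

lemma cont_\<Theta>: "continuous_on {a..b} (\<lambda>s. \<Theta> x s * s powr r)"
 unfolding \<Theta>_def using ab sq_pos by (intro continuous_intros cont_comp) (auto simp: less_imp_neq[OF sq_pos, symmetric])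

lemma cont_pow: "continuous_on {a..b} (\<lambda>s. k * s powr r)"
 using ab by (intro continuous_intros) auto

lemma P_ge: "P0 \<le> P x"
 unfolding P_def P0_def
proof (rule integral_le)
 show "(\<lambda>s. \<delta> powr p * s powr (e - 1)) integrable_on {a..b}" by (rule integrable_continuous_interval[OF cont_pow])
 show "(\<lambda>s. \<Theta> x s * s powr (e - 1)) integrable_on {a..b}" by (rule integrable_continuous_interval[OF cont_\<Theta>])
qed (intro mult_right_mono \<Theta>_ge, simp)

lemma P0_pos: "0 < P0"
proof -
 have c: "continuous_on {a..b} (\<lambda>s. \<delta> powr p * s powr (e - 1))" by (rule cont_pow)
 have "\<exists>k>0. \<forall>s\<in>{a..b}. k \<le> \<delta> powr p * s powr (e - 1)"
 proof -
  obtain s where s: "s \<in> {a..b}" "\<forall>t\<in>{a..b}. \<delta> powr p * s powr (e - 1) \<le> \<delta> powr p * t powr (e - 1)"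
   using continuous_attains_inf[OF _ _ c] ab by auto
  moreover have "0 < \<delta> powr p * s powr (e - 1)" using s(1) ab \<delta> by auto
  ultimately show ?thesis by blast
 qed
 then obtain k where k: "k > 0" "\<forall>s\<in>{a..b}. k \<le> \<delta> powr p * s powr (e - 1)" by blast
 have "0 < (b - a) * k" using k ab by simp
 also have "\<dots> = integral {a..b} (\<lambda>s. k)" using ab by simp
 also have "\<dots> \<le> P0" unfolding P0_def by (rule integral_le) (use k c in "auto intro: integrable_continuous_interval")
 finally show ?thesis .
qed

lemma P_pos: "0 < P x" using P0_pos P_ge[of x] by simp

lemma u_nonneg: "0 \<le> u x"
 unfolding u_def using P_ge[of x] P0_pos p by (simp add: powr_mono2)

text \<open>The integrand is smooth jointly in x and s > 0, as the base of each power stays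
  positive; the parameter integral inherits this.\<close>

lemma smooth_P: "smooth_on UNIV P"
proof -
 let ?S = "(UNIV :: 'a set) \<times> {0<..} :: ('a \<times> real) set"
 have o: "open ?S" by (intro open_Times) auto
 have lin1: "smooth_on ?S (\<lambda>z. fst z \<bullet> i)" for i :: 'a
  using o by (intro smooth_on_linear bounded_linear_compose[OF bounded_linear_inner_left bounded_linear_fst])
 have lin2: "smooth_on ?S snd" using o by (intro smooth_on_linear bounded_linear_snd)
 have 1: "smooth_on ?S (\<lambda>z. \<phi> (snd z *\<^sub>R fst z))"
 proof (rule smooth_on_compose[OF o open_UNIV T(1)])
  show "smooth_on ?S (\<lambda>z. snd z *\<^sub>R fst z \<bullet> i)" for i :: 'a
   unfolding inner_scaleR_left by (intro smooth_on_mult o lin1 lin2)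
 qed auto
 have 2: "smooth_on ?S (\<lambda>z. (\<phi> (snd z *\<^sub>R fst z))\<^sup>2 + \<delta>\<^sup>2)" unfolding power2_eq_square by (intro smooth_on_add smooth_on_mult smooth_on_const o 1)
 have 3: "smooth_on ?S (\<lambda>z. ((\<phi> (snd z *\<^sub>R fst z))\<^sup>2 + \<delta>\<^sup>2) powr (p / 2))"
  by (rule smooth_on_compose_real[OF o _ smooth_on_powr 2]) (use sq_pos in auto)
 have 4: "smooth_on ?S (\<lambda>z. snd z powr (e - 1))" by (rule smooth_on_compose_real[OF o _ smooth_on_powr lin2]) auto
 have "smooth_on ?S (\<lambda>z. ((\<phi> (snd z *\<^sub>R fst z))\<^sup>2 + \<delta>\<^sup>2) powr (p / 2) * snd z powr (e - 1))" by (intro smooth_on_mult o 3 4)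
 moreover have "{a..b} \<subseteq> {0<..}" using ab by auto
 ultimately show ?thesis using smooth_on_integral[OF open_UNIV, of "{0<..}" _ a b] by (fastforce simp: P_def[abs_def] \<Theta>_def)
qed

lemma smooth_u: "smooth_on UNIV u"
proof -
 have "smooth_on UNIV (\<lambda>x. P x powr (1 / p))" by (rule smooth_on_compose_real[OF _ _ smooth_on_powr smooth_P]) (use P_pos in auto)
 then show ?thesis unfolding u_def[abs_def] by (intro smooth_on_diff smooth_on_const) auto
qed

lemma u_test: "u \<in> tests"
proof (rule sphere_test_functionsI)
 show "smooth_on (- {0}) (\<lambda>x. u (sgn x))" by (rule smooth_on_compose[OF _ open_UNIV smooth_u]) (auto intro: smooth_on_sgn)
 let ?S = "supp \<phi> - ball 0 a"
 have "continuous_on ?S sgn" using ab by (intro continuous_intros) auto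
 moreover have "compact ?S" by (intro compact_diff T open_ball)
 ultimately show "compact (sgn ` ?S)" by (rule compact_continuous_image)
 show "sgn ` ?S \<subseteq> G"
 proof safe
  fix x assume x: "x \<in> supp \<phi>" "x \<notin> ball 0 a"
  then have "x \<in> K" "x \<noteq> 0" using T(3) ab by auto
  from sgn_in_G[OF this] show "sgn x \<in> K" "sgn x \<in> sphere 0 1" by auto
 qed
 show "u w = 0" if w: "norm w = 1" "w \<notin> sgn ` ?S" for w
 proof -
  have "\<phi> (s *\<^sub>R w) = 0" if s: "s \<in> {a..b}" for s
  proof (rule ccontr)
   assume "\<phi> (s *\<^sub>R w) \<noteq> 0"
   then have "s *\<^sub>R w \<in> ?S" using s w ab T(4)[of "s *\<^sub>R w"] by auto
   moreover have "sgn (s *\<^sub>R w) = w" using s ab w by (simp add: sgn_scaleR sgn_div_norm)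
   ultimately show False using w(2) by force
  qed
  then have "P w = P0" unfolding P_def P0_def by (intro integral_cong) (simp add: \<Theta>_zero)
  then show ?thesis by (simp add: u_def)
 qed
qed

lemma P_directional: "((\<lambda>t. P (x + t *\<^sub>R v)) has_real_derivative integral {a..b} (\<lambda>s. p * (A x s * (v \<bullet> grad \<phi> (s *\<^sub>R x))))) (at 0)"
proof -
 let ?g = "\<lambda>t s. p * (A (x + t *\<^sub>R v) s * (v \<bullet> grad \<phi> (s *\<^sub>R (x + t *\<^sub>R v))))"
 have "((\<lambda>t. integral (cbox a b) (\<lambda>s. \<Theta> (x + t *\<^sub>R v) s * s powr (e - 1))) has_real_derivative integral (cbox a b) (?g 0)) (at 0 within UNIV)"
 proof (rule leibniz_rule_field_derivative)
  fix t s :: real assume s: "s \<in> cbox a b"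
  then have s0: "0 < s" using ab by auto
  let ?x = "x + t *\<^sub>R v"
  have "((\<lambda>t. \<phi> (s *\<^sub>R x + t *\<^sub>R (s *\<^sub>R v))) has_real_derivative (s *\<^sub>R v) \<bullet> grad \<phi> (s *\<^sub>R x + t *\<^sub>R (s *\<^sub>R v))) (at t)"
   by (rule GDERIV_direction[OF T(5)])
  then have d: "((\<lambda>t. \<phi> (s *\<^sub>R (x + t *\<^sub>R v))) has_real_derivative s * (v \<bullet> grad \<phi> (s *\<^sub>R ?x))) (at t)" by (simp add: scaleR_add_right mult.commute)
  have d2: "((\<lambda>t. (\<phi> (s *\<^sub>R (x + t *\<^sub>R v)))\<^sup>2 + \<delta>\<^sup>2) has_real_derivative 2 * \<phi> (s *\<^sub>R ?x) * (s * (v \<bullet> grad \<phi> (s *\<^sub>R ?x)))) (at t)"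
   by (rule derivative_eq_intros d refl | simp)+
  have "((\<lambda>t. \<Theta> (x + t *\<^sub>R v) s) has_real_derivative
    (p / 2 * ((\<phi> (s *\<^sub>R ?x))\<^sup>2 + \<delta>\<^sup>2) powr (p / 2 - 1)) * (2 * \<phi> (s *\<^sub>R ?x) * (s * (v \<bullet> grad \<phi> (s *\<^sub>R ?x))))) (at t)"
   unfolding \<Theta>_def by (rule DERIV_chain2[OF has_real_derivative_powr[OF sq_pos] d2])
  from DERIV_cmult_right[OF this, of "s powr (e - 1)"]
  have "((\<lambda>t. \<Theta> (x + t *\<^sub>R v) s * s powr (e - 1)) has_real_derivative
    ((p / 2 * ((\<phi> (s *\<^sub>R ?x))\<^sup>2 + \<delta>\<^sup>2) powr (p / 2 - 1)) * (2 * \<phi> (s *\<^sub>R ?x) * (s * (v \<bullet> grad \<phi> (s *\<^sub>R ?x))))) * s powr (e - 1)) (at t)" .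
  moreover have "s powr e = s * s powr (e - 1)" using s0 by (simp add: powr_diff)
  ultimately show "((\<lambda>t. \<Theta> (x + t *\<^sub>R v) s * s powr (e - 1)) has_real_derivative ?g t s) (at t within UNIV)" by (simp add: A_def ac_simps)
 next
  show "(\<lambda>s. \<Theta> (x + t *\<^sub>R v) s * s powr (e - 1)) integrable_on cbox a b" for t
   using integrable_continuous_interval[OF cont_\<Theta>] by simp
  have ne: "(\<phi> y)\<^sup>2 + \<delta>\<^sup>2 \<noteq> 0" for y by (rule less_imp_neq[OF sq_pos, symmetric])
  have "continuous_on (UNIV \<times> cbox a b) (\<lambda>z. ?g (fst z) (snd z))" unfolding A_def using ab ne by (intro continuous_intros cont_comp) auto
  then show "continuous_on (UNIV \<times> cbox a b) (\<lambda>(t, s). ?g t s)" by (simp add: split_beta)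
 qed auto
 then show ?thesis by (simp add: P_def)
qed

lemma cont_A: "continuous_on {a..b} (\<lambda>s. A x s * (v \<bullet> grad \<phi> (s *\<^sub>R x)))" "continuous_on {a..b} (A x)"
proof -
 have ne: "(\<phi> y)\<^sup>2 + \<delta>\<^sup>2 \<noteq> 0" for y by (rule less_imp_neq[OF sq_pos, symmetric])
 show "continuous_on {a..b} (\<lambda>s. A x s * (v \<bullet> grad \<phi> (s *\<^sub>R x)))" "continuous_on {a..b} (A x)"
  unfolding A_def[abs_def] using ab ne by (intro continuous_intros cont_comp; auto)+
qed

lemma P_grad: "v \<bullet> grad P x = p * integral {a..b} (\<lambda>s. A x s * (v \<bullet> grad \<phi> (s *\<^sub>R x)))"
proof -
 have "GDERIV P (x + 0 *\<^sub>R v) :> grad P x" using smooth_on_GDERIV[OF smooth_P, of x] by simp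
 then have "((\<lambda>t. P (x + t *\<^sub>R v)) has_real_derivative v \<bullet> grad P x) (at 0)" by (rule GDERIV_direction)
 from DERIV_unique[OF this P_directional] show ?thesis by simp
qed

lemma E_nonneg: "0 \<le> E x"
 unfolding E_def using ab p
 by (intro integral_nonneg integrable_continuous_interval continuous_on_mult continuous_on_powr' continuous_intros cont_comp) auto

lemma grad_u: "GDERIV u x :> ((1 / p) * P x powr (1 / p - 1)) *\<^sub>R grad P x"
proof -
 have "GDERIV P x :> grad P x" using smooth_on_GDERIV[OF smooth_P, of x] by simp
 from GDERIV_DERIV_compose[OF this has_real_derivative_powr[OF P_pos, of "1 / p"]]
 have "GDERIV (\<lambda>x. P x powr (1 / p)) x :> ((1 / p) * P x powr (1 / p - 1)) *\<^sub>R grad P x" .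
 then have "((\<lambda>x. P x powr (1 / p)) has_derivative (\<lambda>h. h \<bullet> ((1 / p) * P x powr (1 / p - 1)) *\<^sub>R grad P x)) (at x)" by (simp only: gderiv_def)
 from has_derivative_diff[OF this has_derivative_const[of "P0 powr (1 / p)"]]
 show ?thesis unfolding gderiv_def u_def[abs_def] by (simp only: diff_0_right)
qed

text \<open>The gradient of \<open>P\<close> is estimated by Hoelder's inequality in s between grad
  \<phi> and \<Theta>^((p-1)/p). The resulting power of \<open>P\<close> is exactly what the p-th
  root in \<open>u\<close> removes.\<close>

lemma grad_u_bound: "norm (grad u x) powr p \<le> E x"
proof -
 let ?N = "restrict_space lborel {a..b}"
 define q where "q = p / (p - 1)"
 have pq: "1 < p" "1 < q" "1 / p + 1 / q = 1" using p by (auto simp: q_def field_simps)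
 \<comment> \<open>The powers of s are split between \<open>f1\<close> and \<open>f2\<close> so that
   their product is s^e, while the q-th power of \<open>f1\<close> integrates to \<open>P\<close>
   and the p-th power of \<open>f2\<close> to \<open>E\<close>.\<close>
 define f1 where "f1 s = (\<Theta> x s * s powr (e - 1)) powr ((p - 1) / p)" for s
 define f2 where "f2 s = norm (grad \<phi> (s *\<^sub>R x)) * s powr (real (DIM('a) - 1) / p)" for s
 have \<Theta>0: "0 < \<Theta> x s" for s unfolding \<Theta>_def powr_gt_zero by (rule less_imp_neq[OF sq_pos, symmetric])
 have c1: "continuous_on {a..b} f1" unfolding f1_def
  by (intro continuous_on_powr' cont_\<Theta> continuous_on_const) (use \<Theta>0 p ab in "auto simp: less_imp_le")
 have c2: "continuous_on {a..b} f2" unfolding f2_def using ab by (intro continuous_intros cont_comp) auto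
 have f1p: "norm (f1 s) powr q = \<Theta> x s * s powr (e - 1)" for s
  using p \<Theta>0[of s] by (simp add: f1_def powr_powr q_def)
 have f2p: "norm (f2 s) powr p = norm (grad \<phi> (s *\<^sub>R x)) powr p * s powr real (DIM('a) - 1)" for s
  using p by (simp add: f2_def powr_mult powr_powr abs_mult)
 have cE: "continuous_on {a..b} (\<lambda>s. norm (grad \<phi> (s *\<^sub>R x)) powr p * s powr real (DIM('a) - 1))"
  using ab p by (intro continuous_on_mult continuous_on_powr' continuous_intros cont_comp) auto
 have L1: "Lp_member q ?N f1" and L2: "Lp_member p ?N f2" unfolding Lp_member_def f1p f2p
  using continuous_integral_interval(1)[OF c1] continuous_integral_interval(1)[OF c2]
   continuous_integral_interval(1)[OF cont_\<Theta>] continuous_integral_interval(1)[OF cE] by (blast intro: borel_measurable_integrable)+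
 have n1: "Lp_norm q ?N f1 = P x powr ((p - 1) / p)"
  unfolding Lp_norm_def f1p P_def using p continuous_integral_interval(2)[OF cont_\<Theta>] by (simp add: q_def)
 have n2: "Lp_norm p ?N f2 = E x powr (1 / p)" unfolding Lp_norm_def f2p E_def continuous_integral_interval(2)[OF cE] by (rule refl)
 have Aeq: "\<bar>A x s\<bar> * norm (grad \<phi> (s *\<^sub>R x)) \<le> f2 s * f1 s" if s: "s \<in> {a..b}" for s
 proof -
  let ?S = "(\<phi> (s *\<^sub>R x))\<^sup>2 + \<delta>\<^sup>2"
  have s0: "0 < s" using s ab by auto
  have "\<bar>\<phi> (s *\<^sub>R x)\<bar> = sqrt ((\<phi> (s *\<^sub>R x))\<^sup>2)" by simp
  also have "\<dots> \<le> sqrt ?S" by (rule real_sqrt_le_mono) simp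
  also have "\<dots> = ?S powr (1/2)" using sq_pos[of "s *\<^sub>R x"] by (simp add: powr_half_sqrt)
  finally have "\<bar>A x s\<bar> \<le> ?S powr (p / 2 - 1) * ?S powr (1/2) * s powr e" unfolding A_def abs_mult by (auto intro!: mult_right_mono mult_left_mono)
  also have "?S powr (p / 2 - 1) * ?S powr (1/2) = ?S powr ((p - 1) / 2)" by (simp add: powr_add[symmetric] field_simps)
  also have "s powr e = s powr ((e - 1) * ((p - 1) / p)) * s powr (real (DIM('a) - 1) / p)"
  proof -
   have "real (DIM('a) - 1) = e + p - 1" by (simp add: e_def of_nat_diff)
   then have "(e - 1) * ((p - 1) / p) + real (DIM('a) - 1) / p = e" using p by (simp add: field_simps)
   then show ?thesis by (simp add: powr_add[symmetric])
  qed
  also have "?S powr ((p - 1) / 2) * (s powr ((e - 1) * ((p - 1) / p)) * s powr (real (DIM('a) - 1) / p)) = f1 s * s powr (real (DIM('a) - 1) / p)"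
   using p by (simp add: f1_def \<Theta>_def powr_mult powr_powr)
  finally have "\<bar>A x s\<bar> * norm (grad \<phi> (s *\<^sub>R x)) \<le> (f1 s * s powr (real (DIM('a) - 1) / p)) * norm (grad \<phi> (s *\<^sub>R x))"
   by (intro mult_right_mono) auto
  then show ?thesis by (simp add: f2_def ac_simps)
 qed
 have dir: "v \<bullet> grad P x \<le> p * norm v * (E x powr (1 / p) * P x powr ((p - 1) / p))" for v
 proof -
  have "integral {a..b} (\<lambda>s. A x s * (v \<bullet> grad \<phi> (s *\<^sub>R x))) = (LINT s|?N. A x s * (v \<bullet> grad \<phi> (s *\<^sub>R x)))"
   by (rule continuous_integral_interval(2)[OF cont_A(1)])
  also have "\<dots> \<le> (LINT s|?N. norm v * \<bar>f2 s * f1 s\<bar>)"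
  proof (rule integral_mono)
   show "integrable ?N (\<lambda>s. A x s * (v \<bullet> grad \<phi> (s *\<^sub>R x)))" by (rule continuous_integral_interval(1)[OF cont_A(1)])
   show "integrable ?N (\<lambda>s. norm v * \<bar>f2 s * f1 s\<bar>)" by (rule continuous_integral_interval(1)) (intro continuous_intros c1 c2)
   fix s assume "s \<in> space ?N"
   then have s: "s \<in> {a..b}" by (simp add: space_restrict_space)
   have "A x s * (v \<bullet> grad \<phi> (s *\<^sub>R x)) \<le> \<bar>A x s\<bar> * \<bar>v \<bullet> grad \<phi> (s *\<^sub>R x)\<bar>" by (simp add: abs_mult[symmetric])
   also have "\<dots> \<le> \<bar>A x s\<bar> * (norm v * norm (grad \<phi> (s *\<^sub>R x)))" by (intro mult_left_mono Cauchy_Schwarz_ineq2) auto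
   also have "\<dots> = norm v * (\<bar>A x s\<bar> * norm (grad \<phi> (s *\<^sub>R x)))" by simp
   also have "\<dots> \<le> norm v * \<bar>f2 s * f1 s\<bar>" using Aeq[OF s] by (intro mult_left_mono) auto
   finally show "A x s * (v \<bullet> grad \<phi> (s *\<^sub>R x)) \<le> norm v * \<bar>f2 s * f1 s\<bar>" .
  qed
  also have "\<dots> = norm v * (LINT s|?N. \<bar>f2 s * f1 s\<bar>)" by simp
  also have "\<dots> \<le> norm v * (Lp_norm p ?N f2 * Lp_norm q ?N f1)" by (intro mult_left_mono integral_Hoelder[OF pq L2 L1]) simp
  finally show ?thesis unfolding P_grad n1 n2 using p by simp
 qed
 have "norm (grad P x) * norm (grad P x) \<le> (p * (E x powr (1 / p) * P x powr ((p - 1) / p))) * norm (grad P x)"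
  using dir[of "grad P x"] unfolding dot_square_norm power2_eq_square by (simp only: ac_simps)
 then have nP: "norm (grad P x) \<le> p * (E x powr (1 / p) * P x powr ((p - 1) / p))"
 proof (cases "norm (grad P x) = 0")
  case True
  show ?thesis unfolding True using p by (intro mult_nonneg_nonneg) auto
 next
  case False
  then have "0 < norm (grad P x)" by simp
  with \<open>norm (grad P x) * norm (grad P x) \<le> _\<close> show ?thesis by (rule mult_right_le_imp_le)
 qed
 have "norm (grad u x) = (1 / p) * P x powr (1 / p - 1) * norm (grad P x)" using p by (simp add: grad_eq[OF grad_u])
 also have "\<dots> \<le> (1 / p) * P x powr (1 / p - 1) * (p * (E x powr (1 / p) * P x powr ((p - 1) / p)))" using p by (intro mult_left_mono nP) auto
 also have "\<dots> = (P x powr (1 / p - 1) * P x powr ((p - 1) / p)) * E x powr (1 / p)" using p by simp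
 also have "P x powr (1 / p - 1) * P x powr ((p - 1) / p) = P x powr 0"
  unfolding powr_add[symmetric] using p by (intro arg_cong2[where f="(powr)"]) (auto simp: field_simps)
 finally have "norm (grad u x) \<le> E x powr (1 / p)" using P_pos[of x] by simp
 then have "norm (grad u x) powr p \<le> (E x powr (1 / p)) powr p" using p by (intro powr_mono2) auto
 then show ?thesis using p E_nonneg[of x] by (simp add: powr_powr)
qed

text \<open>Euler's identity for the nearly homogeneous \<open>P\<close>: integrate the derivative
  of s^e times \<Theta> over [a,b] and subtract the same identity for the constant \<delta>^p. The
  end b drops out since \<phi> vanishes there; the end a survives.\<close>

lemma radial_P:
 assumes w: "norm w = 1"
 shows "w \<bullet> grad P w = - e * (P w - P0) - a powr e * (\<Theta> w a - \<delta> powr p)"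
proof -
 have d\<Theta>: "((\<lambda>s. \<Theta> w s) has_real_derivative p * (((\<phi> (s *\<^sub>R w))\<^sup>2 + \<delta>\<^sup>2) powr (p / 2 - 1) * \<phi> (s *\<^sub>R w)) * (w \<bullet> grad \<phi> (s *\<^sub>R w))) (at s)" for s
 proof -
  have "((\<lambda>s. \<phi> (0 + s *\<^sub>R w)) has_real_derivative w \<bullet> grad \<phi> (0 + s *\<^sub>R w)) (at s)" by (rule GDERIV_direction[OF T(5)])
  then have d: "((\<lambda>s. \<phi> (s *\<^sub>R w)) has_real_derivative w \<bullet> grad \<phi> (s *\<^sub>R w)) (at s)" by simp
  have d2: "((\<lambda>s. (\<phi> (s *\<^sub>R w))\<^sup>2 + \<delta>\<^sup>2) has_real_derivative 2 * \<phi> (s *\<^sub>R w) * (w \<bullet> grad \<phi> (s *\<^sub>R w))) (at s)"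
   by (rule derivative_eq_intros d refl | simp)+
  have "((\<lambda>s. \<Theta> w s) has_real_derivative (p / 2 * ((\<phi> (s *\<^sub>R w))\<^sup>2 + \<delta>\<^sup>2) powr (p / 2 - 1)) * (2 * \<phi> (s *\<^sub>R w) * (w \<bullet> grad \<phi> (s *\<^sub>R w)))) (at s)"
   unfolding \<Theta>_def by (rule DERIV_chain2[OF has_real_derivative_powr[OF sq_pos] d2])
  then show ?thesis by (simp add: ac_simps)
 qed
 have dpow: "((\<lambda>s. s powr e) has_real_derivative e * s powr (e - 1)) (at s)" if "s \<in> {a..b}" for s
  using that ab by (intro has_real_derivative_powr) auto
 have "((\<lambda>s. e * (\<Theta> w s * s powr (e - 1)) + p * (A w s * (w \<bullet> grad \<phi> (s *\<^sub>R w)))) has_integral (\<Theta> w b * b powr e - \<Theta> w a * a powr e)) {a..b}"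
 proof (rule fundamental_theorem_of_calculus)
  fix s assume s: "s \<in> {a..b}"
  have "((\<lambda>s. \<Theta> w s * s powr e) has_real_derivative
    (\<Theta> w s * (e * s powr (e - 1)) + (p * (((\<phi> (s *\<^sub>R w))\<^sup>2 + \<delta>\<^sup>2) powr (p / 2 - 1) * \<phi> (s *\<^sub>R w)) * (w \<bullet> grad \<phi> (s *\<^sub>R w))) * s powr e)) (at s)"
   by (rule DERIV_mult'[OF d\<Theta> dpow[OF s]])
  moreover have "\<Theta> w s * (e * s powr (e - 1)) + (p * (((\<phi> (s *\<^sub>R w))\<^sup>2 + \<delta>\<^sup>2) powr (p / 2 - 1) * \<phi> (s *\<^sub>R w)) * (w \<bullet> grad \<phi> (s *\<^sub>R w))) * s powr e =
    e * (\<Theta> w s * s powr (e - 1)) + p * (A w s * (w \<bullet> grad \<phi> (s *\<^sub>R w)))" by (simp add: A_def) ultimately show "((\<lambda>s. \<Theta> w s * s powr e) has_vector_derivative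
    e * (\<Theta> w s * s powr (e - 1)) + p * (A w s * (w \<bullet> grad \<phi> (s *\<^sub>R w)))) (at s within {a..b})"
   unfolding has_real_derivative_iff_has_vector_derivative by (simp only: has_vector_derivative_at_within)
 qed (use ab in simp)
 then have "\<Theta> w b * b powr e - \<Theta> w a * a powr e = integral {a..b} (\<lambda>s. e * (\<Theta> w s * s powr (e - 1)) + p * (A w s * (w \<bullet> grad \<phi> (s *\<^sub>R w))))"
  by (simp add: integral_unique)
 also have "\<dots> = e * P w + w \<bullet> grad P w" unfolding P_grad P_def by (subst Henstock_Kurzweil_Integration.integral_add)
    (auto intro!: integrable_continuous_interval continuous_intros cont_\<Theta> cont_A)
 finally have 1: "\<Theta> w b * b powr e - \<Theta> w a * a powr e = e * P w + w \<bullet> grad P w" .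
 have "((\<lambda>s. e * (\<delta> powr p * s powr (e - 1))) has_integral (\<delta> powr p * b powr e - \<delta> powr p * a powr e)) {a..b}"
 proof (rule fundamental_theorem_of_calculus)
  fix s assume s: "s \<in> {a..b}"
  have "((\<lambda>s. \<delta> powr p * s powr e) has_real_derivative e * (\<delta> powr p * s powr (e - 1))) (at s)"
   using DERIV_cmult[OF dpow[OF s], of "\<delta> powr p"] by (simp only: mult.left_commute)
  then show "((\<lambda>s. \<delta> powr p * s powr e) has_vector_derivative e * (\<delta> powr p * s powr (e - 1))) (at s within {a..b})"
   unfolding has_real_derivative_iff_has_vector_derivative by (rule has_vector_derivative_at_within)
 qed (use ab in simp)
 from integral_unique[OF this] have 2: "\<delta> powr p * b powr e - \<delta> powr p * a powr e = e * P0"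
  unfolding P0_def Henstock_Kurzweil_Integration.integral_mult_right by (rule sym)
 have "\<Theta> w b = \<delta> powr p" using ab w by (intro \<Theta>_zero b) simp
 with 1 2 show ?thesis by (simp add: algebra_simps)
qed

text \<open>For c > 0 the boundary term at a has the same sign as the main term and only helps;
  otherwise \<phi> vanishes at radius a and there is none. The passage from \<open>P\<close> to
  \<open>u\<close> uses P^(1/p - 1) P0 \<le> P0^(1/p), valid as P0 \<le> P.\<close>

lemma radial_u:
 assumes w: "norm w = 1"
 shows "\<bar>c * u w\<bar> \<le> \<bar>w \<bullet> grad u w\<bar>"
proof -
 have "\<bar>e\<bar> * (P w - P0) \<le> \<bar>w \<bullet> grad P w\<bar>"
 proof (cases "0 < c")
  case True
  then have "0 < e" using p by (simp add: c_eq zero_less_divide_iff)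
  then have "0 \<le> e * (P w - P0)" "0 \<le> a powr e * (\<Theta> w a - \<delta> powr p)" using P_ge[of w] \<Theta>_ge[of w a] by auto
  then show ?thesis unfolding radial_P[OF w] using \<open>0 < e\<close> by simp
 next
  case False
  then have "\<Theta> w a = \<delta> powr p" using a w ab by (intro \<Theta>_zero) auto
  then show ?thesis unfolding radial_P[OF w] using P_ge[of w] by (simp add: abs_mult)
 qed
 then have 1: "(1 / p) * P w powr (1 / p - 1) * (\<bar>e\<bar> * (P w - P0)) \<le> (1 / p) * P w powr (1 / p - 1) * \<bar>w \<bullet> grad P w\<bar>"
  using p by (intro mult_left_mono) auto
 have "P w powr (1 / p - 1) * P0 \<le> P0 powr (1 / p - 1) * P0" using p P0_pos P_ge[of w] by (intro mult_right_mono powr_mono2') auto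
 also have "\<dots> = P0 powr (1 / p)" using P0_pos by (simp add: powr_diff)
 finally have "u w \<le> P w powr (1 / p - 1) * (P w - P0)" using P_pos[of w] by (simp add: u_def powr_diff right_diff_distrib)
 then have "\<bar>e\<bar> / p * u w \<le> \<bar>e\<bar> / p * (P w powr (1 / p - 1) * (P w - P0))" using p by (intro mult_left_mono) auto
 also have "\<dots> = (1 / p) * P w powr (1 / p - 1) * (\<bar>e\<bar> * (P w - P0))" by simp
 also note 1
 also have "(1 / p) * P w powr (1 / p - 1) * \<bar>w \<bullet> grad P w\<bar> = \<bar>w \<bullet> grad u w\<bar>" using p by (simp add: grad_eq[OF grad_u] abs_mult)
 finally show ?thesis using p u_nonneg[of w] by (simp add: c_eq abs_mult abs_divide)
qed

text \<open>The zeroth-order term c u is dominated by the radial derivative, so the pair on the left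
  has at most the norm of the full gradient.\<close>

lemma competitor_bound:
 assumes w: "norm w = 1"
 shows "norm (c * u w, tgrad u w) powr p \<le> E w"
proof -
 have D: "GDERIV u w :> grad u w" using smooth_on_GDERIV[OF smooth_u, of w] by simp
 have "(c * u w)\<^sup>2 \<le> (w \<bullet> grad u w)\<^sup>2" using radial_u[OF w] by (rule abs_le_square_iff[THEN iffD1])
 then have "(norm (c * u w, tgrad u w))\<^sup>2 \<le> (norm (grad u w))\<^sup>2" using norm_tgrad_sgn(2)[OF D w] by (simp add: norm_Pair)
 then have "norm (c * u w, tgrad u w) \<le> norm (grad u w)" by (rule power2_le_imp_le) simp
 then have "norm (c * u w, tgrad u w) powr p \<le> norm (grad u w) powr p" using p by (intro powr_mono2) auto
 with grad_u_bound show ?thesis by (rule order_trans[rotated])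
qed

lemma \<Lambda>_I_u_le: "ennreal (\<Lambda> * I u) \<le> (\<integral>\<^sup>+x. ennreal (norm (grad \<phi> x) powr p) \<partial>lborel)"
proof -
 have [measurable]: "grad \<phi> \<in> borel_funs" using T(8) by (rule borel_measurable_continuous_onI)
 have LP: "Lp_member p M (\<lambda>w. (c * u w, tgrad u w))" by (intro Lp_member_pair test_Lp[OF u_test])
 have "ennreal (\<Lambda> * I u) \<le> ennreal (Q u)" by (intro ennreal_leI \<Lambda>_le u_test)
 also have "\<dots> = (\<integral>\<^sup>+w. ennreal (norm (c * u w, tgrad u w) powr p) \<partial>M)"
  unfolding Q_def using LP by (intro nn_integral_eq_integral[symmetric]) (auto simp: Lp_member_def)
 also have "\<dots> \<le> (\<integral>\<^sup>+w. ennreal (E w) \<partial>M)" using competitor_bound by (intro nn_integral_mono ennreal_leI) auto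
 also have "\<dots> \<le> (\<integral>\<^sup>+w. ennreal (E w) \<partial>sphere_borel)"
  unfolding nn_integral_M unfolding sphere_measure_eq nn_integral_completion by (intro nn_integral_mono) (auto simp: indicator_def)
 also have "\<dots> \<le> (\<integral>\<^sup>+w. (\<integral>\<^sup>+s\<in>{0<..}. ennreal (norm (grad \<phi> (s *\<^sub>R w)) powr p) * ennreal (s ^ (DIM('a) - 1)) \<partial>lborel) \<partial>sphere_borel)"
 proof (rule nn_integral_mono)
  fix w :: 'a
  let ?g = "\<lambda>s. norm (grad \<phi> (s *\<^sub>R w)) powr p * s powr real (DIM('a) - 1)"
  have cg: "continuous_on {a..b} ?g" using ab p by (auto intro!: continuous_intros cont_comp continuous_on_powr')
  have "ennreal (E w) = ennreal (LINT s|restrict_space lborel {a..b}. ?g s)" unfolding E_def by (simp only: continuous_integral_interval(2)[OF cg])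
  also have "\<dots> = (\<integral>\<^sup>+s. ennreal (?g s) \<partial>restrict_space lborel {a..b})"
   by (rule nn_integral_eq_integral[symmetric, OF continuous_integral_interval(1)[OF cg]]) auto
  also have "\<dots> = (\<integral>\<^sup>+s\<in>{a..b}. ennreal (?g s) \<partial>lborel)" by (rule nn_integral_restrict_space) simp
  also have "\<dots> \<le> (\<integral>\<^sup>+s\<in>{0<..}. ennreal (norm (grad \<phi> (s *\<^sub>R w)) powr p) * ennreal (s ^ (DIM('a) - 1)) \<partial>lborel)"
  proof (rule nn_integral_mono)
   fix s
   show "ennreal (?g s) * ind {a..b} s \<le> ennreal (norm (grad \<phi> (s *\<^sub>R w)) powr p) * ennreal (s ^ (DIM('a) - 1)) * ind {0<..} s"
   proof (cases "s \<in> {a..b}")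
    case True
    then have "0 < s" using ab by auto
    then have "s powr real (DIM('a) - 1) = s ^ (DIM('a) - 1)" by (rule powr_realpow)
    then show ?thesis using True \<open>0 < s\<close> by (simp add: ennreal_mult)
   qed simp
  qed
  finally show "ennreal (E w) \<le> (\<integral>\<^sup>+s\<in>{0<..}. ennreal (norm (grad \<phi> (s *\<^sub>R w)) powr p) * ennreal (s ^ (DIM('a) - 1)) \<partial>lborel)" .
 qed
 also have "\<dots> = (\<integral>\<^sup>+x. ennreal (norm (grad \<phi> x) powr p) \<partial>lborel)" by (rule nn_integral_polar[symmetric]) measurable
 finally show ?thesis .
qed

text \<open>The p-mean along the ray without regularisation, to which \<open>u\<close> is compared
  as \<delta> tends to 0.\<close>

definition U :: "'a \<Rightarrow> real" where "U x = integral {a..b} (\<lambda>s. \<bar>\<phi> (s *\<^sub>R x)\<bar> powr p * s powr (e - 1)) powr (1 / p)"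

lemma cont_U: "continuous_on {a..b} (\<lambda>s. \<bar>\<phi> (s *\<^sub>R x)\<bar> powr p * s powr (e - 1))"
 using ab p by (auto intro!: continuous_intros cont_comp continuous_on_powr')

lemma U_le: "U w \<le> u w + P0 powr (1 / p)"
proof -
 have "integral {a..b} (\<lambda>s. \<bar>\<phi> (s *\<^sub>R w)\<bar> powr p * s powr (e - 1)) \<le> P w" unfolding P_def
 proof (rule integral_le)
  show "(\<lambda>s. \<bar>\<phi> (s *\<^sub>R w)\<bar> powr p * s powr (e - 1)) integrable_on {a..b}" "(\<lambda>s. \<Theta> w s * s powr (e - 1)) integrable_on {a..b}"
   by (intro integrable_continuous_interval cont_U cont_\<Theta>)+
  fix s assume "s \<in> {a..b}"
  have "\<bar>\<phi> (s *\<^sub>R w)\<bar> powr p = (\<bar>\<phi> (s *\<^sub>R w)\<bar>\<^sup>2) powr (p / 2)" by (subst square_powr_half) auto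
  also have "\<dots> \<le> \<Theta> w s" unfolding \<Theta>_def using p by (intro powr_mono2) auto
  finally show "\<bar>\<phi> (s *\<^sub>R w)\<bar> powr p * s powr (e - 1) \<le> \<Theta> w s * s powr (e - 1)" by (intro mult_right_mono) auto
 qed
 then have "U w \<le> P w powr (1 / p)" unfolding U_def using p
  by (intro powr_mono2) (auto intro!: integral_nonneg integrable_continuous_interval cont_U)
 then show ?thesis by (simp add: u_def)
qed

end

section \<open>Removing the regularisation and the truncation\<close>

lemma nn_integral_Fatou_le:
 fixes f :: "nat \<Rightarrow> 'a \<Rightarrow> ennreal"
 assumes "\<And>n. f n \<in> borel_measurable M" "AE x in M. (\<lambda>n. f n x) ----> g x"
  and "\<And>n. (\<integral>\<^sup>+x. f n x \<partial>M) \<le> T n" "T ----> L"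
 shows "(\<integral>\<^sup>+x. g x \<partial>M) \<le> L"
proof -
 have "(\<integral>\<^sup>+x. g x \<partial>M) = (\<integral>\<^sup>+x. liminf (\<lambda>n. f n x) \<partial>M)"
  using assms(2) by (intro nn_integral_cong_AE) (auto elim!: eventually_mono dest: lim_imp_Liminf[OF sequentially_bot])
 also have "\<dots> \<le> liminf (\<lambda>n. \<integral>\<^sup>+x. f n x \<partial>M)" using assms(1) by (rule nn_integral_liminf)
 also have "\<dots> \<le> liminf T" using assms(3) by (intro Liminf_mono always_eventually) auto
 also have "\<dots> = L" using assms(4) by (rule lim_imp_Liminf[OF sequentially_bot])
 finally show ?thesis .
qed

lemma (in ray_average) \<Lambda>_U_le: "(\<integral>\<^sup>+w. ennreal (\<Lambda> * max 0 (U w - P0 powr (1 / p)) powr p) \<partial>M) \<le> (\<integral>\<^sup>+x. ennreal (norm (grad \<phi> x) powr p) \<partial>lborel)"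
proof -
 have "(\<integral>\<^sup>+w. ennreal (\<Lambda> * max 0 (U w - P0 powr (1 / p)) powr p) \<partial>M) \<le> (\<integral>\<^sup>+w. ennreal (\<Lambda> * \<bar>u w\<bar> powr p) \<partial>M)"
 proof (intro nn_integral_mono ennreal_leI mult_left_mono \<Lambda>_nonneg powr_mono2)
  show "max 0 (U w - P0 powr (1 / p)) \<le> \<bar>u w\<bar>" for w using U_le[of w] by auto
 qed (use p in auto)
 also have "\<dots> = ennreal (\<Lambda> * I u)" using test_Lp(1)[OF u_test] \<Lambda>_nonneg by (subst nn_integral_eq_integral) (auto simp: Lp_member_def I_def)
 also note \<Lambda>_I_u_le
 finally show ?thesis .
qed

context hardy_cone
begin

text \<open>The limit of vanishing \<delta> in \<open>\<Lambda>_U_le\<close>, by Fatou; polar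
  coordinates then turn the spherical integral of the p-means into the Hardy integral over the
  annulus.\<close>

lemma Hardy_annulus:
 assumes \<phi>: "\<phi> \<in> test_functions K" and ab: "0 < a" "a < b"
  and b: "\<And>x. b \<le> norm x \<Longrightarrow> \<phi> x = 0"
  and a: "0 < c \<or> (\<forall>x. norm x = a \<longrightarrow> \<phi> x = 0)"
 shows "(\<integral>\<^sup>+x. ennreal (\<Lambda> * (\<bar>\<phi> x\<bar> / norm x) powr p) * ind {a..b} (norm x) \<partial>lborel) \<le> (\<integral>\<^sup>+x. ennreal (norm (grad \<phi> x) powr p) \<partial>lborel)" (is "_ \<le> ?T")
proof -
 note T = test_functionsD[OF \<phi>]
 have [measurable]: "\<phi> \<in> borel_funs" using T(7) by (rule borel_measurable_continuous_onI)
 define e where "e = real DIM('a) - p"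
 define W where "W x = (\<integral>\<^sup>+s\<in>{a..b}. ennreal (\<bar>\<phi> (s *\<^sub>R x)\<bar> powr p * s powr (e - 1)) \<partial>lborel)" for x
 define J where "J x = integral {a..b} (\<lambda>s. \<bar>\<phi> (s *\<^sub>R x)\<bar> powr p * s powr (e - 1))" for x
 define k where "k = integral {a..b} (\<lambda>s. s powr (e - 1))"
 define \<delta> where "\<delta> n = inverse (real (Suc n))" for n
 have \<delta>: "0 < \<delta> n" for n by (simp add: \<delta>_def)
 have ra: "ray_average K p \<phi> a b (\<delta> n)" for n by unfold_locales (use \<phi> ab b a \<delta> in auto)
 have e_eq: "ray_average.e TYPE('a) p = e" by (simp only: ray_average.e_def[OF ra] e_def)
 have cJ: "continuous_on {a..b} (\<lambda>s. \<bar>\<phi> (s *\<^sub>R x)\<bar> powr p * s powr (e - 1))" for x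
  by (rule ray_average.cont_U[OF ra, unfolded e_eq])
 have J0: "0 \<le> J x" for x unfolding J_def by (intro integral_nonneg integrable_continuous_interval cJ) simp
 have WJ: "W x = ennreal (J x)" for x
 proof -
  have "ennreal (J x) = ennreal (LINT s|restrict_space lborel {a..b}. \<bar>\<phi> (s *\<^sub>R x)\<bar> powr p * s powr (e - 1))"
   unfolding J_def by (simp only: continuous_integral_interval(2)[OF cJ])
  also have "\<dots> = (\<integral>\<^sup>+s. ennreal (\<bar>\<phi> (s *\<^sub>R x)\<bar> powr p * s powr (e - 1)) \<partial>restrict_space lborel {a..b})"
   by (rule nn_integral_eq_integral[symmetric, OF continuous_integral_interval(1)[OF cJ]]) auto
  also have "\<dots> = W x" unfolding W_def by (rule nn_integral_restrict_space) simp
  finally show ?thesis by simp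
 qed
 have [measurable]: "W \<in> borel_funs" unfolding W_def by measurable
 have "(\<lambda>x. enn2real (W x)) \<in> borel_funs" by measurable
 then have J_M: "J \<in> borel_measurable M" by (rule measurable_M_borel) (simp add: WJ J0)
 have step: "(\<integral>\<^sup>+w. ennreal (\<Lambda> * max 0 (J w powr (1 / p) - \<delta> n * k powr (1 / p)) powr p) \<partial>M) \<le> ?T" for n
 proof -
  have \<delta>n: "0 < \<delta> n" by (rule \<delta>)
  interpret ray_average K p \<phi> a b "\<delta> n" by (rule ra)
  \<comment> \<open>The p-th root of the subtracted constant is linear in \<delta>, hence disappears
    in the limit.\<close>
  have "P0 = (\<delta> n) powr p * k" unfolding P0_def k_def e_eq by simp
  moreover have "0 \<le> k" unfolding k_def using ab by (intro integral_nonneg integrable_continuous_interval continuous_intros) auto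
  ultimately have "P0 powr (1 / p) = \<delta> n * k powr (1 / p)" using p \<delta>n by (simp add: powr_mult powr_powr)
  moreover have "U w = J w powr (1 / p)" for w unfolding U_def J_def e_eq by simp
  ultimately show ?thesis using \<Lambda>_U_le by simp
 qed
 have "(\<integral>\<^sup>+w. ennreal (\<Lambda> * J w) \<partial>M) \<le> ?T"
 proof (rule nn_integral_Fatou_le[OF _ _ step tendsto_const])
  show "(\<lambda>w. ennreal (\<Lambda> * max 0 (J w powr (1 / p) - \<delta> n * k powr (1 / p)) powr p)) \<in> borel_measurable M" for n
   using J_M by measurable
  have "(\<lambda>n. ennreal (\<Lambda> * max 0 (J w powr (1 / p) - \<delta> n * k powr (1 / p)) powr p)) ----> ennreal (\<Lambda> * J w)" for w
  proof -
   have "(\<lambda>n. ennreal (\<Lambda> * max 0 (J w powr (1 / p) - \<delta> n * k powr (1 / p)) powr p)) ----> ennreal (\<Lambda> * max 0 (J w powr (1 / p) - 0 * k powr (1 / p)) powr p)"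
    unfolding \<delta>_def using p
    by (intro tendsto_ennrealI tendsto_mult tendsto_const tendsto_powr' tendsto_max tendsto_diff LIMSEQ_inverse_real_of_nat) auto
   then show ?thesis using J0[of w] p by (simp add: powr_powr)
  qed
  then show "AE w in M. (\<lambda>n. ennreal (\<Lambda> * max 0 (J w powr (1 / p) - \<delta> n * k powr (1 / p)) powr p)) ----> ennreal (\<Lambda> * J w)" by simp
 qed
 also have "(\<integral>\<^sup>+w. ennreal (\<Lambda> * J w) \<partial>M) = (\<integral>\<^sup>+w\<in>G. ennreal \<Lambda> * W w \<partial>sphere_borel)"
  unfolding nn_integral_M unfolding sphere_measure_eq nn_integral_completion by (simp add: WJ ennreal_mult' \<Lambda>_nonneg)
 also have "\<dots> = (\<integral>\<^sup>+x. ennreal (\<Lambda> * (\<bar>\<phi> x\<bar> / norm x) powr p) * ind {a..b} (norm x) \<partial>lborel)"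
 proof (subst nn_integral_polar)
  show "(\<lambda>x. ennreal (\<Lambda> * (\<bar>\<phi> x\<bar> / norm x) powr p) * ind {a..b} (norm x)) \<in> borel_funs" by measurable
  show "(\<integral>\<^sup>+w\<in>G. ennreal \<Lambda> * W w \<partial>sphere_borel) =
   (\<integral>\<^sup>+w. (\<integral>\<^sup>+s\<in>{0<..}. ennreal (\<Lambda> * (\<bar>\<phi> (s *\<^sub>R w)\<bar> / norm (s *\<^sub>R w)) powr p) * ind {a..b} (norm (s *\<^sub>R w)) *
    ennreal (s ^ (DIM('a) - 1)) \<partial>lborel) \<partial>sphere_borel)"
  proof (rule nn_integral_cong_AE, rule AE_mp[OF AE_sphere_borel_norm], rule AE_I2, rule impI)
   fix w :: 'a assume w: "norm w = 1"
   have "(\<integral>\<^sup>+s\<in>{0<..}. ennreal (\<Lambda> * (\<bar>\<phi> (s *\<^sub>R w)\<bar> / norm (s *\<^sub>R w)) powr p) * ind {a..b} (norm (s *\<^sub>R w)) *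
    ennreal (s ^ (DIM('a) - 1)) \<partial>lborel) =
    (\<integral>\<^sup>+s. ennreal \<Lambda> * (ennreal (\<bar>\<phi> (s *\<^sub>R w)\<bar> powr p * s powr (e - 1)) * ind {a..b} s) \<partial>lborel)" proof (rule nn_integral_cong) fix s :: real
    show "ennreal (\<Lambda> * (\<bar>\<phi> (s *\<^sub>R w)\<bar> / norm (s *\<^sub>R w)) powr p) * ind {a..b} (norm (s *\<^sub>R w)) * ennreal (s ^ (DIM('a) - 1)) * ind {0<..} s =
     ennreal \<Lambda> * (ennreal (\<bar>\<phi> (s *\<^sub>R w)\<bar> powr p * s powr (e - 1)) * ind {a..b} s)" proof (cases "s \<in> {a..b}") case True
     then have s: "0 < s" using ab by auto
     have "s powr real (DIM('a) - 1) = s ^ (DIM('a) - 1)" using s by (rule powr_realpow)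
     moreover have "real (DIM('a) - 1) = real DIM('a) - 1" using DIM_positive[where 'a='a] by (simp add: of_nat_diff Suc_leI del: DIM_positive)
     moreover have "s powr (e - 1) = s powr (real DIM('a) - 1) / s powr p" unfolding powr_diff[symmetric] e_def by (simp add: algebra_simps)
     ultimately have "\<Lambda> * (\<bar>\<phi> (s *\<^sub>R w)\<bar> / norm (s *\<^sub>R w)) powr p * s ^ (DIM('a) - 1) = \<Lambda> * (\<bar>\<phi> (s *\<^sub>R w)\<bar> powr p * s powr (e - 1))"
      using s w by (simp add: powr_divide)
     then show ?thesis using True s w \<Lambda>_nonneg by (simp add: ennreal_mult[symmetric] del: power_Suc)
    next
     case False
     then have "ind {a..b} (norm (s *\<^sub>R w)) * ind {0<..} s = (0::ennreal)" using w by (auto simp: indicator_def)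
     then show ?thesis using False by auto
    qed
   qed
   also have "\<dots> = ennreal \<Lambda> * W w" unfolding W_def by (rule nn_integral_cmult) measurable
   also have "\<dots> = ennreal \<Lambda> * W w * ind G w"
   proof (cases "w \<in> K")
    case False
    have "\<phi> (s *\<^sub>R w) = 0" if "s \<in> {a..b}" for s
     using that ab False cone_scale_iff[of s w] T(3) by (intro T(4)) auto
    then have "W w = (\<integral>\<^sup>+s. 0 \<partial>(lborel :: real measure))" unfolding W_def by (intro nn_integral_cong) (auto simp: indicator_def)
    then show ?thesis by simp
   qed (use w in simp)
   finally show "ennreal \<Lambda> * W w * ind G w = (\<integral>\<^sup>+s\<in>{0<..}. ennreal (\<Lambda> * (\<bar>\<phi> (s *\<^sub>R w)\<bar> / norm (s *\<^sub>R w)) powr p) * ind {a..b} (norm (s *\<^sub>R w)) *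
    ennreal (s ^ (DIM('a) - 1)) \<partial>lborel)" by simp qed qed finally show ?thesis .
qed

text \<open>The inner radius tends to 0. For p < m any radius is admissible; for p \<ge> m the
  support of \<phi> stays away from the origin and small radii are.\<close>

theorem Hardy_test:
 assumes \<phi>: "\<phi> \<in> test_functions K" and pK: "real DIM('a) \<le> p \<Longrightarrow> K \<noteq> UNIV"
 shows "(\<integral>\<^sup>+y. ennreal (\<Lambda> * (\<bar>\<phi> y\<bar> / norm y) powr p) \<partial>lborel) \<le> (\<integral>\<^sup>+y. ennreal (norm (grad \<phi> y) powr p) \<partial>lborel)"
proof -
 note T = test_functionsD[OF \<phi>]
 have [measurable]: "\<phi> \<in> borel_funs" using T(7) by (rule borel_measurable_continuous_onI)
 obtain r where r: "0 < r" "0 < c \<or> (\<forall>x. norm x < r \<longrightarrow> \<phi> x = 0)"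
 proof (cases "0 < c")
  case True
  with that[of 1] show ?thesis by simp
 next
  case False
  then have "real DIM('a) \<le> p" using p by (simp add: c_def zero_less_divide_iff not_less)
  then have "K \<noteq> UNIV" by (rule pK)
  \<comment> \<open>An open cone containing the origin contains a ball around it, hence after
    dilation the whole space.\<close>
  have "0 \<notin> K"
  proof
   assume "0 \<in> K"
   with open_K obtain r where r: "0 < r" "ball 0 r \<subseteq> K" by (auto simp: open_contains_ball)
   have "y \<in> K" for y
   proof -
    define t where "t = r / (2 * (norm y + 1))"
    have n: "0 < 2 * (norm y + 1)" by (simp add: add_nonneg_pos)
    have t: "0 < t" using r n by (simp add: t_def)
    have "norm (t *\<^sub>R y) = r * (norm y / (2 * (norm y + 1)))" using t r n by (simp add: t_def)
    also have "\<dots> < r * 1" using r n by (intro mult_strict_left_mono) auto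
    finally have "t *\<^sub>R y \<in> K" using r by auto
    then show ?thesis using cone_scale_iff[OF t] by simp
   qed
   with \<open>K \<noteq> UNIV\<close> show False by auto
  qed
  then have "0 \<in> - supp \<phi>" using T(3) by auto
  then obtain r where "0 < r" "ball 0 r \<subseteq> - supp \<phi>" by (meson open_Compl closed_closure open_contains_ball)
  then show ?thesis using that[of r] T(4) by (auto simp: subset_eq)
 qed
 obtain B where B: "\<forall>x\<in>supp \<phi>. norm x \<le> B" using compact_imp_bounded[OF T(2)] unfolding bounded_iff by blast
 define b where "b = max B r + 1"
 define a where "a n = r * inverse (real (Suc (Suc n)))" for n
 have b: "\<phi> x = 0" if "b \<le> norm x" for x using that B by (intro T(4)) (auto simp: b_def)
 have a1: "0 < a n" "a n < r" for n
 proof -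
  show "0 < a n" using r by (simp add: a_def)
  have "r * inverse (real (Suc (Suc n))) < r * 1" using r(1) by (intro mult_strict_left_mono) (auto simp: inverse_less_1_iff)
  then show "a n < r" by (simp add: a_def)
 qed
 have ab: "a n < b" for n using a1(2)[of n] by (simp add: b_def)
 have a0: "a ----> 0" unfolding a_def using tendsto_mult_right_zero[OF LIMSEQ_Suc[OF LIMSEQ_inverse_real_of_nat], of r] by simp
 show ?thesis
 proof (rule nn_integral_Fatou_le[OF _ _ _ tendsto_const])
  show "(\<lambda>x. ennreal (\<Lambda> * (\<bar>\<phi> x\<bar> / norm x) powr p) * ind {a n..b} (norm x)) \<in> borel_measurable lborel" for n by measurable
  show "(\<integral>\<^sup>+x. ennreal (\<Lambda> * (\<bar>\<phi> x\<bar> / norm x) powr p) * ind {a n..b} (norm x) \<partial>lborel) \<le> (\<integral>\<^sup>+y. ennreal (norm (grad \<phi> y) powr p) \<partial>lborel)" for n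
   by (rule Hardy_annulus[OF \<phi> a1(1) ab b]) (use r a1(2) in auto)
  have "(\<lambda>n. ennreal (\<Lambda> * (\<bar>\<phi> x\<bar> / norm x) powr p) * ind {a n..b} (norm x)) ----> ennreal (\<Lambda> * (\<bar>\<phi> x\<bar> / norm x) powr p)" for x
  proof (cases "x = 0 \<or> b \<le> norm x")
   case True
   then have "(\<bar>\<phi> x\<bar> / norm x) powr p = 0" using b by auto
   then show ?thesis by (simp only: mult_zero_right mult_zero_left ennreal_0 tendsto_const)
  next
   case False
   then have "\<forall>\<^sub>F n in sequentially. a n < norm x" using a0 by (intro order_tendstoD) auto
   then have "\<forall>\<^sub>F n in sequentially. ennreal (\<Lambda> * (\<bar>\<phi> x\<bar> / norm x) powr p) * ind {a n..b} (norm x) = ennreal (\<Lambda> * (\<bar>\<phi> x\<bar> / norm x) powr p)"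
    by (rule eventually_mono) (use False in simp)
   then show ?thesis by (rule tendsto_eventually)
  qed
  then show "AE x in lborel. (\<lambda>n. ennreal (\<Lambda> * (\<bar>\<phi> x\<bar> / norm x) powr p) * ind {a n..b} (norm x)) ----> ennreal (\<Lambda> * (\<bar>\<phi> x\<bar> / norm x) powr p)"
   by simp
 qed
qed

end

section \<open>From the cone to the cylinder\<close>

lemma test_slice:
 fixes \<phi> :: "'a::euclidean_space \<times> 'b::euclidean_space \<Rightarrow> real"
 assumes \<phi>: "\<phi> \<in> test_functions (K \<times> UNIV)"
 shows "(\<lambda>y. \<phi> (y, z)) \<in> test_functions K" "grad (\<lambda>y. \<phi> (y, z)) y = fst (grad \<phi> (y, z))"
proof -
 note T = test_functionsD[OF \<phi>]
 show "(\<lambda>y. \<phi> (y, z)) \<in> test_functions K"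
 proof (rule test_functionsI)
  show "smooth_on UNIV (\<lambda>y. \<phi> (y, z))"
  proof (rule smooth_on_compose[OF open_UNIV open_UNIV T(1)])
   fix i :: "'a \<times> 'b"
   have "smooth_on (UNIV :: 'a set) (\<lambda>y. y \<bullet> fst i + z \<bullet> snd i)"
    by (intro smooth_on_add smooth_on_const smooth_on_linear bounded_linear_inner_left open_UNIV)
   then show "smooth_on UNIV (\<lambda>y. (y, z) \<bullet> i)" by (simp add: inner_prod_def)
  qed simp
  show "compact (fst ` supp \<phi>)" using T(2) by (intro compact_continuous_image continuous_on_fst continuous_on_id)
  show "fst ` supp \<phi> \<subseteq> K" using T(3) by auto
  fix y assume "y \<notin> fst ` supp \<phi>"
  then show "\<phi> (y, z) = 0" by (intro T(4)) force
 qed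
 have "((\<lambda>y. (y, z)) has_derivative (\<lambda>v. (v, 0))) (at y)" by (intro has_derivative_Pair has_derivative_ident has_derivative_const)
 from has_derivative_compose[OF this T(5)[of "(y, z)", unfolded gderiv_def]]
 have "GDERIV (\<lambda>y. \<phi> (y, z)) y :> fst (grad \<phi> (y, z))" by (simp add: gderiv_def inner_prod_def)
 then show "grad (\<lambda>y. \<phi> (y, z)) y = fst (grad \<phi> (y, z))" by (rule grad_eq)
qed

lemma nn_integral_lborel_slices:
 fixes f :: "'a::euclidean_space \<times> 'b::euclidean_space \<Rightarrow> ennreal"
 assumes "f \<in> borel_funs"
 shows "(\<integral>\<^sup>+x. f x \<partial>lborel) = (\<integral>\<^sup>+z. (\<integral>\<^sup>+y. f (y, z) \<partial>lborel) \<partial>lborel)" unfolding lborel_prod[symmetric]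
 by (rule lborel_pair.nn_integral_snd[symmetric]) (use assms in "simp add: lborel_prod")

context hardy_cone
begin

text \<open>The inequality on K holds for each slice of fixed z and is integrated in z. Keeping only
  the y-part of the gradient on the right is essential for the equality case.\<close>

theorem Hardy_test_cylinder:
 fixes \<phi> :: "'a \<times> 'b::euclidean_space \<Rightarrow> real"
 assumes \<phi>: "\<phi> \<in> test_functions (K \<times> UNIV)" and pK: "real DIM('a) \<le> p \<Longrightarrow> K \<noteq> UNIV"
 shows "(\<integral>\<^sup>+x. ennreal (\<Lambda> * (\<bar>\<phi> x\<bar> / norm (fst x)) powr p) \<partial>lborel) \<le> (\<integral>\<^sup>+x. ennreal (norm (fst (grad \<phi> x)) powr p) \<partial>lborel)"
proof -
 note T = test_functionsD[OF \<phi>]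
 have [measurable]: "\<phi> \<in> borel_funs" "grad \<phi> \<in> borel_funs" using T(7,8) by (auto intro: borel_measurable_continuous_onI)
 have [measurable]: "fst \<in> borel_measurable (borel :: ('a \<times> 'b) measure)" by (intro borel_measurable_continuous_onI continuous_intros)
 have "(\<integral>\<^sup>+y. ennreal (\<Lambda> * (\<bar>\<phi> (y, z)\<bar> / norm y) powr p) \<partial>lborel) \<le> (\<integral>\<^sup>+y. ennreal (norm (fst (grad \<phi> (y, z))) powr p) \<partial>lborel)" for z
  using Hardy_test[OF test_slice(1)[OF \<phi>] pK] by (simp add: test_slice(2)[OF \<phi>])
 then have "(\<integral>\<^sup>+z. (\<integral>\<^sup>+y. ennreal (\<Lambda> * (\<bar>\<phi> (y, z)\<bar> / norm (fst (y, z))) powr p) \<partial>lborel) \<partial>(lborel :: 'b measure)) \<le>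
  (\<integral>\<^sup>+z. (\<integral>\<^sup>+y. ennreal (norm (fst (grad \<phi> (y, z))) powr p) \<partial>lborel) \<partial>lborel)" unfolding fst_conv by (rule nn_integral_mono)
 moreover have "(\<lambda>x. ennreal (\<Lambda> * (\<bar>\<phi> x\<bar> / norm (fst x)) powr p)) \<in> borel_funs" "(\<lambda>x. ennreal (norm (fst (grad \<phi> x)) powr p)) \<in> borel_funs"
  by measurable
 ultimately show ?thesis by (simp only: nn_integral_lborel_slices)
qed

end

section \<open>The energy space on the cylinder\<close>

lemma locally_integrable_measurable:
 fixes f :: "'a::euclidean_space \<Rightarrow> 'b::euclidean_space"
 assumes \<Omega>: "open \<Omega>" and f: "locally_integrable \<Omega> f"
 shows "f \<in> borel_measurable (lebesgue_on \<Omega>)"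
proof -
 obtain C :: "nat \<Rightarrow> 'a set" where C: "\<And>n. compact (C n)" "\<And>n. C n \<subseteq> \<Omega>" "\<And>n. C n \<subseteq> interior (C (Suc n))" "\<Union> (range C) = \<Omega>"
  using open_Union_compact_subsets[OF \<Omega>] by metis
 have mono: "C m \<subseteq> C n" if "m \<le> n" for m n
  by (rule lift_Suc_mono_le[OF _ that]) (use C(3) interior_subset in blast)
 show ?thesis
 proof (rule borel_measurable_LIMSEQ_metric)
  fix n
  have b: "C n \<in> sets lebesgue" using C(1)[of n] by (simp add: compact_imp_closed borel_closed)
  have "f \<in> borel_measurable (lebesgue_on (C n))" by (rule borel_measurable_integrable) (use f C(1,2)[of n] in "simp add: locally_integrable_def")
  then have "(\<lambda>x. ind (C n) x *\<^sub>R f x) \<in> borel_measurable lebesgue" using b by (subst (asm) borel_measurable_restrict_space_iff) auto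
  then show "(\<lambda>x. ind (C n) x *\<^sub>R f x) \<in> borel_measurable (lebesgue_on \<Omega>)" by (rule measurable_restrict_space1)
 next
  fix x assume "x \<in> space (lebesgue_on \<Omega>)"
  then obtain m where m: "x \<in> C m" using C(4) by (auto simp: space_restrict_space)
  have "\<forall>\<^sub>F n in sequentially. ind (C n) x *\<^sub>R f x = f x" using eventually_ge_at_top[of m]
  proof (rule eventually_mono)
   fix n assume "m \<le> n"
   then have "x \<in> C n" using m mono by blast
   then show "ind (C n) x *\<^sub>R f x = f x" by simp
  qed
  then show "(\<lambda>n. ind (C n) x *\<^sub>R f x) ----> f x" by (rule tendsto_eventually)
 qed
qed

lemma test_functions_translate:
 fixes \<phi> :: "'a::euclidean_space \<times> 'b::euclidean_space \<Rightarrow> real"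
 assumes \<phi>: "\<phi> \<in> test_functions (K \<times> UNIV)"
 shows "(\<lambda>x. \<phi> (x + (0, z))) \<in> test_functions (K \<times> UNIV)"
proof -
 note T = test_functionsD[OF \<phi>]
 let ?C = "(\<lambda>x. x - (0, z)) ` supp \<phi>"
 show ?thesis
 proof (rule test_functionsI)
  show "smooth_on UNIV (\<lambda>x. \<phi> (x + (0, z)))"
  proof (rule smooth_on_compose[OF open_UNIV open_UNIV T(1)])
   show "smooth_on UNIV (\<lambda>x. (x + (0, z)) \<bullet> i)" for i :: "'a \<times> 'b"
    unfolding inner_add_left by (intro smooth_on_add smooth_on_const smooth_on_linear bounded_linear_inner_left open_UNIV)
  qed simp
  show "compact ?C" using T(2) by (intro compact_continuous_image continuous_intros)
  show "?C \<subseteq> K \<times> UNIV" using T(3) by auto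
  fix x assume x: "x \<notin> ?C"
  have "x + (0, z) \<notin> supp \<phi>"
  proof
   assume "x + (0, z) \<in> supp \<phi>"
   then have "(x + (0, z)) - (0, z) \<in> ?C" by (rule imageI)
   with x show False by (simp only: add_diff_cancel_right')
  qed
  then show "\<phi> (x + (0, z)) = 0" by (rule T(4))
 qed
qed

text \<open>Integrating \<phi> along a segment in a z-direction gives a test function whose
  derivative in that direction is the increment of \<phi>. It transforms a vanishing weak derivative
  of v into invariance of the pairing of v with translates of \<phi>.\<close>

lemma segment_average:
 fixes \<phi> :: "'a::euclidean_space \<times> 'b::euclidean_space \<Rightarrow> real" and i :: 'b
 assumes \<phi>: "\<phi> \<in> test_functions (K \<times> UNIV)" and h: "0 < h"
 defines "\<Phi> \<equiv> \<lambda>x. integral {0..h} (\<lambda>t. \<phi> (x + t *\<^sub>R (0, i)))"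
 shows "\<Phi> \<in> test_functions (K \<times> UNIV)" "grad \<Phi> x \<bullet> (0, i) = \<phi> (x + h *\<^sub>R (0, i)) - \<phi> x"
proof -
 note T = test_functionsD[OF \<phi>]
 let ?e = "(0, i) :: 'a \<times> 'b" and ?S = "supp \<phi>"
 let ?C = "(\<lambda>z. fst z - snd z *\<^sub>R ?e) ` (?S \<times> {0..h})"
 have "smooth_on (UNIV \<times> UNIV) (\<lambda>z. \<phi> (fst z + snd z *\<^sub>R ?e))"
 proof (rule smooth_on_compose[OF _ open_UNIV T(1)])
  show "smooth_on (UNIV \<times> UNIV) (\<lambda>z. (fst z + snd z *\<^sub>R ?e) \<bullet> b)" for b
   by (intro smooth_on_linear bounded_linear_compose[OF bounded_linear_inner_left] bounded_linear_add bounded_linear_fst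
     bounded_linear_compose[OF bounded_linear_scaleR_left] bounded_linear_snd) simp
 qed auto
 from smooth_on_integral[OF open_UNIV this open_UNIV, of 0 h] have sm: "smooth_on UNIV \<Phi>" by (simp add: \<Phi>_def)
 show test: "\<Phi> \<in> test_functions (K \<times> UNIV)"
 proof (rule test_functionsI[OF sm])
  show "compact ?C" by (intro compact_continuous_image compact_Times T(2) compact_Icc continuous_intros)
  show "?C \<subseteq> K \<times> UNIV" using T(3) by auto
  fix x assume x: "x \<notin> ?C"
  have "\<phi> (x + t *\<^sub>R ?e) = 0" if "t \<in> {0..h}" for t
  proof (rule T(4), rule notI)
   assume "x + t *\<^sub>R ?e \<in> ?S"
   then have "fst (x + t *\<^sub>R ?e, t) - snd (x + t *\<^sub>R ?e, t) *\<^sub>R ?e \<in> ?C" using that by (intro imageI) simp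
   with x show False by (simp only: fst_conv snd_conv add_diff_cancel_right')
  qed
  then have "\<Phi> x = integral {0..h} (\<lambda>t. 0)" unfolding \<Phi>_def by (intro integral_cong)
  then show "\<Phi> x = 0" by simp
 qed
 have cont: "continuous_on S (\<lambda>z. \<phi> (f z + g z *\<^sub>R ?e))" "continuous_on S (\<lambda>z. grad \<phi> (f z + g z *\<^sub>R ?e))"
  if "continuous_on S f" "continuous_on S g" for S :: "'c::topological_space set" and f g
  by (intro continuous_on_compose2[OF T(7)] continuous_on_compose2[OF T(8)] continuous_intros that subset_UNIV)+
 have "((\<lambda>s. integral (cbox 0 h) (\<lambda>t. \<phi> (x + (t + s) *\<^sub>R ?e))) has_real_derivative integral (cbox 0 h) (\<lambda>t. ?e \<bullet> grad \<phi> (x + (t + 0) *\<^sub>R ?e))) (at 0 within UNIV)"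
 proof (rule leibniz_rule_field_derivative)
  fix s t :: real
  have "((\<lambda>s. \<phi> ((x + t *\<^sub>R ?e) + s *\<^sub>R ?e)) has_real_derivative ?e \<bullet> grad \<phi> ((x + t *\<^sub>R ?e) + s *\<^sub>R ?e)) (at s)"
   by (rule GDERIV_direction[OF T(5)])
  then show "((\<lambda>s. \<phi> (x + (t + s) *\<^sub>R ?e)) has_real_derivative ?e \<bullet> grad \<phi> (x + (t + s) *\<^sub>R ?e)) (at s within UNIV)"
   by (simp only: scaleR_add_left add.assoc)
 next
  show "(\<lambda>t. \<phi> (x + (t + s) *\<^sub>R ?e)) integrable_on cbox 0 h" for s
   by (intro integrable_continuous cont continuous_intros)
  have "continuous_on (UNIV \<times> cbox 0 h) (\<lambda>z. ?e \<bullet> grad \<phi> (x + (snd z + fst z) *\<^sub>R ?e))" by (intro continuous_on_inner cont continuous_intros)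
  then show "continuous_on (UNIV \<times> cbox 0 h) (\<lambda>(s, t). ?e \<bullet> grad \<phi> (x + (t + s) *\<^sub>R ?e))" by (simp only: split_beta')
 qed auto
 then have 1: "((\<lambda>s. \<Phi> (x + s *\<^sub>R ?e)) has_real_derivative integral {0..h} (\<lambda>t. ?e \<bullet> grad \<phi> (x + t *\<^sub>R ?e))) (at 0)"
  unfolding \<Phi>_def by (simp add: algebra_simps)
 have "((\<lambda>t. ?e \<bullet> grad \<phi> (x + t *\<^sub>R ?e)) has_integral (\<phi> (x + h *\<^sub>R ?e) - \<phi> (x + 0 *\<^sub>R ?e))) {0..h}"
 proof (rule fundamental_theorem_of_calculus)
  show "((\<lambda>t. \<phi> (x + t *\<^sub>R ?e)) has_vector_derivative ?e \<bullet> grad \<phi> (x + t *\<^sub>R ?e)) (at t within {0..h})" for t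
   using GDERIV_direction[OF T(5), where x=x and t=t and e="?e"]
   unfolding has_real_derivative_iff_has_vector_derivative by (rule has_vector_derivative_at_within)
 qed (use h in simp)
 from integral_unique[OF this] have 2: "integral {0..h} (\<lambda>t. ?e \<bullet> grad \<phi> (x + t *\<^sub>R ?e)) = \<phi> (x + h *\<^sub>R ?e) - \<phi> x"
  by (simp only: scaleR_zero_left add_0_right)
 have "GDERIV \<Phi> (x + 0 *\<^sub>R ?e) :> grad \<Phi> x" using smooth_on_GDERIV[OF sm UNIV_I, of x] by (simp only: scaleR_zero_left add_0_right)
 then have "((\<lambda>s. \<Phi> (x + s *\<^sub>R ?e)) has_real_derivative ?e \<bullet> grad \<Phi> x) (at 0)" by (rule GDERIV_direction)
 from DERIV_unique[OF this 1] 2 show "grad \<Phi> x \<bullet> ?e = \<phi> (x + h *\<^sub>R ?e) - \<phi> x" by (simp add: inner_commute)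
qed

lemma AE_fst_nonzero: "AE x in lebesgue. fst (x :: 'a::euclidean_space \<times> 'b::euclidean_space) \<noteq> 0"
proof -
 obtain i :: 'a where i: "i \<in> Basis" by (meson ex_in_conv nonempty_Basis)
 have "negligible {x :: 'a \<times> 'b. (i, 0) \<bullet> x = 0}" using i by (intro negligible_hyperplane) (auto simp: prod_eq_iff)
 then have "negligible {x :: 'a \<times> 'b. fst x = 0}" by (rule negligible_subset) (auto simp: inner_prod_def)
 then have "{x :: 'a \<times> 'b. fst x = 0} \<in> null_sets lebesgue" by (simp add: negligible_iff_null_sets)
 from AE_not_in[OF this] show ?thesis by simp
qed

text \<open>A function that does not depend on some direction along which the domain is
 invariant pairs equally with all translates of a test function; integrability of \<open>v / |y|\<close> forces the pairing to vanish as the translates escape to infinity.\<close>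

lemma weak_gradient_fst_only:
 fixes v :: "'a::euclidean_space \<times> 'b::euclidean_space \<Rightarrow> real"
 assumes K: "open K" and p: "1 < p" and g: "has_weak_gradient (K \<times> UNIV) v g"
  and snd0: "AE x in lebesgue_on (K \<times> UNIV). snd (g x) = 0"
  and Lp: "Lp_member p (lebesgue_on (K \<times> UNIV)) (\<lambda>x. v x / norm (fst x))"
 shows "AE x in lebesgue_on (K \<times> UNIV). v x = 0"
proof -
 let ?\<Omega> = "K \<times> (UNIV :: 'b set)"
 have \<Omega>: "open ?\<Omega>" using K by (intro open_Times) auto
 have \<Omega>s [measurable]: "?\<Omega> \<in> sets lebesgue" using \<Omega> by auto
 have lv: "locally_integrable ?\<Omega> v" and lg: "locally_integrable ?\<Omega> g" using g by (auto simp: has_weak_gradient_def)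
 obtain i :: 'b where i: "i \<in> Basis" by (meson ex_in_conv nonempty_Basis)
 then have eB: "(0, i) \<in> (Basis :: ('a \<times> 'b) set)" by (simp add: Basis_prod_def)
 have ni: "norm ((0, i) :: 'a \<times> 'b) = 1" using i by (simp add: norm_Pair)
 have snd0': "AE x in lebesgue. x \<in> ?\<Omega> \<longrightarrow> snd (g x) = 0" using snd0 \<Omega>s by (simp add: AE_restrict_space_iff)
 define q where "q = p / (p - 1)"
 have pq: "1 < p" "1 < q" "1 / p + 1 / q = 1" using p by (auto simp: q_def field_simps)
 have "(LINT x|lebesgue. \<phi> x * v x) = 0" if \<phi>: "\<phi> \<in> test_functions ?\<Omega>" for \<phi>
 proof -
  note T = test_functionsD[OF \<phi>]
  let ?S = "supp \<phi>"
  define e where "e n = real (Suc n) *\<^sub>R ((0, i) :: 'a \<times> 'b)" for n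
  have e2: "e n = (0, real (Suc n) *\<^sub>R i)" for n by (simp add: e_def)
  have const: "(LINT x|lebesgue. \<phi> (x + e n) * v x) = (LINT x|lebesgue. \<phi> x * v x)" for n
  proof -
   define \<Phi> where "\<Phi> = (\<lambda>x. integral {0..real (Suc n)} (\<lambda>t. \<phi> (x + t *\<^sub>R (0, i))))"
   note \<Phi> = segment_average[OF \<phi>, of "real (Suc n)" i, OF of_nat_0_less_iff[THEN iffD2, OF zero_less_Suc], folded \<Phi>_def]
   have "(LINT x|lebesgue. (grad \<Phi> x \<bullet> (0, i)) * v x) = - (LINT x|lebesgue. \<Phi> x * (g x \<bullet> (0, i)))"
    using g \<Phi>(1) eB unfolding has_weak_gradient_iff[OF \<Omega>] by simp
   also have "(LINT x|lebesgue. \<Phi> x * (g x \<bullet> (0, i))) = 0"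
   proof (rule integral_eq_zero_AE)
    have "\<Phi> x = 0" if "x \<notin> ?\<Omega>" for x :: "'a \<times> 'b"
     using that test_functionsD(3,4)[OF \<Phi>(1)] by blast
    with snd0' show "AE x in lebesgue. \<Phi> x * (g x \<bullet> (0, i)) = 0" by (auto elim!: eventually_mono simp: inner_prod_def)
   qed
   finally have "(LINT x|lebesgue. \<phi> (x + e n) * v x - \<phi> x * v x) = 0" by (simp add: \<Phi>(2) e_def left_diff_distrib)
   moreover have "integrable lebesgue (\<lambda>x. \<phi> (x + e n) * v x)"
    using weak_gradient_integrable(1)[OF test_functions_translate[OF \<phi>] lv, of "real (Suc n) *\<^sub>R i"] by (simp add: e2)
   moreover have "integrable lebesgue (\<lambda>x. \<phi> x * v x)" using weak_gradient_integrable(1)[OF \<phi> lv] by simp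
   ultimately show ?thesis by (simp add: Bochner_Integration.integral_diff)
  qed
  obtain R where R: "\<forall>x\<in>?S. norm x \<le> R" using compact_imp_bounded[OF T(2)] unfolding bounded_iff by blast
  \<comment> \<open>Translations in z do not change y, so this bound gives |\<phi>(x + e)| |v| \<le>
    B |v|/|y| on every translated support.\<close>
  obtain B where B: "0 < B" "\<And>x. norm (norm (fst x) * \<phi> x) \<le> B" by (rule bounded_compact_support[of "\<lambda>x. norm (fst x) * \<phi> x" ?S])
     (use T(2,4,7) in "auto intro!: continuous_intros")
  define D where "D n = cball (- e n) R" for n
  have D: "D n \<in> sets borel" for n by (simp add: D_def)
  have \<phi>D: "x \<in> D n" if "\<phi> (x + e n) \<noteq> 0" for x n
  proof -
   have "norm (x + e n) \<le> R" using R T(4)[of "x + e n"] that by blast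
   moreover have "dist (- e n) x = norm (x + e n)" by (simp add: dist_norm norm_minus_commute[of "- e n" x])
   ultimately show ?thesis by (simp add: D_def)
  qed
  define f where "f n x = ind (?\<Omega> \<inter> D n) x * (v x / norm (fst x))" for n x
  define g' where "g' n x = B * ind (D n) x" for n :: nat and x :: "'a \<times> 'b"
  define w where "w x = indicator ?\<Omega> x * norm (v x / norm (fst x)) powr p" for x
  have vm: "(\<lambda>x. indicator ?\<Omega> x * (v x / norm (fst x))) \<in> borel_measurable lebesgue"
   using Lp unfolding Lp_member_def by (subst (asm) borel_measurable_restrict_space_iff) auto
  have wi: "integrable lebesgue w" using Lp unfolding Lp_member_def w_def by (subst (asm) integrable_restrict_space) auto
  have fm: "f n \<in> borel_measurable lebesgue" for n
  proof -
   have "(\<lambda>x. ind (D n) x * (indicator ?\<Omega> x * (v x / norm (fst x)))) \<in> borel_measurable lebesgue"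
    by (rule borel_measurable_times[OF borel_measurable_indicator vm]) (use D[of n] in simp)
   moreover have "f n = (\<lambda>x. ind (D n) x * (indicator ?\<Omega> x * (v x / norm (fst x))))" by (auto simp: f_def indicator_def)
   ultimately show ?thesis by simp
  qed
  have fw: "norm (f n x) powr p = ind (D n) x * w x" for n x by (simp add: f_def w_def indicator_def)
  have fL: "Lp_member p lebesgue (f n)" for n
   unfolding Lp_member_def fw using fm integrable_mult_indicator[OF _ wi, of "D n"] D[of n] by auto
  have fin: "emeasure lebesgue (D n) < \<infinity>" for n 
   using emeasure_lborel_cball_finite[of "- e n" R] by (simp add: D_def)
  have g'p: "norm (g' n x) powr q = B powr q * ind (D n) x" for n x using B by (simp add: g'_def indicator_def)
  have gL: "Lp_member q lebesgue (g' n)" for n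
   unfolding Lp_member_def g'p unfolding g'_def using D[of n] fin[of n]
   by (intro conjI borel_measurable_times borel_measurable_indicator integrable_mult_right) auto
  have gN: "Lp_norm q lebesgue (g' n) = (B powr q * measure lebesgue (D 0)) powr (1 / q)" for n
  proof -
   have "measure lebesgue (D n) = measure lebesgue (D 0)"
   proof -
    have "D n = (+) (- e n) ` cball 0 R" for n unfolding D_def image_add_cball add_0_left ..
    then show ?thesis by (simp only: measure_translation)
   qed
   then show ?thesis unfolding Lp_norm_def g'p using D[of n] by simp
  qed
  \<comment> \<open>Each point leaves D(n) eventually, and |v/|y||^p is an integrable
    majorant.\<close>
  have "(\<lambda>n. LINT x|lebesgue. norm (f n x) powr p) ----> (LINT x|(lebesgue :: ('a \<times> 'b) measure). 0)"
  proof (rule integral_dominated_convergence[where w=w])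
   show "(\<lambda>x. norm (f n x) powr p) \<in> borel_measurable lebesgue" for n
    using fL[of n] unfolding Lp_member_def by (blast intro: borel_measurable_integrable)
   show "AE x in lebesgue. norm (norm (f n x) powr p) \<le> w x" for n
   proof (rule AE_I2)
    fix x
    have "norm (norm (f n x) powr p) = norm (f n x) powr p" by simp
    also have "\<dots> \<le> w x" unfolding fw by (auto simp: indicator_def w_def)
    finally show "norm (norm (f n x) powr p) \<le> w x" .
   qed
   have "(\<lambda>n. norm (f n x) powr p) ----> 0" for x
   proof (rule tendsto_eventually)
    obtain N :: nat where N: "norm x + R < real N" using reals_Archimedean2 by blast
    show "\<forall>\<^sub>F n in sequentially. norm (f n x) powr p = 0" using eventually_ge_at_top[of N]
    proof eventually_elim
     fix n assume n: "N \<le> n"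
     have "x \<notin> D n"
     proof
      assume "x \<in> D n"
      then have "norm (- e n - x) \<le> R" by (simp add: D_def dist_norm)
      moreover have "norm (- e n) \<le> norm (- e n - x) + norm x" using norm_triangle_ineq[of "- e n - x" x] by simp
      moreover have "norm (- e n) = real (Suc n)" unfolding norm_minus_cancel e_def norm_scaleR ni by simp
      ultimately show False using N n by simp
     qed
     then show "norm (f n x) powr p = 0" unfolding fw by simp
    qed
   qed
   then show "AE x in lebesgue. (\<lambda>n. norm (f n x) powr p) ----> 0" by simp
  qed (use wi in auto)
  then have "(\<lambda>n. (LINT x|lebesgue. norm (f n x) powr p) powr (1 / p)) ----> 0 powr (1 / p)"
   using p by (intro tendsto_powr') (auto intro: integral_nonneg)
  then have "(\<lambda>n. Lp_norm p lebesgue (f n)) ----> 0" by (simp add: Lp_norm_def)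
  from tendsto_mult_left_zero[OF this]
  have lim: "(\<lambda>n. Lp_norm p lebesgue (f n) * (B powr q * measure lebesgue (D 0)) powr (1 / q)) ----> 0" .
  have "\<bar>LINT x|lebesgue. \<phi> x * v x\<bar> \<le> Lp_norm p lebesgue (f n) * (B powr q * measure lebesgue (D 0)) powr (1 / q)" for n
  proof -
   have "\<bar>LINT x|lebesgue. \<phi> x * v x\<bar> = \<bar>LINT x|lebesgue. \<phi> (x + e n) * v x\<bar>" by (simp add: const)
   also have "\<dots> \<le> (LINT x|lebesgue. \<bar>\<phi> (x + e n) * v x\<bar>)" by (rule integral_abs_bound)
   also have "\<dots> \<le> (LINT x|lebesgue. \<bar>f n x * g' n x\<bar>)"
   proof (rule integral_mono_AE)
    show "integrable lebesgue (\<lambda>x. \<bar>\<phi> (x + e n) * v x\<bar>)"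
     using weak_gradient_integrable(1)[OF test_functions_translate[OF \<phi>] lv, of "real (Suc n) *\<^sub>R i"] by (intro integrable_abs) (simp add: e2)
    show "integrable lebesgue (\<lambda>x. \<bar>f n x * g' n x\<bar>)" by (intro integrable_abs integrable_Hoelder[OF pq fL gL])
    show "AE x in lebesgue. \<bar>\<phi> (x + e n) * v x\<bar> \<le> \<bar>f n x * g' n x\<bar>" using AE_fst_nonzero
    proof eventually_elim
     fix x :: "'a \<times> 'b" assume x: "fst x \<noteq> 0"
     show "\<bar>\<phi> (x + e n) * v x\<bar> \<le> \<bar>f n x * g' n x\<bar>"
     proof (cases "\<phi> (x + e n) = 0")
      case False
      then have xD: "x \<in> D n" by (rule \<phi>D)
      have "x + e n \<in> ?\<Omega>" using False T(3,4) by blast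
      then have x\<Omega>: "x \<in> ?\<Omega>" by (auto simp: e2 mem_Times_iff)
      have "norm (fst x) * \<bar>\<phi> (x + e n)\<bar> \<le> B" using B(2)[of "x + e n"] by (simp add: abs_mult e2)
      then have "\<bar>\<phi> (x + e n)\<bar> \<le> B / norm (fst x)" using x by (simp add: field_simps)
      then have "\<bar>\<phi> (x + e n)\<bar> * \<bar>v x\<bar> \<le> B / norm (fst x) * \<bar>v x\<bar>" by (rule mult_right_mono) simp
      then show ?thesis using xD x\<Omega> B(1) by (simp add: f_def g'_def abs_mult mult.commute)
     qed simp
    qed
   qed
   also have "\<dots> \<le> Lp_norm p lebesgue (f n) * Lp_norm q lebesgue (g' n)" by (rule integral_Hoelder[OF pq fL gL])
   finally show ?thesis unfolding gN .
  qed
  then have "\<bar>LINT x|lebesgue. \<phi> x * v x\<bar> \<le> 0" by (intro LIMSEQ_le_const[OF lim]) auto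
  then show ?thesis by simp
 qed
 from fundamental_lemma[OF \<Omega> lv this] show ?thesis using \<Omega>s by (simp add: AE_restrict_space_iff)
qed

lemma norm_fst_le': "norm (fst z) \<le> norm z"
 using norm_fst_le[of "fst z" "snd z"] by simp

section \<open>The energy space and approximation by test functions\<close>

lemma gradient_norm_eq:
 fixes v :: "'a::euclidean_space \<Rightarrow> real"
 assumes \<Omega>: "open \<Omega>" and g: "has_weak_gradient \<Omega> v g"
 shows "gradient_norm p \<Omega> v = Lp_norm p (lebesgue_on \<Omega>) g" unfolding gradient_norm_def
proof (rule Lp_norm_cong_AE)
 show "AE x in lebesgue_on \<Omega>. norm (weak_gradient \<Omega> v x) = norm (g x)" using weak_gradient_AE(2)[OF \<Omega> g] by (rule AE_mp) simp
 show "g \<in> borel_measurable (lebesgue_on \<Omega>)" "weak_gradient \<Omega> v \<in> borel_measurable (lebesgue_on \<Omega>)"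
  using g weak_gradient_AE(1)[OF \<Omega> g] by (auto simp: has_weak_gradient_def intro: locally_integrable_measurable[OF \<Omega>])
qed

lemma test_grad_Lp:
 fixes \<phi> :: "'a::euclidean_space \<Rightarrow> real"
 assumes \<Omega>: "open \<Omega>" and \<phi>: "\<phi> \<in> test_functions \<Omega>" and p: "0 < p"
 shows "Lp_member p (lebesgue_on \<Omega>) (grad \<phi>)"
proof -
 note T = test_functionsD[OF \<phi>]
 have "integrable lborel (\<lambda>x. norm (grad \<phi> x) powr p)"
 proof (rule integrable_compact_support[OF _ T(2)])
  show "continuous_on UNIV (\<lambda>x. norm (grad \<phi> x) powr p)" using p by (intro continuous_on_powr' continuous_on_norm T(8) continuous_on_const) auto
 qed (simp add: T(6))
 then have "integrable lebesgue (\<lambda>x. norm (grad \<phi> x) powr p)" by (simp add: integrable_completion borel_measurable_integrable)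
 moreover have "norm (grad \<phi> x) powr p = 0" if "x \<notin> \<Omega>" for x
 proof -
  have "x \<notin> supp \<phi>" using that T(3) by blast
  then show ?thesis by (simp add: T(6))
 qed
 ultimately have "integrable (lebesgue_on \<Omega>) (\<lambda>x. norm (grad \<phi> x) powr p)"
  using integral_lebesgue_on_eq(2)[of \<Omega> "\<lambda>x. norm (grad \<phi> x) powr p"] \<Omega> by auto
 moreover have "grad \<phi> \<in> borel_measurable (lebesgue_on \<Omega>)"
  using borel_measurable_continuous_onI[OF T(8)] by (intro measurable_restrict_space1 measurable_completion) simp
 ultimately show ?thesis by (simp add: Lp_member_def)
qed

lemma test_W_dot:
 fixes \<phi> :: "'a::euclidean_space \<Rightarrow> real"
 assumes \<Omega>: "open \<Omega>" and \<phi>: "\<phi> \<in> test_functions \<Omega>" and p: "0 < p"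
 shows "\<phi> \<in> W_dot p \<Omega>" "gradient_norm p \<Omega> \<phi> = Lp_norm p (lebesgue_on \<Omega>) (grad \<phi>)"
proof -
 have "smooth_on UNIV \<phi>" using \<phi> by (rule test_functionsD)
 then have "smooth_on \<Omega> \<phi>" by (rule smooth_on_subset) simp
 then have w: "has_weak_gradient \<Omega> \<phi> (grad \<phi>)" by (rule smooth_has_weak_gradient[OF \<Omega>])
 show "gradient_norm p \<Omega> \<phi> = Lp_norm p (lebesgue_on \<Omega>) (grad \<phi>)" by (rule gradient_norm_eq[OF \<Omega> w])
 have "gradient_norm p \<Omega> (\<lambda>x. \<phi> x - \<phi> x) = Lp_norm p (lebesgue_on \<Omega>) (\<lambda>x. grad \<phi> x - grad \<phi> x)"
  by (rule gradient_norm_eq[OF \<Omega> has_weak_gradient_diff[OF \<Omega> w w]])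
 also have "\<dots> = 0" using p by (simp add: Lp_norm_def)
 finally have "gradient_norm p \<Omega> (\<lambda>x. \<phi> x - \<phi> x) = 0" .
 then show "\<phi> \<in> W_dot p \<Omega>" unfolding W_dot_def using w test_grad_Lp[OF \<Omega> \<phi> p] \<phi> by (intro CollectI conjI exI[of _ "grad \<phi>"] exI[of _ "\<lambda>j. \<phi>"]) auto
qed

text \<open>Unfolds membership into a concrete weak gradient g and classical gradients of the
  approximating functions, so that the chosen \<open>weak_gradient\<close> disappears from later
  arguments.\<close>

lemma W_dot_approx:
 fixes v :: "'a::euclidean_space \<Rightarrow> real"
 assumes \<Omega>: "open \<Omega>" and v: "v \<in> W_dot p \<Omega>"
 obtains g \<phi> where "has_weak_gradient \<Omega> v g" "Lp_member p (lebesgue_on \<Omega>) g" "\<And>j::nat. \<phi> j \<in> test_functions \<Omega>"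
  "(\<lambda>j. Lp_norm p (lebesgue_on \<Omega>) (\<lambda>x. grad (\<phi> j) x - g x)) ----> 0" "\<And>C. compact C \<Longrightarrow> C \<subseteq> \<Omega> \<Longrightarrow> (\<lambda>j. LINT x|lebesgue_on C. \<bar>\<phi> j x - v x\<bar>) ----> 0"
proof -
 obtain g \<phi> where g: "has_weak_gradient \<Omega> v g" "Lp_member p (lebesgue_on \<Omega>) g"
  and \<phi>: "\<And>j::nat. \<phi> j \<in> test_functions \<Omega>" "(\<lambda>j. gradient_norm p \<Omega> (\<lambda>x. \<phi> j x - v x)) ----> 0" "\<And>C. compact C \<Longrightarrow> C \<subseteq> \<Omega> \<Longrightarrow> (\<lambda>j. LINT x|lebesgue_on C. \<bar>\<phi> j x - v x\<bar>) ----> 0"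
  using v unfolding W_dot_def by blast
 have "gradient_norm p \<Omega> (\<lambda>x. \<phi> j x - v x) = Lp_norm p (lebesgue_on \<Omega>) (\<lambda>x. grad (\<phi> j) x - g x)" for j
 proof -
  have "smooth_on UNIV (\<phi> j)" using \<phi>(1) by (rule test_functionsD)
  then have "smooth_on \<Omega> (\<phi> j)" by (rule smooth_on_subset) simp
  from has_weak_gradient_diff[OF \<Omega> smooth_has_weak_gradient[OF \<Omega> this] g(1)]
  show ?thesis by (rule gradient_norm_eq[OF \<Omega>])
 qed
 with \<phi> g that[of g \<phi>] show ?thesis by simp
qed

lemma Lp_member_fst:
 fixes g :: "'c \<Rightarrow> 'a::euclidean_space \<times> 'b::euclidean_space"
 assumes "0 < p" "Lp_member p M g"
 shows "Lp_member p M (\<lambda>x. fst (g x))"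
proof (rule Lp_member_bound[OF assms])
 have [measurable]: "fst \<in> borel_measurable (borel :: ('a \<times> 'b) measure)" by (intro borel_measurable_continuous_onI continuous_intros)
 have [measurable]: "g \<in> borel_measurable M" using assms by (simp add: Lp_member_def)
 show "(\<lambda>x. fst (g x)) \<in> borel_measurable M" by measurable
 show "AE x in M. norm (fst (g x)) \<le> norm (g x)" by (simp add: norm_fst_le')
qed

section \<open>Hardy's inequality in the energy space and the equality case\<close>

context hardy_cone
begin

text \<open>Fatou's lemma for approximating test functions, on compact sets first and then along an
  exhaustion. The right side retains only the y-part of an arbitrary weak gradient, the form needed
  for non-attainment. Positivity of \<Lambda> turns the bound into integrability of the Hardy
  term.\<close>

lemma Hardy_W_dot:
 fixes v :: "'a \<times> 'b::euclidean_space \<Rightarrow> real"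
 assumes pK: "real DIM('a) \<le> p \<Longrightarrow> K \<noteq> UNIV" and pos: "0 < \<Lambda>" and v: "v \<in> W_dot p (K \<times> UNIV)"
  and g0: "has_weak_gradient (K \<times> UNIV) v g0"
 shows "Lp_member p (lebesgue_on (K \<times> UNIV)) (\<lambda>x. v x / norm (fst x))"
  and "\<Lambda> * (LINT x|lebesgue_on (K \<times> UNIV). norm (v x / norm (fst x)) powr p) \<le> (LINT x|lebesgue_on (K \<times> UNIV). norm (fst (g0 x)) powr p)"
  and "Lp_member p (lebesgue_on (K \<times> UNIV)) g0"
proof -
 let ?\<Omega> = "K \<times> (UNIV :: 'b set)"
 let ?M = "lebesgue_on ?\<Omega>"
 have p0: "0 < p" using p by simp
 have \<Omega>: "open ?\<Omega>" using open_K by (intro open_Times) auto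
 have \<Omega>s [measurable]: "?\<Omega> \<in> sets lebesgue" using \<Omega> by auto
 obtain g \<phi> where g: "has_weak_gradient ?\<Omega> v g" "Lp_member p ?M g" and \<phi>: "\<And>j::nat. \<phi> j \<in> test_functions ?\<Omega>" "(\<lambda>j. Lp_norm p ?M (\<lambda>x. grad (\<phi> j) x - g x)) ----> 0"
  "\<And>C. compact C \<Longrightarrow> C \<subseteq> ?\<Omega> \<Longrightarrow> (\<lambda>j. LINT x|lebesgue_on C. \<bar>\<phi> j x - v x\<bar>) ----> 0" using W_dot_approx[OF \<Omega> v] by blast
 note T = test_functionsD[OF \<phi>(1)]
 have lv: "locally_integrable ?\<Omega> v" using g by (simp add: has_weak_gradient_def)
 have fstb [measurable]: "fst \<in> borel_measurable (borel :: ('a \<times> 'b) measure)" by (intro borel_measurable_continuous_onI continuous_intros)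
 have [measurable]: "\<phi> j \<in> borel_funs" for j using T(7) by (rule borel_measurable_continuous_onI)
 have fstL: "fst \<in> borel_measurable (lebesgue :: ('a \<times> 'b) measure)" by (rule measurable_completion) simp
 define t where "t j = ennreal (Lp_norm p ?M (\<lambda>x. fst (grad (\<phi> j) x)) powr p)" for j
 have gj: "Lp_member p ?M (grad (\<phi> j))" for j by (rule test_grad_Lp[OF \<Omega> \<phi>(1) p0])
 note fgj = Lp_member_fst[OF p0 gj] and fg = Lp_member_fst[OF p0 g(2)]
 have Ht: "(\<integral>\<^sup>+x. ennreal (\<Lambda> * (\<bar>\<phi> j x\<bar> / norm (fst x)) powr p) \<partial>lebesgue) \<le> t j" for j
 proof -
  have "(\<integral>\<^sup>+x. ennreal (\<Lambda> * (\<bar>\<phi> j x\<bar> / norm (fst x)) powr p) \<partial>lebesgue) \<le> (\<integral>\<^sup>+x. ennreal (norm (fst (grad (\<phi> j) x)) powr p) \<partial>lebesgue)"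
   unfolding nn_integral_completion by (rule Hardy_test_cylinder[OF \<phi>(1) pK])
  also have "\<dots> = (\<integral>\<^sup>+x. ennreal (norm (fst (grad (\<phi> j) x)) powr p) * indicator ?\<Omega> x \<partial>lebesgue)"
  proof (rule nn_integral_cong)
   fix x :: "'a \<times> 'b"
   show "ennreal (norm (fst (grad (\<phi> j) x)) powr p) = ennreal (norm (fst (grad (\<phi> j) x)) powr p) * indicator ?\<Omega> x"
   proof (cases "x \<in> ?\<Omega>")
    case False
    then have "x \<notin> supp (\<phi> j)" using T(3)[of j] by blast
    then show ?thesis by (simp add: T(6))
   qed simp
  qed
  also have "\<dots> = (\<integral>\<^sup>+x. ennreal (norm (fst (grad (\<phi> j) x)) powr p) \<partial>?M)" by (rule nn_integral_restrict_space[symmetric]) simp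
  also have "\<dots> = t j" unfolding t_def Lp_norm_powr[OF p0] using fgj[of j] by (intro nn_integral_eq_integral) (auto simp: Lp_member_def)
  finally show ?thesis .
 qed
 have fm: "(\<lambda>x. fst (grad (\<phi> j) x) - fst (g x)) \<in> borel_measurable ?M" for j
  using Lp_member_diff[OF p fgj fg] by (simp add: Lp_member_def)
 have lim: "(\<lambda>j. Lp_norm p ?M (\<lambda>x. fst (grad (\<phi> j) x))) ----> Lp_norm p ?M (\<lambda>x. fst (g x))"
 proof (rule Lp_norm_tendsto[OF p fgj fg])
  have "Lp_norm p ?M (\<lambda>x. fst (grad (\<phi> j) x) - fst (g x)) \<le> Lp_norm p ?M (\<lambda>x. grad (\<phi> j) x - g x)" for j
  proof (rule Lp_norm_mono[OF p0 Lp_member_diff[OF p gj g(2)] fm])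
   have "norm (fst (grad (\<phi> j) x) - fst (g x)) \<le> norm (grad (\<phi> j) x - g x)" for x
    using norm_fst_le'[of "grad (\<phi> j) x - g x"] by simp
   then show "AE x in ?M. norm (fst (grad (\<phi> j) x) - fst (g x)) \<le> norm (grad (\<phi> j) x - g x)" by simp
  qed
  then show "(\<lambda>j. Lp_norm p ?M (\<lambda>x. fst (grad (\<phi> j) x) - fst (g x))) ----> 0"
   by (intro tendsto_sandwich[OF _ _ tendsto_const \<phi>(2)]) (auto simp: Lp_norm_nonneg)
 qed
 have t: "t ----> ennreal (Lp_norm p ?M (\<lambda>x. fst (g x)) powr p)"
  unfolding t_def using p by (intro tendsto_ennrealI tendsto_powr' lim tendsto_const) (auto simp: Lp_norm_nonneg)
 define F where "F x = ennreal (\<Lambda> * (\<bar>v x\<bar> / norm (fst x)) powr p)" for x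
 have vM: "v \<in> borel_measurable ?M" by (rule locally_integrable_measurable[OF \<Omega> lv])
 have quotM: "(\<lambda>x. v x / norm (fst x)) \<in> borel_measurable ?M" using vM measurable_restrict_space1[OF fstL] by measurable
 have FM: "F \<in> borel_measurable ?M"
 proof -
  have "F = (\<lambda>x. ennreal (\<Lambda> * \<bar>v x / norm (fst x)\<bar> powr p))" by (rule ext) (simp add: F_def)
  moreover have "(\<lambda>x. ennreal (\<Lambda> * \<bar>v x / norm (fst x)\<bar> powr p)) \<in> borel_measurable ?M" using quotM by measurable
  ultimately show ?thesis by (simp only:)
 qed
 \<comment> \<open>On a compact set the approximation converges in L1, hence almost everywhere along
   a subsequence that may depend on the set.\<close>
 have FC: "(\<integral>\<^sup>+x. F x \<partial>lebesgue_on C) \<le> ennreal (Lp_norm p ?M (\<lambda>x. fst (g x)) powr p)" if C: "compact C" "C \<subseteq> ?\<Omega>" for C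
 proof -
  have Cs: "C \<in> sets lebesgue" using C(1) by (simp add: compact_imp_closed borel_closed)
  have i: "integrable (lebesgue_on C) (\<lambda>x. \<phi> n x - v x)" for n
  proof (rule Bochner_Integration.integrable_diff)
   show "integrable (lebesgue_on C) (\<phi> n)" using locally_integrable_continuous[OF T(7)[of n]] C(1) by (simp add: locally_integrable_def)
   show "integrable (lebesgue_on C) v" using lv C by (simp add: locally_integrable_def)
  qed
  have "(\<lambda>j. LINT x|lebesgue_on C. norm (\<phi> j x - v x)) ----> 0" using \<phi>(3)[OF C] by simp
  from tendsto_L1_AE_subseq[OF i this]
  obtain r where r: "strict_mono r" "AE x in lebesgue_on C. (\<lambda>n. \<phi> (r n) x - v x) ----> 0" by blast
  show ?thesis
  proof (rule nn_integral_Fatou_le)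
   have "(\<lambda>x. ennreal (\<Lambda> * (\<bar>\<phi> (r n) x\<bar> / norm (fst x)) powr p)) \<in> borel_funs" for n by measurable
   then show "(\<lambda>x. ennreal (\<Lambda> * (\<bar>\<phi> (r n) x\<bar> / norm (fst x)) powr p)) \<in> borel_measurable (lebesgue_on C)" for n
    by (intro measurable_restrict_space1 measurable_completion) simp
   show "AE x in lebesgue_on C. (\<lambda>n. ennreal (\<Lambda> * (\<bar>\<phi> (r n) x\<bar> / norm (fst x)) powr p)) ----> F x" using r(2)
   proof (rule AE_mp, intro AE_I2 impI)
    fix x assume "(\<lambda>n. \<phi> (r n) x - v x) ----> 0"
    then have "(\<lambda>n. \<phi> (r n) x) ----> v x" by (rule LIM_zero_cancel)
    then show "(\<lambda>n. ennreal (\<Lambda> * (\<bar>\<phi> (r n) x\<bar> / norm (fst x)) powr p)) ----> F x" unfolding F_def divide_inverse using p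
     by (intro tendsto_ennrealI tendsto_mult tendsto_powr' tendsto_rabs tendsto_const) auto
   qed
   show "(\<lambda>n. t (r n)) ----> ennreal (Lp_norm p ?M (\<lambda>x. fst (g x)) powr p)" using LIMSEQ_subseq_LIMSEQ[OF t r(1)] by (simp add: o_def)
   fix n
   have "(\<integral>\<^sup>+x. ennreal (\<Lambda> * (\<bar>\<phi> (r n) x\<bar> / norm (fst x)) powr p) \<partial>lebesgue_on C) =
    (\<integral>\<^sup>+x\<in>C. ennreal (\<Lambda> * (\<bar>\<phi> (r n) x\<bar> / norm (fst x)) powr p) \<partial>lebesgue)" using Cs by (intro nn_integral_restrict_space) simp
   also have "\<dots> \<le> (\<integral>\<^sup>+x. ennreal (\<Lambda> * (\<bar>\<phi> (r n) x\<bar> / norm (fst x)) powr p) \<partial>lebesgue)" by (rule nn_integral_mono) (simp add: indicator_def)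
   also note Ht
   finally show "(\<integral>\<^sup>+x. ennreal (\<Lambda> * (\<bar>\<phi> (r n) x\<bar> / norm (fst x)) powr p) \<partial>lebesgue_on C) \<le> t (r n)" .
  qed
 qed
 obtain C :: "nat \<Rightarrow> ('a \<times> 'b) set" where C: "\<And>n. compact (C n)" "\<And>n. C n \<subseteq> ?\<Omega>" "\<And>n. C n \<subseteq> interior (C (Suc n))" "\<Union> (range C) = ?\<Omega>"
  using open_Union_compact_subsets[OF \<Omega>] by metis
 have mono: "C m \<subseteq> C n" if "m \<le> n" for m n
  by (rule lift_Suc_mono_le[OF _ that]) (use C(3) interior_subset in blast)
 have Cs: "C n \<in> sets lebesgue" for n using C(1)[of n] by (simp add: compact_imp_closed borel_closed)
 have F\<Omega>: "(\<integral>\<^sup>+x. F x \<partial>?M) \<le> ennreal (Lp_norm p ?M (\<lambda>x. fst (g x)) powr p)"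
 proof (rule nn_integral_Fatou_le[OF _ _ _ tendsto_const])
  show "(\<lambda>x. F x * ind (C n) x) \<in> borel_measurable ?M" for n
   by (rule borel_measurable_times_ennreal[OF FM]) (intro measurable_restrict_space1 borel_measurable_indicator Cs)
  show "AE x in ?M. (\<lambda>n. F x * ind (C n) x) ----> F x"
  proof (rule AE_I2)
   fix x assume "x \<in> space ?M"
   then obtain m where m: "x \<in> C m" using C(4) by (auto simp: space_restrict_space)
   have "\<forall>\<^sub>F n in sequentially. F x * ind (C n) x = F x" using eventually_ge_at_top[of m]
   proof (rule eventually_mono)
    fix n assume "m \<le> n"
    then have "x \<in> C n" using m mono by blast
    then show "F x * ind (C n) x = F x" by simp
   qed
   then show "(\<lambda>n. F x * ind (C n) x) ----> F x" by (rule tendsto_eventually)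
  qed
  fix n
  have "(\<integral>\<^sup>+x\<in>C n. F x \<partial>?M) = (\<integral>\<^sup>+x. F x * ind (C n) x * indicator ?\<Omega> x \<partial>lebesgue)" by (rule nn_integral_restrict_space) simp
  also have "\<dots> = (\<integral>\<^sup>+x\<in>C n. F x \<partial>lebesgue)" by (rule nn_integral_cong) (use C(2)[of n] in "auto simp: indicator_def")
  also have "\<dots> = (\<integral>\<^sup>+x. F x \<partial>lebesgue_on (C n))" by (rule nn_integral_restrict_space[symmetric]) (use Cs in simp)
  also have "\<dots> \<le> ennreal (Lp_norm p ?M (\<lambda>x. fst (g x)) powr p)" by (rule FC[OF C(1,2)])
  finally show "(\<integral>\<^sup>+x\<in>C n. F x \<partial>?M) \<le> ennreal (Lp_norm p ?M (\<lambda>x. fst (g x)) powr p)" .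
 qed
 have Fint: "integrable ?M (\<lambda>x. \<Lambda> * norm (v x / norm (fst x)) powr p)"
 proof (rule integrableI_bounded)
  show "(\<lambda>x. \<Lambda> * norm (v x / norm (fst x)) powr p) \<in> borel_measurable ?M" using quotM by measurable
  have "(\<integral>\<^sup>+x. ennreal (norm (\<Lambda> * norm (v x / norm (fst x)) powr p)) \<partial>?M) = (\<integral>\<^sup>+x. F x \<partial>?M)" using pos by (simp add: F_def abs_mult)
  also have "\<dots> < \<infinity>" using F\<Omega> by (rule le_less_trans) simp
  finally show "(\<integral>\<^sup>+x. ennreal (norm (\<Lambda> * norm (v x / norm (fst x)) powr p)) \<partial>?M) < \<infinity>" .
 qed
 then have int: "integrable ?M (\<lambda>x. norm (v x / norm (fst x)) powr p)" using pos by (simp only: integrable_mult_left_iff) simp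
 then show "Lp_member p ?M (\<lambda>x. v x / norm (fst x))" using quotM by (simp add: Lp_member_def)
 have "ennreal (LINT x|?M. \<Lambda> * norm (v x / norm (fst x)) powr p) = (\<integral>\<^sup>+x. ennreal (\<Lambda> * norm (v x / norm (fst x)) powr p) \<partial>?M)"
  using pos by (intro nn_integral_eq_integral[symmetric] Fint) simp
 also have "\<dots> = (\<integral>\<^sup>+x. F x \<partial>?M)" by (simp add: F_def)
 also note F\<Omega>
 finally have "(LINT x|?M. \<Lambda> * norm (v x / norm (fst x)) powr p) \<le> Lp_norm p ?M (\<lambda>x. fst (g x)) powr p" by simp
 then have le: "\<Lambda> * (LINT x|?M. norm (v x / norm (fst x)) powr p) \<le> (LINT x|?M. norm (fst (g x)) powr p)" by (simp add: Lp_norm_powr[OF p0])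
 have AE: "AE x in ?M. g x = g0 x" by (rule has_weak_gradient_unique[OF \<Omega> g(1) g0])
 have g0M: "g0 \<in> borel_measurable ?M" using g0 by (auto simp: has_weak_gradient_def intro: locally_integrable_measurable[OF \<Omega>])
 show L0: "Lp_member p ?M g0" by (rule Lp_member_bound[OF p0 g(2) g0M]) (use AE in "auto elim!: eventually_mono")
 have "(LINT x|?M. norm (fst (g x)) powr p) = (LINT x|?M. norm (fst (g0 x)) powr p)" using fg Lp_member_fst[OF p0 L0] AE
  by (intro integral_cong_AE) (auto simp: Lp_member_def borel_measurable_integrable elim!: eventually_mono)
 with le show "\<Lambda> * (LINT x|?M. norm (v x / norm (fst x)) powr p) \<le> (LINT x|?M. norm (fst (g0 x)) powr p)" by simp
qed

lemma Lp_norm_fst_le':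
 fixes g :: "'c \<Rightarrow> 'a \<times> 'b::euclidean_space"
 assumes "Lp_member p N g"
 shows "(LINT x|N. norm (fst (g x)) powr p) \<le> (LINT x|N. norm (g x) powr p)" using assms Lp_member_fst[of p N g] p
 by (intro integral_mono) (auto simp: Lp_member_def norm_fst_le' intro!: powr_mono2)

theorem Hardy_cylinder:
 assumes pK: "real DIM('a) \<le> p \<Longrightarrow> K \<noteq> UNIV" and pos: "0 < \<Lambda>"
 shows "hardy_inequality p (K \<times> (UNIV :: 'b::euclidean_space set)) (\<Lambda> powr (- 1 / p))" unfolding hardy_inequality_def
proof (intro ballI conjI)
 let ?M = "lebesgue_on (K \<times> (UNIV :: 'b set))"
 have \<Omega>: "open (K \<times> (UNIV :: 'b set))" using open_K by (intro open_Times) auto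
 fix v assume v: "v \<in> W_dot p (K \<times> (UNIV :: 'b set))"
 obtain g where g: "has_weak_gradient (K \<times> UNIV) v g" using v unfolding W_dot_def by blast
 note H = Hardy_W_dot[OF pK pos v g]
 show "Lp_member p ?M (\<lambda>x. v x / norm (fst x))" by (rule H(1))
 let ?V = "LINT x|?M. norm (v x / norm (fst x)) powr p" and ?D = "LINT x|?M. norm (g x) powr p"
 have "\<Lambda> * ?V \<le> ?D" using H(2) Lp_norm_fst_le'[OF H(3)] by (rule order_trans)
 then have "?V \<le> ?D / \<Lambda>" using pos by (simp add: field_simps)
 then have "?V powr (1 / p) \<le> (?D / \<Lambda>) powr (1 / p)" using p by (intro powr_mono2) (auto intro: integral_nonneg)
 also have "\<dots> = \<Lambda> powr (- 1 / p) * ?D powr (1 / p)" using pos by (simp add: powr_divide powr_minus_divide integral_nonneg)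
 finally show "hardy_norm p (K \<times> UNIV) v \<le> \<Lambda> powr (- 1 / p) * gradient_norm p (K \<times> UNIV) v"
  unfolding hardy_norm_def gradient_norm_eq[OF \<Omega> g] Lp_norm_def .
qed

text \<open>Equality makes the Lp norms of the gradient and of its y-part coincide. Pointwise the
  former dominates, so the z-part vanishes almost everywhere and
  \<open>weak_gradient_fst_only\<close> applies.\<close>

theorem Hardy_not_attained:
 assumes pK: "real DIM('a) \<le> p \<Longrightarrow> K \<noteq> UNIV" and pos: "0 < \<Lambda>"
 shows "\<not> hardy_equality_attained p (K \<times> (UNIV :: 'b::euclidean_space set)) (\<Lambda> powr (- 1 / p))"
proof
 let ?M = "lebesgue_on (K \<times> (UNIV :: 'b set))"
 have \<Omega>: "open (K \<times> (UNIV :: 'b set))" using open_K by (intro open_Times) auto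
 assume "hardy_equality_attained p (K \<times> (UNIV :: 'b set)) (\<Lambda> powr (- 1 / p))"
 then obtain v where v: "v \<in> W_dot p (K \<times> (UNIV :: 'b set))" "\<not> (AE x in ?M. v x = 0)"
  and eq: "hardy_norm p (K \<times> UNIV) v = \<Lambda> powr (- 1 / p) * gradient_norm p (K \<times> UNIV) v" unfolding hardy_equality_attained_def by blast
 obtain g where g: "has_weak_gradient (K \<times> UNIV) v g" using v unfolding W_dot_def by blast
 note H = Hardy_W_dot[OF pK pos v(1) g]
 have p0: "0 < p" using p by simp
 let ?V = "LINT x|?M. norm (v x / norm (fst x)) powr p" and ?D = "LINT x|?M. norm (g x) powr p"
  and ?F = "LINT x|?M. norm (fst (g x)) powr p"
 have "?V = (hardy_norm p (K \<times> UNIV) v) powr p" unfolding hardy_norm_def by (rule Lp_norm_powr[OF p0, symmetric])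
 also have "\<dots> = (\<Lambda> powr (- 1 / p)) powr p * ?D" unfolding eq gradient_norm_eq[OF \<Omega> g] Lp_norm_powr[OF p0, symmetric] by (rule powr_mult)
 also have "(\<Lambda> powr (- 1 / p)) powr p = inverse \<Lambda>" unfolding powr_powr using p pos by (simp add: powr_minus)
 finally have "\<Lambda> * ?V = ?D" using pos by (simp add: field_simps)
 then have FD: "?D - ?F = 0" using H(2) Lp_norm_fst_le'[OF H(3)] by simp
 have i: "integrable ?M (\<lambda>x. norm (g x) powr p)" "integrable ?M (\<lambda>x. norm (fst (g x)) powr p)"
  using H(3) Lp_member_fst[OF p0 H(3)] by (auto simp: Lp_member_def)
 have "(LINT x|?M. norm (g x) powr p - norm (fst (g x)) powr p) = 0" using FD by (simp add: Bochner_Integration.integral_diff[OF i])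
 then have "AE x in ?M. norm (g x) powr p - norm (fst (g x)) powr p = 0" using p by (subst (asm) integral_nonneg_eq_0_iff_AE)
   (auto intro!: Bochner_Integration.integrable_diff i powr_mono2 simp: norm_fst_le')
 then have "AE x in ?M. snd (g x) = 0"
 proof (rule AE_mp, intro AE_I2 impI)
  fix x assume "norm (g x) powr p - norm (fst (g x)) powr p = 0"
  then have "(norm (g x) powr p) powr (1 / p) = (norm (fst (g x)) powr p) powr (1 / p)" by simp
  then have "norm (g x) = norm (fst (g x))" using p by (simp add: powr_powr)
  then have "(norm (g x))\<^sup>2 = (norm (fst (g x)))\<^sup>2" by simp
  then show "snd (g x) = 0" by (simp add: norm_prod_def)
 qed
 from weak_gradient_fst_only[OF open_K p g this H(1)] v(2) show False by blast
qed

end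

section \<open>Sharpness\<close>

text \<open>The substitution s = exp(R t): the scale-invariant measure ds/s becomes R dt.\<close>

lemma nn_integral_log:
 fixes h :: "real \<Rightarrow> ennreal"
 assumes [measurable]: "h \<in> borel_funs" and R: "0 < R"
 shows "(\<integral>\<^sup>+s\<in>{exp (- R)..exp R}. h (ln s / R) * ennreal (1 / s) \<partial>lborel) = ennreal R * (\<integral>\<^sup>+t\<in>{-1..1}. h t \<partial>lborel)"
proof -
 have "(\<integral>\<^sup>+t\<in>{ln (exp (- R))..ln (exp R)}. h (t / R) \<partial>lborel) = (\<integral>\<^sup>+s\<in>{exp (- R)..exp R}. h (ln s / R) * ennreal (1 / s) \<partial>lborel)"
 proof (rule nn_integral_substitution_aux)
  fix s assume "s \<in> {exp (- R)..exp R}"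
  then have s: "0 < s" using exp_gt_zero[of "- R"] by (auto simp del: exp_gt_zero intro: less_le_trans)
  then show "(ln has_real_derivative 1 / s) (at s)" "0 \<le> 1 / s" by (auto simp: DERIV_ln_divide)
 next
  have "0 < s" if "exp (- R) \<le> s" for s using less_le_trans[OF exp_gt_zero that] .
  then show "continuous_on {exp (- R)..exp R} (\<lambda>s. 1 / s)" by (intro continuous_intros) force
 qed (use R in auto)
 moreover have "(\<integral>\<^sup>+t\<in>{ln (exp (- R))..ln (exp R)}. h (t / R) \<partial>lborel) =
   ennreal (R ^ DIM(real)) * (\<integral>\<^sup>+t. h (R *\<^sub>R t / R) * ind {ln (exp (- R))..ln (exp R)} (R *\<^sub>R t) \<partial>lborel)"
  by (rule nn_integral_lborel_scale[OF _ R]) measurable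
 moreover have "h (R *\<^sub>R t / R) * ind {ln (exp (- R))..ln (exp R)} (R *\<^sub>R t) = h t * ind {-1..1} t" for t
 proof -
  have "- R \<le> R * t \<and> R * t \<le> R \<longleftrightarrow> -1 \<le> t \<and> t \<le> 1" using R mult_le_cancel_left_pos[of R "-1" t] mult_le_cancel_left_pos[of R t 1] by simp
  then show ?thesis using R by (simp add: indicator_def)
 qed
 ultimately show ?thesis by simp
qed

text \<open>The integrand is a product in the angular, radial and z variables. The factor |y|^(-m)
  turns the radial density s^(m-1) ds into ds/s.\<close>

lemma nn_integral_cylinder:
 fixes a :: "'a::euclidean_space \<Rightarrow> ennreal" and h :: "real \<Rightarrow> ennreal" and k :: "'b::euclidean_space \<Rightarrow> ennreal"
 assumes [measurable]: "a \<in> borel_funs" "h \<in> borel_funs" "k \<in> borel_funs"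
  and R: "0 < R" and L: "0 < L"
 shows "(\<integral>\<^sup>+x. a (sgn (fst x)) * (ennreal (norm (fst x) powr - real DIM('a)) * h (ln (norm (fst x)) / R) *
   ind {exp (- R)..exp R} (norm (fst x))) * k (snd x /\<^sub>R L) \<partial>lborel) = (\<integral>\<^sup>+w. a w \<partial>sphere_borel) * (ennreal R * (\<integral>\<^sup>+t\<in>{-1..1}. h t \<partial>lborel)) *
  (ennreal (L ^ DIM('b)) * (\<integral>\<^sup>+z. k z \<partial>lborel))" (is "?l = ?A * ?B * ?C")
proof -
 let ?g = "\<lambda>s. ennreal (s powr - real DIM('a)) * h (ln s / R) * ind {exp (- R)..exp R} s"
 have [measurable]: "fst \<in> borel_measurable (borel :: ('a \<times> 'b) measure)" "snd \<in> borel_measurable (borel :: ('a \<times> 'b) measure)"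
  by (intro borel_measurable_continuous_onI continuous_intros)+
 have [measurable]: "(\<lambda>y::'a. a (sgn y)) \<in> borel_funs" by (rule measurable_compose[OF borel_measurable_sgn]) measurable
 have gm: "?g \<in> borel_funs" by measurable
 have ag: "(\<lambda>y. a (sgn y) * ?g (norm y)) \<in> borel_funs"
  by (intro borel_measurable_times_ennreal measurable_compose[OF borel_measurable_norm gm]) measurable
 have km: "(\<lambda>z. k (z /\<^sub>R L)) \<in> borel_funs" by measurable
 have "(\<lambda>x :: 'a \<times> 'b. a (sgn (fst x)) * ?g (norm (fst x)) * k (snd x /\<^sub>R L)) \<in> borel_funs"
  by (intro borel_measurable_times_ennreal[OF measurable_compose[OF _ ag] measurable_compose[OF _ km]]) measurable
 from nn_integral_lborel_slices[OF this]
 have "?l = (\<integral>\<^sup>+z. (\<integral>\<^sup>+y. a (sgn y) * ?g (norm y) * k (z /\<^sub>R L) \<partial>lborel) \<partial>(lborel :: 'b measure))" by (simp only: fst_conv snd_conv)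
 also have "\<dots> = (\<integral>\<^sup>+z. (\<integral>\<^sup>+y. a (sgn y) * ?g (norm y) \<partial>(lborel :: 'a measure)) * k (z /\<^sub>R L) \<partial>(lborel :: 'b measure))"
  using ag by (subst nn_integral_multc) auto
 also have "\<dots> = (\<integral>\<^sup>+y. a (sgn y) * ?g (norm y) \<partial>(lborel :: 'a measure)) * (\<integral>\<^sup>+z. k (z /\<^sub>R L) \<partial>(lborel :: 'b measure))"
  using km by (intro nn_integral_cmult) simp
 also have "(\<integral>\<^sup>+z. k (z /\<^sub>R L) \<partial>(lborel :: 'b measure)) = ennreal (L ^ DIM('b)) * (\<integral>\<^sup>+z. k ((L *\<^sub>R z) /\<^sub>R L) \<partial>lborel)"
  by (rule nn_integral_lborel_scale[OF km L])
 also have "\<dots> = ?C" using L by simp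
 also have "(\<integral>\<^sup>+y. a (sgn y) * ?g (norm y) \<partial>(lborel :: 'a measure)) = ?A * (\<integral>\<^sup>+s\<in>{0<..}. ?g s * ennreal (s ^ (DIM('a) - 1)) \<partial>lborel)"
  by (rule nn_integral_polar_product[OF assms(1) gm])
 also have "(\<integral>\<^sup>+s\<in>{0<..}. ?g s * ennreal (s ^ (DIM('a) - 1)) \<partial>lborel) =
   (\<integral>\<^sup>+s\<in>{exp (- R)..exp R}. h (ln s / R) * ennreal (1 / s) \<partial>lborel)" proof (rule nn_integral_cong) fix s :: real
  show "?g s * ennreal (s ^ (DIM('a) - 1)) * ind {0<..} s = h (ln s / R) * ennreal (1 / s) * ind {exp (- R)..exp R} s"
  proof (cases "s \<in> {exp (- R)..exp R}")
   case True
   then have s: "0 < s" using less_le_trans[OF exp_gt_zero] by auto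
   have "s ^ (DIM('a) - 1) * s = s ^ DIM('a)" by (simp add: power_eq_if)
   then have "s powr - real DIM('a) * s ^ (DIM('a) - 1) = 1 / s" using s by (simp add: powr_minus powr_realpow field_simps)
   moreover have "?g s * ennreal (s ^ (DIM('a) - 1)) = h (ln s / R) * ennreal (s powr - real DIM('a) * s ^ (DIM('a) - 1))"
    using True s by (subst ennreal_mult) (auto simp: mult.assoc mult.left_commute)
   ultimately show ?thesis using True s by simp
  qed simp
 qed
 also have "\<dots> = ?B" by (rule nn_integral_log[OF _ R]) measurable
 finally show ?thesis .
qed

lemma Lp_of_nn_integral:
 fixes g :: "'a::euclidean_space \<Rightarrow> 'b::euclidean_space"
 assumes g: "g \<in> borel_funs" and V: "(\<integral>\<^sup>+x. ennreal (norm (g x) powr p) \<partial>lborel) = ennreal V" "0 \<le> V"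
  and p: "0 < p" and \<Omega>: "\<Omega> \<in> sets borel"
 shows "Lp_member p (lebesgue_on \<Omega>) g" "Lp_norm p (lebesgue_on \<Omega>) g \<le> V powr (1 / p)" "(\<And>x. x \<notin> \<Omega> \<Longrightarrow> g x = 0) \<Longrightarrow> Lp_norm p (lebesgue_on \<Omega>) g = V powr (1 / p)"
proof -
 have m: "(\<lambda>x. norm (g x) powr p) \<in> borel_funs" using g by measurable
 have i: "integrable lborel (\<lambda>x. norm (g x) powr p)" by (rule integrableI_bounded) (use m V in auto)
 have L: "(LINT x|lborel. norm (g x) powr p) = V" using V m by (subst integral_eq_nn_integral) auto
 have il: "integrable lebesgue (\<lambda>x. norm (g x) powr p)" using i m by (simp add: integrable_completion)
 have Ll: "(LINT x|lebesgue. norm (g x) powr p) = V" using L m by (simp add: integral_completion)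
 have \<Omega>l: "\<Omega> \<in> sets lebesgue" using \<Omega> by simp
 have ind: "integrable lebesgue (\<lambda>x. ind \<Omega> x *\<^sub>R (norm (g x) powr p))" by (rule integrable_mult_indicator[OF \<Omega>l il])
 have "g \<in> borel_measurable (lebesgue_on \<Omega>)" using g by (intro measurable_restrict_space1 measurable_completion) simp
 then show "Lp_member p (lebesgue_on \<Omega>) g" using ind \<Omega>l by (simp add: Lp_member_def integrable_restrict_space)
 have "(LINT x|lebesgue_on \<Omega>. norm (g x) powr p) = (LINT x|lebesgue. ind \<Omega> x *\<^sub>R (norm (g x) powr p))"
  using \<Omega>l by (simp add: integral_restrict_space)
 also have "\<dots> \<le> (LINT x|lebesgue. norm (g x) powr p)" by (rule integral_mono[OF ind il]) (simp add: indicator_def)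
 finally show "Lp_norm p (lebesgue_on \<Omega>) g \<le> V powr (1 / p)" unfolding Ll Lp_norm_def using p by (intro powr_mono2) (auto intro: integral_nonneg)
 assume "\<And>x. x \<notin> \<Omega> \<Longrightarrow> g x = 0"
 then have "norm (g x) powr p = 0" if "x \<notin> \<Omega>" for x using that by simp
 from integral_lebesgue_on_eq(1)[OF \<Omega>l this] show "Lp_norm p (lebesgue_on \<Omega>) g = V powr (1 / p)" by (simp add: Lp_norm_def Ll)
qed

lemma ex_nonzero_test:
 fixes x :: "'a::euclidean_space"
 assumes "open \<Omega>" "x \<in> \<Omega>" and p: "0 < p"
 obtains \<phi> where "\<phi> \<in> test_functions \<Omega>" "0 < (LINT x|lborel. \<bar>\<phi> x\<bar> powr p)"
proof -
 obtain a b where ab: "cbox a b \<subseteq> \<Omega>" "x \<in> box a b" using open_contains_cbox[OF assms(1,2)] by metis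
 let ?u = "box_bump a b"
 have z: "?u y = 0" if "y \<notin> cbox a b" for y using that box_subset_cbox[of a b] by (intro box_bump_zero) auto
 have t: "?u \<in> test_functions \<Omega>" by (rule test_functionsI[OF smooth_box_bump compact_cbox ab(1) z])
 note T = test_functionsD[OF t]
 have [measurable]: "?u \<in> borel_funs" using T(7) by (rule borel_measurable_continuous_onI)
 have i: "integrable lborel (\<lambda>y. \<bar>?u y\<bar> powr p)"
 proof (rule integrable_compact_support[OF _ T(2)])
  show "continuous_on UNIV (\<lambda>y. \<bar>?u y\<bar> powr p)" using p by (intro continuous_on_powr' continuous_on_rabs T(7) continuous_on_const) auto
 qed (simp add: T(4))
 have "(LINT y|lborel. \<bar>?u y\<bar> powr p) \<noteq> 0"
 proof
  assume "(LINT y|lborel. \<bar>?u y\<bar> powr p) = 0"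
  then have "AE y in lborel. \<bar>?u y\<bar> powr p = 0" using i by (subst (asm) integral_nonneg_eq_0_iff_AE) auto
  then have "AE y in lborel. y \<notin> box a b" by (rule AE_mp) (auto intro!: AE_I2 simp: box_bump_pos_iff[symmetric])
  then have "box a b \<in> null_sets lebesgue" by (subst (asm) AE_iff_null_sets[symmetric]) (auto intro: null_sets_completionI)
  then show False using open_not_negligible[of "box a b"] ab(2) by (auto simp: negligible_iff_null_sets)
 qed
 moreover have "0 \<le> (LINT y|lborel. \<bar>?u y\<bar> powr p)" by (rule Bochner_Integration.integral_nonneg) simp
 ultimately have "0 < (LINT y|lborel. \<bar>?u y\<bar> powr p)" by linarith
 then show thesis by (rule that[OF t])
qed

section \<open>Trial functions and their gradients\<close>

text \<open>The trial functions are \<open>|y|\<^sup>-\<^sup>c u(y/|y|)\<close>, whose Hardy quotient is formally that of \<open>u\<close> on the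
 sphere, with a logarithmic cutoff in \<open>|y|\<close> and a cutoff in \<open>z\<close> at so large a scale that its gradient does not matter on the support of the first cutoff.\<close>

locale trial = hardy_cone K p for K :: "'a::euclidean_space set" and p +
 fixes u :: "'a \<Rightarrow> real" and \<eta> :: "real \<Rightarrow> real" and \<zeta> :: "'b::euclidean_space \<Rightarrow> real" and R B :: real
 assumes u: "u \<in> tests" and \<eta>: "\<eta> \<in> test_functions {-1<..<1}"
  and \<zeta>: "\<zeta> \<in> test_functions UNIV" and R: "0 < R"
  and B: "\<And>t. \<bar>\<eta> t\<bar> \<le> B" "\<And>t. \<bar>grad \<eta> t\<bar> \<le> B" "\<And>z. \<bar>\<zeta> z\<bar> \<le> B" "\<And>z. norm (grad \<zeta> z) \<le> B"
begin

lemmas T\<eta> = test_functionsD[OF \<eta>] and T\<zeta> = test_functionsD[OF \<zeta>]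

sublocale u: smooth_sphere_function u by (rule sphere_test_functionsD(1)[OF u])

text \<open>The radial cutoff confines |y| to at most exp(R), so |y|/L \<le> 1/R there: a
  z-derivative, which costs 1/L, is as small as a derivative of the logarithmic cutoff.\<close>

definition L :: real where "L = R * exp R"

definition f :: "'a \<Rightarrow> real" where "f y = norm y powr (- c) * u (sgn y) * \<eta> (ln (norm y) / R)"

definition \<phi> :: "'a \<times> 'b \<Rightarrow> real" where "\<phi> x = f (fst x) * \<zeta> (snd x /\<^sub>R L)"

abbreviation "T \<equiv> supp \<zeta>"

lemma L: "0 < L" using R by (simp add: L_def)

lemma B0: "0 \<le> B" using B(1)[of 0] by simp

lemma annulus_iff: "0 < s \<Longrightarrow> s \<in> {exp (- R)..exp R} \<longleftrightarrow> ln s / R \<in> {-1..1}"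
 using R by (auto simp: ln_ge_iff[symmetric] field_simps) (metis exp_le_cancel_iff exp_ln)+

lemma \<eta>_zero:
 assumes "0 < s" "s \<notin> {exp (- R)..exp R}"
 shows "\<eta> (ln s / R) = 0" "grad \<eta> (ln s / R) = 0"
proof -
 have "ln s / R \<notin> supp \<eta>" using annulus_iff[OF assms(1)] assms(2) T\<eta>(3) by (metis atLeastAtMost_iff greaterThanLessThan_iff less_imp_le subsetD)
 then show "\<eta> (ln s / R) = 0" "grad \<eta> (ln s / R) = 0" by (auto simp: T\<eta>(4,6))
qed

lemma f_zero:
 assumes "norm y \<notin> {exp (- R)..exp R}"
 shows "f y = 0" using \<eta>_zero(1)[of "norm y"] assms by (cases "y = 0") (auto simp: f_def)

text \<open>Smoothness off the origin is clear, and the cutoff kills f near the origin. The support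
  lies in the product of the interval of admissible radii with the support of u, mapped by
  scaling.\<close>

lemma f_test: "f \<in> test_functions K"
proof (rule test_functionsI)
 have s1: "smooth_on (- {0}) f" unfolding f_def
 proof (intro smooth_on_mult smooth_on_norm_powr u.smooth)
  have "smooth_on (- {0::'a}) (\<lambda>y. ln (norm y) * (1 / R))" by (intro smooth_on_mult smooth_on_ln_norm smooth_on_const) auto
  then have "smooth_on (- {0::'a}) (\<lambda>y. ln (norm y) / R)" by simp
  from smooth_on_compose_real[OF open_Compl[OF closed_singleton] open_UNIV T\<eta>(1) this]
  show "smooth_on (- {0::'a}) (\<lambda>y. \<eta> (ln (norm y) / R))" by simp
 qed auto
 have s2: "smooth_on (ball 0 (exp (- R))) f"
  by (rule smooth_on_cong[OF open_ball _ smooth_on_const[OF open_ball, of _ _ 0]]) (rule f_zero[symmetric], simp)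
 have "- {0} \<union> ball 0 (exp (- R)) = (UNIV :: 'a set)" by auto
 with smooth_on_Un[OF open_Compl[OF closed_singleton] open_ball s1 s2] show "smooth_on UNIV f" by simp
 let ?S = "closure (support_on (sphere 0 1) u)" let ?C = "(\<lambda>z. fst z *\<^sub>R snd z) ` ({exp (- R)..exp R} \<times> ?S)"
 have S: "compact ?S" "?S \<subseteq> G" using u by (auto simp: sphere_test_functions_def)
 show "compact ?C" by (intro compact_continuous_image compact_Times S compact_Icc continuous_intros)
 have "0 < s" if "exp (- R) \<le> s" for s using less_le_trans[OF exp_gt_zero that] .
 then show "?C \<subseteq> K" using S(2) cone_scale by fastforce
 fix y assume y: "y \<notin> ?C"
 show "f y = 0"
 proof (cases "norm y \<in> {exp (- R)..exp R}")
  case True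
  then have y0: "y \<noteq> 0" using less_le_trans[OF exp_gt_zero] by auto
  have "sgn y \<notin> ?S"
  proof
   assume "sgn y \<in> ?S"
   then have "fst (norm y, sgn y) *\<^sub>R snd (norm y, sgn y) \<in> ?C" using True by (intro imageI) simp
   then show False using y y0 by (simp add: sgn_div_norm)
  qed
  then have "sgn y \<notin> support_on (sphere 0 1) u" using closure_subset by blast
  then have "u (sgn y) = 0" using y0 by (simp add: support_on_def norm_sgn)
  then show ?thesis by (simp add: f_def)
 qed (rule f_zero)
qed

lemma grad_\<phi>: "grad \<phi> x = (\<zeta> (snd x /\<^sub>R L) *\<^sub>R grad f (fst x), (f (fst x) / L) *\<^sub>R grad \<zeta> (snd x /\<^sub>R L))"
proof (rule grad_eq)
 have 1: "((\<lambda>x. f (fst x)) has_derivative (\<lambda>h. fst h \<bullet> grad f (fst x))) (at x)"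
  by (rule has_derivative_compose[OF has_derivative_fst[OF has_derivative_ident] test_functionsD(5)[OF f_test, unfolded gderiv_def]])
 have "((\<lambda>x. snd x /\<^sub>R L) has_derivative (\<lambda>h. snd h /\<^sub>R L)) (at x)" by (intro has_derivative_scaleR_right has_derivative_snd has_derivative_ident)
 from has_derivative_compose[OF this T\<zeta>(5)[of "snd x /\<^sub>R L", unfolded gderiv_def]]
 have 2: "((\<lambda>x. \<zeta> (snd x /\<^sub>R L)) has_derivative (\<lambda>h. (snd h /\<^sub>R L) \<bullet> grad \<zeta> (snd x /\<^sub>R L))) (at x)" .
 show "GDERIV \<phi> x :> (\<zeta> (snd x /\<^sub>R L) *\<^sub>R grad f (fst x), (f (fst x) / L) *\<^sub>R grad \<zeta> (snd x /\<^sub>R L))"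
  using has_derivative_mult[OF 1 2] L unfolding gderiv_def \<phi>_def[abs_def] by (simp add: inner_prod_def field_simps)
qed

lemma \<phi>_test: "\<phi> \<in> test_functions (K \<times> UNIV)"
proof (rule test_functionsI)
 note Tf = test_functionsD[OF f_test]
 let ?D = "(\<lambda>z. L *\<^sub>R z) ` T"
 have "smooth_on UNIV (\<lambda>x :: 'a \<times> 'b. f (fst x))" by (rule smooth_on_compose[OF open_UNIV open_UNIV Tf(1)])
   (auto intro!: smooth_on_linear bounded_linear_compose[OF bounded_linear_inner_left] bounded_linear_fst)
 moreover have "smooth_on UNIV (\<lambda>x :: 'a \<times> 'b. \<zeta> (snd x /\<^sub>R L))" by (rule smooth_on_compose[OF open_UNIV open_UNIV T\<zeta>(1)])
   (auto intro!: smooth_on_linear bounded_linear_compose[OF bounded_linear_inner_left]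
    bounded_linear_compose[OF bounded_linear_scaleR_right] bounded_linear_snd simp del: inner_scaleR_left)
 ultimately show "smooth_on UNIV \<phi>" unfolding \<phi>_def[abs_def] by (intro smooth_on_mult) auto
 show "compact (supp f \<times> ?D)" by (intro compact_Times Tf(2) compact_scaling T\<zeta>(2))
 show "supp f \<times> ?D \<subseteq> K \<times> UNIV" using Tf(3) by auto
 fix x assume x: "x \<notin> supp f \<times> ?D"
 show "\<phi> x = 0"
 proof (cases "fst x \<in> supp f")
  case True
  have "snd x /\<^sub>R L \<notin> T"
  proof
   assume "snd x /\<^sub>R L \<in> T"
   then have "L *\<^sub>R (snd x /\<^sub>R L) \<in> ?D" by (rule imageI)
   then show False using x True L by (simp add: mem_Times_iff)
  qed
  then show ?thesis by (simp add: \<phi>_def T\<zeta>(4))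
 qed (simp add: \<phi>_def Tf(4))
qed

text \<open>The radial and tangential parts of the gradient of |y|^(-c) u(y/|y|) are orthogonal, so
  its norm is |y|^(-c-1) times that of the pair (c u, tangential gradient). Differentiating the
  cutoff in ln|y|/R adds a term with the factor 1/(R |y|).\<close>

lemma norm_grad_f:
 assumes y: "y \<noteq> 0"
 shows "norm (grad f y) \<le> norm (c * u (sgn y), tgrad u (sgn y)) * norm y powr (- c - 1) * \<bar>\<eta> (ln (norm y) / R)\<bar> +
  (B / R) * \<bar>u (sgn y)\<bar> * norm y powr (- c - 1) * ind {exp (- R)..exp R} (norm y)"
proof -
 have ny: "0 < norm y" using y by simp
 have sy: "norm (sgn y) = 1" using y by (simp add: norm_sgn)
 then have sy1: "sgn y \<bullet> sgn y = 1" by (simp add: norm_eq_1)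
 have pw: "norm y powr (- c) / norm y = norm y powr (- c - 1)" using ny by (simp add: powr_diff)
 have "GDERIV (\<lambda>y. norm y powr (- c)) y :> (- c * norm y powr (- c - 1)) *\<^sub>R sgn y"
  using GDERIV_DERIV_compose[OF GDERIV_norm[OF y] has_real_derivative_powr[OF ny, of "- c"]] by simp
 from GDERIV_mult[OF this u.GDERIV_sgn[OF y, unfolded u.grad_eq_tgrad[OF y]]]
 have F: "GDERIV (\<lambda>y. norm y powr (- c) * u (sgn y)) y :>
  norm y powr (- c) *\<^sub>R (tgrad u (sgn y) /\<^sub>R norm y) + u (sgn y) *\<^sub>R ((- c * norm y powr (- c - 1)) *\<^sub>R sgn y)" (is "GDERIV _ _ :> ?F") .
 have "?F = norm y powr (- c - 1) *\<^sub>R (tgrad u (sgn y) - (c * u (sgn y)) *\<^sub>R sgn y)"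
  unfolding pw[symmetric] using ny by (simp add: algebra_simps divide_inverse)
 moreover have "(norm (tgrad u (sgn y) - (c * u (sgn y)) *\<^sub>R sgn y))\<^sup>2 = (norm (c * u (sgn y), tgrad u (sgn y)))\<^sup>2"
  unfolding power2_norm_eq_inner using u.tgrad_radial[of "sgn y"] y sy1
  by (simp add: inner_diff_left inner_diff_right inner_commute inner_prod_def sgn_zero_iff power2_eq_square)
 then have "norm (tgrad u (sgn y) - (c * u (sgn y)) *\<^sub>R sgn y) = norm (c * u (sgn y), tgrad u (sgn y))"
  by (simp only: power2_eq_iff_nonneg norm_ge_zero)
 ultimately have nF: "norm ?F = norm (c * u (sgn y), tgrad u (sgn y)) * norm y powr (- c - 1)" by simp
 have "DERIV (\<lambda>t. ln t / R) (norm y) :> (1 / norm y) / R" by (intro DERIV_cdivide DERIV_ln_divide ny)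
 from DERIV_chain2[OF T\<eta>(5)[unfolded gderiv_deriv] this]
 have "GDERIV (\<lambda>y. \<eta> (ln (norm y) / R)) y :> (grad \<eta> (ln (norm y) / R) * (1 / norm y / R)) *\<^sub>R sgn y"
  by (rule GDERIV_DERIV_compose[OF GDERIV_norm[OF y]])
 from grad_eq[OF GDERIV_mult[OF F this]]
 have "grad f y = (norm y powr (- c) * u (sgn y)) *\<^sub>R ((grad \<eta> (ln (norm y) / R) * (1 / norm y / R)) *\<^sub>R sgn y) +
   \<eta> (ln (norm y) / R) *\<^sub>R ?F" unfolding f_def[abs_def] .
 then have "norm (grad f y) \<le> norm ((norm y powr (- c) * u (sgn y)) *\<^sub>R ((grad \<eta> (ln (norm y) / R) * (1 / norm y / R)) *\<^sub>R sgn y)) +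
   norm (\<eta> (ln (norm y) / R) *\<^sub>R ?F)" by (simp only: norm_triangle_ineq)
 also have "norm (\<eta> (ln (norm y) / R) *\<^sub>R ?F) = norm (c * u (sgn y), tgrad u (sgn y)) * norm y powr (- c - 1) * \<bar>\<eta> (ln (norm y) / R)\<bar>"
  unfolding norm_scaleR nF by simp
 also have "norm ((norm y powr (- c) * u (sgn y)) *\<^sub>R ((grad \<eta> (ln (norm y) / R) * (1 / norm y / R)) *\<^sub>R sgn y)) =
   \<bar>u (sgn y)\<bar> * norm y powr (- c - 1) * (\<bar>grad \<eta> (ln (norm y) / R)\<bar> / R)" unfolding pw[symmetric] using sy R by (simp add: abs_mult)
 also have "\<dots> \<le> (B / R) * \<bar>u (sgn y)\<bar> * norm y powr (- c - 1) * ind {exp (- R)..exp R} (norm y)"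
 proof (cases "norm y \<in> {exp (- R)..exp R}")
  case True
  have "\<bar>u (sgn y)\<bar> * norm y powr (- c - 1) * (\<bar>grad \<eta> (ln (norm y) / R)\<bar> / R) \<le> \<bar>u (sgn y)\<bar> * norm y powr (- c - 1) * (B / R)"
   using R B(2) by (intro mult_left_mono divide_right_mono) auto
  then show ?thesis using True by (simp add: mult.commute mult.left_commute)
 qed (use \<eta>_zero(2)[OF ny] in simp)
 finally show ?thesis by simp
qed

text \<open>The main part of the gradient bound, which reproduces the numerator of the spherical
  quotient.\<close>

definition f1 :: "'a \<times> 'b \<Rightarrow> real" where
 "f1 x = norm (c * u (sgn (fst x)), tgrad u (sgn (fst x))) * norm (fst x) powr (- c - 1) * \<bar>\<eta> (ln (norm (fst x)) / R)\<bar> * \<bar>\<zeta> (snd x /\<^sub>R L)\<bar>"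

text \<open>The error part. Both cutoffs contribute B^2/R, which explains the factor 2; the
  indicators remember their supports.\<close>

definition f2 :: "'a \<times> 'b \<Rightarrow> real" where
 "f2 x = (2 * B\<^sup>2 / R) * \<bar>u (sgn (fst x))\<bar> * norm (fst x) powr (- c - 1) * ind {exp (- R)..exp R} (norm (fst x)) * ind T (snd x /\<^sub>R L)"

lemma grad_\<phi>_bound: "norm (grad \<phi> x) \<le> f1 x + f2 x"
proof (cases "fst x = 0")
 case True
 have "f 0 = 0" by (simp add: f_def)
 moreover have "grad f 0 = 0" by (rule grad_eq, rule GDERIV_zero[OF open_ball, of _ 0 "exp (- R)"]) (auto intro!: f_zero)
 ultimately show ?thesis unfolding grad_\<phi> True by (simp add: f1_def f2_def True)
next
 case False
 obtain y z where x: "x = (y, z)" by (cases x)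
 with False have y: "y \<noteq> 0" by simp
 let ?W = "norm y powr (- c - 1)" and ?S = "ind {exp (- R)..exp R} (norm y) :: real" and ?Z = "ind T (z /\<^sub>R L) :: real"
 have ny: "0 < norm y" using y by simp
 have Zb: "\<bar>\<zeta> (z /\<^sub>R L)\<bar> \<le> B * ?Z" "norm (grad \<zeta> (z /\<^sub>R L)) \<le> B * ?Z" using B(3,4)[of "z /\<^sub>R L"] T\<zeta>(4,6)[of "z /\<^sub>R L"] by (auto simp: indicator_def)
 have fb: "\<bar>f y\<bar> / L \<le> (B / R) * \<bar>u (sgn y)\<bar> * ?W * ?S"
 proof (cases "norm y \<in> {exp (- R)..exp R}")
  case True
  \<comment> \<open>The reason for the choice of L: the z-derivative of the cutoff gains the missing
    power of |y| at the price 1/R.\<close>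
  then have "norm y / L \<le> 1 / R" using R by (simp add: L_def field_simps)
  have "\<bar>f y\<bar> / L = \<bar>u (sgn y)\<bar> * ?W * (\<bar>\<eta> (ln (norm y) / R)\<bar> * (norm y / L))" using ny L by (simp add: f_def abs_mult powr_diff)
  also have "\<dots> \<le> \<bar>u (sgn y)\<bar> * ?W * (B * (1 / R))" using B(1) B0 L \<open>norm y / L \<le> 1 / R\<close> by (intro mult_left_mono mult_mono) auto
  finally show ?thesis using True by (simp add: mult.commute mult.left_commute)
 qed (simp add: f_zero)
 have W0: "0 \<le> \<bar>u (sgn y)\<bar> * ?W * ?S" by simp
 have "norm (grad \<phi> x) \<le> norm (\<zeta> (z /\<^sub>R L) *\<^sub>R grad f y) + norm ((f y / L) *\<^sub>R grad \<zeta> (z /\<^sub>R L))"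
  unfolding grad_\<phi> x fst_conv snd_conv by (rule norm_Pair_le)
 also have "norm (\<zeta> (z /\<^sub>R L) *\<^sub>R grad f y) \<le> \<bar>\<zeta> (z /\<^sub>R L)\<bar> * (norm (c * u (sgn y), tgrad u (sgn y)) * ?W * \<bar>\<eta> (ln (norm y) / R)\<bar>
   + (B / R) * \<bar>u (sgn y)\<bar> * ?W * ?S)" unfolding norm_scaleR real_norm_def by (intro mult_left_mono norm_grad_f y) simp
 also have "\<dots> = f1 x + \<bar>\<zeta> (z /\<^sub>R L)\<bar> * ((B / R) * \<bar>u (sgn y)\<bar> * ?W * ?S)" by (simp add: f1_def x algebra_simps)
 also have "\<bar>\<zeta> (z /\<^sub>R L)\<bar> * ((B / R) * \<bar>u (sgn y)\<bar> * ?W * ?S) \<le> (B * ?Z) * ((B / R) * \<bar>u (sgn y)\<bar> * ?W * ?S)"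
  using R B0 by (intro mult_right_mono Zb) auto
 also have "norm ((f y / L) *\<^sub>R grad \<zeta> (z /\<^sub>R L)) \<le> ((B / R) * \<bar>u (sgn y)\<bar> * ?W * ?S) * (B * ?Z)"
  unfolding norm_scaleR using fb Zb L B0 R by (intro mult_mono) auto
 finally have "norm (grad \<phi> x) \<le> f1 x + (B * ?Z) * ((B / R) * \<bar>u (sgn y)\<bar> * ?W * ?S) + ((B / R) * \<bar>u (sgn y)\<bar> * ?W * ?S) * (B * ?Z)" by simp
 also have "\<dots> = f1 x + f2 x" by (simp add: f2_def x power2_eq_square algebra_simps add_divide_distrib)
 finally show ?thesis .
qed

end

section \<open>Norms of the trial functions and the lower bound for the constant\<close>

lemma test_nn_integral:
 fixes \<phi> :: "'a::euclidean_space \<Rightarrow> real"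
 assumes \<phi>: "\<phi> \<in> test_functions \<Omega>" and p: "0 < p"
 shows "(\<integral>\<^sup>+x. ennreal (\<bar>\<phi> x\<bar> powr p) \<partial>lborel) = ennreal (LINT x|lborel. \<bar>\<phi> x\<bar> powr p)"
proof -
 note T = test_functionsD[OF \<phi>]
 have "integrable lborel (\<lambda>x. \<bar>\<phi> x\<bar> powr p)"
 proof (rule integrable_compact_support[OF _ T(2)])
  show "continuous_on UNIV (\<lambda>y. \<bar>\<phi> y\<bar> powr p)" using p by (intro continuous_on_powr' continuous_on_rabs T(7) continuous_on_const) auto
 qed (simp add: T(4))
 then show ?thesis by (rule nn_integral_eq_integral) simp
qed

lemma (in hardy_cone) nn_integral_sphere_sgn:
 assumes F: "integrable M (\<lambda>w. \<bar>F w\<bar> powr p)" and z: "\<And>w. norm w = 1 \<Longrightarrow> w \<notin> G \<Longrightarrow> F w = 0"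
 shows "(\<integral>\<^sup>+w. ennreal (\<bar>F (sgn w)\<bar> powr p) \<partial>sphere_borel) = ennreal (LINT w|M. \<bar>F w\<bar> powr p)"
proof -
 have "ennreal (LINT w|M. \<bar>F w\<bar> powr p) = (\<integral>\<^sup>+w. ennreal (\<bar>F w\<bar> powr p) \<partial>M)" by (rule nn_integral_eq_integral[symmetric, OF F]) simp
 also have "\<dots> = (\<integral>\<^sup>+w\<in>G. ennreal (\<bar>F w\<bar> powr p) \<partial>sphere_borel)"
  unfolding nn_integral_M unfolding sphere_measure_eq nn_integral_completion ..
 also have "\<dots> = (\<integral>\<^sup>+w. ennreal (\<bar>F (sgn w)\<bar> powr p) \<partial>sphere_borel)"
 proof (rule nn_integral_cong_AE, rule AE_mp[OF AE_sphere_borel_norm], rule AE_I2, rule impI)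
  fix w :: 'a assume w: "norm w = 1"
  then have "sgn w = w" by (simp add: sgn_div_norm)
  then show "ennreal (\<bar>F w\<bar> powr p) * ind G w = ennreal (\<bar>F (sgn w)\<bar> powr p)" using z[OF w] by (cases "w \<in> G") auto
 qed
 finally show ?thesis by simp
qed

context trial
begin

text \<open>The Hardy term and both parts of the gradient bound all have this product form. The
  exponent -c-1 becomes -m after taking the p-th power, so the three integrals share the factor R
  L^k with k the dimension of z.\<close>

lemma nn_integral_trial:
 fixes F :: "'a \<Rightarrow> real" and h :: "real \<Rightarrow> real" and k :: "'b \<Rightarrow> real"
 assumes F: "(\<lambda>w. F (sgn w)) \<in> borel_funs" "integrable M (\<lambda>w. \<bar>F w\<bar> powr p)" "\<And>w. norm w = 1 \<Longrightarrow> w \<notin> G \<Longrightarrow> F w = 0"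
  and h: "h \<in> borel_funs" "(\<integral>\<^sup>+t\<in>{-1..1}. ennreal (\<bar>h t\<bar> powr p) \<partial>lborel) = ennreal X" "0 \<le> X"
  and k: "k \<in> borel_funs" "(\<integral>\<^sup>+z. ennreal (\<bar>k z\<bar> powr p) \<partial>lborel) = ennreal Z" "0 \<le> Z"
  and g: "\<And>x. g x = F (sgn (fst x)) * norm (fst x) powr (- c - 1) * (h (ln (norm (fst x)) / R) * ind {exp (- R)..exp R} (norm (fst x))) * k (snd x /\<^sub>R L)"
 shows "g \<in> borel_funs" "(\<integral>\<^sup>+x. ennreal (norm (g x) powr p) \<partial>lborel) = ennreal ((LINT w|M. \<bar>F w\<bar> powr p) * (R * X) * (L ^ DIM('b) * Z))"
proof -
 have [measurable]: "fst \<in> borel_measurable (borel :: ('a \<times> 'b) measure)" "snd \<in> borel_measurable (borel :: ('a \<times> 'b) measure)"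
  by (intro borel_measurable_continuous_onI continuous_intros)+
 note [measurable] = h(1) k(1) F(1)
 have 1: "(\<lambda>x :: 'a \<times> 'b. F (sgn (fst x))) \<in> borel_funs" by (rule measurable_compose[OF _ F(1)]) measurable
 have 2: "(\<lambda>s. h (ln s / R) * ind {exp (- R)..exp R} s) \<in> borel_funs" by measurable
 have 3: "(\<lambda>x :: 'a \<times> 'b. h (ln (norm (fst x)) / R) * ind {exp (- R)..exp R} (norm (fst x))) \<in> borel_funs"
  by (rule measurable_compose[OF _ 2]) measurable
 have 4: "(\<lambda>x :: 'a \<times> 'b. k (snd x /\<^sub>R L)) \<in> borel_funs" by (rule measurable_compose[OF _ k(1)]) measurable
 have 5: "(\<lambda>x :: 'a \<times> 'b. norm (fst x) powr (- c - 1)) \<in> borel_funs" by measurable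
 show "g \<in> borel_funs" unfolding g[abs_def] by (intro borel_measurable_times 1 3 4 5)
 have e: "(- c - 1) * p = - real DIM('a)" using p by (simp add: c_def field_simps)
 have "ennreal (norm (g x) powr p) = ennreal (\<bar>F (sgn (sgn (fst x)))\<bar> powr p) * (ennreal (norm (fst x) powr - real DIM('a)) *
   ennreal (\<bar>h (ln (norm (fst x)) / R)\<bar> powr p) * ind {exp (- R)..exp R} (norm (fst x))) * ennreal (\<bar>k (snd x /\<^sub>R L)\<bar> powr p)" for x
 proof (cases "norm (fst x) \<in> {exp (- R)..exp R}")
  case True
  have s: "sgn (sgn y) = sgn y" for y :: 'a by (cases "y = 0") (auto simp: sgn_div_norm)
  have "norm (g x) powr p = \<bar>F (sgn (fst x))\<bar> powr p * norm (fst x) powr - real DIM('a) * \<bar>h (ln (norm (fst x)) / R)\<bar> powr p * \<bar>k (snd x /\<^sub>R L)\<bar> powr p"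
   using True unfolding g real_norm_def abs_mult e[symmetric] powr_powr[symmetric] by (simp add: powr_mult)
  then show ?thesis using True by (simp add: s ennreal_mult mult.assoc)
 qed (use p in "simp add: g")
 then have "(\<integral>\<^sup>+x. ennreal (norm (g x) powr p) \<partial>lborel) = (\<integral>\<^sup>+x. ennreal (\<bar>F (sgn (sgn (fst x)))\<bar> powr p) * (ennreal (norm (fst x) powr - real DIM('a)) *
   ennreal (\<bar>h (ln (norm (fst x)) / R)\<bar> powr p) * ind {exp (- R)..exp R} (norm (fst x))) * ennreal (\<bar>k (snd x /\<^sub>R L)\<bar> powr p) \<partial>lborel)" by (simp only:)
 also have "\<dots> = (\<integral>\<^sup>+w. ennreal (\<bar>F (sgn w)\<bar> powr p) \<partial>sphere_borel) * (ennreal R * (\<integral>\<^sup>+t\<in>{-1..1}. ennreal (\<bar>h t\<bar> powr p) \<partial>lborel)) *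
   (ennreal (L ^ DIM('b)) * (\<integral>\<^sup>+z. ennreal (\<bar>k z\<bar> powr p) \<partial>lborel))" by (rule nn_integral_cylinder[OF _ _ _ R L]) measurable
 also have "\<dots> = ennreal ((LINT w|M. \<bar>F w\<bar> powr p) * (R * X) * (L ^ DIM('b) * Z))"
 proof -
  have "(\<integral>\<^sup>+w. ennreal (\<bar>F (sgn w)\<bar> powr p) \<partial>sphere_borel) = ennreal (LINT w|M. \<bar>F w\<bar> powr p)" using F(2,3) by (rule nn_integral_sphere_sgn)
  moreover have "0 \<le> (LINT w|M. \<bar>F w\<bar> powr p)" by (rule Bochner_Integration.integral_nonneg) simp
  ultimately show ?thesis unfolding h(2) k(2) using R L h(3) k(3) by (simp add: ennreal_mult[symmetric])
 qed
 finally show "(\<integral>\<^sup>+x. ennreal (norm (g x) powr p) \<partial>lborel) = ennreal ((LINT w|M. \<bar>F w\<bar> powr p) * (R * X) * (L ^ DIM('b) * Z))" .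
qed

text \<open>The assumed inequality for the trial function, after the common factor R L^k has been
  cancelled. Only the error term still depends on R.\<close>

lemma trial_inequality:
 assumes C: "hardy_inequality p (K \<times> (UNIV :: 'b set)) C" and Iu: "0 < I u"
 defines "X \<equiv> LINT t|lborel. \<bar>\<eta> t\<bar> powr p" and "Z \<equiv> LINT z|lborel. \<bar>\<zeta> z\<bar> powr p"
 assumes X: "0 < X" and Z: "0 < Z"
 shows "(I u * X * Z) powr (1 / p) \<le> C * ((Q u * X * Z) powr (1 / p) + (2 * B\<^sup>2 / R) * (I u * 2 * measure lborel T) powr (1 / p))"
proof -
 have p0: "0 < p" using p by simp
 let ?\<Omega> = "K \<times> (UNIV :: 'b set)" let ?N = "lebesgue_on ?\<Omega>"
 have \<Omega>: "open ?\<Omega>" using open_K by (intro open_Times) auto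
 have \<Omega>b: "?\<Omega> \<in> sets borel" using \<Omega> by simp
 define D where "D = R * L ^ DIM('b)"
 have D: "0 < D" using R L by (simp add: D_def)
 note z = sphere_test_functionsD(2,3)[OF u]
 have um: "(\<lambda>w. u (sgn w)) \<in> borel_funs" by (rule borel_measurable_off_zero[OF u.continuous_sgn])
 have tm: "(\<lambda>w. tgrad u (sgn w)) \<in> borel_funs"
  by (intro borel_measurable_off_zero continuous_on_compose2[OF u.continuous_tgrad] continuous_intros) (auto simp: sgn_zero_iff)
 have LP: "Lp_member p M u" "Lp_member p M (\<lambda>w. (c * u w, tgrad u w))" by (intro test_Lp[OF u] Lp_member_pair)+
 have \<eta>m: "\<eta> \<in> borel_funs" and \<zeta>m: "\<zeta> \<in> borel_funs" using T\<eta>(7) T\<zeta>(7) by (auto intro: borel_measurable_continuous_onI)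
 have \<eta>i: "(\<integral>\<^sup>+t\<in>{-1..1}. ennreal (\<bar>\<eta> t\<bar> powr p) \<partial>lborel) = ennreal X"
 proof -
  have "\<eta> t = 0" if "t \<notin> {-1..1}" for t
   using that T\<eta>(3) by (intro T\<eta>(4)) (auto dest!: subsetD)
  then have "ennreal (\<bar>\<eta> t\<bar> powr p) * ind {-1..1} t = ennreal (\<bar>\<eta> t\<bar> powr p)" for t
   by (cases "t \<in> {-1..1}") auto
  then show ?thesis unfolding X_def using test_nn_integral[OF \<eta> p0] by (simp only:)
 qed
 have \<zeta>i: "(\<integral>\<^sup>+z. ennreal (\<bar>\<zeta> z\<bar> powr p) \<partial>lborel) = ennreal Z" unfolding Z_def by (rule test_nn_integral[OF \<zeta> p0])
 have Tb: "T \<in> sets borel" by simp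
 have Tfin: "emeasure lborel T < \<infinity>" using emeasure_compact_finite[OF T\<zeta>(2)] .
 have ind: "\<eta> (ln (norm y) / R) * ind {exp (- R)..exp R} (norm y) = \<eta> (ln (norm y) / R)" if "y \<noteq> 0" for y :: 'a
  using \<eta>_zero(1)[of "norm y"] that by (cases "norm y \<in> {exp (- R)..exp R}") auto
 have hardy: "(\<phi> x / norm (fst x)) = u (sgn (fst x)) * norm (fst x) powr (- c - 1) *
   (\<eta> (ln (norm (fst x)) / R) * ind {exp (- R)..exp R} (norm (fst x))) * \<zeta> (snd x /\<^sub>R L)" for x proof (cases "fst x = 0") case False
  then have "norm (fst x) powr (- c - 1) = norm (fst x) powr (- c) / norm (fst x)" by (simp add: powr_diff)
  then show ?thesis unfolding ind[OF False] by (simp add: \<phi>_def f_def)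
 qed simp
 have ui: "integrable M (\<lambda>w. \<bar>u w\<bar> powr p)" using LP(1) by (simp add: Lp_member_def)
 note H = nn_integral_trial[OF um ui z(1) \<eta>m \<eta>i less_imp_le[OF X] \<zeta>m \<zeta>i less_imp_le[OF Z] hardy]
 have Hv: "(\<integral>\<^sup>+x. ennreal (norm (\<phi> x / norm (fst x)) powr p) \<partial>lborel) = ennreal (I u * X * Z * D)" using H(2) by (simp add: I_def D_def ac_simps)
 have "Lp_norm p ?N (\<lambda>x. \<phi> x / norm (fst x)) = (I u * X * Z * D) powr (1 / p)"
 proof (rule Lp_of_nn_integral(3)[OF H(1) Hv _ p0 \<Omega>b])
  show "0 \<le> I u * X * Z * D" using Iu X Z D by simp
  fix x assume "x \<notin> ?\<Omega>"
  then have "\<phi> x = 0" using test_functionsD(3,4)[OF \<phi>_test] by blast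
  then show "\<phi> x / norm (fst x) = 0" by simp
 qed
 then have l: "hardy_norm p ?\<Omega> \<phi> = (I u * X * Z * D) powr (1 / p)" by (simp add: hardy_norm_def)
 define F1 where "F1 w = norm (c * u w, tgrad u w)" for w
 have "f1 x = F1 (sgn (fst x)) * norm (fst x) powr (- c - 1) *
   (\<bar>\<eta> (ln (norm (fst x)) / R)\<bar> * ind {exp (- R)..exp R} (norm (fst x))) * \<bar>\<zeta> (snd x /\<^sub>R L)\<bar>" for x proof (cases "fst x = 0") case False
  have "\<bar>\<eta> (ln (norm (fst x)) / R)\<bar> * ind {exp (- R)..exp R} (norm (fst x)) = \<bar>\<eta> (ln (norm (fst x)) / R)\<bar>"
   using ind[OF False] by (cases "norm (fst x) \<in> {exp (- R)..exp R}") auto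
  then show ?thesis by (simp add: f1_def F1_def)
 qed (simp add: f1_def)
 note f1 = this
 have F1m: "(\<lambda>w. F1 (sgn w)) \<in> borel_funs" unfolding F1_def norm_Pair using um tm by measurable
 have F1i: "integrable M (\<lambda>w. \<bar>F1 w\<bar> powr p)" using LP(2) by (simp add: Lp_member_def F1_def)
 have F1z: "F1 w = 0" if "norm w = 1" "w \<notin> G" for w using z[OF that] by (simp add: F1_def)
 have "(\<integral>\<^sup>+t\<in>{-1..1}. ennreal (\<bar>\<bar>\<eta> t\<bar>\<bar> powr p) \<partial>lborel) = ennreal X" "(\<integral>\<^sup>+z. ennreal (\<bar>\<bar>\<zeta> z\<bar>\<bar> powr p) \<partial>lborel) = ennreal Z" using \<eta>i \<zeta>i by simp_all
 note J = nn_integral_trial[OF F1m F1i F1z borel_measurable_abs[OF \<eta>m] this(1) less_imp_le[OF X] borel_measurable_abs[OF \<zeta>m] this(2) less_imp_le[OF Z] f1]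
 have Jv: "(\<integral>\<^sup>+x. ennreal (norm (f1 x) powr p) \<partial>lborel) = ennreal (Q u * X * Z * D)" using J(2) by (simp add: Q_def F1_def D_def ac_simps)
 have QXZ: "0 \<le> Q u * X * Z * D" using X Z D Q_nonneg by simp
 define F2 where "F2 w = (2 * B\<^sup>2 / R) * \<bar>u w\<bar>" for w
 have F2p: "\<bar>F2 w\<bar> powr p = (2 * B\<^sup>2 / R) powr p * \<bar>u w\<bar> powr p" for w
 proof -
  have "\<bar>F2 w\<bar> = (2 * B\<^sup>2 / R) * \<bar>u w\<bar>" using R by (simp add: F2_def abs_mult)
  then show ?thesis by (simp only: powr_mult)
 qed
 have f2: "f2 x = F2 (sgn (fst x)) * norm (fst x) powr (- c - 1) * (1 * ind {exp (- R)..exp R} (norm (fst x))) * ind T (snd x /\<^sub>R L)" for x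
  by (simp add: f2_def F2_def)
 have F2m: "(\<lambda>w. F2 (sgn w)) \<in> borel_funs" unfolding F2_def using um by measurable
 have F2i: "integrable M (\<lambda>w. \<bar>F2 w\<bar> powr p)" unfolding F2p using ui by simp
 have F2z: "F2 w = 0" if "norm w = 1" "w \<notin> G" for w using z[OF that] by (simp add: F2_def)
 have i1: "(\<integral>\<^sup>+t\<in>{-1..1}. ennreal (\<bar>1\<bar> powr p) \<partial>(lborel :: real measure)) = ennreal 2" by simp
 have "\<bar>ind T z\<bar> powr p = ind T z" for z :: 'b by (simp add: indicator_def)
 then have i2: "(\<integral>\<^sup>+z. ennreal (\<bar>ind T z\<bar> powr p) \<partial>lborel) = ennreal (measure lborel T)"
  using Tfin by (simp add: ennreal_indicator emeasure_eq_ennreal_measure)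
 note E = nn_integral_trial[OF F2m F2i F2z borel_measurable_const i1 zero_le_numeral borel_measurable_indicator[OF Tb] i2 measure_nonneg f2]
 have Ev: "(\<integral>\<^sup>+x. ennreal (norm (f2 x) powr p) \<partial>lborel) = ennreal ((2 * B\<^sup>2 / R) powr p * (I u * 2 * measure lborel T) * D)"
  using E(2) unfolding F2p by (simp add: I_def D_def ac_simps)
 have E0: "0 \<le> (2 * B\<^sup>2 / R) powr p * (I u * 2 * measure lborel T) * D" using Iu D by simp
 note L1 = Lp_of_nn_integral[OF J(1) Jv QXZ p0 \<Omega>b] and L2 = Lp_of_nn_integral[OF E(1) Ev E0 p0 \<Omega>b]
 have "Lp_norm p ?N (grad \<phi>) \<le> Lp_norm p ?N (\<lambda>x. f1 x + f2 x)"
 proof (rule Lp_norm_mono[OF p0 Lp_member_add[OF p L1(1) L2(1)]])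
  show "grad \<phi> \<in> borel_measurable ?N" using test_grad_Lp[OF \<Omega> \<phi>_test p0] by (simp add: Lp_member_def)
  have "norm (grad \<phi> x) \<le> norm (f1 x + f2 x)" for x
   using grad_\<phi>_bound[of x] by (rule order_trans) simp
  then show "AE x in ?N. norm (grad \<phi> x) \<le> norm (f1 x + f2 x)" by simp
 qed
 also have "\<dots> \<le> Lp_norm p ?N f1 + Lp_norm p ?N f2" by (rule Lp_norm_triangle[OF p L1(1) L2(1)])
 also have "\<dots> \<le> (Q u * X * Z * D) powr (1 / p) + ((2 * B\<^sup>2 / R) powr p * (I u * 2 * measure lborel T) * D) powr (1 / p)"
  by (intro add_mono L1(2) L2(2))
 also have "\<dots> = ((Q u * X * Z) powr (1 / p) + (2 * B\<^sup>2 / R) * (I u * 2 * measure lborel T) powr (1 / p)) * D powr (1 / p)"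
  using p R by (simp add: powr_mult[of _ D] powr_mult[of "(2 * B\<^sup>2 / R) powr p"] powr_powr distrib_right)
 finally have g: "gradient_norm p ?\<Omega> \<phi> \<le> \<dots>" by (simp only: test_W_dot(2)[OF \<Omega> \<phi>_test p0])
 have h: "(I u * X * Z * D) powr (1 / p) \<le> C * gradient_norm p ?\<Omega> \<phi>"
  using C test_W_dot(1)[OF \<Omega> \<phi>_test p0] unfolding hardy_inequality_def l[symmetric] by blast
 have "0 < (I u * X * Z * D) powr (1 / p)" using Iu X Z D by simp
 with h have "0 < C * gradient_norm p ?\<Omega> \<phi>" by linarith
 moreover have "0 \<le> gradient_norm p ?\<Omega> \<phi>" unfolding gradient_norm_def by (rule Lp_norm_nonneg)
 \<comment> \<open>Nonnegativity of C is not assumed; it follows because the left side of the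
   inequality is positive for the trial function.\<close>
 ultimately have "0 \<le> C" by (auto simp: zero_less_mult_iff)
 from h mult_left_mono[OF g this]
 have "(I u * X * Z) powr (1 / p) * D powr (1 / p) \<le> C * ((Q u * X * Z) powr (1 / p) + (2 * B\<^sup>2 / R) * (I u * 2 * measure lborel T) powr (1 / p)) * D powr (1 / p)"
  unfolding powr_mult[of "I u * X * Z" D] by (simp only: mult.assoc)
 then show ?thesis using D by (simp only: mult_le_cancel_right_pos powr_gt_zero)
qed

end

context hardy_cone
begin

text \<open>With fixed profiles for both cutoffs, R runs through the positive integers; in the limit
  the error vanishes and the integrals of the profiles cancel.\<close>

lemma sphere_le_cylinder:
 assumes C: "hardy_inequality p (K \<times> (UNIV :: 'b::euclidean_space set)) C" and u: "u \<in> tests" and Iu: "0 < I u"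
 shows "I u powr (1 / p) \<le> C * Q u powr (1 / p)"
proof -
 have p0: "0 < p" using p by simp
 obtain \<eta> :: "real \<Rightarrow> real" where \<eta>: "\<eta> \<in> test_functions {-1<..<1}" "0 < (LINT t|lborel. \<bar>\<eta> t\<bar> powr p)"
  by (rule ex_nonzero_test[of "{-1<..<1::real}" 0 p]) (use p0 in auto)
 obtain \<zeta> :: "'b \<Rightarrow> real" where \<zeta>: "\<zeta> \<in> test_functions UNIV" "0 < (LINT z|lborel. \<bar>\<zeta> z\<bar> powr p)"
  by (rule ex_nonzero_test[of "UNIV :: 'b set" 0 p]) (use p0 in auto)
 note T\<eta> = test_functionsD[OF \<eta>(1)] and T\<zeta> = test_functionsD[OF \<zeta>(1)]
 obtain B1 B2 B3 B4 where B: "\<And>t. norm (\<eta> t) \<le> B1" "\<And>t. norm (grad \<eta> t) \<le> B2" "\<And>z. norm (\<zeta> z) \<le> B3" "\<And>z. norm (grad \<zeta> z) \<le> B4"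
  using bounded_compact_support[OF T\<eta>(7,2,4)] bounded_compact_support[OF T\<eta>(8,2,6)]
   bounded_compact_support[OF T\<zeta>(7,2,4)] bounded_compact_support[OF T\<zeta>(8,2,6)] by metis
 define B where "B = max (max B1 B2) (max B3 B4)"
 let ?X = "LINT t|lborel. \<bar>\<eta> t\<bar> powr p" and ?Z = "LINT z|lborel. \<bar>\<zeta> z\<bar> powr p" and ?m = "measure lborel (supp \<zeta>)"
 have le: "(I u * ?X * ?Z) powr (1 / p) \<le> C * ((Q u * ?X * ?Z) powr (1 / p) + (2 * B\<^sup>2 / real (Suc n)) * (I u * 2 * ?m) powr (1 / p))" for n
 proof -
  note pos = \<eta>(2) \<zeta>(2)
  interpret trial K p u \<eta> \<zeta> "real (Suc n)" B by unfold_locales (use u \<eta>(1) \<zeta>(1) B in "auto simp: B_def le_max_iff_disj")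
  show ?thesis by (rule trial_inequality[OF C Iu pos])
 qed
 have "(\<lambda>n. C * ((Q u * ?X * ?Z) powr (1 / p) + (2 * B\<^sup>2 * inverse (real (Suc n))) * (I u * 2 * ?m) powr (1 / p))) ---->
   C * ((Q u * ?X * ?Z) powr (1 / p) + (2 * B\<^sup>2 * 0) * (I u * 2 * ?m) powr (1 / p))" by (intro tendsto_intros LIMSEQ_inverse_real_of_nat)
 from LIMSEQ_le_const[OF this[folded divide_inverse], of "(I u * ?X * ?Z) powr (1 / p)"] le
 have "(I u * ?X * ?Z) powr (1 / p) \<le> C * ((Q u * ?X * ?Z) powr (1 / p) + (2 * B\<^sup>2 * 0) * (I u * 2 * ?m) powr (1 / p))" by blast
 then have "I u powr (1 / p) * (?X * ?Z) powr (1 / p) \<le> C * Q u powr (1 / p) * (?X * ?Z) powr (1 / p)" by (simp add: powr_mult mult.assoc)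
 moreover have "0 < (?X * ?Z) powr (1 / p)" using \<eta>(2) \<zeta>(2) by simp
 ultimately show ?thesis by (simp only: mult_le_cancel_right_pos)
qed

text \<open>Insert almost minimizing spherical functions. Smooth ones suffice because \<Lambda> was
  defined through them.\<close>

theorem Hardy_constant_ge:
 assumes C: "hardy_inequality p (K \<times> (UNIV :: 'b::euclidean_space set)) C" and pos: "0 < \<Lambda>"
 shows "\<Lambda> powr (- 1 / p) \<le> C"
proof -
 have le: "1 \<le> C * (\<Lambda> + inverse (real (Suc n))) powr (1 / p)" for n
 proof -
  obtain u where u: "u \<in> tests" "I u = 1" "Q u < \<Lambda> + inverse (real (Suc n))" by (rule \<Lambda>_approx[of "inverse (real (Suc n))"]) simp
  have 1: "1 \<le> C * Q u powr (1 / p)" using sphere_le_cylinder[OF C u(1)] u(2) by simp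
  then have "0 < C * Q u powr (1 / p)" by linarith
  then have "0 \<le> C" by (auto simp: zero_less_mult_iff not_less[symmetric])
  moreover have "Q u powr (1 / p) \<le> (\<Lambda> + inverse (real (Suc n))) powr (1 / p)" using u(3) Q_nonneg p by (intro powr_mono2) auto
  ultimately have "C * Q u powr (1 / p) \<le> C * (\<Lambda> + inverse (real (Suc n))) powr (1 / p)" by (intro mult_left_mono)
  with 1 show ?thesis by linarith
 qed
 have "(\<lambda>n. C * (\<Lambda> + inverse (real (Suc n))) powr (1 / p)) ----> C * (\<Lambda> + 0) powr (1 / p)"
  using pos by (intro tendsto_intros LIMSEQ_inverse_real_of_nat) auto
 from LIMSEQ_le_const[OF this, of 1] le have "1 \<le> C * \<Lambda> powr (1 / p)" by simp
 then show ?thesis using pos by (simp add: powr_minus field_simps)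
qed

end

theorem theorem2p1:
 fixes K :: "(real ^ 'm) set"
  and \<Omega> :: "((real ^ 'm) \<times> (real ^ 'k)) set"
  and G :: "(real ^ 'm) set"
  and p :: real
 assumes "CARD('m) \<ge> 2"
  and "1 < p"
  and "open_cone K"
  and "p \<ge> real CARD('m) \<Longrightarrow> K \<noteq> UNIV"
  and "p = real CARD('m) \<Longrightarrow> K \<noteq> UNIV - {0}"
 defines "\<Omega> \<equiv> K \<times> UNIV"
  and "G \<equiv> K \<inter> sphere 0 1"
 shows "\<exists>\<Lambda> N. is_minimum (sphere_quotients p G) \<Lambda> \<and> is_sharp_hardy_constant p \<Omega> N \<and> N = \<Lambda> powr (- 1 / p) \<and> \<not> hardy_equality_attained p \<Omega> N"
proof -
 interpret hardy_cone K p by unfold_locales fact+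
 have pK: "K \<noteq> UNIV" if "real DIM(real ^ 'm) \<le> p" using assms(4) that by simp
 \<comment> \<open>Both exclusions on K enter here in the case p = m; \<open>pK\<close> serves to
   keep the origin out of K when p is at least m.\<close>
 have pos: "0 < \<Lambda>" by (rule \<Lambda>_pos) (use assms in auto)
 show ?thesis
 proof (intro exI conjI)
  show "is_minimum (sphere_quotients p G) \<Lambda>" unfolding G_def by (rule is_minimum_\<Lambda>)
  show "is_sharp_hardy_constant p \<Omega> (\<Lambda> powr (- 1 / p))" unfolding is_sharp_hardy_constant_def is_minimum_def \<Omega>_def
   using Hardy_cylinder[OF pK pos] Hardy_constant_ge[OF _ pos] by blast
  show "\<not> hardy_equality_attained p \<Omega> (\<Lambda> powr (- 1 / p))" unfolding \<Omega>_def by (rule Hardy_not_attained[OF pK pos])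
 qed (rule refl)
qed

end
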